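(* Let $1<p<\infty$. Then $$\dot B^{d/p}_\infty L_{p,\infty}(\mathbb R^d)\hookrightarrow \mathrm{BMO}(\mathbb R^d).$$ Consequently, $$\dot H^{d/p}L_{p,\infty}(\mathbb R^d)\hookrightarrow\mathrm{BMO}(\mathbb R^d)$$ and, for $k\in\mathbb N$ with $k<d$, $$\dot W^kL_{d/k,\infty}(\mathbb R^d)\hookrightarrow\mathrm{BMO}(\mathbb R^d).$$
   Context: $A_0\hookrightarrow A_1$ means $A_0\subset A_1$ with continuous natural embedding, i.e. $\|f\|_{A_1}\le C\|f\|_{A_0}$ for the corresponding (quasi-semi-)norms. $f^*(t)=\inf\{\lambda\ge0:|\{|f|>\lambda\}|_d\le t\}$ is the non-increasing rearrangement; $\|f\|_{L_{p,\infty}(\mathbb R^d)}=\sup_{t>0}t^{1/p}f^*(t)$. $\|f\|_{\mathrm{BMO}(\mathbb R^d)}=\sup_Q\frac1{|Q|_d}\int_Q|f-f_Q|$ over all cubes $Q$ with sides parallel to the axes, $f_Q=\frac1{|Q|_d}\int_Qf$. With $\Delta_hf(x)=f(x+h)-f(x)$, $\Delta^k_h=\Delta_h\Delta^{k-1}_h$, put $\omega_k(f,t)_{p,\infty}=\sup_{|h|\le t}\|\Delta^k_hf\|_{L_{p,\infty}(\mathbb R^d)}$. The homogeneous Lorentz--Besov space $\dot B^{s}_\infty L_{p,\infty}(\mathbb R^d)$, $s>0$, is the completion of $C_0^\infty(\mathbb R^d)$ with respect to $\sup_{t>0}t^{-s}\omega_k(f,t)_{p,\infty}$, where $k\in\mathbb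 N$, $k>s$ (different such $k$ give equivalent seminorms). The Riesz-potential space $\dot H^sL_{p,\infty}(\mathbb R^d)$ is the completion of $C_0^\infty(\mathbb R^d)$ with respect to $\|(-\Delta)^{s/2}f\|_{L_{p,\infty}(\mathbb R^d)}$. The space $\dot W^kL_{p,\infty}(\mathbb R^d)$ is the analogous space with seminorm $\|\,|\nabla^kf|\,\|_{L_{p,\infty}(\mathbb R^d)}$, $|\nabla^kf|=\big(\sum_{|\alpha|_1=k}|D^\alpha f|^2\big)^{1/2}$; it coincides with $\dot H^kL_{p,\infty}(\mathbb R^d)$ up to equivalence of seminorms for $1<p<\infty$. *)

theory Defs
  imports "HOL-Analysis.Analysis"
begin

text \<open>
  Functions on \<open>\<real>\<^sup>d\<close> are complex-valued functions on \<open>real ^ 'd\<close>, with \<open>d = CARD('d)\<close>.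
  All (quasi-)(semi-)norms take values in \<open>ennreal\<close>.
\<close>

definition partial_deriv :: "'d \<Rightarrow> (real ^ 'd::finite \<Rightarrow> complex) \<Rightarrow> real ^ 'd \<Rightarrow> complex" where
  "partial_deriv i f x = vector_derivative (\<lambda>t. f (x + t *\<^sub>R axis i 1)) (at 0)"

definition iterated_partial ::
    "'d list \<Rightarrow> (real ^ 'd::finite \<Rightarrow> complex) \<Rightarrow> real ^ 'd \<Rightarrow> complex" where
  "iterated_partial is f = foldr partial_deriv is f"

definition smooth :: "(real ^ 'd::finite \<Rightarrow> complex) \<Rightarrow> bool" where
  "smooth f \<longleftrightarrow>
     (\<forall>is. continuous_on UNIV (iterated_partial is f) \<and>
       (\<forall>i x. (\<lambda>t. iterated_partial is f (x + t *\<^sub>R axis i 1)) differentiable (at (0::real))))"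

definition test_functions :: "(real ^ 'd::finite \<Rightarrow> complex) set" where
  "test_functions = {f. smooth f \<and> compact (closure {x. f x \<noteq> 0})}"

text \<open>
  A multi-index is a function \<open>\<alpha> :: 'd \<Rightarrow> nat\<close>. For smooth functions the order of
  differentiation is irrelevant, so an arbitrary one is chosen.
\<close>

definition multi_deriv ::
    "('d \<Rightarrow> nat) \<Rightarrow> (real ^ 'd::finite \<Rightarrow> complex) \<Rightarrow> real ^ 'd \<Rightarrow> complex" where
  "multi_deriv \<alpha> f = iterated_partial (SOME is. \<forall>i. count_list is i = \<alpha> i) f"

definition grad_norm :: "nat \<Rightarrow> (real ^ 'd::finite \<Rightarrow> complex) \<Rightarrow> real ^ 'd \<Rightarrow> real" where
  "grad_norm k f x = sqrt (\<Sum>\<alpha> | (\<Sum>i\<in>UNIV. \<alpha> i) = k. (norm (multi_deriv \<alpha> f x))\<^sup>2)"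

definition rearrangement ::
    "(real ^ 'd::finite \<Rightarrow> 'b::real_normed_vector) \<Rightarrow> real \<Rightarrow> ennreal" where
  "rearrangement f t =
     Inf {ennreal l | l. 0 \<le> l \<and> emeasure lebesgue {x. l < norm (f x)} \<le> ennreal t}"

definition weak_Lp_norm ::
    "real \<Rightarrow> (real ^ 'd::finite \<Rightarrow> 'b::real_normed_vector) \<Rightarrow> ennreal" where
  "weak_Lp_norm p f = (SUP t\<in>{0<..}. ennreal (t powr (1 / p)) * rearrangement f t)"

definition fwd_diff ::
    "real ^ 'd::finite \<Rightarrow> (real ^ 'd \<Rightarrow> complex) \<Rightarrow> real ^ 'd \<Rightarrow> complex" where
  "fwd_diff h f x = f (x + h) - f x"

definition modulus_smoothness ::
    "nat \<Rightarrow> real \<Rightarrow> (real ^ 'd::finite \<Rightarrow> complex) \<Rightarrow> real \<Rightarrow> ennreal" where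
  "modulus_smoothness k p f t = (SUP h\<in>{h. norm h \<le> t}. weak_Lp_norm p ((fwd_diff h ^^ k) f))"

definition Besov_seminorm ::
    "nat \<Rightarrow> real \<Rightarrow> real \<Rightarrow> (real ^ 'd::finite \<Rightarrow> complex) \<Rightarrow> ennreal" where
  "Besov_seminorm k s p f = (SUP t\<in>{0<..}. ennreal (t powr (- s)) * modulus_smoothness k p f t)"

definition fourier :: "(real ^ 'd::finite \<Rightarrow> complex) \<Rightarrow> real ^ 'd \<Rightarrow> complex" where
  "fourier f \<xi> = (LINT x|lborel. exp (- \<i> * complex_of_real (x \<bullet> \<xi>)) * f x)"

text \<open>
  The operator \<open>(-\<Delta>)\<^sup>\<sigma>\<close> is the Fourier multiplier with symbol \<open>\<bar>\<xi>\<bar>\<^sup>2\<^sup>\<sigma>\<close>. For a test function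
  and \<open>\<sigma> > 0\<close> the inversion integral converges absolutely.
\<close>

definition frac_laplacian ::
    "real \<Rightarrow> (real ^ 'd::finite \<Rightarrow> complex) \<Rightarrow> real ^ 'd \<Rightarrow> complex" where
  "frac_laplacian \<sigma> f x =
     (LINT \<xi>|lborel. exp (\<i> * complex_of_real (x \<bullet> \<xi>)) *
        complex_of_real (norm \<xi> powr (2 * \<sigma>)) * fourier f \<xi>) / (2 * complex_of_real pi) ^ CARD('d)"

definition Riesz_seminorm ::
    "real \<Rightarrow> real \<Rightarrow> (real ^ 'd::finite \<Rightarrow> complex) \<Rightarrow> ennreal" where
  "Riesz_seminorm s p f = weak_Lp_norm p (frac_laplacian (s / 2) f)"

definition Sobolev_seminorm ::
    "nat \<Rightarrow> real \<Rightarrow> (real ^ 'd::finite \<Rightarrow> complex) \<Rightarrow> ennreal" where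
  "Sobolev_seminorm k p f = weak_Lp_norm p (grad_norm k f)"

definition cube :: "real ^ 'd::finite \<Rightarrow> real \<Rightarrow> (real ^ 'd) set" where
  "cube a r = cbox a (\<chi> i. a $ i + r)"

definition average :: "(real ^ 'd::finite \<Rightarrow> complex) \<Rightarrow> (real ^ 'd) set \<Rightarrow> complex" where
  "average f Q = (LINT x:Q|lebesgue. f x) /\<^sub>R measure lebesgue Q"

definition BMO_seminorm :: "(real ^ 'd::finite \<Rightarrow> complex) \<Rightarrow> ennreal" where
  "BMO_seminorm f =
     (SUP Q\<in>{cube a r | a r. 0 < r}.
        (\<integral>\<^sup>+x\<in>Q. ennreal (norm (f x - average f Q)) \<partial>lebesgue) / emeasure lebesgue Q)"

definition BMO_functions :: "(real ^ 'd::finite \<Rightarrow> complex) set" where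
  "BMO_functions =
     {f. (\<forall>a b. f absolutely_integrable_on cbox a b) \<and> BMO_seminorm f < \<infinity>}"

text \<open>
  Elements of BMO are classes of functions that agree almost everywhere up to an additive constant.
\<close>

definition BMO :: "(real ^ 'd::finite \<Rightarrow> complex) set set" where
  "BMO = BMO_functions //
     {(f, g). f \<in> BMO_functions \<and> g \<in> BMO_functions \<and> BMO_seminorm (\<lambda>x. f x - g x) = 0}"

definition Cauchy_seqs :: "'v::minus set \<Rightarrow> ('v \<Rightarrow> ennreal) \<Rightarrow> (nat \<Rightarrow> 'v) set" where
  "Cauchy_seqs V N =
     {u. (\<forall>n. u n \<in> V) \<and> (\<forall>e>0. \<exists>M. \<forall>m\<ge>M. \<forall>n\<ge>M. N (u m - u n) < e)}"

definition completion :: "'v::minus set \<Rightarrow> ('v \<Rightarrow> ennreal) \<Rightarrow> (nat \<Rightarrow> 'v) set set" where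
  "completion V N = Cauchy_seqs V N //
     {(u, v). u \<in> Cauchy_seqs V N \<and> v \<in> Cauchy_seqs V N \<and> (\<lambda>n. N (u n - v n)) \<longlonglongrightarrow> 0}"

text \<open>
  A quasi-norm need not be continuous, so that the usual definition of the norm of a class as
  the limit of \<open>N (u n)\<close> is not meaningful in general. For the seminorms above this limit
  exists and does not depend on the representative, and the following is equal to it.
\<close>

definition completion_norm :: "('v \<Rightarrow> ennreal) \<Rightarrow> (nat \<Rightarrow> 'v) set \<Rightarrow> ennreal" where
  "completion_norm N F = (INF u\<in>F. limsup (\<lambda>n. N (u n)))"

text \<open>
  The natural embedding \<open>\<iota>\<close> of a completion of the test functions into BMO is the continuous
  extension of the inclusion of the test functions: the class of a Cauchy sequence is mapped to
  the limit of that sequence in BMO. This determines \<open>\<iota>\<close>, makes it linear, and, for constant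
  sequences, makes it send a test function to its own class. Injectivity is part of the inclusion
  of the completion in BMO.
\<close>

definition embeds_in_BMO :: "((real ^ 'd::finite \<Rightarrow> complex) \<Rightarrow> ennreal) \<Rightarrow> bool" where
  "embeds_in_BMO N \<longleftrightarrow>
     (\<exists>\<iota> C::real.
        \<iota> \<in> completion test_functions N \<rightarrow> BMO \<and>
        inj_on \<iota> (completion test_functions N) \<and>
        (\<forall>F\<in>completion test_functions N. \<forall>f\<in>\<iota> F.
           (\<forall>u\<in>F. (\<lambda>n. BMO_seminorm (\<lambda>x. u n x - f x)) \<longlonglongrightarrow> 0) \<and>
           BMO_seminorm f \<le> ennreal C * completion_norm N F))"

end

theory Submission
  imports Defs "HOL-Probability.Probability"
begin

text \<open>
  For \<open>p > 1\<close> the weak norm is equivalent to a genuine norm, the supremum of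
  \<open>\<bar>E\<bar>\<^sup>1\<^sup>/\<^sup>p\<^sup>-\<^sup>1 \<integral>\<^sub>E \<bar>f\<bar>\<close> over bounded Borel sets \<open>E\<close>. It satisfies Minkowski's integral inequality and
  is lower semicontinuous, and it bounds the mean of \<open>\<bar>f\<bar>\<close> over a cube of side \<open>r\<close> by
  \<open>r\<^sup>-\<^sup>d\<^sup>/\<^sup>p\<close> times the norm. Hence a test function has small mean oscillation as soon as on every scale
  \<open>r\<close> it splits into a part of norm \<open>O(r\<^sup>d\<^sup>/\<^sup>p)\<close> and a part that varies by \<open>O(1)\<close> over
  distances \<open>r\<close>. In the Besov and Sobolev cases the smooth part is a combination of heat averages
  that reproduces the function up to \<open>k\<close>-th differences; in the Riesz case it is the
  large-time part of the representation of a Riesz potential by the heat semigroup. The embedding of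
  the completion is injective because all three seminorms are lower semicontinuous along sequences of
  test functions that tend to \<open>0\<close> in BMO.
\<close>

section \<open>A norm equivalent to the weak norm\<close>

text \<open>A weak norm cannot be moved under an integral sign, and every decomposition below is an
  average; this is why \<open>p > 1\<close> enters at the start, through an equivalent norm. One
  kernel serves all three spaces: the Gaussian average contracts the norm as a convolution, and as
  the multiplier \<open>exp (- (\<rho> * norm \<xi>)\<^sup>2)\<close> it meets the fractional
  Laplacian. The Riesz space is not sent through the Besov space; the time integral of the heat
  semigroup, cut at \<open>r\<^sup>2\<close>, already is the required splitting at scale
  \<open>r\<close>.

  The obstacle is injectivity. Equal limits in BMO give convergence modulo constants only, whereas
  equality in the completion asks for convergence in the stronger seminorm. For a Cauchy sequence it
  is enough to keep a bound on \<open>N' (w - v m)\<close> in the limit, as \<open>v m\<close> tends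
  to 0 in BMO. Differences kill the constants and are local, so the bound survives for them;
  derivatives are reached through small difference quotients. The fractional Laplacian is not local:
  it is first smoothed at scale \<open>\<rho>\<close>, after which it maps BMO to bounded functions,
  and \<open>\<rho>\<close> tends to 0 last.\<close>

definition mz_norm :: "real \<Rightarrow> (real ^ 'd::finite \<Rightarrow> ennreal) \<Rightarrow> ennreal" where
  "mz_norm p G = (SUP E\<in>{E \<in> sets borel. bounded E}.
     (\<integral>\<^sup>+x\<in>E. G x \<partial>lborel) / ennreal (measure lborel E powr (1 - 1 / p)))"

abbreviation mz_seminorm :: "real \<Rightarrow> (real ^ 'd::finite \<Rightarrow> 'b::real_normed_vector) \<Rightarrow> ennreal" where
  "mz_seminorm p f \<equiv> mz_norm p (\<lambda>x. ennreal (norm (f x)))"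

lemma emeasure_lborel_bounded:
  "bounded E \<Longrightarrow> E \<in> sets borel \<Longrightarrow> emeasure lborel E = ennreal (measure lborel E)"
  by (metis emeasure_bounded_finite emeasure_eq_ennreal_measure infinity_ennreal_def order_less_irrefl)

lemma mz_normI:
  fixes G :: "real ^ 'd::finite \<Rightarrow> ennreal"
  assumes "\<And>E. E \<in> sets borel \<Longrightarrow> bounded E \<Longrightarrow>
    (\<integral>\<^sup>+x\<in>E. G x \<partial>lborel) \<le> M * ennreal (measure lborel E powr (1 - 1 / p))"
  shows "mz_norm p G \<le> M"
  unfolding mz_norm_def
proof (rule SUP_least, clarify)
  fix E :: "(real ^ 'd) set" assume E: "E \<in> sets borel" "bounded E"
  let ?b = "ennreal (measure lborel E powr (1 - 1 / p))"
  show "(\<integral>\<^sup>+x\<in>E. G x \<partial>lborel) / ?b \<le> M"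
  proof (cases "?b = 0")
    \<comment> \<open>Null sets are harmless: \<open>M * 0 = 0\<close> even for infinite
      \<open>M\<close>, and \<open>0 / 0 = 0\<close> in \<open>ennreal\<close>.\<close>
    case True
    then have "(\<integral>\<^sup>+x\<in>E. G x \<partial>lborel) = 0" using assms[OF E] by simp
    then show ?thesis by simp
  next
    case False
    then show ?thesis using assms[OF E]
      by (simp add: divide_le_posI_ennreal zero_less_iff_neq_zero mult.commute)
  qed
qed

lemma mz_normD:
  assumes "E \<in> sets borel" "bounded E"
  shows "(\<integral>\<^sup>+x\<in>E. G x \<partial>lborel) \<le> mz_norm p G * ennreal (measure lborel E powr (1 - 1 / p))"
proof (cases "measure lborel E = 0")
  case True
  then have "E \<in> null_sets lborel"
    using assms emeasure_lborel_bounded[of E] by auto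
  then show ?thesis by (simp add: nn_integral_null_set)
next
  case False
  let ?b = "ennreal (measure lborel E powr (1 - 1 / p))"
  have b: "?b \<noteq> 0" "?b \<noteq> \<top>" using False by (auto simp: zero_less_measure_iff)
  have "(\<integral>\<^sup>+x\<in>E. G x \<partial>lborel) / ?b \<le> mz_norm p G"
    unfolding mz_norm_def using assms by (intro SUP_upper) auto
  then have "(\<integral>\<^sup>+x\<in>E. G x \<partial>lborel) / ?b * ?b \<le> mz_norm p G * ?b"
    by (rule mult_right_mono) simp
  then show ?thesis using b
    by (simp add: ennreal_divide_times ennreal_divide_self zero_less_iff_neq_zero top.not_eq_extremum ennreal_mult_divide_eq ennreal_times_divide)
qed

lemma mz_norm_mono:
  fixes G H :: "real ^ 'd::finite \<Rightarrow> ennreal"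
  assumes "\<And>x. G x \<le> H x"
  shows "mz_norm p G \<le> mz_norm p H"
  by (rule mz_normI, rule order_trans[OF _ mz_normD]) (auto intro!: nn_integral_mono mult_right_mono assms)

lemma mz_norm_zero [simp]: "mz_norm p (\<lambda>x. 0) = 0"
  using mz_normI[of "\<lambda>x. 0" 0 p] by simp

lemma mz_norm_add:
  fixes G H :: "real ^ 'd::finite \<Rightarrow> ennreal"
  assumes [measurable]: "G \<in> borel_measurable borel" "H \<in> borel_measurable borel"
  shows "mz_norm p (\<lambda>x. G x + H x) \<le> mz_norm p G + mz_norm p H"
proof (rule mz_normI)
  fix E :: "(real ^ 'd) set" assume E[measurable]: "E \<in> sets borel" and b: "bounded E"
  have "(\<integral>\<^sup>+x\<in>E. (G x + H x) \<partial>lborel) = (\<integral>\<^sup>+x\<in>E. G x \<partial>lborel) + (\<integral>\<^sup>+x\<in>E. H x \<partial>lborel)"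
    by (subst nn_integral_add[symmetric]) (auto intro!: nn_integral_cong simp: indicator_def)
  also have "\<dots> \<le> (mz_norm p G + mz_norm p H) * ennreal (measure lborel E powr (1 - 1 / p))"
    unfolding distrib_right by (intro add_mono mz_normD E b)
  finally show "(\<integral>\<^sup>+x\<in>E. (G x + H x) \<partial>lborel) \<le> (mz_norm p G + mz_norm p H) * ennreal (measure lborel E powr (1 - 1 / p))" .
qed

lemma mz_norm_sum:
  assumes "finite I" and meas: "\<And>i. i \<in> I \<Longrightarrow> G i \<in> borel_measurable borel"
  shows "mz_norm p (\<lambda>x. \<Sum>i\<in>I. G i x) \<le> (\<Sum>i\<in>I. mz_norm p (G i))"
  using assms
proof (induction I rule: finite_induct)
  case (insert i I)
  have "mz_norm p (\<lambda>x. G i x + (\<Sum>i\<in>I. G i x)) \<le> mz_norm p (G i) + mz_norm p (\<lambda>x. \<Sum>i\<in>I. G i x)"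
    using insert by (intro mz_norm_add) auto
  then show ?case using insert by (auto intro: order_trans add_left_mono)
qed simp

lemma mz_norm_cmult:
  fixes G :: "real ^ 'd::finite \<Rightarrow> ennreal"
  assumes [measurable]: "G \<in> borel_measurable borel"
  shows "mz_norm p (\<lambda>x. c * G x) \<le> c * mz_norm p G"
proof (rule mz_normI)
  fix E :: "(real ^ 'd) set" assume E[measurable]: "E \<in> sets borel" and b: "bounded E"
  have "(\<integral>\<^sup>+x\<in>E. (c * G x) \<partial>lborel) = c * (\<integral>\<^sup>+x\<in>E. G x \<partial>lborel)"
    by (subst nn_integral_cmult[symmetric]) (auto intro!: nn_integral_cong simp: mult.assoc)
  also have "\<dots> \<le> c * (mz_norm p G * ennreal (measure lborel E powr (1 - 1 / p)))"
    by (intro mult_left_mono mz_normD E b) auto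
  finally show "(\<integral>\<^sup>+x\<in>E. (c * G x) \<partial>lborel) \<le> c * mz_norm p G * ennreal (measure lborel E powr (1 - 1 / p))"
    by (simp add: mult.assoc)
qed

lemma nn_integral_lborel_affine:
  fixes f :: "real ^ 'd::finite \<Rightarrow> ennreal"
  assumes [measurable]: "f \<in> borel_measurable borel" and c: "c > 0"
  shows "(\<integral>\<^sup>+x. f (t + c *\<^sub>R x) \<partial>lborel) = ennreal (c powr - real CARD('d)) * (\<integral>\<^sup>+x. f x \<partial>lborel)"
proof -
  have cc: "c powr real CARD('d) = c ^ CARD('d)" using c by (simp add: powr_realpow)
  have "(\<integral>\<^sup>+x. f x \<partial>lborel) = (\<integral>\<^sup>+x. f x \<partial>(density (distr lborel borel (\<lambda>x. t + c *\<^sub>R x)) (\<lambda>_. \<bar>c\<bar>^DIM(real ^ 'd))))"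
    using c by (subst lborel_affine[of c t]) auto
  also have "\<dots> = ennreal (c ^ CARD('d)) * (\<integral>\<^sup>+x. f (t + c *\<^sub>R x) \<partial>lborel)"
    using c by (simp add: nn_integral_density nn_integral_distr nn_integral_cmult)
  finally have *: "(\<integral>\<^sup>+x. f x \<partial>lborel) = ennreal (c ^ CARD('d)) * (\<integral>\<^sup>+x. f (t + c *\<^sub>R x) \<partial>lborel)" .
  show ?thesis unfolding * mult.assoc[symmetric] using c
    by (simp add: ennreal_mult[symmetric] cc[symmetric] powr_add[symmetric])
qed

lemma sets_borel_vimage_affine:
  assumes "E \<in> sets borel" shows "{x :: real ^ 'd::finite. t + c *\<^sub>R x \<in> E} \<in> sets borel"
  using measurable_sets_borel[OF _ assms, of "\<lambda>x. t + c *\<^sub>R x"] by (simp add: vimage_def)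

text \<open>The substitution multiplies both the integral and the volume of the set by c^(-d). The
  weight, a power 1 - 1/p of the volume, absorbs all of this factor except c^(-d/p).\<close>

lemma mz_norm_affine:
  fixes G :: "real ^ 'd::finite \<Rightarrow> ennreal"
  assumes [measurable]: "G \<in> borel_measurable borel" and c: "c > 0"
  shows "mz_norm p (\<lambda>x. G (t + c *\<^sub>R x)) \<le> ennreal (c powr - (real CARD('d) / p)) * mz_norm p G"
proof (rule mz_normI)
  fix E :: "(real ^ 'd) set" assume E[measurable]: "E \<in> sets borel" and b: "bounded E"
  define d where "d = real CARD('d)"
  define F where "F = {x. (-t/\<^sub>Rc) + (1/c) *\<^sub>R x \<in> E}"
  have iF: "t + c *\<^sub>R x \<in> F \<longleftrightarrow> x \<in> E" for x
    using c by (simp add: F_def scaleR_add_right divide_inverse_commute)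
  have F[measurable]: "F \<in> sets borel" unfolding F_def by (rule sets_borel_vimage_affine[OF E])
  have "F = (\<lambda>x. t + c *\<^sub>R x) ` E"
  proof safe
    fix x assume "x \<in> F"
    moreover have "x = t + c *\<^sub>R ((-t/\<^sub>Rc) + (1/c) *\<^sub>R x)" using c by (simp add: scaleR_add_right scaleR_diff_right)
    ultimately show "x \<in> (\<lambda>x. t + c *\<^sub>R x) ` E" by (auto simp: F_def)
  qed (use iF in auto)
  then have bF: "bounded F" using bounded_translation[OF bounded_scaling[OF b, of c], of t]
    by (simp add: image_image)
  have eF: "emeasure lborel E = ennreal (c powr - d) * emeasure lborel F"
    using nn_integral_lborel_affine[of "indicator F" c t] c iF by (simp add: d_def indicator_def[abs_def] flip: nn_integral_indicator)
  have mF: "measure lborel E = c powr - d * measure lborel F"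
    using eF b bF by (simp add: emeasure_lborel_bounded ennreal_mult[symmetric])
  have "(\<integral>\<^sup>+x\<in>E. G (t + c *\<^sub>R x) \<partial>lborel) = (\<integral>\<^sup>+x. (G (t + c *\<^sub>R x) * indicator F (t + c *\<^sub>R x)) \<partial>lborel)"
    using iF by (intro nn_integral_cong) (auto simp: indicator_def)
  also have "\<dots> = ennreal (c powr - d) * (\<integral>\<^sup>+x\<in>F. G x \<partial>lborel)"
    using c by (subst nn_integral_lborel_affine[where f="\<lambda>x. G x * indicator F x"]) (auto simp: d_def)
  also have "\<dots> \<le> ennreal (c powr - d) * (mz_norm p G * ennreal (measure lborel F powr (1 - 1 / p)))"
    by (intro mult_left_mono mz_normD F bF) auto
  also have "\<dots> = ennreal (c powr - (d / p)) * mz_norm p G * ennreal (measure lborel E powr (1 - 1 / p))"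
  proof -
    have m: "measure lborel E powr (1 - 1 / p) = c powr (- d * (1 - 1/p)) * measure lborel F powr (1 - 1 / p)"
      unfolding mF using c by (simp add: powr_mult powr_powr)
    have "c powr - (d / p) * (c powr (- d * (1 - 1/p))) = c powr - d"
      unfolding powr_add[symmetric] by (simp add: algebra_simps)
    then have "c powr - d * measure lborel F powr (1 - 1 / p) = c powr - (d / p) * measure lborel E powr (1 - 1 / p)"
      unfolding m by (simp add: mult.assoc[symmetric])
    then have "ennreal (c powr - d) * ennreal (measure lborel F powr (1 - 1 / p)) = ennreal (c powr - (d / p)) * ennreal (measure lborel E powr (1 - 1 / p))"
      by (simp add: ennreal_mult[symmetric])
    then show ?thesis by (simp add: mult.assoc mult.left_commute)
  qed
  finally show "(\<integral>\<^sup>+x\<in>E. G (t + c *\<^sub>R x) \<partial>lborel) \<le> ennreal (c powr - (real CARD('d) / p)) * mz_norm p G * ennreal (measure lborel E powr (1 - 1 / p))"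
    unfolding d_def .
qed

lemma mz_norm_translate:
  fixes G :: "real ^ 'd::finite \<Rightarrow> ennreal"
  assumes "G \<in> borel_measurable borel"
  shows "mz_norm p (\<lambda>x. G (x + t)) \<le> mz_norm p G"
  using mz_norm_affine[OF assms, of 1 p t] by (simp add: add.commute)

text \<open>The norm is a supremum of positive linear functionals, so Tonelli's theorem for each
  single set \<open>E\<close> gives Minkowski's integral inequality.\<close>

lemma mz_norm_integral:
  fixes K :: "real ^ 'd::finite \<Rightarrow> 'a \<Rightarrow> ennreal"
  assumes "sigma_finite_measure N"
    and [measurable]: "(\<lambda>(x, y). K x y) \<in> borel_measurable (borel \<Otimes>\<^sub>M N)" "B \<in> borel_measurable N"
    and B: "\<And>y. y \<in> space N \<Longrightarrow> mz_norm p (\<lambda>x. K x y) \<le> B y"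
  shows "mz_norm p (\<lambda>x. \<integral>\<^sup>+y. K x y \<partial>N) \<le> (\<integral>\<^sup>+y. B y \<partial>N)"
proof (rule mz_normI)
  fix E :: "(real ^ 'd) set" assume E[measurable]: "E \<in> sets borel" and b: "bounded E"
  interpret N: sigma_finite_measure N by fact
  interpret pair_sigma_finite lborel N ..
  have "(\<integral>\<^sup>+x\<in>E. (\<integral>\<^sup>+y. K x y \<partial>N) \<partial>lborel) = (\<integral>\<^sup>+x. (\<integral>\<^sup>+y. K x y * indicator E x \<partial>N) \<partial>lborel)"
    by (intro nn_integral_cong nn_integral_multc[symmetric]) measurable
  also have "\<dots> = (\<integral>\<^sup>+y. (\<integral>\<^sup>+x. K x y * indicator E x \<partial>lborel) \<partial>N)"
    by (rule Fubini'[symmetric]) measurable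
  also have "\<dots> \<le> (\<integral>\<^sup>+y. B y * ennreal (measure lborel E powr (1 - 1 / p)) \<partial>N)"
    by (intro nn_integral_mono order_trans[OF mz_normD[OF E b, where p=p]] mult_right_mono B) auto
  also have "\<dots> = (\<integral>\<^sup>+y. B y \<partial>N) * ennreal (measure lborel E powr (1 - 1 / p))"
    by (intro nn_integral_multc) auto
  finally show "(\<integral>\<^sup>+x\<in>E. (\<integral>\<^sup>+y. K x y \<partial>N) \<partial>lborel) \<le> (\<integral>\<^sup>+y. B y \<partial>N) * ennreal (measure lborel E powr (1 - 1 / p))" .
qed

text \<open>The comparison function \<open>H\<close> may depend on the set and on the error. All
  limits in the lower semicontinuity proofs are therefore taken in L1 on one bounded set at a
  time.\<close>

lemma mz_norm_approx:
  fixes G :: "real ^ 'd::finite \<Rightarrow> ennreal"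
  assumes "\<And>E \<delta>. E \<in> sets borel \<Longrightarrow> bounded E \<Longrightarrow> \<delta> > 0 \<Longrightarrow>
    \<exists>H. mz_norm p H \<le> M \<and> (\<integral>\<^sup>+x\<in>E. G x \<partial>lborel) \<le> (\<integral>\<^sup>+x\<in>E. H x \<partial>lborel) + ennreal \<delta>"
  shows "mz_norm p G \<le> M"
proof (rule mz_normI)
  fix E :: "(real ^ 'd) set" assume E: "E \<in> sets borel" "bounded E"
  show "(\<integral>\<^sup>+x\<in>E. G x \<partial>lborel) \<le> M * ennreal (measure lborel E powr (1 - 1 / p))"
  proof (rule ennreal_le_epsilon)
    fix e :: real assume "0 < e"
    then obtain H where H: "mz_norm p H \<le> M" "(\<integral>\<^sup>+x\<in>E. G x \<partial>lborel) \<le> (\<integral>\<^sup>+x\<in>E. H x \<partial>lborel) + ennreal e"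
      using assms[OF E] by blast
    have "(\<integral>\<^sup>+x\<in>E. H x \<partial>lborel) \<le> M * ennreal (measure lborel E powr (1 - 1 / p))"
      by (rule order_trans[OF mz_normD[OF E, where p=p]]) (intro mult_right_mono H(1), simp)
    then show "(\<integral>\<^sup>+x\<in>E. G x \<partial>lborel) \<le> M * ennreal (measure lborel E powr (1 - 1 / p)) + ennreal e"
      using H(2) by (meson add_right_mono order_trans)
  qed
qed

section \<open>Tails, duality with bounded integrable functions, and comparison with the weak
  norm\<close>

lemma mz_norm_tail:
  fixes G :: "real ^ 'd::finite \<Rightarrow> ennreal"
  assumes p: "p > 1" and [measurable]: "G \<in> borel_measurable borel"
    and M: "mz_norm p G \<le> ennreal M" "M > 0" and l: "l > 0"
  shows emeasure_mz_norm_tail: "emeasure lborel {x. ennreal l < G x} \<le> ennreal ((M / l) powr p)"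
    and nn_integral_mz_norm_tail:
      "(\<integral>\<^sup>+x\<in>{x. ennreal l < G x}. G x \<partial>lborel) \<le> ennreal (M * (M / l) powr (p - 1))"
proof -
  \<comment> \<open>The norm tests bounded sets only, so the level set is exhausted by its parts in
    balls. Their volume e is finite, which permits dividing l e <= M e^(1 - 1/p) to obtain e^(1/p)
    <= M / l.\<close>
  define E where "E n = {x. ennreal l < G x} \<inter> cball 0 (real n)" for n
  have [measurable]: "E n \<in> sets borel" for n unfolding E_def by measurable
  have bE: "bounded (E n)" for n unfolding E_def by (auto intro: bounded_subset[OF bounded_cball])
  have inc: "incseq E" unfolding E_def incseq_def by auto
  have U: "(\<Union>n. E n) = {x. ennreal l < G x}"
    unfolding E_def by (auto simp: dist_norm real_arch_simple)
  have int: "(\<integral>\<^sup>+x\<in>E n. G x \<partial>lborel) \<le> ennreal (M * measure lborel (E n) powr (1 - 1 / p))" for n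
  proof -
    have "(\<integral>\<^sup>+x\<in>E n. G x \<partial>lborel) \<le> ennreal M * ennreal (measure lborel (E n) powr (1 - 1 / p))"
      by (rule order_trans[OF mz_normD[where p=p] mult_right_mono]) (auto simp: M bE)
    then show ?thesis using M by (simp add: ennreal_mult)
  qed
  have meas: "measure lborel (E n) \<le> (M / l) powr p" for n
  proof (cases "measure lborel (E n) = 0")
    case False
    define e where "e = measure lborel (E n)"
    have e: "e > 0" using False by (simp add: e_def zero_less_measure_iff)
    have "ennreal (l * e) = (\<integral>\<^sup>+x\<in>E n. ennreal l \<partial>lborel)"
      using l e bE by (simp add: nn_integral_cmult_indicator emeasure_lborel_bounded e_def ennreal_mult)
    also have "\<dots> \<le> (\<integral>\<^sup>+x\<in>E n. G x \<partial>lborel)"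
      by (intro nn_integral_mono) (auto simp: E_def indicator_def)
    also have "\<dots> \<le> ennreal (M * e powr (1 - 1 / p))" using int by (simp add: e_def)
    finally have "l * e \<le> M * e powr (1 - 1 / p)" using M by (simp add: ennreal_le_iff)
    then have "e / e powr (1 - 1 / p) \<le> M / l" using e l by (simp add: field_simps)
    moreover have "e / e powr (1 - 1 / p) = e powr (1 / p)"
      using e by (simp add: powr_diff)
    ultimately have "e powr (1 / p) \<le> M / l" by simp
    then have "(e powr (1 / p)) powr p \<le> (M / l) powr p" using p by (intro powr_mono2) auto
    then show ?thesis using e p by (simp add: powr_powr e_def)
  qed simp
  have "emeasure lborel {x. ennreal l < G x} = (SUP n. emeasure lborel (E n))"
    unfolding U[symmetric] by (intro SUP_emeasure_incseq[symmetric] inc) auto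
  also have "\<dots> \<le> ennreal ((M / l) powr p)"
    using meas by (intro SUP_least) (simp add: emeasure_lborel_bounded bE)
  finally show "emeasure lborel {x. ennreal l < G x} \<le> ennreal ((M / l) powr p)" .
  have "(\<integral>\<^sup>+x\<in>{x. ennreal l < G x}. G x \<partial>lborel) = (\<integral>\<^sup>+x. (SUP n. G x * indicator (E n) x) \<partial>lborel)"
  proof (intro nn_integral_cong)
    fix x
    have "(SUP n. G x * indicator (E n) x) = G x * (SUP n. indicator (E n) x)"
      by (simp add: SUP_mult_left_ennreal)
    also have "(SUP n. indicator (E n) x :: ennreal) = indicator {x. ennreal l < G x} x"
      unfolding U[symmetric] by (auto simp: indicator_def intro!: antisym SUP_least SUP_upper2)
    finally show "G x * indicator {x. ennreal l < G x} x = (SUP n. G x * indicator (E n) x)" by simp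
  qed
  also have "\<dots> = (SUP n. \<integral>\<^sup>+x. G x * indicator (E n) x \<partial>lborel)"
    using inc by (intro nn_integral_monotone_convergence_SUP)
      (auto simp: incseq_def le_fun_def indicator_def)
  also have "\<dots> \<le> ennreal (M * (M / l) powr (p - 1))"
  proof (intro SUP_least order_trans[OF int] ennreal_leI mult_left_mono)
    fix n
    have "measure lborel (E n) powr (1 - 1 / p) \<le> ((M / l) powr p) powr (1 - 1 / p)"
      using p by (intro powr_mono2 meas) auto
    also have "\<dots> = (M / l) powr (p - 1)" using p by (simp add: powr_powr algebra_simps)
    finally show "measure lborel (E n) powr (1 - 1 / p) \<le> (M / l) powr (p - 1)" .
  qed (use M in auto)
  finally show "(\<integral>\<^sup>+x\<in>{x. ennreal l < G x}. G x \<partial>lborel) \<le> ennreal (M * (M / l) powr (p - 1))" .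
qed

text \<open>Pairing with a kernel that is bounded and integrable, both by \<open>a\<close>. Where
  \<open>G\<close> is at most \<open>M\<close> the integral of the kernel counts; where it is
  larger, the bound of the kernel counts and the tail of \<open>G\<close> contributes at most
  \<open>M\<close>. Each part gives \<open>a * M\<close>.\<close>

lemma mz_norm_hoelder:
  fixes G \<phi> :: "real ^ 'd::finite \<Rightarrow> ennreal"
  assumes p: "p > 1" and [measurable]: "G \<in> borel_measurable borel" "\<phi> \<in> borel_measurable borel"
    and M: "mz_norm p G \<le> ennreal M"
    and a: "\<And>y. \<phi> y \<le> ennreal a" "(\<integral>\<^sup>+y. \<phi> y \<partial>lborel) \<le> ennreal a" "a \<ge> 0"
    and M0: "M \<ge> 0"
  shows "(\<integral>\<^sup>+y. \<phi> y * G y \<partial>lborel) \<le> ennreal (2 * a * M)"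
proof (rule ennreal_le_epsilon)
  fix e :: real assume e: "e > 0"
  \<comment> \<open>The cut must be at a positive level even for \<open>M = 0\<close>; the
    perturbation costs 2 a e / (2 a + 1), which is at most e.\<close>
  define N where "N = M + e / (2 * a + 1)"
  have N: "N > 0" "M \<le> N" using M0 e a(3) by (auto simp: N_def intro: add_nonneg_pos)
  have MN: "mz_norm p G \<le> ennreal N" by (rule order_trans[OF M ennreal_leI[OF N(2)]])
  have "(\<integral>\<^sup>+y. \<phi> y * G y \<partial>lborel)
      \<le> (\<integral>\<^sup>+y. (\<phi> y * ennreal N + ennreal a * (G y * indicator {x. ennreal N < G x} y)) \<partial>lborel)"
  proof (intro nn_integral_mono)
    fix y
    show "\<phi> y * G y \<le> \<phi> y * ennreal N + ennreal a * (G y * indicator {x. ennreal N < G x} y)"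
    proof (cases "ennreal N < G y")
      case True
      then show ?thesis using a(1)[of y] by (simp add: add_increasing mult_right_mono)
    qed (simp add: mult_left_mono not_less)
  qed
  also have "\<dots> = (\<integral>\<^sup>+y. \<phi> y \<partial>lborel) * ennreal N + ennreal a * (\<integral>\<^sup>+x\<in>{x. ennreal N < G x}. G x \<partial>lborel)"
    by (subst nn_integral_add) (auto simp: nn_integral_cmult nn_integral_multc)
  also have "\<dots> \<le> ennreal a * ennreal N + ennreal a * ennreal (N * (N / N) powr (p - 1))"
    by (intro add_mono mult_right_mono mult_left_mono a nn_integral_mz_norm_tail[OF p _ MN N(1) N(1)]) auto
  also have "\<dots> = ennreal (2 * a * N)" using N a(3) by (simp add: ennreal_mult[symmetric] ennreal_plus[symmetric] del: ennreal_plus)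
  also have "\<dots> \<le> ennreal (2 * a * M + e)"
  proof (intro ennreal_leI)
    have "2 * a * (e / (2 * a + 1)) \<le> e" using e a(3) by (simp add: field_simps)
    then show "2 * a * N \<le> 2 * a * M + e" by (simp add: N_def distrib_left)
  qed
  also have "\<dots> = ennreal (2 * a * M) + ennreal e" using e a(3) M0 by (simp add: ennreal_plus)
  finally show "(\<integral>\<^sup>+y. \<phi> y * G y \<partial>lborel) \<le> ennreal (2 * a * M) + ennreal e" .
qed

lemma weak_Lp_norm_leI:
  fixes f :: "real ^ 'd::finite \<Rightarrow> 'b::real_normed_vector"
  assumes p: "p > 0" and M: "M > 0"
    and le: "\<And>l. l > 0 \<Longrightarrow> emeasure lebesgue {x. l < norm (f x)} \<le> ennreal ((M / l) powr p)"
  shows "weak_Lp_norm p f \<le> ennreal M"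
  unfolding weak_Lp_norm_def
proof (rule SUP_least)
  fix t :: real assume "t \<in> {0<..}"
  then have t: "t > 0" by simp
  define l where "l = M / t powr (1 / p)"
  have l: "l > 0" using t M by (simp add: l_def)
  have "(M / l) powr p = t" using t M p by (simp add: l_def powr_powr)
  then have "rearrangement f t \<le> ennreal l"
    unfolding rearrangement_def using l le[OF l] by (intro Inf_lower) auto
  then have "ennreal (t powr (1 / p)) * rearrangement f t \<le> ennreal (t powr (1 / p)) * ennreal l"
    by (rule mult_left_mono) simp
  also have "\<dots> = ennreal M" using t M l by (simp add: ennreal_mult[symmetric] l_def)
  finally show "ennreal (t powr (1 / p)) * rearrangement f t \<le> ennreal M" .
qed

lemma weak_Lp_normD:
  fixes f :: "real ^ 'd::finite \<Rightarrow> 'b::real_normed_vector"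
  assumes p: "p > 0" and M: "M \<ge> 0" and le: "weak_Lp_norm p f \<le> ennreal M" and l: "l > 0"
    and meas: "\<And>l. 0 \<le> l \<Longrightarrow> {x. l < norm (f x)} \<in> sets lebesgue"
  shows "emeasure lebesgue {x. l < norm (f x)} \<le> ennreal ((M / l) powr p)"
proof (rule ccontr)
  assume "\<not> ?thesis"
  then have "ennreal ((M / l) powr p) < emeasure lebesgue {x. l < norm (f x)}" by (simp only: not_le)
  then obtain t where t: "ennreal ((M / l) powr p) < t" "t < emeasure lebesgue {x. l < norm (f x)}"
    by (blast dest: dense)
  then obtain t' where t': "t = ennreal t'" "t' \<ge> 0" by (cases t) auto
  have t'0: "(M / l) powr p < t'" using t t' by (simp add: ennreal_less_iff)
  then have pos: "t' > 0" using powr_ge_zero[of "M / l" p] by linarith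
  have "ennreal l \<le> rearrangement f t'"
    unfolding rearrangement_def
  proof (rule Inf_greatest, clarify)
    fix m :: real assume m: "0 \<le> m" "emeasure lebesgue {x. m < norm (f x)} \<le> ennreal t'"
    show "ennreal l \<le> ennreal m"
    proof (rule ccontr)
      assume "\<not> ?thesis"
      then have "m \<le> l" using m by (simp add: ennreal_le_iff2 not_le)
      then have "emeasure lebesgue {x. l < norm (f x)} \<le> emeasure lebesgue {x. m < norm (f x)}"
        by (intro emeasure_mono meas m) auto
      then show False using m(2) t(2) t' by auto
    qed
  qed
  then have "ennreal (t' powr (1 / p)) * ennreal l \<le> ennreal (t' powr (1 / p)) * rearrangement f t'"
    by (rule mult_left_mono) simp
  also have "\<dots> \<le> weak_Lp_norm p f" unfolding weak_Lp_norm_def using pos by (intro SUP_upper) auto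
  also have "\<dots> \<le> ennreal M" by (rule le)
  finally have "t' powr (1 / p) * l \<le> M" using l M by (simp add: ennreal_mult[symmetric] ennreal_le_iff)
  then have "t' powr (1 / p) \<le> M / l" using l by (simp add: field_simps)
  then have "(t' powr (1 / p)) powr p \<le> (M / l) powr p" using p by (intro powr_mono2) auto
  moreover have "(t' powr (1 / p)) powr p = t'" using pos p by (simp add: powr_powr)
  ultimately show False using t'0 by linarith
qed

lemma weak_Lp_norm_le_mz_norm:
  fixes f :: "real ^ 'd::finite \<Rightarrow> 'b::real_normed_vector"
  assumes p: "p > 1" and [measurable]: "(\<lambda>x. norm (f x)) \<in> borel_measurable borel"
  shows "weak_Lp_norm p f \<le> mz_seminorm p f"
proof (rule ennreal_le_epsilon)
  fix e :: real assume e: "e > 0" and fin: "mz_seminorm p f < \<top>"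
  then obtain M where M: "mz_seminorm p f = ennreal M" "M \<ge> 0"
    by (cases "mz_seminorm p f") auto
  have "weak_Lp_norm p f \<le> ennreal (M + e)"
  proof (rule weak_Lp_norm_leI)
    fix l :: real assume l: "l > 0"
    have "{x. l < norm (f x)} = {x. ennreal l < ennreal (norm (f x))}"
      using l by (auto simp: ennreal_less_iff)
    then have "emeasure lebesgue {x. l < norm (f x)} = emeasure lborel {x. ennreal l < ennreal (norm (f x))}"
      by simp
    also have "\<dots> \<le> ennreal (((M + e) / l) powr p)"
      using M e by (intro emeasure_mz_norm_tail[OF p _ _ _ l]) auto
    finally show "emeasure lebesgue {x. l < norm (f x)} \<le> ennreal (((M + e) / l) powr p)" .
  qed (use p M e in auto)
  then show "weak_Lp_norm p f \<le> mz_seminorm p f + ennreal e"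
    using M e by (simp add: ennreal_plus)
qed

text \<open>For \<open>y > l\<close> the single layer 2^j l < y <= 2^(j+1) l already dominates
  \<open>y\<close>.\<close>

lemma dyadic_layer_bound:
  assumes l: "l > (0::real)" and y: "y \<ge> 0"
  shows "ennreal y \<le> ennreal l + (\<Sum>j. ennreal (2 ^ Suc j * l) * indicator {z. 2 ^ j * l < z} y)"
proof (cases "y \<le> l")
  case True
  then show ?thesis by (auto intro: add_increasing2 ennreal_leI)
next
  case False
  define P where "P j \<longleftrightarrow> y \<le> 2 ^ j * l" for j
  obtain n where "y / l < 2 ^ n" using real_arch_pow[of 2 "y / l"] by auto
  then have "P n" using l by (simp add: P_def field_simps)
  moreover have "\<not> P 0" using False by (simp add: P_def)
  ultimately obtain j where j: "\<not> P j" "P (Suc j)" using dec_induct[of 0 n "\<lambda>j. \<not> P j"] by blast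
  have "ennreal y \<le> ennreal (2 ^ Suc j * l) * indicator {z. 2 ^ j * l < z} y"
    using j by (auto simp: P_def intro!: ennreal_leI)
  also have "\<dots> = (\<Sum>j\<in>{j}. ennreal (2 ^ Suc j * l) * indicator {z. 2 ^ j * l < z} y)"
    by (simp only: sum.insert sum.empty finite.emptyI empty_iff add_0_right not_False_eq_True)
  also have "\<dots> \<le> (\<Sum>j. ennreal (2 ^ Suc j * l) * indicator {z. 2 ^ j * l < z} y)"
    by (intro sum_le_suminf) auto
  finally show ?thesis by (auto intro: add_increasing)
qed

text \<open>The value of 1 + 2 times the sum of 2^(j (1 - p)) over j: the 1 comes from the values
  below the cutting level, the series from the dyadic layers above it. It converges because p >
  1.\<close>

definition mz_const :: "real \<Rightarrow> real" where
  "mz_const p = 1 + 2 / (1 - 2 powr (1 - p))"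

lemma mz_const_pos: "p > 1 \<Longrightarrow> mz_const p > 0"
proof -
  assume "p > 1"
  then have "2 powr (1 - p) < (2::real) powr 0" by (intro powr_less_mono) auto
  then show ?thesis by (simp add: mz_const_def add_pos_nonneg)
qed

lemma mz_norm_le_weak_aux:
  fixes f :: "real ^ 'd::finite \<Rightarrow> 'b::real_normed_vector"
  assumes p: "p > 1" and [measurable]: "(\<lambda>x. norm (f x)) \<in> borel_measurable borel"
    and M: "M > 0" "weak_Lp_norm p f \<le> ennreal M"
  shows "mz_seminorm p f \<le> ennreal (mz_const p * M)"
proof (rule mz_normI)
  fix E :: "(real ^ 'd) set" assume E[measurable]: "E \<in> sets borel" and b: "bounded E"
  define e where "e = measure lborel E"
  show "(\<integral>\<^sup>+x\<in>E. ennreal (norm (f x)) \<partial>lborel) \<le> ennreal (mz_const p * M) * ennreal (measure lborel E powr (1 - 1 / p))"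
  proof (cases "e = 0")
    case True
    then have "E \<in> null_sets lborel" using b E emeasure_lborel_bounded[of E] by (auto simp: e_def)
    then show ?thesis by (simp add: nn_integral_null_set)
  next
    case False
    then have e: "e > 0" by (simp add: e_def zero_less_measure_iff)
    \<comment> \<open>This level balances the two parts: l e equals M e^(1 - 1/p), and the set where
      the function exceeds 2^j l has volume at most e 2^(- j p).\<close>
    define l where "l = M * e powr (- (1 / p))"
    have l: "l > 0" using M e by (simp add: l_def)
    define r where "r = (2::real) powr (1 - p)"
    have r: "0 < r" "r < 1" using p powr_less_mono[of "1 - p" 0 "2::real"] by (auto simp: r_def)
    have tail: "emeasure lborel {x. 2 ^ j * l < norm (f x)} \<le> ennreal (e * 2 powr (- (real j * p)))" for j
    proof -
      have "emeasure lborel {x. 2 ^ j * l < norm (f x)} = emeasure lebesgue {x. 2 ^ j * l < norm (f x)}" by simp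
      also have "\<dots> \<le> ennreal ((M / (2 ^ j * l)) powr p)"
        using p M l by (intro weak_Lp_normD) (auto intro!: sets_completionI_sets)
      also have "M / (2 ^ j * l) = 2 powr (- real j) * e powr (1 / p)"
        using M e by (simp add: l_def powr_minus powr_realpow field_simps)
      also have "(2 powr (- real j) * e powr (1 / p)) powr p = e * 2 powr (- (real j * p))"
        using e p by (simp add: powr_mult powr_powr)
      finally show ?thesis .
    qed
    have "(\<integral>\<^sup>+x\<in>E. ennreal (norm (f x)) \<partial>lborel) \<le>
        (\<integral>\<^sup>+x. (ennreal l * indicator E x + (\<Sum>j. ennreal (2 ^ Suc j * l) * indicator {x. 2 ^ j * l < norm (f x)} x)) \<partial>lborel)"
    proof (intro nn_integral_mono)
      fix x
      show "ennreal (norm (f x)) * indicator E x \<le> ennreal l * indicator E x + (\<Sum>j. ennreal (2 ^ Suc j * l) * indicator {x. 2 ^ j * l < norm (f x)} x)"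
        using dyadic_layer_bound[OF l norm_ge_zero, of "f x"] by (auto simp: indicator_def cong: if_cong)
    qed
    also have "\<dots> = ennreal l * emeasure lborel E + (\<Sum>j. ennreal (2 ^ Suc j * l) * emeasure lborel {x. 2 ^ j * l < norm (f x)})"
      by (subst nn_integral_add) (auto simp: nn_integral_suminf nn_integral_cmult_indicator)
    also have "\<dots> \<le> ennreal (l * e) + (\<Sum>j. ennreal (2 * l * e * r ^ j))"
    proof (intro add_mono suminf_le)
      show "ennreal l * emeasure lborel E \<le> ennreal (l * e)"
        using b l e by (simp add: emeasure_lborel_bounded e_def ennreal_mult)
      fix j
      have "ennreal (2 ^ Suc j * l) * emeasure lborel {x. 2 ^ j * l < norm (f x)} \<le> ennreal (2 ^ Suc j * l) * ennreal (e * 2 powr (- (real j * p)))"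
        by (intro mult_left_mono tail) auto
      also have "\<dots> = ennreal (2 ^ Suc j * l * (e * 2 powr (- (real j * p))))"
        using l e by (simp add: ennreal_mult)
      also have "2 ^ Suc j * l * (e * 2 powr (- (real j * p))) = 2 * l * e * r ^ j"
      proof -
        have "r ^ j = 2 powr (real j) * 2 powr (- (real j * p))"
          using r by (simp add: r_def powr_realpow[symmetric] powr_powr powr_add[symmetric] algebra_simps)
        then show ?thesis by (simp add: powr_realpow)
      qed
      finally show "ennreal (2 ^ Suc j * l) * emeasure lborel {x. 2 ^ j * l < norm (f x)} \<le> ennreal (2 * l * e * r ^ j)" .
    qed auto
    also have "(\<Sum>j. ennreal (2 * l * e * r ^ j)) = ennreal (2 * l * e * (1 / (1 - r)))"
    proof -
      have "(\<lambda>j. 2 * l * e * r ^ j) sums (2 * l * e * (1 / (1 - r)))"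
        using r by (intro sums_mult geometric_sums) auto
      then show ?thesis using l e r by (subst suminf_ennreal_eq) auto
    qed
    also have "ennreal (l * e) + ennreal (2 * l * e * (1 / (1 - r))) = ennreal (mz_const p * M) * ennreal (e powr (1 - 1 / p))"
    proof -
      have "l * e = M * e powr (1 - 1 / p)" using e by (simp add: l_def powr_diff powr_minus field_simps)
      then have "l * e + 2 * l * e * (1 / (1 - r)) = (mz_const p * M) * e powr (1 - 1 / p)"
        by (simp add: mz_const_def r_def algebra_simps)
      then show ?thesis using l e r M mz_const_pos[OF p] by (simp add: ennreal_mult[symmetric] ennreal_plus[symmetric] del: ennreal_plus)
    qed
    finally show ?thesis by (simp add: e_def)
  qed
qed

lemma mz_norm_le_weak_Lp_norm:
  fixes f :: "real ^ 'd::finite \<Rightarrow> 'b::real_normed_vector"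
  assumes p: "p > 1" and meas: "(\<lambda>x. norm (f x)) \<in> borel_measurable borel"
  shows "mz_seminorm p f \<le> ennreal (mz_const p) * weak_Lp_norm p f"
proof (cases "weak_Lp_norm p f")
  case top
  then show ?thesis using mz_const_pos[OF p] by (simp add: ennreal_mult_top)
next
  case (real M)
  show ?thesis
  proof (rule ennreal_le_epsilon)
    fix e :: real assume e: "e > 0"
    let ?c = "mz_const p"
    have c: "?c > 0" by (rule mz_const_pos[OF p])
    have "mz_seminorm p f \<le> ennreal (?c * (M + e / ?c))"
      using real c e by (intro mz_norm_le_weak_aux[OF p meas]) (auto intro!: add_nonneg_pos ennreal_leI)
    also have "\<dots> = ennreal ?c * weak_Lp_norm p f + ennreal e"
      using real c e by (simp add: distrib_left ennreal_mult[symmetric] ennreal_plus)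
    finally show "mz_seminorm p f \<le> ennreal ?c * weak_Lp_norm p f + ennreal e" .
  qed
qed

section \<open>Bounded mean oscillation and its completeness\<close>

lemma cube_borel [measurable, simp]: "cube a r \<in> sets borel"
  by (simp add: cube_def)

lemma measure_cube [simp]: "r > 0 \<Longrightarrow> measure lborel (cube (a :: real ^ 'd::finite) r) = r ^ CARD('d)"
  unfolding cube_def by (subst content_cbox_cart) (auto simp: interval_ne_empty_cart)

lemma emeasure_cube [simp]:
  assumes "r > 0" shows "emeasure lborel (cube (a :: real ^ 'd::finite) r) = ennreal (r ^ CARD('d))"
proof -
  have "emeasure lborel (cube a r) \<noteq> \<top>" unfolding cube_def using emeasure_lborel_cbox_finite by (auto simp: less_top)
  then show ?thesis using measure_cube[OF assms, of a] by (metis emeasure_eq_ennreal_measure)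
qed

lemma mem_cube: "x \<in> cube a r \<longleftrightarrow> (\<forall>i. a $ i \<le> x $ i \<and> x $ i \<le> a $ i + r)"
  by (simp add: cube_def mem_box_cart)

definition loc_integrable :: "(real ^ 'd::finite \<Rightarrow> complex) \<Rightarrow> bool" where
  "loc_integrable f \<longleftrightarrow> (\<forall>a b. f absolutely_integrable_on cbox a b)"

lemma loc_integrable_cube: "loc_integrable f \<Longrightarrow> set_integrable lebesgue (cube a r) f"
  by (simp add: loc_integrable_def cube_def)

text \<open>Local integrability gives measurability on each cube; the function is the pointwise
  limit of its restrictions to growing cubes.\<close>

lemma loc_integrable_measurable [measurable_dest]:
  fixes f :: "real ^ 'd::finite \<Rightarrow> complex"
  assumes "loc_integrable f" shows "f \<in> borel_measurable lebesgue"
proof (rule borel_measurable_LIMSEQ_metric)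
  define Q where "Q n = cube (\<chi> i. - real n :: real ^ 'd) (2 * real n)" for n
  show "(\<lambda>x. indicator (Q n) x *\<^sub>R f x) \<in> borel_measurable lebesgue" for n
    using loc_integrable_cube[OF assms] unfolding Q_def set_integrable_def by auto
  fix x :: "real ^ 'd"
  obtain N :: nat where N: "norm x \<le> real N" using real_arch_simple by blast
  have "x \<in> Q n" if "n \<ge> N" for n
    unfolding Q_def mem_cube
  proof
    fix i
    show "(\<chi> i. - real n :: real ^ 'd) $ i \<le> x $ i \<and> x $ i \<le> (\<chi> i. - real n :: real ^ 'd) $ i + 2 * real n"
      using that N component_le_norm_cart[of x i] by (simp add: abs_le_iff)
  qed
  then show "(\<lambda>n. indicator (Q n) x *\<^sub>R f x) \<longlonglongrightarrow> f x"
    by (intro tendsto_eventually) (auto simp: eventually_sequentially indicator_def)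
qed

lemma loc_integrable_diff: "loc_integrable f \<Longrightarrow> loc_integrable g \<Longrightarrow> loc_integrable (\<lambda>x. f x - g x)"
  unfolding loc_integrable_def by (blast intro: set_integral_diff)

lemma loc_integrable_const: "loc_integrable (\<lambda>x. c)"
  unfolding loc_integrable_def by (auto intro: absolutely_integrable_continuous)

lemma loc_integrable_bounded:
  fixes f :: "real ^ 'd::finite \<Rightarrow> complex"
  assumes [measurable]: "f \<in> borel_measurable borel" and B: "\<And>x. norm (f x) \<le> B"
  shows "loc_integrable f"
  unfolding loc_integrable_def
proof (intro allI)
  fix a b :: "real ^ 'd"
  have "integrable lborel (\<lambda>x. indicator (cbox a b) x *\<^sub>R f x)"
  proof (rule Bochner_Integration.integrable_bound)
    show "integrable lborel (\<lambda>x. indicator (cbox a b) x * B)"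
      using emeasure_lborel_cbox_finite[of a b] by (auto intro!: integrable_real_indicator integrable_mult_left)
    show "AE x in lborel. norm (indicator (cbox a b) x *\<^sub>R f x) \<le> norm (indicator (cbox a b) x * B)"
      using order_trans[OF B abs_ge_self] by (auto simp: indicator_def)
  qed auto
  then show "f absolutely_integrable_on cbox a b"
    unfolding set_integrable_def by (subst integrable_completion) auto
qed

lemma average_diff:
  "loc_integrable f \<Longrightarrow> loc_integrable g \<Longrightarrow> average (\<lambda>x. f x - g x) (cube a r) = average f (cube a r) - average g (cube a r)"
  unfolding average_def by (simp add: loc_integrable_cube set_integral_diff scaleR_diff_right)

lemma average_const: "r > 0 \<Longrightarrow> average (\<lambda>x. c) (cube (a :: real ^ 'd::finite) r) = c"
  unfolding average_def by (simp add: set_lebesgue_integral_def emeasure_cube)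

lemma average_dist:
  fixes f :: "real ^ 'd::finite \<Rightarrow> complex"
  assumes f: "loc_integrable f" and r: "r > 0"
  shows "ennreal (norm (average f (cube a r) - c)) * ennreal (r ^ CARD('d)) \<le> (\<integral>\<^sup>+x\<in>cube a r. ennreal (norm (f x - c)) \<partial>lebesgue)"
proof -
  let ?Q = "cube a r"
  have g: "loc_integrable (\<lambda>x. f x - c)" by (intro loc_integrable_diff f loc_integrable_const)
  have "average f ?Q - c = average (\<lambda>x. f x - c) ?Q"
    using average_diff[OF f loc_integrable_const, of c a r] average_const[OF r, of c a] by simp
  then have "ennreal (norm (average f ?Q - c)) * ennreal (r ^ CARD('d)) = ennreal (norm (LINT x:?Q|lebesgue. f x - c))"
    using r by (simp add: average_def ennreal_mult[symmetric] divide_inverse[symmetric])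
  also have "\<dots> \<le> (\<integral>\<^sup>+x. norm (indicator ?Q x *\<^sub>R (f x - c)) \<partial>lebesgue)"
    using loc_integrable_cube[OF g] unfolding set_lebesgue_integral_def set_integrable_def
    by (rule integral_norm_bound_ennreal)
  also have "\<dots> = (\<integral>\<^sup>+x\<in>?Q. ennreal (norm (f x - c)) \<partial>lebesgue)"
    by (intro nn_integral_cong) (auto simp: indicator_def)
  finally show ?thesis .
qed

lemma nn_integral_diff_triangle:
  fixes f g :: "real ^ 'd::finite \<Rightarrow> complex"
  assumes [measurable]: "f \<in> borel_measurable lebesgue" "g \<in> borel_measurable lebesgue" and [measurable]: "Q \<in> sets lebesgue"
  shows "(\<integral>\<^sup>+x\<in>Q. ennreal (norm (f x - g x)) \<partial>lebesgue) \<le> (\<integral>\<^sup>+x\<in>Q. ennreal (norm (f x)) \<partial>lebesgue) + (\<integral>\<^sup>+x\<in>Q. ennreal (norm (g x)) \<partial>lebesgue)"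
  by (subst nn_integral_add[symmetric])
     (auto intro!: nn_integral_mono simp: indicator_def ennreal_plus[symmetric] norm_triangle_ineq4 simp del: ennreal_plus)

text \<open>The average itself deviates from \<open>c\<close> by at most the mean of the deviation
  of \<open>f\<close>. Hence any constant may replace the average at the price of a factor
  2.\<close>

lemma oscillation_le:
  fixes f :: "real ^ 'd::finite \<Rightarrow> complex"
  assumes f: "loc_integrable f" and r: "r > 0"
  shows "(\<integral>\<^sup>+x\<in>cube a r. ennreal (norm (f x - average f (cube a r))) \<partial>lebesgue)
    \<le> 2 * (\<integral>\<^sup>+x\<in>cube a r. ennreal (norm (f x - c)) \<partial>lebesgue)"
proof -
  note [measurable] = loc_integrable_measurable[OF f]
  let ?Q = "cube a r"
  have "(\<integral>\<^sup>+x\<in>?Q. ennreal (norm (f x - average f ?Q)) \<partial>lebesgue) = (\<integral>\<^sup>+x\<in>?Q. ennreal (norm ((f x - c) - (average f ?Q - c))) \<partial>lebesgue)"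
    by simp
  also have "\<dots> \<le> (\<integral>\<^sup>+x\<in>?Q. ennreal (norm (f x - c)) \<partial>lebesgue) + (\<integral>\<^sup>+x\<in>?Q. ennreal (norm (average f ?Q - c)) \<partial>lebesgue)"
    by (rule nn_integral_diff_triangle) auto
  also have "(\<integral>\<^sup>+x\<in>?Q. ennreal (norm (average f ?Q - c)) \<partial>lebesgue) = ennreal (norm (average f ?Q - c)) * ennreal (r ^ CARD('d))"
    using r by (simp add: nn_integral_cmult_indicator emeasure_cube)
  also have "\<dots> \<le> (\<integral>\<^sup>+x\<in>?Q. ennreal (norm (f x - c)) \<partial>lebesgue)" by (rule average_dist[OF f r])
  finally show ?thesis by (simp add: mult_2)
qed

lemma BMO_seminormD:
  fixes f :: "real ^ 'd::finite \<Rightarrow> complex"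
  assumes r: "r > 0"
  shows "(\<integral>\<^sup>+x\<in>cube a r. ennreal (norm (f x - average f (cube a r))) \<partial>lebesgue) \<le> BMO_seminorm f * ennreal (r ^ CARD('d))"
proof -
  let ?b = "ennreal (r ^ CARD('d))" and ?I = "\<integral>\<^sup>+x\<in>cube a r. ennreal (norm (f x - average f (cube a r))) \<partial>lebesgue"
  have "?I / emeasure lebesgue (cube a r) \<le> BMO_seminorm f"
    unfolding BMO_seminorm_def using r by (intro SUP_upper) auto
  then have "?I / ?b * ?b \<le> BMO_seminorm f * ?b"
    using r by (intro mult_right_mono) (simp_all add: emeasure_cube)
  moreover have "?I / ?b * ?b = ?I" using r by (simp add: ennreal_divide_times ennreal_divide_self ennreal_times_divide[symmetric])
  ultimately show ?thesis by simp
qed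

lemma BMO_seminorm_leI:
  fixes f :: "real ^ 'd::finite \<Rightarrow> complex"
  assumes "\<And>a r. r > 0 \<Longrightarrow> (\<integral>\<^sup>+x\<in>cube a r. ennreal (norm (f x - average f (cube a r))) \<partial>lebesgue) \<le> M * ennreal (r ^ CARD('d))"
  shows "BMO_seminorm f \<le> M"
  unfolding BMO_seminorm_def
proof (rule SUP_least, clarify)
  fix a :: "real ^ 'd" and r :: real assume r: "r > 0"
  show "(\<integral>\<^sup>+x\<in>cube a r. ennreal (norm (f x - average f (cube a r))) \<partial>lebesgue) / emeasure lebesgue (cube a r) \<le> M"
    using assms[OF r, of a] r by (simp add: emeasure_cube divide_le_posI_ennreal mult.commute)
qed

lemma BMO_seminorm_le_approx:
  fixes f :: "real ^ 'd::finite \<Rightarrow> complex"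
  assumes f: "loc_integrable f"
    and "\<And>a r. r > 0 \<Longrightarrow> \<exists>c. (\<integral>\<^sup>+x\<in>cube a r. ennreal (norm (f x - c)) \<partial>lebesgue) \<le> M * ennreal (r ^ CARD('d))"
  shows "BMO_seminorm f \<le> 2 * M"
proof (rule BMO_seminorm_leI)
  fix a :: "real ^ 'd" and r :: real assume r: "r > 0"
  then obtain c where "(\<integral>\<^sup>+x\<in>cube a r. ennreal (norm (f x - c)) \<partial>lebesgue) \<le> M * ennreal (r ^ CARD('d))"
    using assms(2) by blast
  then show "(\<integral>\<^sup>+x\<in>cube a r. ennreal (norm (f x - average f (cube a r))) \<partial>lebesgue) \<le> 2 * M * ennreal (r ^ CARD('d))"
    unfolding mult.assoc by (intro order_trans[OF oscillation_le[OF f r, of a c]] mult_left_mono) auto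
qed

lemma BMO_seminorm_bounded_finite:
  fixes f :: "real ^ 'd::finite \<Rightarrow> complex"
  assumes "loc_integrable f" and B: "\<And>x. norm (f x) \<le> B"
  shows "BMO_seminorm f < \<infinity>"
proof -
  have "BMO_seminorm f \<le> 2 * ennreal B"
  proof (intro BMO_seminorm_le_approx assms exI)
    fix a :: "real ^ 'd" and r :: real assume r: "r > 0"
    have "(\<integral>\<^sup>+x\<in>cube a r. ennreal (norm (f x - 0)) \<partial>lebesgue) \<le> (\<integral>\<^sup>+x\<in>cube a r. ennreal B \<partial>lebesgue)"
      using B by (intro nn_integral_mono mult_right_mono ennreal_leI) auto
    also have "\<dots> = ennreal B * ennreal (r ^ CARD('d))" using r by (simp add: nn_integral_cmult_indicator emeasure_cube)
    finally show "(\<integral>\<^sup>+x\<in>cube a r. ennreal (norm (f x - 0)) \<partial>lebesgue) \<le> ennreal B * ennreal (r ^ CARD('d))" .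
  qed
  also have "\<dots> < \<infinity>" by (simp add: ennreal_mult_less_top)
  finally show ?thesis .
qed

lemma oscillation_diff_le:
  fixes f g :: "real ^ 'd::finite \<Rightarrow> complex"
  assumes f: "loc_integrable f" and g: "loc_integrable g"
  shows "(\<integral>\<^sup>+x\<in>cube a r. ennreal (norm (f x - g x - average (\<lambda>x. f x - g x) (cube a r))) \<partial>lebesgue)
    \<le> (\<integral>\<^sup>+x\<in>cube a r. ennreal (norm (f x - average f (cube a r))) \<partial>lebesgue)
      + (\<integral>\<^sup>+x\<in>cube a r. ennreal (norm (g x - average g (cube a r))) \<partial>lebesgue)"
proof -
  let ?Q = "cube a r"
  note [measurable] = loc_integrable_measurable[OF f] loc_integrable_measurable[OF g]
  have "(\<integral>\<^sup>+x\<in>?Q. ennreal (norm (f x - g x - average (\<lambda>x. f x - g x) ?Q)) \<partial>lebesgue)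
      = (\<integral>\<^sup>+x\<in>?Q. ennreal (norm ((f x - average f ?Q) - (g x - average g ?Q))) \<partial>lebesgue)"
    by (simp add: average_diff[OF f g] algebra_simps)
  also have "\<dots> \<le> (\<integral>\<^sup>+x\<in>?Q. ennreal (norm (f x - average f ?Q)) \<partial>lebesgue) + (\<integral>\<^sup>+x\<in>?Q. ennreal (norm (g x - average g ?Q)) \<partial>lebesgue)"
    by (rule nn_integral_diff_triangle) auto
  finally show ?thesis .
qed

lemma BMO_seminorm_diff_le:
  fixes f g :: "real ^ 'd::finite \<Rightarrow> complex"
  assumes f: "loc_integrable f" and g: "loc_integrable g"
  shows "BMO_seminorm (\<lambda>x. f x - g x) \<le> BMO_seminorm f + BMO_seminorm g"
  by (rule BMO_seminorm_leI, rule order_trans[OF oscillation_diff_le[OF f g]])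
     (auto simp: distrib_right intro: add_mono BMO_seminormD)

lemma BMO_seminorm_diff_commute:
  "BMO_seminorm (\<lambda>x. f x - g x) = BMO_seminorm (\<lambda>x. g x - f x)"
proof -
  have *: "average (\<lambda>x. f x - g x) Q = - average (\<lambda>x. g x - f x) Q" for Q
  proof -
    have "(LINT x:Q|lebesgue. f x - g x) = (LINT x:Q|lebesgue. - (g x - f x))" by simp
    then show ?thesis unfolding average_def by (simp add: set_lebesgue_integral_def flip: integral_minus scaleR_minus_right)
  qed
  have "norm (f x - g x - average (\<lambda>x. f x - g x) Q) = norm (g x - f x - average (\<lambda>x. g x - f x) Q)" for x Q
  proof -
    have "f x - g x - average (\<lambda>x. f x - g x) Q = - (g x - f x - average (\<lambda>x. g x - f x) Q)" unfolding * by simp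
    then show ?thesis by (simp only: norm_minus_cancel)
  qed
  then show ?thesis unfolding BMO_seminorm_def by (simp only:)
qed

lemma BMO_seminorm_const: "BMO_seminorm (\<lambda>x :: real ^ 'd::finite. c) = 0"
proof -
  have "BMO_seminorm (\<lambda>x :: real ^ 'd. c) \<le> 0" by (rule BMO_seminorm_leI) (simp add: average_const)
  then show ?thesis by simp
qed

lemma BMO_seminorm_diff_const:
  fixes f :: "real ^ 'd::finite \<Rightarrow> complex"
  assumes f: "loc_integrable f" shows "BMO_seminorm (\<lambda>x. f x - c) = BMO_seminorm f"
proof (rule antisym)
  show "BMO_seminorm (\<lambda>x. f x - c) \<le> BMO_seminorm f"
    using BMO_seminorm_diff_le[OF f loc_integrable_const, of c] by (simp add: BMO_seminorm_const)
  have "BMO_seminorm (\<lambda>x. (f x - c) - (- c)) \<le> BMO_seminorm (\<lambda>x. f x - c)"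
    using BMO_seminorm_diff_le[OF loc_integrable_diff[OF f loc_integrable_const] loc_integrable_const, of c "-c"] by (simp add: BMO_seminorm_const)
  then show "BMO_seminorm f \<le> BMO_seminorm (\<lambda>x. f x - c)" by simp
qed

text \<open>The deviation from the large average is integrated over the large cube but divided by
  the volume of the small one, whence the ratio of the volumes.\<close>

lemma average_subcube:
  fixes f :: "real ^ 'd::finite \<Rightarrow> complex"
  assumes f: "loc_integrable f" and r: "r > 0" "r' > 0" and sub: "cube a' r' \<subseteq> cube a r"
  shows "ennreal (norm (average f (cube a' r') - average f (cube a r))) \<le> BMO_seminorm f * ennreal ((r / r') ^ CARD('d))"
proof -
  let ?n = "ennreal (norm (average f (cube a' r') - average f (cube a r)))"
  have "?n * ennreal (r' ^ CARD('d)) \<le> (\<integral>\<^sup>+x\<in>cube a' r'. ennreal (norm (f x - average f (cube a r))) \<partial>lebesgue)"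
    by (rule average_dist[OF f r(2)])
  also have "\<dots> \<le> (\<integral>\<^sup>+x\<in>cube a r. ennreal (norm (f x - average f (cube a r))) \<partial>lebesgue)"
    using sub by (intro nn_integral_mono) (auto simp: indicator_def)
  also have "\<dots> \<le> BMO_seminorm f * ennreal (r ^ CARD('d))" by (rule BMO_seminormD[OF r(1)])
  finally have le: "?n * ennreal (r' ^ CARD('d)) \<le> BMO_seminorm f * ennreal (r ^ CARD('d))" .
  have "?n = ?n * ennreal (r' ^ CARD('d)) * ennreal (1 / r' ^ CARD('d))"
    using r by (simp add: mult.assoc ennreal_mult[symmetric])
  also have "\<dots> \<le> BMO_seminorm f * ennreal (r ^ CARD('d)) * ennreal (1 / r' ^ CARD('d))"
    by (rule mult_right_mono[OF le]) simp
  also have "\<dots> = BMO_seminorm f * ennreal ((r / r') ^ CARD('d))"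
    using r by (simp add: mult.assoc ennreal_mult[symmetric] power_divide)
  finally show ?thesis .
qed

lemma ennreal_power_half_tendsto: "(\<lambda>i. ennreal (K * (1 / 2) ^ i)) \<longlonglongrightarrow> 0"
proof -
  have "(\<lambda>i. ennreal (K * (1 / 2) ^ i)) \<longlonglongrightarrow> ennreal (K * 0)"
    by (intro tendsto_ennrealI tendsto_mult tendsto_const LIMSEQ_realpow_zero) auto
  then show ?thesis by simp
qed

text \<open>BMO ignores constants, so a fast subsequence is first normalised to have mean 0 on a
  fixed cube. On every larger cube the oscillation together with the drift of the averages then
  bounds its increments in L1, the increments form an absolutely convergent series almost
  everywhere, and the oscillation estimates pass to its sum.\<close>

lemma BMO_complete:
  fixes u :: "nat \<Rightarrow> real ^ 'd::finite \<Rightarrow> complex"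
  assumes u: "\<And>n. loc_integrable (u n)"
    and Cauchy: "\<And>e. e > 0 \<Longrightarrow> \<exists>M. \<forall>m\<ge>M. \<forall>n\<ge>M. BMO_seminorm (\<lambda>x. u m x - u n x) < e"
  shows "\<exists>f. loc_integrable f \<and> (\<lambda>n. BMO_seminorm (\<lambda>x. u n x - f x)) \<longlonglongrightarrow> 0"
proof -
  have "\<forall>i. \<exists>M. \<forall>m\<ge>M. \<forall>n\<ge>M. BMO_seminorm (\<lambda>x. u m x - u n x) < ennreal ((1 / 2) ^ i)"
    by (intro allI Cauchy) simp
  then obtain N where N: "\<And>i m n. m \<ge> N i \<Longrightarrow> n \<ge> N i \<Longrightarrow> BMO_seminorm (\<lambda>x. u m x - u n x) < ennreal ((1 / 2) ^ i)"
    by metis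
  \<comment> \<open>Summing the thresholds makes each index exceed all earlier thresholds as well as
    its own.\<close>
  define \<nu> where "\<nu> i = (\<Sum>j\<le>i. N j)" for i
  have \<nu>: "\<nu> i \<ge> N i0" if "i \<ge> i0" for i i0
    unfolding \<nu>_def using that by (intro member_le_sum) auto
  define Q where "Q j = cube (\<chi> i. - real (Suc j) :: real ^ 'd) (2 * real (Suc j))" for j
  have mem_Q: "x \<in> Q j \<longleftrightarrow> (\<forall>i. \<bar>x $ i\<bar> \<le> real (Suc j))" for x j
  proof -
    have "(- a \<le> y \<and> y \<le> - a + 2 * a) \<longleftrightarrow> \<bar>y\<bar> \<le> a" for a y :: real by auto
    then show ?thesis by (simp only: Q_def mem_cube vec_lambda_beta)
  qed
  have Qmono: "Q 0 \<subseteq> Q j" for j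
  proof
    fix x assume "x \<in> Q 0"
    then have "\<bar>x $ i\<bar> \<le> 1" for i by (simp add: mem_Q)
    then have "\<bar>x $ i\<bar> \<le> real (Suc j)" for i by (rule order_trans) simp
    then show "x \<in> Q j" by (simp only: mem_Q) simp
  qed
  have [measurable]: "Q j \<in> sets lebesgue" for j by (simp add: Q_def)
  \<comment> \<open>Fixing the free constants on one cube is what turns convergence modulo constants
    into convergence in L1 on all cubes.\<close>
  define c where "c i = average (u (\<nu> i)) (Q 0)" for i
  define v where "v i x = u (\<nu> i) x - c i" for i x
  define w where "w i x = v (Suc i) x - v i x" for i x
  have v: "loc_integrable (v i)" for i
    unfolding v_def by (intro loc_integrable_diff u loc_integrable_const)
  have w: "loc_integrable (w i)" for i
    unfolding w_def by (intro loc_integrable_diff v)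
  have [measurable]: "v i \<in> borel_measurable lebesgue" "w i \<in> borel_measurable lebesgue" for i
    using v w loc_integrable_measurable by auto
  have BMOw: "BMO_seminorm (w i) \<le> ennreal ((1 / 2) ^ i)" for i
  proof -
    have "w i = (\<lambda>x. (u (\<nu> (Suc i)) x - u (\<nu> i) x) - (c (Suc i) - c i))" by (auto simp: w_def v_def)
    then have "BMO_seminorm (w i) = BMO_seminorm (\<lambda>x. u (\<nu> (Suc i)) x - u (\<nu> i) x)"
      by (simp add: BMO_seminorm_diff_const loc_integrable_diff u)
    then show ?thesis using N[of i "\<nu> (Suc i)" "\<nu> i"] \<nu> by (simp add: less_imp_le)
  qed
  have avw: "average (w i) (Q 0) = 0" for i
  proof -
    have "average (v i) (Q 0) = 0" for i
      unfolding v_def Q_def by (subst average_diff) (auto simp: u loc_integrable_const average_const c_def Q_def)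
    then show ?thesis unfolding w_def Q_def by (subst average_diff) (auto simp: v Q_def)
  qed
  \<comment> \<open>The volume of \<open>Q j\<close>, times 1 for the oscillation on
    \<open>Q j\<close> plus the volume ratio of \<open>Q j\<close> to \<open>Q 0\<close> for the
    distance of its average from 0.\<close>
  define K where "K j = (2 * real (Suc j)) ^ CARD('d) * (1 + real (Suc j) ^ CARD('d))" for j
  have K: "K j \<ge> 0" for j by (simp add: K_def)
  have Iw: "(\<integral>\<^sup>+x\<in>Q j. ennreal (norm (w i x)) \<partial>lebesgue) \<le> ennreal (K j * (1 / 2) ^ i)" for i j
  proof -
    let ?a = "average (w i) (Q j)" and ?V = "(2 * real (Suc j)) ^ CARD('d)" and ?e = "(1 / 2 :: real) ^ i"
    have "ennreal (norm (average (w i) (Q 0) - ?a)) \<le> BMO_seminorm (w i) * ennreal ((2 * real (Suc j) / (2 * real (Suc 0))) ^ CARD('d))"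
      using Qmono[of j] unfolding Q_def by (intro average_subcube w) auto
    also have "\<dots> \<le> ennreal ?e * ennreal (real (Suc j) ^ CARD('d))"
      by (intro mult_mono BMOw) auto
    finally have a: "ennreal (norm ?a) \<le> ennreal (?e * real (Suc j) ^ CARD('d))"
      by (simp add: avw ennreal_mult)
    have "(\<integral>\<^sup>+x\<in>Q j. ennreal (norm (w i x)) \<partial>lebesgue) = (\<integral>\<^sup>+x\<in>Q j. ennreal (norm ((w i x - ?a) - (- ?a))) \<partial>lebesgue)" by simp
    also have "\<dots> \<le> (\<integral>\<^sup>+x\<in>Q j. ennreal (norm (w i x - ?a)) \<partial>lebesgue) + (\<integral>\<^sup>+x\<in>Q j. ennreal (norm (- ?a)) \<partial>lebesgue)"
      by (rule nn_integral_diff_triangle) auto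
    also have "\<dots> \<le> BMO_seminorm (w i) * ennreal ?V + ennreal (norm ?a) * ennreal ?V"
    proof (intro add_mono)
      show "(\<integral>\<^sup>+x\<in>Q j. ennreal (norm (w i x - ?a)) \<partial>lebesgue) \<le> BMO_seminorm (w i) * ennreal ?V"
        unfolding Q_def by (rule BMO_seminormD) simp
      show "(\<integral>\<^sup>+x\<in>Q j. ennreal (norm (- ?a)) \<partial>lebesgue) \<le> ennreal (norm ?a) * ennreal ?V"
        by (simp add: nn_integral_cmult_indicator Q_def)
    qed
    also have "\<dots> \<le> ennreal ?e * ennreal ?V + ennreal (?e * real (Suc j) ^ CARD('d)) * ennreal ?V"
      by (intro add_mono mult_right_mono BMOw a) auto
    also have "\<dots> = ennreal (?e * ?V + ?e * real (Suc j) ^ CARD('d) * ?V)"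
      by (simp add: ennreal_mult ennreal_plus)
    also have "?e * ?V + ?e * real (Suc j) ^ CARD('d) * ?V = K j * ?e"
      by (simp add: K_def algebra_simps)
    finally show ?thesis .
  qed
  have Tw: "(\<Sum>l. \<integral>\<^sup>+x\<in>Q j. ennreal (norm (w (l + i) x)) \<partial>lebesgue) \<le> ennreal (2 * K j * (1 / 2) ^ i)" for i j
  proof -
    have "(\<Sum>l. \<integral>\<^sup>+x\<in>Q j. ennreal (norm (w (l + i) x)) \<partial>lebesgue) \<le> (\<Sum>l. ennreal (K j * (1 / 2) ^ i * (1 / 2) ^ l))"
      by (intro suminf_le order_trans[OF Iw]) (auto simp: power_add mult_ac)
    also have "\<dots> = ennreal (2 * K j * (1 / 2) ^ i)"
    proof -
      have "(\<lambda>l. K j * (1 / 2) ^ i * (1 / 2) ^ l) sums (K j * (1 / 2) ^ i * (1 / (1 - 1 / 2)))"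
        by (intro sums_mult geometric_sums) auto
      then show ?thesis using K[of j] by (subst suminf_ennreal_eq) (auto simp: mult_ac)
    qed
    finally show ?thesis .
  qed
  have AEs: "AE x in lebesgue. x \<in> Q j \<longrightarrow> summable (\<lambda>i. norm (w i x))" for j
  proof -
    have "(\<integral>\<^sup>+x. (\<Sum>i. ennreal (norm (w i x)) * indicator (Q j) x) \<partial>lebesgue) = (\<Sum>i. \<integral>\<^sup>+x\<in>Q j. ennreal (norm (w i x)) \<partial>lebesgue)"
      by (intro nn_integral_suminf) auto
    also have "\<dots> \<le> ennreal (2 * K j * (1 / 2) ^ 0)" using Tw[of 0 j] by simp
    also have "\<dots> < \<top>" by simp
    finally have "AE x in lebesgue. (\<Sum>i. ennreal (norm (w i x)) * indicator (Q j) x) \<noteq> \<infinity>"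
      by (intro nn_integral_noteq_infinite) auto
    then show ?thesis
      by eventually_elim (auto intro: summable_suminf_not_top)
  qed
  \<comment> \<open>On the null set where the series does not converge the value of
    \<open>suminf\<close> is arbitrary.\<close>
  define f where "f x = v 0 x + (\<Sum>i. w i x)" for x
  have intf: "set_integrable lebesgue (Q j) f" for j
  proof -
    have int: "integrable lebesgue (\<lambda>x. indicator (Q j) x *\<^sub>R w i x)" for i
      using loc_integrable_cube[OF w] unfolding Q_def set_integrable_def by blast
    have "integrable lebesgue (\<lambda>x. \<Sum>i. indicator (Q j) x *\<^sub>R w i x)"
    proof (rule integrable_suminf[OF int])
      show "AE x in lebesgue. summable (\<lambda>i. norm (indicator (Q j) x *\<^sub>R w i x))"
        using AEs[of j] by eventually_elim (auto simp: indicator_def)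
      show "summable (\<lambda>i. LINT x|lebesgue. norm (indicator (Q j) x *\<^sub>R w i x))"
      proof (rule summable_comparison_test')
        show "summable (\<lambda>i. K j * (1 / 2) ^ i)" by (intro summable_mult summable_geometric) auto
        fix i :: nat
        have "ennreal (LINT x|lebesgue. norm (indicator (Q j) x *\<^sub>R w i x)) = (\<integral>\<^sup>+x. ennreal (norm (indicator (Q j) x *\<^sub>R w i x)) \<partial>lebesgue)"
          by (intro nn_integral_eq_integral[symmetric] integrable_norm int) auto
        also have "\<dots> = (\<integral>\<^sup>+x\<in>Q j. ennreal (norm (w i x)) \<partial>lebesgue)"
          by (intro nn_integral_cong) (auto simp: indicator_def)
        also have "\<dots> \<le> ennreal (K j * (1 / 2) ^ i)" by (rule Iw)
        finally show "norm (LINT x|lebesgue. norm (indicator (Q j) x *\<^sub>R w i x)) \<le> K j * (1 / 2) ^ i"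
          using K[of j] by (simp add: ennreal_le_iff)
      qed
    qed
    also have "(\<lambda>x. \<Sum>i. indicator (Q j) x *\<^sub>R w i x) = (\<lambda>x. indicator (Q j) x *\<^sub>R (\<Sum>i. w i x))"
    proof
      fix x
      show "(\<Sum>i. indicator (Q j) x *\<^sub>R w i x) = indicator (Q j) x *\<^sub>R (\<Sum>i. w i x)"
        by (cases "x \<in> Q j") simp_all
    qed
    finally have "set_integrable lebesgue (Q j) (\<lambda>x. \<Sum>i. w i x)" unfolding set_integrable_def .
    moreover have "set_integrable lebesgue (Q j) (v 0)" unfolding Q_def by (rule loc_integrable_cube[OF v])
    ultimately show ?thesis unfolding f_def by (rule set_integral_add(1)[rotated])
  qed
  have cover: "\<exists>j. S \<subseteq> Q j" if S: "bounded S" for S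
  proof -
    obtain B where B: "\<forall>x\<in>S. norm x \<le> B" using S by (auto simp: bounded_iff)
    obtain j :: nat where j: "B \<le> real j" using real_arch_simple by blast
    have "S \<subseteq> Q j"
    proof
      fix x assume "x \<in> S"
      then have "norm x \<le> real j" using B j by force
      then have "\<bar>x $ i\<bar> \<le> real (Suc j)" for i using component_le_norm_cart[of x i] by simp
      then show "x \<in> Q j" by (simp only: mem_Q) simp
    qed
    then show ?thesis ..
  qed
  have f: "loc_integrable f"
    unfolding loc_integrable_def
  proof (intro allI)
    fix a b
    obtain j where "cbox a b \<subseteq> Q j" using cover bounded_cbox by blast
    then show "f absolutely_integrable_on cbox a b" by (intro set_integrable_subset[OF intf]) auto
  qed
  note [measurable] = loc_integrable_measurable[OF f]
  have vf: "(\<integral>\<^sup>+x\<in>Q j. ennreal (norm (f x - v i x)) \<partial>lebesgue) \<le> ennreal (2 * K j * (1 / 2) ^ i)" for i j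
  proof -
    have "(\<integral>\<^sup>+x\<in>Q j. ennreal (norm (f x - v i x)) \<partial>lebesgue) \<le> (\<integral>\<^sup>+x. (\<Sum>l. ennreal (norm (w (l + i) x)) * indicator (Q j) x) \<partial>lebesgue)"
    proof (rule nn_integral_mono_AE)
      show "AE x in lebesgue. ennreal (norm (f x - v i x)) * indicator (Q j) x \<le> (\<Sum>l. ennreal (norm (w (l + i) x)) * indicator (Q j) x)"
        using AEs[of j]
      proof eventually_elim
        fix x assume s: "x \<in> Q j \<longrightarrow> summable (\<lambda>i. norm (w i x))"
        show "ennreal (norm (f x - v i x)) * indicator (Q j) x \<le> (\<Sum>l. ennreal (norm (w (l + i) x)) * indicator (Q j) x)"
        proof (cases "x \<in> Q j")
          case True
          then have sn: "summable (\<lambda>i. norm (w i x))" using s by simp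
          then have sw: "summable (\<lambda>i. w i x)" by (rule summable_norm_cancel)
          have sni: "summable (\<lambda>l. norm (w (l + i) x))"
            using sn summable_iff_shift[of "\<lambda>l. norm (w l x)" i] by simp
          have "(\<Sum>l<i. w l x) = v i x - v 0 x" unfolding w_def by (rule sum_lessThan_telescope)
          then have "f x - v i x = (\<Sum>l. w (l + i) x)"
            unfolding f_def using suminf_split_initial_segment[OF sw, of i] by simp
          moreover have "norm (\<Sum>l. w (l + i) x) \<le> (\<Sum>l. norm (w (l + i) x))"
            by (rule summable_norm[OF sni])
          ultimately have "ennreal (norm (f x - v i x)) \<le> ennreal (\<Sum>l. norm (w (l + i) x))" by (simp add: ennreal_leI)
          also have "\<dots> = (\<Sum>l. ennreal (norm (w (l + i) x)))"
            by (intro suminf_ennreal2[symmetric] sni) auto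
          finally show ?thesis using True by simp
        qed simp
      qed
    qed
    also have "\<dots> = (\<Sum>l. \<integral>\<^sup>+x\<in>Q j. ennreal (norm (w (l + i) x)) \<partial>lebesgue)"
      by (intro nn_integral_suminf) auto
    also have "\<dots> \<le> ennreal (2 * K j * (1 / 2) ^ i)" by (rule Tw)
    finally show ?thesis .
  qed
  \<comment> \<open>On a fixed cube \<open>u n\<close> is compared with a late
    \<open>u (\<nu> i)\<close>. The remaining error from \<open>f\<close> is measured in L1 on some
    \<open>Q j\<close> and vanishes as \<open>i\<close> grows, so the bound does not depend on the
    cube.\<close>
  have est: "BMO_seminorm (\<lambda>x. u n x - f x) \<le> ennreal ((1 / 2) ^ i0)" if n: "n \<ge> N i0" for n i0
  proof (rule BMO_seminorm_leI)
    fix a :: "real ^ 'd" and r :: real assume r: "r > 0"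
    let ?Q = "cube a r" and ?e = "ennreal ((1 / 2) ^ i0) * ennreal (r ^ CARD('d))"
    have "bounded ?Q" by (simp add: cube_def)
    then obtain j where j: "?Q \<subseteq> Q j" using cover by blast
    let ?I = "\<integral>\<^sup>+x\<in>?Q. ennreal (norm (u n x - f x - average (\<lambda>x. u n x - f x) ?Q)) \<partial>lebesgue"
    have le: "?I \<le> ?e + ennreal (4 * K j * (1 / 2) ^ i)" if i: "i \<ge> i0" for i
    proof -
      define p where "p x = u n x - u (\<nu> i) x" for x
      define q where "q x = f x - u (\<nu> i) x" for x
      have pq: "loc_integrable p" "loc_integrable q" unfolding p_def q_def by (intro loc_integrable_diff u f)+
      have "?I = (\<integral>\<^sup>+x\<in>?Q. ennreal (norm (p x - q x - average (\<lambda>x. p x - q x) ?Q)) \<partial>lebesgue)"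
        by (simp add: p_def q_def)
      also have "\<dots> \<le> (\<integral>\<^sup>+x\<in>?Q. ennreal (norm (p x - average p ?Q)) \<partial>lebesgue) + (\<integral>\<^sup>+x\<in>?Q. ennreal (norm (q x - average q ?Q)) \<partial>lebesgue)"
        by (rule oscillation_diff_le[OF pq])
      also have "(\<integral>\<^sup>+x\<in>?Q. ennreal (norm (p x - average p ?Q)) \<partial>lebesgue) \<le> BMO_seminorm p * ennreal (r ^ CARD('d))"
        by (rule BMO_seminormD[OF r])
      also have "\<dots> \<le> ?e"
        using N[OF n \<nu>[OF i]] unfolding p_def by (intro mult_right_mono) (auto simp: less_imp_le)
      also have "(\<integral>\<^sup>+x\<in>?Q. ennreal (norm (q x - average q ?Q)) \<partial>lebesgue) \<le> 2 * (\<integral>\<^sup>+x\<in>?Q. ennreal (norm (q x - (- c i))) \<partial>lebesgue)"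
        by (rule oscillation_le[OF pq(2) r])
      also have "\<dots> \<le> 2 * (\<integral>\<^sup>+x\<in>Q j. ennreal (norm (f x - v i x)) \<partial>lebesgue)"
        using j by (intro mult_left_mono nn_integral_mono) (auto simp: q_def v_def indicator_def algebra_simps)
      also have "\<dots> \<le> 2 * ennreal (2 * K j * (1 / 2) ^ i)"
        by (intro mult_left_mono vf) auto
      also have "2 * ennreal (2 * K j * (1 / 2) ^ i) = ennreal 2 * ennreal (2 * K j * (1 / 2) ^ i)" by simp
      also have "\<dots> = ennreal (4 * K j * (1 / 2) ^ i)"
        using K[of j] by (subst ennreal_mult[symmetric]) auto
      finally show ?thesis by (simp add: add_mono)
    qed
    have "(\<lambda>i. ?e + ennreal (4 * K j * (1 / 2) ^ i)) \<longlonglongrightarrow> ?e + 0"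
      by (intro tendsto_add tendsto_const ennreal_power_half_tendsto)
    then show "?I \<le> ?e"
      using le by (intro LIMSEQ_le_const[of _ ?e]) auto
  qed
  have "(\<lambda>n. BMO_seminorm (\<lambda>x. u n x - f x)) \<longlonglongrightarrow> 0"
  proof (rule order_tendstoI)
    fix a :: ennreal assume "0 < a"
    then have "\<forall>\<^sub>F i in sequentially. ennreal (1 * (1 / 2) ^ i) < a"
      using order_tendstoD(2)[OF ennreal_power_half_tendsto] by blast
    then obtain i where i: "ennreal ((1 / 2) ^ i) < a" by (auto simp: eventually_sequentially)
    then show "\<forall>\<^sub>F n in sequentially. BMO_seminorm (\<lambda>x. u n x - f x) < a"
      using est[of i] by (auto simp: eventually_sequentially intro: le_less_trans)
  qed auto
  with f show ?thesis by blast
qed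

section \<open>Test functions\<close>

lemma iterated_partial_Nil [simp]: "iterated_partial [] f = f"
  and iterated_partial_Cons [simp]: "iterated_partial (i # is) f = partial_deriv i (iterated_partial is f)"
  by (simp_all add: iterated_partial_def)

lemma smooth_continuous: "smooth f \<Longrightarrow> continuous_on UNIV (iterated_partial is f)"
  by (simp add: smooth_def)

lemma smooth_vector_derivative:
  assumes "smooth f"
  shows "((\<lambda>t. iterated_partial is f (x + t *\<^sub>R axis i 1)) has_vector_derivative iterated_partial (i # is) f x) (at 0)"
  using assms unfolding smooth_def by (auto simp: partial_deriv_def vector_derivative_works[symmetric])

lemma smoothI:
  assumes "\<And>is. iterated_partial is f = F is"
    and "\<And>is. continuous_on UNIV (F is)"
    and "\<And>is i x. ((\<lambda>t. F is (x + t *\<^sub>R axis i 1)) has_vector_derivative F (i # is) x) (at 0)"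
  shows "smooth f"
  unfolding smooth_def assms(1) using assms(2) differentiableI_vector[OF assms(3)] by blast

text \<open>A calculus rule for derivatives of all orders at once: \<open>F\<close> lists the
  expected derivatives, and verifying one differentiation for each list identifies them by
  induction.\<close>

lemma iterated_partial_eqI:
  assumes "F [] = f"
    and "\<And>is i x. ((\<lambda>t. F is (x + t *\<^sub>R axis i 1)) has_vector_derivative F (i # is) x) (at 0)"
  shows "iterated_partial is f = F is"
proof (induction "is")
  case (Cons i "is")
  then show ?case using vector_derivative_at[OF assms(2)] by (auto simp: partial_deriv_def)
qed (simp add: assms)

lemma iterated_partial_diff:
  assumes "smooth f" "smooth g"
  shows "iterated_partial is (\<lambda>x. f x - g x) = (\<lambda>x. iterated_partial is f x - iterated_partial is g x)"
  by (rule iterated_partial_eqI)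
     (auto intro!: derivative_intros smooth_vector_derivative assms simp del: iterated_partial_Cons)

lemma smooth_diff:
  assumes "smooth f" "smooth g" shows "smooth (\<lambda>x. f x - g x)"
  by (rule smoothI[OF iterated_partial_diff[OF assms]])
     (auto intro!: derivative_intros continuous_intros smooth_continuous smooth_vector_derivative assms simp del: iterated_partial_Cons)

lemma iterated_partial_translate:
  assumes "smooth f"
  shows "iterated_partial is (\<lambda>x. f (x + h)) = (\<lambda>x. iterated_partial is f (x + h))"
proof (rule iterated_partial_eqI)
  fix js i x
  show "((\<lambda>t. iterated_partial js f (x + t *\<^sub>R axis i 1 + h)) has_vector_derivative iterated_partial (i # js) f (x + h)) (at 0)"
    using smooth_vector_derivative[OF assms, of js "x + h" i] by (simp add: add_ac)
qed simp

lemma smooth_translate: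
  assumes "smooth f" shows "smooth (\<lambda>x. f (x + h))"
proof (rule smoothI[OF iterated_partial_translate[OF assms]])
  fix js i x
  show "((\<lambda>t. iterated_partial js f (x + t *\<^sub>R axis i 1 + h)) has_vector_derivative iterated_partial (i # js) f (x + h)) (at 0)"
    using smooth_vector_derivative[OF assms, of js "x + h" i] by (simp add: add_ac)
  show "continuous_on UNIV (\<lambda>x. iterated_partial js f (x + h))"
    by (rule continuous_on_compose2[OF smooth_continuous[OF assms, of js]]) (auto intro: continuous_intros)
qed

lemma iterated_partial_append: "iterated_partial (is @ js) f = iterated_partial is (iterated_partial js f)"
  by (induction "is") auto

lemma smooth_iterated_partial:
  assumes "smooth f" shows "smooth (iterated_partial js f)"
  using assms unfolding smooth_def iterated_partial_append[symmetric] by blast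

lemma test_function_smooth: "f \<in> test_functions \<Longrightarrow> smooth f"
  by (simp add: test_functions_def)

lemma test_function_support:
  assumes "f \<in> test_functions" obtains R where "R > 0" "\<forall>x. norm x > R \<longrightarrow> f x = 0"
proof -
  have "bounded (closure {x. f x \<noteq> 0})" using assms by (simp add: test_functions_def compact_imp_bounded)
  then obtain R where R: "\<And>x. x \<in> closure {x. f x \<noteq> 0} \<Longrightarrow> norm x \<le> R" "R > 0" by (auto simp: bounded_pos)
  then have "\<forall>x. norm x > R \<longrightarrow> f x = 0" using closure_subset[of "{x. f x \<noteq> 0}"] by fastforce
  then show thesis using that R(2) by blast
qed

lemma test_functionI:
  assumes "smooth f" "\<And>x. norm x > R \<Longrightarrow> f x = 0" shows "f \<in> test_functions"
proof -
  have "{x. f x \<noteq> 0} \<subseteq> cball 0 R" using assms(2) by (force simp: not_le[symmetric])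
  then have "bounded (closure {x. f x \<noteq> 0})" by (metis bounded_cball bounded_closure bounded_subset)
  then show ?thesis using assms(1) by (simp add: test_functions_def compact_eq_bounded_closed)
qed

lemma test_function_diff:
  assumes "f \<in> test_functions" "g \<in> test_functions" shows "(\<lambda>x. f x - g x) \<in> test_functions"
proof -
  obtain R where R: "R > 0" "\<forall>x. norm x > R \<longrightarrow> f x = 0" by (rule test_function_support[OF assms(1)])
  obtain S where S: "S > 0" "\<forall>x. norm x > S \<longrightarrow> g x = 0" by (rule test_function_support[OF assms(2)])
  show ?thesis
  proof (rule test_functionI[where R="max R S"])
    show "smooth (\<lambda>x. f x - g x)" by (intro smooth_diff test_function_smooth assms)
  qed (use R S in auto)
qed

lemma test_function_translate:
  assumes "f \<in> test_functions" shows "(\<lambda>x. f (x + h)) \<in> test_functions"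
proof -
  obtain R where R: "R > 0" "\<forall>x. norm x > R \<longrightarrow> f x = 0" by (rule test_function_support[OF assms])
  have "f (x + h) = 0" if "norm x > R + norm h" for x
    using R(2)[rule_format, of "x + h"] that norm_triangle_ineq2[of "x + h" h] norm_diff_ineq[of x h] by auto
  show ?thesis
  proof (rule test_functionI[where R="R + norm h"])
    show "smooth (\<lambda>x. f (x + h))" by (intro smooth_translate test_function_smooth assms)
  qed fact
qed

lemma iterated_partial_eq_0:
  assumes "\<And>x. norm x > R \<Longrightarrow> f x = 0" "norm x > R"
  shows "iterated_partial is f x = 0"
  using assms(2)
proof (induction "is" arbitrary: x)
  case (Cons i "is")
  \<comment> \<open>The strict inequality makes the outer region open, so a whole segment around
    \<open>x\<close> avoids the support.\<close>
  have "open {y :: real ^ 'a. norm y > R}" by (intro open_Collect_less continuous_intros)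
  moreover have "x \<in> {y. norm y > R}" using Cons.prems by simp
  ultimately obtain e where e: "e > 0" "ball x e \<subseteq> {y. norm y > R}" by (rule openE)
  have "((\<lambda>t. iterated_partial is f (x + t *\<^sub>R axis i 1)) has_vector_derivative 0) (at 0)"
  proof (rule has_vector_derivative_transform_within[where f="\<lambda>t. 0", OF _ e(1)])
    fix t :: real assume "dist t 0 < e"
    then have "x + t *\<^sub>R axis i 1 \<in> ball x e" by (simp add: dist_norm)
    then show "0 = iterated_partial is f (x + t *\<^sub>R axis i 1)" using e(2) Cons.IH by auto
  qed auto
  then show ?case using vector_derivative_at by (auto simp: partial_deriv_def)
qed (use assms in auto)

lemma test_function_iterated_partial:
  assumes "f \<in> test_functions" shows "iterated_partial is f \<in> test_functions"
proof -
  obtain R where R: "R > 0" "\<forall>x. norm x > R \<longrightarrow> f x = 0" by (rule test_function_support[OF assms])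
  show ?thesis
    by (rule test_functionI[where R=R])
      (auto intro: smooth_iterated_partial test_function_smooth assms iterated_partial_eq_0[OF R(2)[rule_format]])
qed

lemma test_function_zero: "(\<lambda>x. 0) \<in> test_functions"
proof (rule test_functionI[of _ 0])
  show "smooth (\<lambda>x. 0)"
    by (rule smoothI[where F="\<lambda>_ _. 0"], rule iterated_partial_eqI[where F="\<lambda>_ _. 0"]) auto
qed auto

lemma test_function_continuous: "f \<in> test_functions \<Longrightarrow> continuous_on UNIV f"
  using smooth_continuous[of f "[]"] test_function_smooth[of f] by simp

lemma test_function_borel [measurable_dest]: "f \<in> test_functions \<Longrightarrow> f \<in> borel_measurable borel"
  by (simp add: borel_measurable_continuous_onI test_function_continuous)

lemma test_function_bounded:
  assumes "f \<in> test_functions" obtains B where "B > 0" "\<forall>x. norm (f x) \<le> B"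
proof -
  obtain R where R: "R > 0" "\<forall>x. norm x > R \<longrightarrow> f x = 0" by (rule test_function_support[OF assms])
  have "bounded (f ` cball 0 R)"
    by (intro compact_imp_bounded compact_continuous_image continuous_on_subset[OF test_function_continuous[OF assms]]) auto
  then obtain B where B: "B > 0" "\<And>x. x \<in> cball 0 R \<Longrightarrow> norm (f x) \<le> B" by (auto simp: bounded_pos)
  have "\<forall>x. norm (f x) \<le> B"
  proof
    fix x
    show "norm (f x) \<le> B" using B R(2)[rule_format, of x] by (cases "norm x > R") auto
  qed
  then show thesis using that B(1) by blast
qed

lemma test_function_integrable:
  assumes "f \<in> test_functions" shows "integrable lborel f"
proof -
  obtain R where R: "R > 0" "\<forall>x. norm x > R \<longrightarrow> f x = 0" by (rule test_function_support[OF assms])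
  obtain B where B: "B > 0" "\<forall>x. norm (f x) \<le> B" by (rule test_function_bounded[OF assms])
  note [measurable] = test_function_borel[OF assms]
  show ?thesis
  proof (rule Bochner_Integration.integrable_bound)
    show "integrable lborel (\<lambda>x :: real ^ 'a. indicator (cball 0 R) x * B)"
      using emeasure_lborel_cball_finite[of 0 R] by (auto intro!: integrable_real_indicator integrable_mult_left)
    show "AE x in lborel. norm (f x) \<le> norm (indicator (cball 0 R) x * B)"
      using B R by (auto simp: indicator_def)
  qed auto
qed

lemma test_function_loc_integrable: "f \<in> test_functions \<Longrightarrow> loc_integrable f"
  by (rule test_function_bounded) (auto intro: loc_integrable_bounded test_function_borel)

lemma test_function_BMO: "f \<in> test_functions \<Longrightarrow> BMO_seminorm f < \<infinity>"
  by (rule test_function_bounded) (auto intro: BMO_seminorm_bounded_finite test_function_loc_integrable simp del: infinity_ennreal_def)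

section \<open>Embeddings of completions\<close>

lemma tendsto_0_ennreal_le:
  fixes f g :: "nat \<Rightarrow> ennreal"
  assumes "g \<longlonglongrightarrow> 0" "\<And>n. f n \<le> ennreal C * g n" shows "f \<longlonglongrightarrow> 0"
proof -
  have "(\<lambda>n. ennreal C * g n) \<longlonglongrightarrow> ennreal C * 0"
    by (rule ennreal_tendsto_cmult[OF _ assms(1)]) simp
  then show ?thesis using assms(2)
    by (intro tendsto_sandwich[where f="\<lambda>_. 0" and g=f]) auto
qed

lemma tendsto_0_ennreal_add:
  fixes f g h :: "nat \<Rightarrow> ennreal"
  assumes "g \<longlonglongrightarrow> 0" "h \<longlonglongrightarrow> 0" "\<And>n. f n \<le> g n + h n" shows "f \<longlonglongrightarrow> 0"
proof -
  have "(\<lambda>n. g n + h n) \<longlonglongrightarrow> 0 + 0" by (intro tendsto_add assms)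
  then show ?thesis using assms(3)
    by (intro tendsto_sandwich[where f="\<lambda>_. 0" and g=f]) auto
qed

lemma ennreal_Cauchy_le:
  fixes A B :: "nat \<Rightarrow> nat \<Rightarrow> ennreal"
  assumes A: "\<And>e. e > 0 \<Longrightarrow> \<exists>M. \<forall>m\<ge>M. \<forall>n\<ge>M. A m n < e"
    and B: "\<And>m n. B m n \<le> ennreal C * A m n" and e: "e > 0"
  shows "\<exists>M. \<forall>m\<ge>M. \<forall>n\<ge>M. B m n < e"
proof -
  \<comment> \<open>\<open>e\<close> may be infinite; a finite number below it can be divided by
    \<open>K\<close>.\<close>
  obtain e0 where e0: "0 < e0" "e0 < e" using dense[OF e] by blast
  then obtain r where r: "e0 = ennreal r" "r > 0" by (cases e0) auto
  define K where "K = \<bar>C\<bar> + 1"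
  have K: "K > 0" "ennreal C \<le> ennreal K"
    unfolding K_def by (simp, rule ennreal_leI, linarith)
  have "ennreal (r / K) > 0" using r K by simp
  then obtain M where M: "\<forall>m\<ge>M. \<forall>n\<ge>M. A m n < ennreal (r / K)" using A by blast
  have "B m n < e" if "m \<ge> M" "n \<ge> M" for m n
  proof -
    have "B m n \<le> ennreal K * ennreal (r / K)"
      using M that by (intro order_trans[OF B] mult_mono K) (auto simp: less_imp_le)
    also have "\<dots> = e0" using r K by (simp add: ennreal_mult[symmetric])
    finally show ?thesis using e0 by simp
  qed
  then show ?thesis by blast
qed

text \<open>An equivalent subadditive \<open>N'\<close> has the same Cauchy and null sequences as
  \<open>N\<close>. Completeness of BMO and \<open>bmo\<close> give the map. For injectivity, two
  Cauchy sequences with a common limit have a difference \<open>w\<close> that is Cauchy and tends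
  to 0 in BMO; \<open>lsc\<close>, applied to \<open>w n\<close> and to the tail of \<open>w\<close>
  itself, turns the Cauchy bound for \<open>w n - w m\<close> into the same bound for
  \<open>w n\<close>.\<close>

lemma embeds_in_BMO_criterion:
  fixes N N' :: "(real ^ 'd::finite \<Rightarrow> complex) \<Rightarrow> ennreal"
  assumes le1: "\<And>f. f \<in> test_functions \<Longrightarrow> N f \<le> ennreal K * N' f"
    and le2: "\<And>f. f \<in> test_functions \<Longrightarrow> N' f \<le> ennreal K * N f"
    and zero: "N' (\<lambda>x. 0) = 0"
    and tri: "\<And>f g. f \<in> test_functions \<Longrightarrow> g \<in> test_functions \<Longrightarrow> N' (\<lambda>x. f x - g x) \<le> N' f + N' g"
    and bmo: "\<And>f. f \<in> test_functions \<Longrightarrow> BMO_seminorm f \<le> ennreal C * N' f"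
    and lsc: "\<And>w v e. w \<in> test_functions \<Longrightarrow> (\<And>m. v m \<in> test_functions) \<Longrightarrow>
      (\<lambda>m. BMO_seminorm (v m)) \<longlonglongrightarrow> 0 \<Longrightarrow> (\<And>m :: nat. N' (\<lambda>x. w x - v m x) \<le> e) \<Longrightarrow> N' w \<le> e"
  shows "embeds_in_BMO N"
proof -
  let ?T = "test_functions :: (real ^ 'd \<Rightarrow> complex) set"
  let ?C = "Cauchy_seqs ?T N"
  define S where "S = {(u, v). u \<in> ?C \<and> v \<in> ?C \<and> (\<lambda>n. N (u n - v n)) \<longlonglongrightarrow> 0}"
  define R where "R = {(f, g). f \<in> BMO_functions \<and> g \<in> BMO_functions \<and> BMO_seminorm (\<lambda>x :: real ^ 'd. f x - g x) = 0}"
  have completion: "completion ?T N = ?C // S" unfolding completion_def S_def ..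
  have BMO: "BMO = BMO_functions // R" unfolding BMO_def R_def ..
  have BMOf: "f \<in> BMO_functions \<longleftrightarrow> loc_integrable f \<and> BMO_seminorm f < \<infinity>" for f :: "real ^ 'd \<Rightarrow> complex"
    by (simp add: BMO_functions_def loc_integrable_def)
  have CT: "u n \<in> ?T" if "u \<in> ?C" for u n using that by (simp add: Cauchy_seqs_def)
  have Tl: "loc_integrable (u n)" if "u \<in> ?C" for u n using CT[OF that] by (rule test_function_loc_integrable)
  have CN: "\<exists>M. \<forall>m\<ge>M. \<forall>n\<ge>M. N (\<lambda>x. u m x - u n x) < e" if "u \<in> ?C" "e > 0" for u e
    using that unfolding Cauchy_seqs_def fun_diff_def by blast
  have CN': "\<exists>M. \<forall>m\<ge>M. \<forall>n\<ge>M. N' (\<lambda>x. u m x - u n x) < e" if u: "u \<in> ?C" and e: "e > 0" for u e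
    by (rule ennreal_Cauchy_le[OF CN[OF u] _ e]) (assumption, rule le2[OF test_function_diff[OF CT[OF u] CT[OF u]]])
  have CB: "\<exists>M. \<forall>m\<ge>M. \<forall>n\<ge>M. BMO_seminorm (\<lambda>x. u m x - u n x) < e" if u: "u \<in> ?C" and e: "e > 0" for u e
    by (rule ennreal_Cauchy_le[OF CN'[OF u] _ e]) (assumption, rule bmo[OF test_function_diff[OF CT[OF u] CT[OF u]]])
  have NN': "(\<lambda>n. N (u n - v n)) \<longlonglongrightarrow> 0 \<longleftrightarrow> (\<lambda>n. N' (\<lambda>x. u n x - v n x)) \<longlonglongrightarrow> 0" if u: "u \<in> ?C" and v: "v \<in> ?C" for u v
    unfolding fun_diff_def
  proof
    assume "(\<lambda>n. N (\<lambda>x. u n x - v n x)) \<longlonglongrightarrow> 0"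
    then show "(\<lambda>n. N' (\<lambda>x. u n x - v n x)) \<longlonglongrightarrow> 0"
      by (rule tendsto_0_ennreal_le) (rule le2[OF test_function_diff[OF CT[OF u] CT[OF v]]])
  next
    assume "(\<lambda>n. N' (\<lambda>x. u n x - v n x)) \<longlonglongrightarrow> 0"
    then show "(\<lambda>n. N (\<lambda>x. u n x - v n x)) \<longlonglongrightarrow> 0"
      by (rule tendsto_0_ennreal_le) (rule le1[OF test_function_diff[OF CT[OF u] CT[OF v]]])
  qed
  have S: "(u, v) \<in> S \<longleftrightarrow> u \<in> ?C \<and> v \<in> ?C \<and> (\<lambda>n. N' (\<lambda>x. u n x - v n x)) \<longlonglongrightarrow> 0" for u v
    unfolding S_def using NN' by auto
  \<comment> \<open>Symmetry comes from the triangle inequality for the pair 0 and g - f.\<close>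
  have comm: "N' (\<lambda>x. f x - g x) \<le> N' (\<lambda>x. g x - f x)" if "f \<in> ?T" "g \<in> ?T" for f g
    using tri[OF test_function_zero test_function_diff[OF that(2,1)]] by (simp add: zero)
  have tri3: "N' (\<lambda>x. f x - g x) \<le> N' (\<lambda>x. f x - h x) + N' (\<lambda>x. g x - h x)" if "f \<in> ?T" "g \<in> ?T" "h \<in> ?T" for f g h
    using tri[OF test_function_diff[OF that(1,3)] test_function_diff[OF that(2,3)]] by simp
  have refl_S: "(u, u) \<in> S" if "u \<in> ?C" for u using that by (simp add: S zero)
  have sym_S: "(v, u) \<in> S" if uv: "(u, v) \<in> S" for u v
  proof -
    have u: "u \<in> ?C" and v: "v \<in> ?C" and l: "(\<lambda>n. N' (\<lambda>x. u n x - v n x)) \<longlonglongrightarrow> 0" using uv unfolding S by auto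
    have "(\<lambda>n. N' (\<lambda>x. v n x - u n x)) \<longlonglongrightarrow> 0"
      by (rule tendsto_0_ennreal_le[OF l, where C=1]) (use comm[OF CT[OF v] CT[OF u]] in simp)
    then show ?thesis using u v unfolding S by simp
  qed
  have trans_S: "(u, w) \<in> S" if uv: "(u, v) \<in> S" and vw: "(v, w) \<in> S" for u v w
  proof -
    have u: "u \<in> ?C" and v: "v \<in> ?C" and w: "w \<in> ?C" and l: "(\<lambda>n. N' (\<lambda>x. u n x - v n x)) \<longlonglongrightarrow> 0"
      and l': "(\<lambda>n. N' (\<lambda>x. w n x - v n x)) \<longlonglongrightarrow> 0" using uv sym_S[OF vw] unfolding S by auto
    have "(\<lambda>n. N' (\<lambda>x. u n x - w n x)) \<longlonglongrightarrow> 0"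
      by (rule tendsto_0_ennreal_add[OF l l']) (rule tri3[OF CT[OF u] CT[OF w] CT[OF v]])
    then show ?thesis using u w unfolding S by simp
  qed
  have class_eq: "S `` {u} = S `` {v}" if uv: "(u, v) \<in> S" for u v
  proof (intro set_eqI)
    fix x
    have "(u, x) \<in> S \<longleftrightarrow> (v, x) \<in> S" using trans_S[OF uv] trans_S[OF sym_S[OF uv]] by blast
    then show "x \<in> S `` {u} \<longleftrightarrow> x \<in> S `` {v}" by simp
  qed
  have limI: "(\<lambda>n. BMO_seminorm (\<lambda>x. g n x - f x)) \<longlonglongrightarrow> 0"
    if "loc_integrable f" "\<And>n. loc_integrable (h n)" "\<And>n. loc_integrable (g n)"
      "(\<lambda>n. BMO_seminorm (\<lambda>x. h n x - f x)) \<longlonglongrightarrow> 0" "(\<lambda>n. BMO_seminorm (\<lambda>x. h n x - g n x)) \<longlonglongrightarrow> 0"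
    for f :: "real ^ 'd \<Rightarrow> complex" and g h
  proof (rule tendsto_0_ennreal_add[OF that(4,5)])
    fix n
    show "BMO_seminorm (\<lambda>x. g n x - f x) \<le> BMO_seminorm (\<lambda>x. h n x - f x) + BMO_seminorm (\<lambda>x. h n x - g n x)"
      using BMO_seminorm_diff_le[OF loc_integrable_diff[OF that(2,1), of n] loc_integrable_diff[OF that(2,3), of n n]] by simp
  qed
  \<comment> \<open>Collecting every common limit of the sequences in \<open>F\<close> avoids
    choosing one; \<open>cls\<close> shows that this set is exactly one class of BMO.\<close>
  define \<iota> where "\<iota> F = {f \<in> BMO_functions. \<forall>u\<in>F. (\<lambda>n. BMO_seminorm (\<lambda>x. u n x - f x)) \<longlonglongrightarrow> 0}"
    for F :: "(nat \<Rightarrow> real ^ 'd \<Rightarrow> complex) set"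
  have F_C: "u \<in> ?C" if "F \<in> completion ?T N" "u \<in> F" for F u
    using that unfolding completion quotient_def by (auto simp: S)
  have ex: "\<iota> F \<noteq> {}" if F: "F \<in> completion ?T N" for F
  proof -
    obtain u where u: "u \<in> ?C" "F = S `` {u}" using F unfolding completion quotient_def by auto
    obtain f where f: "loc_integrable f" "(\<lambda>n. BMO_seminorm (\<lambda>x. u n x - f x)) \<longlonglongrightarrow> 0"
      using BMO_complete[OF Tl[OF u(1)] CB[OF u(1)]] by blast
    have "\<forall>\<^sub>F n in sequentially. BMO_seminorm (\<lambda>x. u n x - f x) < 1" using order_tendstoD(2)[OF f(2), of 1] by simp
    then obtain n where n: "BMO_seminorm (\<lambda>x. u n x - f x) < 1" by (auto simp: eventually_sequentially)
    have "BMO_seminorm f \<le> BMO_seminorm (u n) + BMO_seminorm (\<lambda>x. u n x - f x)"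
      using BMO_seminorm_diff_le[OF Tl[OF u(1)] loc_integrable_diff[OF Tl[OF u(1)] f(1)], of n n] by simp
    also have "\<dots> < \<infinity>" using n test_function_BMO[OF CT[OF u(1)], of n]
      by (auto simp: less_top intro: less_trans[OF _ ennreal_one_less_top])
    finally have "f \<in> BMO_functions" using f by (simp add: BMOf)
    moreover have "(\<lambda>n. BMO_seminorm (\<lambda>x. v n x - f x)) \<longlonglongrightarrow> 0" if "v \<in> F" for v
    proof -
      have v: "v \<in> ?C" and l: "(\<lambda>n. N' (\<lambda>x. u n x - v n x)) \<longlonglongrightarrow> 0" using that unfolding u by (auto simp: S)
      have "(\<lambda>n. BMO_seminorm (\<lambda>x. u n x - v n x)) \<longlonglongrightarrow> 0"
        by (rule tendsto_0_ennreal_le[OF l]) (rule bmo[OF test_function_diff[OF CT[OF u(1)] CT[OF v]]])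
      then show ?thesis by (rule limI[OF f(1) Tl[OF u(1)] Tl[OF v] f(2)])
    qed
    ultimately show ?thesis by (auto simp: \<iota>_def)
  qed
  have nonempty: "F \<noteq> {}" if F: "F \<in> completion ?T N" for F
    using F refl_S unfolding completion quotient_def by auto
  have cls: "\<iota> F = R `` {f}" if F: "F \<in> completion ?T N" and f: "f \<in> \<iota> F" for F f
  proof -
    have fB: "f \<in> BMO_functions" and fl: "loc_integrable f" using f by (auto simp: \<iota>_def BMOf)
    have "g \<in> \<iota> F" if g: "(f, g) \<in> R" for g
    proof -
      have gB: "g \<in> BMO_functions" and gl: "loc_integrable g" and fg: "BMO_seminorm (\<lambda>x. g x - f x) = 0"
        using g BMO_seminorm_diff_commute[of g f] by (auto simp: R_def BMOf)
      have "(\<lambda>n. BMO_seminorm (\<lambda>x. u n x - g x)) \<longlonglongrightarrow> 0" if u: "u \<in> F" for u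
      proof (rule tendsto_0_ennreal_add)
        show "(\<lambda>n. BMO_seminorm (\<lambda>x. u n x - f x)) \<longlonglongrightarrow> 0" using f u by (auto simp: \<iota>_def)
        show "(\<lambda>n. BMO_seminorm (\<lambda>x. g x - f x)) \<longlonglongrightarrow> 0" unfolding fg by simp
        show "BMO_seminorm (\<lambda>x. u n x - g x) \<le> BMO_seminorm (\<lambda>x. u n x - f x) + BMO_seminorm (\<lambda>x. g x - f x)" for n
          using BMO_seminorm_diff_le[OF loc_integrable_diff[OF Tl[OF F_C[OF F u]] fl] loc_integrable_diff[OF gl fl], of n] by simp
      qed
      then show ?thesis using gB by (auto simp: \<iota>_def)
    qed
    moreover have "(f, g) \<in> R" if g: "g \<in> \<iota> F" for g
    proof -
      have gB: "g \<in> BMO_functions" and gl: "loc_integrable g" using g by (auto simp: \<iota>_def BMOf)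
      obtain u where u: "u \<in> F" using nonempty[OF F] by blast
      have "(\<lambda>n :: nat. BMO_seminorm (\<lambda>x. f x - g x)) \<longlonglongrightarrow> 0"
      proof (rule tendsto_0_ennreal_add)
        show "(\<lambda>n. BMO_seminorm (\<lambda>x. u n x - g x)) \<longlonglongrightarrow> 0" using g u by (auto simp: \<iota>_def)
        show "(\<lambda>n. BMO_seminorm (\<lambda>x. u n x - f x)) \<longlonglongrightarrow> 0" using f u by (auto simp: \<iota>_def)
        show "BMO_seminorm (\<lambda>x. f x - g x) \<le> BMO_seminorm (\<lambda>x. u n x - g x) + BMO_seminorm (\<lambda>x. u n x - f x)" for n
          using BMO_seminorm_diff_le[OF loc_integrable_diff[OF Tl[OF F_C[OF F u]] gl] loc_integrable_diff[OF Tl[OF F_C[OF F u]] fl], of n n] by simp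
      qed
      then have "BMO_seminorm (\<lambda>x. f x - g x) = 0" by (simp add: LIMSEQ_const_iff)
      then show ?thesis using fB gB by (simp add: R_def)
    qed
    ultimately show ?thesis by auto
  qed
  have "\<iota> \<in> completion ?T N \<rightarrow> BMO"
  proof
    fix F assume F: "F \<in> completion ?T N"
    then obtain f where f: "f \<in> \<iota> F" using ex by blast
    then have "f \<in> BMO_functions" by (simp add: \<iota>_def)
    then show "\<iota> F \<in> BMO" unfolding cls[OF F f] BMO by (rule quotientI)
  qed
  moreover have "inj_on \<iota> (completion ?T N)"
  proof (rule inj_onI)
    fix F G assume F: "F \<in> completion ?T N" and G: "G \<in> completion ?T N" and eq: "\<iota> F = \<iota> G"
    obtain f where f: "f \<in> \<iota> F" "f \<in> \<iota> G" using ex[OF F] eq by blast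
    have fl: "loc_integrable f" using f by (auto simp: \<iota>_def BMOf)
    obtain u where u: "u \<in> ?C" "F = S `` {u}" using F unfolding completion quotient_def by auto
    obtain v where v: "v \<in> ?C" "G = S `` {v}" using G unfolding completion quotient_def by auto
    have uF: "u \<in> F" and vG: "v \<in> G" using refl_S u v by auto
    define w where "w n = (\<lambda>x. u n x - v n x)" for n
    have wT: "w n \<in> ?T" for n unfolding w_def by (rule test_function_diff[OF CT[OF u(1)] CT[OF v(1)]])
    have wB: "(\<lambda>n. BMO_seminorm (w n)) \<longlonglongrightarrow> 0"
    proof (rule tendsto_0_ennreal_add)
      show "(\<lambda>n. BMO_seminorm (\<lambda>x. u n x - f x)) \<longlonglongrightarrow> 0" using f uF by (auto simp: \<iota>_def)
      show "(\<lambda>n. BMO_seminorm (\<lambda>x. v n x - f x)) \<longlonglongrightarrow> 0" using f vG by (auto simp: \<iota>_def)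
      show "BMO_seminorm (w n) \<le> BMO_seminorm (\<lambda>x. u n x - f x) + BMO_seminorm (\<lambda>x. v n x - f x)" for n
        using BMO_seminorm_diff_le[OF loc_integrable_diff[OF Tl[OF u(1)] fl] loc_integrable_diff[OF Tl[OF v(1)] fl], of n n] by (simp add: w_def)
    qed
    have "(\<lambda>n. N' (w n)) \<longlonglongrightarrow> 0"
    proof (rule order_tendstoI)
      fix a :: ennreal assume "0 < a"
      then obtain a1 where a1: "0 < a1" "a1 < a" using dense by blast
      then obtain r where r: "a1 = ennreal r" "r > 0" by (cases a1) auto
      define e where "e = ennreal (r / 2)"
      have e: "e > 0" "e + e = a1" using r by (auto simp: e_def ennreal_plus[symmetric] simp del: ennreal_plus)
      obtain M1 where M1: "\<forall>m\<ge>M1. \<forall>n\<ge>M1. N' (\<lambda>x. u m x - u n x) < e" using CN'[OF u(1) e(1)] by blast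
      obtain M2 where M2: "\<forall>m\<ge>M2. \<forall>n\<ge>M2. N' (\<lambda>x. v m x - v n x) < e" using CN'[OF v(1) e(1)] by blast
      define M where "M = max M1 M2"
      have "N' (w n) < a" if n: "n \<ge> M" for n
      proof -
        have "N' (w n) \<le> a1"
        \<comment> \<open>The subtracted sequence is the tail of \<open>w\<close> beginning at
          \<open>M\<close>; both Cauchy conditions together bound the differences by
          \<open>e + e\<close>, which is \<open>a1\<close>.\<close>
        proof (rule lsc[OF wT])
          show "w (M + m) \<in> ?T" for m by (rule wT)
          show "(\<lambda>m. BMO_seminorm (w (M + m))) \<longlonglongrightarrow> 0"
            using LIMSEQ_ignore_initial_segment[OF wB, of M] by (simp add: add.commute)
          fix m
          have "N' (\<lambda>x. w n x - w (M + m) x) = N' (\<lambda>x. (u n x - u (M + m) x) - (v n x - v (M + m) x))"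
            by (simp add: w_def algebra_simps)
          also have "\<dots> \<le> N' (\<lambda>x. u n x - u (M + m) x) + N' (\<lambda>x. v n x - v (M + m) x)"
            by (rule tri[OF test_function_diff[OF CT[OF u(1)] CT[OF u(1)]] test_function_diff[OF CT[OF v(1)] CT[OF v(1)]]])
          also have "\<dots> \<le> e + e"
            using M1 M2 n by (intro add_mono less_imp_le) (auto simp: M_def)
          finally show "N' (\<lambda>x. w n x - w (M + m) x) \<le> a1" using e by simp
        qed
        then show ?thesis using a1 by simp
      qed
      then show "\<forall>\<^sub>F n in sequentially. N' (w n) < a" by (auto simp: eventually_sequentially)
    qed auto
    then have "(u, v) \<in> S" unfolding S using u v by (simp add: w_def)
    then show "F = G" unfolding u v by (rule class_eq)
  qed
  moreover have "BMO_seminorm f \<le> ennreal (\<bar>C * K\<bar> + 1) * completion_norm N F"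
    if F: "F \<in> completion ?T N" and f: "f \<in> \<iota> F" for F f
  proof -
    \<comment> \<open>Constants of either sign are covered, as \<open>ennreal\<close> sends negative
      ones to 0; the added 1 makes division by \<open>D\<close> possible.\<close>
    define D where "D = \<bar>C * K\<bar> + 1"
    have D: "D > 0" by (simp add: D_def add_nonneg_pos)
    have "BMO_seminorm f \<le> ennreal D * limsup (\<lambda>n. N (u n))" if uF: "u \<in> F" for u
    proof (cases "limsup (\<lambda>n. N (u n))")
      case top
      then show ?thesis using D by (simp add: ennreal_mult_top)
    next
      case (real L)
      note u = F_C[OF F uF]
      have fl: "loc_integrable f" and lim: "(\<lambda>n. BMO_seminorm (\<lambda>x. u n x - f x)) \<longlonglongrightarrow> 0"
        using f uF by (auto simp: \<iota>_def BMOf)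
      show ?thesis
      proof (rule ennreal_le_epsilon)
        fix e :: real assume e: "e > 0"
        \<comment> \<open>Chosen so that the error \<open>D * e'\<close> from the limsup and the
          error \<open>e'\<close> from the convergence in BMO add up to \<open>e\<close>.\<close>
        define e' where "e' = e / (D + 1)"
have e'0: "e' > 0" "(D + 1) * e' = e" using e D by (simp_all add: e'_def add_nonneg_pos)
        then have e': "e' > 0" "D * e' + e' = e" by (simp_all add: algebra_simps)
        have "limsup (\<lambda>n. N (u n)) < ennreal (L + e')" using real e' by (simp add: ennreal_lessI)
        then have "\<forall>\<^sub>F n in sequentially. N (u n) < ennreal (L + e')" by (rule Limsup_lessD)
        moreover have "\<forall>\<^sub>F n in sequentially. BMO_seminorm (\<lambda>x. u n x - f x) < ennreal e'"
          using order_tendstoD(2)[OF lim, of "ennreal e'"] e' by simp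
        ultimately have "\<forall>\<^sub>F n in sequentially. N (u n) < ennreal (L + e') \<and> BMO_seminorm (\<lambda>x. u n x - f x) < ennreal e'"
          by eventually_elim simp
        then obtain n where n: "N (u n) < ennreal (L + e')" "BMO_seminorm (\<lambda>x. u n x - f x) < ennreal e'"
          by (auto simp: eventually_sequentially)
        have "BMO_seminorm (u n) \<le> ennreal C * (ennreal K * N (u n))"
          by (rule order_trans[OF bmo[OF CT[OF u]] mult_left_mono[OF le2[OF CT[OF u]]]]) simp
        also have "\<dots> \<le> ennreal D * ennreal (L + e')"
        proof -
          have "ennreal C * ennreal K \<le> ennreal D"
          proof (cases "C \<ge> 0 \<and> K \<ge> 0")
            case True
            then show ?thesis by (simp add: D_def ennreal_mult[symmetric] ennreal_leI del: ennreal_plus)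
          qed (auto simp: ennreal_neg)
          then show ?thesis unfolding mult.assoc[symmetric] using n by (intro mult_mono) auto
        qed
        finally have b: "BMO_seminorm (u n) \<le> ennreal D * ennreal (L + e')" .
        have "BMO_seminorm f \<le> BMO_seminorm (u n) + BMO_seminorm (\<lambda>x. u n x - f x)"
          using BMO_seminorm_diff_le[OF Tl[OF u] loc_integrable_diff[OF Tl[OF u] fl], of n n] by simp
        also have "\<dots> \<le> ennreal D * ennreal (L + e') + ennreal e'"
          using n b by (intro add_mono) auto
        also have "\<dots> = ennreal (D * L + (D * e' + e'))"
          using real e' D by (simp add: ennreal_mult[symmetric] ennreal_plus[symmetric] distrib_left add.assoc del: ennreal_plus)
        also have "\<dots> = ennreal D * limsup (\<lambda>n. N (u n)) + ennreal e"
          unfolding e'(2) using real e D by (simp add: ennreal_mult[symmetric] ennreal_plus)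
        finally show "BMO_seminorm f \<le> ennreal D * limsup (\<lambda>n. N (u n)) + ennreal e" .
      qed
    qed
    then have "BMO_seminorm f / ennreal D \<le> completion_norm N F"
      unfolding completion_norm_def using D by (intro INF_greatest divide_le_posI_ennreal) auto
    then have "BMO_seminorm f / ennreal D * ennreal D \<le> completion_norm N F * ennreal D"
      by (rule mult_right_mono) simp
    moreover have "BMO_seminorm f / ennreal D * ennreal D = BMO_seminorm f"
      using D by (simp add: ennreal_divide_times ennreal_divide_self ennreal_times_divide[symmetric])
    ultimately show ?thesis unfolding D_def[symmetric] by (simp add: mult.commute)
  qed
  moreover have "(\<lambda>n. BMO_seminorm (\<lambda>x. u n x - f x)) \<longlonglongrightarrow> 0" if "f \<in> \<iota> F" "u \<in> F" for F f u
    using that by (auto simp: \<iota>_def)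
  ultimately show ?thesis unfolding embeds_in_BMO_def by blast
qed

section \<open>The heat kernel\<close>

lemma sum_axis_inner: "(\<Sum>b\<in>Basis. f b *\<^sub>R b) $ i = f (axis i (1 :: real))"
proof -
  have "(\<Sum>b\<in>Basis. f b *\<^sub>R b) $ i = (\<Sum>b\<in>Basis. f b *\<^sub>R b) \<bullet> axis i 1" by (simp add: inner_axis)
  also have "\<dots> = f (axis i 1)" by (rule inner_sum_left_Basis) (auto simp: Basis_vec_def)
  finally show ?thesis .
qed

lemma prod_Basis_vec: "(\<Prod>b\<in>(Basis :: (real ^ 'd::finite) set). f b) = (\<Prod>i\<in>UNIV. f (axis i 1))"
proof -
  have B: "(Basis :: (real ^ 'd) set) = range (\<lambda>i. axis i 1)" by (auto simp: Basis_vec_def)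
  have "inj (\<lambda>i :: 'd. axis i (1 :: real))" by (auto simp: inj_on_def axis_eq_axis)
  then show ?thesis unfolding B by (simp add: prod.reindex)
qed

text \<open>Lebesgue measure on vectors is the image of the product measure indexed by
  \<open>Basis\<close>. Transporting the integrand along this map reduces the claim to Fubini's
  theorem for finite products.\<close>

lemma lborel_product_integral:
  fixes g :: "'d::finite \<Rightarrow> real \<Rightarrow> 'b::{real_normed_field, banach, second_countable_topology}"
  assumes g: "\<And>i. integrable lborel (g i)"
  shows integrable_lborel_product: "integrable lborel (\<lambda>y :: real ^ 'd. \<Prod>i\<in>UNIV. g i (y $ i))"
    and integral_lborel_product: "(LINT y|lborel. (\<Prod>i\<in>UNIV. g i (y $ i))) = (\<Prod>i\<in>UNIV. LINT t|lborel. g i t)"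
proof -
  interpret product_sigma_finite "\<lambda>_ :: real ^ 'd. lborel :: real measure" ..
  define h where "h b = g (inv (\<lambda>i. axis i 1) b)" for b :: "real ^ 'd"
  have h: "h (axis i 1) = g i" for i
  proof -
    have "inj (\<lambda>i :: 'd. axis i (1 :: real))" by (auto simp: inj_on_def axis_eq_axis)
    from inv_f_f[OF this] show ?thesis unfolding h_def by simp
  qed
  have hi: "integrable lborel (h b)" for b unfolding h_def by (rule g)
  have meas [measurable]: "(\<lambda>y :: real ^ 'd. \<Prod>i\<in>UNIV. g i (y $ i)) \<in> borel_measurable borel"
    by (intro borel_measurable_prod measurable_compose[OF _ borel_measurable_integrable[OF g], simplified]) auto
  have T [measurable]: "(\<lambda>f. \<Sum>b\<in>Basis. f b *\<^sub>R b) \<in> measurable (Pi\<^sub>M Basis (\<lambda>_. lborel)) (borel :: (real ^ 'd) measure)"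
    by measurable
  have eq: "(\<Prod>i\<in>UNIV. g i ((\<Sum>b\<in>Basis. f b *\<^sub>R b) $ i)) = (\<Prod>b\<in>Basis. h b (f b))" for f :: "real ^ 'd \<Rightarrow> real"
    unfolding prod_Basis_vec sum_axis_inner h ..
  have L: "(lborel :: (real ^ 'd) measure) = distr (Pi\<^sub>M Basis (\<lambda>_. lborel)) borel (\<lambda>f. \<Sum>b\<in>Basis. f b *\<^sub>R b)"
    unfolding lborel_def[where 'a="real ^ 'd"] lborel_eq_real ..
  show "integrable lborel (\<lambda>y :: real ^ 'd. \<Prod>i\<in>UNIV. g i (y $ i))"
    unfolding L by (subst integrable_distr_eq[OF T meas]) (simp only: eq, rule product_integrable_prod[OF finite_Basis hi])
  have "(LINT y|lborel. (\<Prod>i\<in>UNIV. g i (y $ i))) = (LINT f|Pi\<^sub>M Basis (\<lambda>_. lborel). (\<Prod>b\<in>Basis. h b (f b)))"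
    unfolding L by (subst integral_distr[OF T meas]) (simp only: eq)
  also have "\<dots> = (\<Prod>b\<in>Basis. LINT t|lborel. h b t)" by (rule product_integral_prod[OF finite_Basis hi])
  also have "\<dots> = (\<Prod>i\<in>UNIV. LINT t|lborel. g i t)" unfolding prod_Basis_vec h ..
  finally show "(LINT y|lborel. (\<Prod>i\<in>UNIV. g i (y $ i))) = (\<Prod>i\<in>UNIV. LINT t|lborel. g i t)" .
qed

text \<open>The heat kernel at time 1, (4 pi)^(-d/2) exp (- |y|^2 / 4). Variance 2 in each
  coordinate makes its Fourier transform exp (- |xi|^2), free of constants.\<close>

definition heat_kernel :: "real ^ 'd::finite \<Rightarrow> real" where
  "heat_kernel y = (\<Prod>i\<in>UNIV. normal_density 0 (sqrt 2) (y $ i))"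

lemma norm_vec_sum: "(norm (y :: real ^ 'd::finite))\<^sup>2 = (\<Sum>i\<in>UNIV. (y $ i)\<^sup>2)"
  by (simp add: norm_vec_def L2_set_def sum_nonneg)

lemma heat_kernel_eq: "heat_kernel (y :: real ^ 'd::finite) = (1 / sqrt (4 * pi)) ^ CARD('d) * exp (- (norm y)\<^sup>2 / 4)"
proof -
  have "heat_kernel y = (\<Prod>i\<in>(UNIV :: 'd set). (1 / sqrt (4 * pi)) * exp (- (y $ i)\<^sup>2 / 4))"
    unfolding heat_kernel_def normal_density_def by (intro prod.cong) (auto simp: mult.commute)
  also have "\<dots> = (1 / sqrt (4 * pi)) ^ CARD('d) * exp (\<Sum>i\<in>UNIV. - (y $ i)\<^sup>2 / 4)"
    by (simp add: prod.distrib exp_sum power_one_over prod_dividef)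
  also have "(\<Sum>i\<in>UNIV. - (y $ i)\<^sup>2 / 4) = - (norm y)\<^sup>2 / 4"
    by (simp add: norm_vec_sum sum_negf sum_divide_distrib)
  finally show ?thesis .
qed

lemma heat_kernel_measurable [measurable]: "heat_kernel \<in> borel_measurable borel"
  unfolding heat_kernel_eq[abs_def] by measurable

lemma heat_kernel_pos: "heat_kernel y > 0"
  by (simp add: heat_kernel_eq)

lemma heat_kernel_nonneg [simp]: "heat_kernel y \<ge> 0"
  by (rule less_imp_le[OF heat_kernel_pos])

lemma heat_kernel_le_1: "heat_kernel (y :: real ^ 'd::finite) \<le> 1"
proof -
  have "1 / sqrt (4 * pi) \<le> 1" using pi_ge_two by (simp add: real_le_rsqrt)
  then have "(1 / sqrt (4 * pi)) ^ CARD('d) \<le> 1" by (intro power_le_one) auto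
  moreover have "exp (- (norm y)\<^sup>2 / 4) \<le> 1" by simp
  ultimately show ?thesis unfolding heat_kernel_eq by (intro mult_le_one) auto
qed

text \<open>The characteristic function of the standard normal law, evaluated at sqrt 2 times the
  frequency.\<close>

lemma normal_density_fourier:
  "integrable lborel (\<lambda>x. complex_of_real (normal_density 0 (sqrt 2) x) * exp (\<i> * complex_of_real (x * \<xi>)))"
  "(LINT x|lborel. complex_of_real (normal_density 0 (sqrt 2) x) * exp (\<i> * complex_of_real (x * \<xi>))) = complex_of_real (exp (- \<xi>\<^sup>2))"
proof -
  let ?f = "\<lambda>x. complex_of_real (normal_density 0 (sqrt 2) x) * exp (\<i> * complex_of_real (x * \<xi>))"
  have n: "integrable lborel (normal_density 0 (sqrt 2))" by (intro integrable_normal_density) auto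
  show "integrable lborel ?f"
    by (rule Bochner_Integration.integrable_bound[OF n]) (auto simp: norm_mult)
  have "complex_of_real (exp (- \<xi>\<^sup>2)) = char std_normal_distribution (sqrt 2 * \<xi>)"
    by (simp add: char_std_normal_distribution power_mult_distrib)
  also have "\<dots> = (LINT x|lborel. std_normal_density x *\<^sub>R iexp (sqrt 2 * \<xi> * x))"
    unfolding char_def by (intro integral_density) auto
  also have "\<dots> = (LINT x|lborel. \<bar>1 / sqrt 2\<bar> *\<^sub>R (std_normal_density (0 + 1 / sqrt 2 * x) *\<^sub>R iexp (sqrt 2 * \<xi> * (0 + 1 / sqrt 2 * x))))"
    by (subst lborel_integral_real_affine[where c="1 / sqrt 2" and t=0]) (auto simp: scaleR_conv_of_real)
  also have "\<dots> = (LINT x|lborel. ?f x)"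
  proof (intro Bochner_Integration.integral_cong refl)
    fix x :: real
    have a: "sqrt 2 * \<xi> * (0 + 1 / sqrt 2 * x) = x * \<xi>" by simp
    have b: "\<bar>1 / sqrt 2\<bar> * std_normal_density (0 + 1 / sqrt 2 * x) = normal_density 0 (sqrt 2) x"
    proof -
      have p: "(x / sqrt 2)\<^sup>2 = x\<^sup>2 / 2" by (simp add: power_divide)
      have "\<bar>1 / sqrt 2\<bar> * std_normal_density (0 + 1 / sqrt 2 * x) = 1 / sqrt 2 * (1 / sqrt (2 * pi) * exp (- (x / sqrt 2)\<^sup>2 / 2))"
        unfolding std_normal_density_def by simp
      also have "\<dots> = 1 / sqrt (2 * pi * 2) * exp (- (x\<^sup>2 / 2) / 2)" unfolding p real_sqrt_mult by simp
      also have "\<dots> = normal_density 0 (sqrt 2) x" unfolding normal_density_def by simp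
      finally show ?thesis .
    qed
    show "\<bar>1 / sqrt 2\<bar> *\<^sub>R (std_normal_density (0 + 1 / sqrt 2 * x) *\<^sub>R iexp (sqrt 2 * \<xi> * (0 + 1 / sqrt 2 * x))) = ?f x"
      unfolding scaleR_scaleR a b by (simp add: scaleR_conv_of_real)
  qed
  finally show "(LINT x|lborel. ?f x) = complex_of_real (exp (- \<xi>\<^sup>2))" by simp
qed

lemma heat_kernel_fourier:
  fixes \<xi> :: "real ^ 'd::finite"
  shows "integrable lborel (\<lambda>y. complex_of_real (heat_kernel y) * exp (\<i> * complex_of_real (y \<bullet> \<xi>)))"
    and "(LINT y|lborel. complex_of_real (heat_kernel y) * exp (\<i> * complex_of_real (y \<bullet> \<xi>))) = complex_of_real (exp (- (norm \<xi>)\<^sup>2))"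
proof -
  have eq: "complex_of_real (heat_kernel y) * exp (\<i> * complex_of_real (y \<bullet> \<xi>))
      = (\<Prod>i\<in>UNIV. complex_of_real (normal_density 0 (sqrt 2) (y $ i)) * exp (\<i> * complex_of_real (y $ i * \<xi> $ i)))" for y
    by (simp add: heat_kernel_def prod.distrib inner_vec_def sum_distrib_left flip: exp_sum)
  show "integrable lborel (\<lambda>y. complex_of_real (heat_kernel y) * exp (\<i> * complex_of_real (y \<bullet> \<xi>)))"
    unfolding eq by (rule integrable_lborel_product[OF normal_density_fourier(1)])
  show "(LINT y|lborel. complex_of_real (heat_kernel y) * exp (\<i> * complex_of_real (y \<bullet> \<xi>))) = complex_of_real (exp (- (norm \<xi>)\<^sup>2))"
    unfolding eq integral_lborel_product[OF normal_density_fourier(1)] normal_density_fourier(2) norm_vec_sum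
    by (simp add: sum_negf[symmetric] exp_sum)
qed

lemma heat_kernel_integrable: "integrable lborel (heat_kernel :: real ^ 'd::finite \<Rightarrow> real)"
  using integrable_norm[OF heat_kernel_fourier(1)[of 0]] by simp

lemma heat_kernel_integral: "(LINT y|lborel. heat_kernel (y :: real ^ 'd::finite)) = 1"
  using heat_kernel_fourier(2)[of "0 :: real ^ 'd"] by simp

lemma heat_kernel_nn_integral: "(\<integral>\<^sup>+y. ennreal (heat_kernel (y :: real ^ 'd::finite)) \<partial>lborel) = 1"
  using heat_kernel_integral by (subst nn_integral_eq_integral[OF heat_kernel_integrable]) auto

text \<open>A common integrable majorant for all kernel differences. The exponent 2 d lets it lie
  below the product of the functions 1 / (1 + y_i^2), and later beats the growth 2^(d j) of the
  volume of dyadic cubes.\<close>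

definition decay :: "real ^ 'd::finite \<Rightarrow> real" where
  "decay y = 1 / (1 + norm y) ^ (2 * CARD('d))"

lemma decay_pos: "decay y > 0"
  unfolding decay_def by (intro divide_pos_pos zero_less_power add_pos_nonneg) auto

lemma decay_nonneg [simp]: "decay y \<ge> 0"
  by (rule less_imp_le[OF decay_pos])

lemma decay_le_1: "decay y \<le> 1"
  unfolding decay_def by (simp add: add_pos_nonneg)

lemma decay_measurable [measurable]: "decay \<in> borel_measurable borel"
  unfolding decay_def[abs_def] by measurable

lemma decay_integrable: "integrable lborel (decay :: real ^ 'd::finite \<Rightarrow> real)"
proof (rule Bochner_Integration.integrable_bound)
  have "integrable lborel (\<lambda>x :: real. inverse (1 + x\<^sup>2))"
    using integrable_inverse_1_plus_square by (simp add: set_integrable_def)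
  then show "integrable lborel (\<lambda>y :: real ^ 'd. \<Prod>i\<in>UNIV. inverse (1 + (y $ i)\<^sup>2))"
    by (rule integrable_lborel_product)
  have "decay y \<le> (\<Prod>i\<in>UNIV. inverse (1 + (y $ i)\<^sup>2))" for y :: "real ^ 'd"
  proof -
    have "(\<Prod>i\<in>(UNIV :: 'd set). inverse ((1 + norm y)\<^sup>2)) \<le> (\<Prod>i\<in>UNIV. inverse (1 + (y $ i)\<^sup>2))"
    proof (rule prod_mono, safe)
      fix i
      have "\<bar>y $ i\<bar>\<^sup>2 \<le> (norm y)\<^sup>2" by (intro power_mono component_le_norm_cart) auto
      then have "1 + (y $ i)\<^sup>2 \<le> (1 + norm y)\<^sup>2" by (simp add: power2_sum add_increasing2)
      then show "inverse ((1 + norm y)\<^sup>2) \<le> inverse (1 + (y $ i)\<^sup>2)" by (intro le_imp_inverse_le add_pos_nonneg) auto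
    qed auto
    then show ?thesis by (simp add: decay_def power_mult inverse_eq_divide power_one_over)
  qed
  then show "AE y :: real ^ 'd in lborel. norm (decay y) \<le> norm (\<Prod>i\<in>UNIV. inverse (1 + (y $ i)\<^sup>2))"
    by (intro AE_I2) (simp add: order_trans[OF _ abs_ge_self])
qed auto

lemma decay_nn_integral:
  "K \<ge> 0 \<Longrightarrow> (\<integral>\<^sup>+y. ennreal (K * decay (y :: real ^ 'd::finite)) \<partial>lborel) = ennreal (K * (LINT y|lborel. decay (y :: real ^ 'd)))"
  by (subst nn_integral_eq_integral) (auto simp: decay_integrable)

text \<open>With r the norm of y, (1 + r)^(2 d) is at most exp (2 d r), and completing the square
  gives 2 d r <= a r^2 + d^2 / a.\<close>

lemma exp_le_decay:
  assumes a: "a > 0"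
  shows "exp (- (a * (norm (y :: real ^ 'd::finite))\<^sup>2)) \<le> exp ((real CARD('d))\<^sup>2 / a) * decay y"
proof -
  define d r where "d = real CARD('d)" and "r = norm y"
  have r: "r \<ge> 0" by (simp add: r_def)
  have "(1 + r) ^ (2 * CARD('d)) \<le> exp r ^ (2 * CARD('d))"
    using r by (intro power_mono exp_ge_add_one_self) auto
  also have "\<dots> = exp (2 * d * r)" by (simp add: d_def exp_of_nat_mult[symmetric])
  also have "\<dots> \<le> exp (a * r\<^sup>2 + d\<^sup>2 / a)"
  proof -
    have "a * (a * r\<^sup>2 + d\<^sup>2 / a - 2 * d * r) = (a * r - d)\<^sup>2"
      using a by (simp add: power2_eq_square algebra_simps)
    then have "a * (a * r\<^sup>2 + d\<^sup>2 / a - 2 * d * r) \<ge> 0" by simp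
    then show ?thesis using a by (simp add: zero_le_mult_iff)
  qed
  finally have "(1 + r) ^ (2 * CARD('d)) * exp (- (a * r\<^sup>2)) \<le> exp (a * r\<^sup>2 + d\<^sup>2 / a) * exp (- (a * r\<^sup>2))"
    by (rule mult_right_mono) simp
  also have "\<dots> = exp (d\<^sup>2 / a)" by (simp add: exp_add[symmetric])
  finally show ?thesis using r unfolding decay_def d_def[symmetric] r_def[symmetric]
    by (simp add: pos_le_divide_eq add_pos_nonneg mult.commute)
qed

section \<open>Shifts, dilations and moments of the Gaussian\<close>

lemma decay_shift:
  fixes y z :: "real ^ 'd::finite"
  assumes "norm (y - z) \<le> 1" shows "decay z \<le> 4 ^ CARD('d) * decay y"
proof -
  have "norm y \<le> norm z + 1" using order_trans[OF norm_triangle_sub[of y z] add_left_mono[OF assms]] .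
  then have "1 + norm y \<le> 2 * (1 + norm z)" using norm_ge_zero[of z] unfolding distrib_left by linarith
  then have "(1 + norm y) ^ (2 * CARD('d)) \<le> (2 * (1 + norm z)) ^ (2 * CARD('d))" by (intro power_mono) auto
  also have "\<dots> = 4 ^ CARD('d) * (1 + norm z) ^ (2 * CARD('d))"
    by (simp only: power_mult_distrib) (simp add: power_mult)
  finally show ?thesis unfolding decay_def
    by (simp add: field_simps add_pos_nonneg zero_less_power)
qed

text \<open>Mean value theorem on the segment from y to y + h. Half of the Gaussian exponent absorbs
  the linear factor of the gradient and the other half gives the decay; as h is at most 1 long, the
  intermediate point is exchanged for y by \<open>decay_shift\<close>.\<close>

lemma heat_kernel_shift_decay:
  "\<exists>A>0. \<forall>y h :: real ^ 'd::finite. norm h \<le> 1 \<longrightarrow> \<bar>heat_kernel (y + h) - heat_kernel y\<bar> \<le> A * norm h * decay y"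
proof (intro exI conjI allI impI)
  define G where "G = (1 / sqrt (4 * pi)) ^ CARD('d)"
  define E where "E = exp ((real CARD('d))\<^sup>2 / (1 / 8))"
  have G: "G > 0" by (simp add: G_def)
  show "G * E * 4 ^ CARD('d) > 0" using G by (simp add: E_def)
  fix y h :: "real ^ 'd" assume h: "norm h \<le> 1"
  define \<phi> where "\<phi> \<tau> = exp (- (norm (y + \<tau> *\<^sub>R h))\<^sup>2 / 4)" for \<tau>
  have der: "(\<phi> has_real_derivative (- ((y + \<tau> *\<^sub>R h) \<bullet> h) / 2 * \<phi> \<tau>)) (at \<tau>)" for \<tau>
  proof -
    have eq: "(norm (y + \<tau> *\<^sub>R h))\<^sup>2 = y \<bullet> y + 2 * \<tau> * (y \<bullet> h) + \<tau>\<^sup>2 * (h \<bullet> h)" for \<tau>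
      unfolding power2_norm_eq_inner
      by (simp add: inner_add_left inner_add_right inner_commute power2_eq_square algebra_simps)
    show ?thesis unfolding \<phi>_def eq
      by (auto intro!: derivative_eq_intros simp: inner_add_left field_simps)
  qed
  have "\<exists>\<tau>. 0 < \<tau> \<and> \<tau> < 1 \<and> \<phi> 1 - \<phi> 0 = (1 - 0) * (- ((y + \<tau> *\<^sub>R h) \<bullet> h) / 2 * \<phi> \<tau>)"
    by (rule MVT2) (use der in auto)
  then obtain \<tau> where \<tau>: "0 < \<tau>" "\<tau> < 1" "\<phi> 1 - \<phi> 0 = - ((y + \<tau> *\<^sub>R h) \<bullet> h) / 2 * \<phi> \<tau>" by auto
  define z where "z = y + \<tau> *\<^sub>R h"
  have yz: "norm (y - z) \<le> 1" using \<tau> h mult_mono[of \<tau> 1 "norm h" 1] by (simp add: z_def)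
  have "norm z \<le> 2 * exp ((norm z)\<^sup>2 / 8)"
  proof -
    have "(norm z - 4)\<^sup>2 \<ge> 0" by simp
    then have "norm z \<le> 2 + (norm z)\<^sup>2 / 8" by (simp add: power2_diff)
    also have "\<dots> \<le> 2 * exp ((norm z)\<^sup>2 / 8)"
      using exp_ge_add_one_self[of "(norm z)\<^sup>2 / 8"] zero_le_power2[of "norm z"] by linarith
    finally show ?thesis .
  qed
  then have "norm z * exp (- (norm z)\<^sup>2 / 4) \<le> 2 * exp ((norm z)\<^sup>2 / 8) * exp (- (norm z)\<^sup>2 / 4)"
    by (rule mult_right_mono) simp
  also have "\<dots> = 2 * exp (- ((1 / 8) * (norm z)\<^sup>2))" by (simp add: mult.assoc exp_add[symmetric])
  also have "\<dots> \<le> 2 * (E * decay z)" unfolding E_def by (intro mult_left_mono exp_le_decay) auto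
  also have "\<dots> \<le> 2 * (E * (4 ^ CARD('d) * decay y))"
    by (intro mult_left_mono decay_shift yz) (auto simp: E_def)
  finally have z: "norm z * \<phi> \<tau> \<le> 2 * (E * (4 ^ CARD('d) * decay y))" by (simp add: \<phi>_def z_def)
  have "\<bar>\<phi> 1 - \<phi> 0\<bar> = \<bar>z \<bullet> h\<bar> / 2 * \<phi> \<tau>" unfolding \<tau>(3) z_def[symmetric] by (simp add: abs_mult \<phi>_def)
  also have "\<dots> \<le> (norm z * norm h) / 2 * \<phi> \<tau>"
    by (intro mult_right_mono divide_right_mono Cauchy_Schwarz_ineq2) (auto simp: \<phi>_def)
  also have "\<dots> = norm h / 2 * (norm z * \<phi> \<tau>)" by simp
  also have "\<dots> \<le> norm h / 2 * (2 * (E * (4 ^ CARD('d) * decay y)))" by (intro mult_left_mono z) auto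
  finally have d: "\<bar>\<phi> 1 - \<phi> 0\<bar> \<le> norm h * (E * (4 ^ CARD('d) * decay y))" by simp
  have "heat_kernel (y + h) - heat_kernel y = G * (\<phi> 1 - \<phi> 0)"
    by (simp add: heat_kernel_eq \<phi>_def G_def algebra_simps)
  then have "\<bar>heat_kernel (y + h) - heat_kernel y\<bar> = G * \<bar>\<phi> 1 - \<phi> 0\<bar>" using G by (simp add: abs_mult)
  also have "\<dots> \<le> G * (norm h * (E * (4 ^ CARD('d) * decay y)))" using G d by (intro mult_left_mono) auto
  finally show "\<bar>heat_kernel (y + h) - heat_kernel y\<bar> \<le> G * E * 4 ^ CARD('d) * norm h * decay y" by (simp add: mult_ac)
qed

text \<open>The two bounds are the ones that \<open>mz_norm_hoelder\<close> asks of a kernel. Short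
  shifts follow from the decay estimate; for shifts longer than 1 the trivial bound 2 is already at
  most 2 |h|.\<close>

lemma heat_kernel_shift:
  "\<exists>A>0. \<forall>h :: real ^ 'd::finite. (\<forall>y. \<bar>heat_kernel (y + h) - heat_kernel y\<bar> \<le> A * norm h) \<and>
    (\<integral>\<^sup>+y. ennreal \<bar>heat_kernel (y + h) - heat_kernel y\<bar> \<partial>lborel) \<le> ennreal (A * norm h)"
proof -
  obtain A where A: "A > 0" "\<And>y h :: real ^ 'd. norm h \<le> 1 \<Longrightarrow> \<bar>heat_kernel (y + h) - heat_kernel y\<bar> \<le> A * norm h * decay y"
    using heat_kernel_shift_decay[where 'd='d] by auto
  define D where "D = (LINT y|lborel. decay (y :: real ^ 'd))"
  have D: "D \<ge> 0" unfolding D_def by (intro integral_nonneg_AE) auto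
  define B where "B = A + A * D + 2"
  have B: "A \<le> B" "A * D \<le> B" "2 \<le> B" using A D by (auto simp: B_def)
  show ?thesis
  proof (intro exI[of _ B] conjI allI)
    show "B > 0" using B by simp
    fix h :: "real ^ 'd"
    show "\<bar>heat_kernel (y + h) - heat_kernel y\<bar> \<le> B * norm h" for y
    proof (cases "norm h \<le> 1")
      case True
      have "\<bar>heat_kernel (y + h) - heat_kernel y\<bar> \<le> A * norm h * decay y" by (rule A(2)[OF True])
      also have "\<dots> \<le> A * norm h * 1" using A decay_le_1 by (intro mult_left_mono) auto
      also have "\<dots> \<le> B * norm h" using B by (simp add: mult_right_mono)
      finally show ?thesis .
    next
      case False
      have "\<bar>heat_kernel (y + h) - heat_kernel y\<bar> \<le> 2 * 1"
        using heat_kernel_le_1[of "y + h"] heat_kernel_le_1[of y] heat_kernel_pos[of "y + h"] heat_kernel_pos[of y] by linarith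
      also have "\<dots> \<le> B * norm h" using False B by (intro mult_mono) auto
      finally show ?thesis .
    qed
    show "(\<integral>\<^sup>+y. ennreal \<bar>heat_kernel (y + h) - heat_kernel y\<bar> \<partial>lborel) \<le> ennreal (B * norm h)"
    proof (cases "norm h \<le> 1")
      case True
      have "(\<integral>\<^sup>+y. ennreal \<bar>heat_kernel (y + h) - heat_kernel y\<bar> \<partial>lborel) \<le> (\<integral>\<^sup>+y. ennreal (A * norm h * decay (y :: real ^ 'd)) \<partial>lborel)"
        by (intro nn_integral_mono ennreal_leI A(2) True)
      also have "\<dots> = ennreal (A * D * norm h)"
        using A(1) by (subst decay_nn_integral) (simp_all add: D_def mult_ac)
      also have "\<dots> \<le> ennreal (B * norm h)" using B by (intro ennreal_leI mult_right_mono) auto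
      finally show ?thesis .
    next
      case False
      have "(\<integral>\<^sup>+y. ennreal \<bar>heat_kernel (y + h) - heat_kernel y\<bar> \<partial>lborel)
          \<le> (\<integral>\<^sup>+y. (ennreal (heat_kernel (h + 1 *\<^sub>R y)) + ennreal (heat_kernel y)) \<partial>lborel)"
        using heat_kernel_pos[THEN less_imp_le]
        by (intro nn_integral_mono) (auto simp: ennreal_plus[symmetric] abs_le_iff add.commute intro!: ennreal_leI simp del: ennreal_plus)
      also have "\<dots> = 1 + 1"
        by (subst nn_integral_add) (auto simp: heat_kernel_nn_integral
          nn_integral_lborel_affine[where f="\<lambda>y. ennreal (heat_kernel y)" and c=1, simplified])
      also have "\<dots> = ennreal (2 * 1)" by simp
      also have "\<dots> \<le> ennreal (B * norm h)" using False B by (intro ennreal_leI mult_mono) auto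
      finally show ?thesis .
    qed
  qed
qed

text \<open>The second term is the heat kernel at time 1 + e. The mean value theorem in the time
  variable yields the factor e, and the polynomial produced by the time derivative is absorbed by
  part of the Gaussian.\<close>

lemma heat_kernel_dilate_decay:
  "\<exists>A>0. \<forall>(y :: real ^ 'd::finite) e. 0 \<le> e \<and> e \<le> 1 \<longrightarrow>
     \<bar>heat_kernel y - (1 + e) powr (- real CARD('d) / 2) * heat_kernel (y /\<^sub>R sqrt (1 + e))\<bar> \<le> A * e * decay y"
proof (intro exI conjI allI impI)
  define G where "G = (1 / sqrt (4 * pi)) ^ CARD('d)"
  define d where "d = real CARD('d)"
  define E where "E = exp (d\<^sup>2 / (1 / 16))"
  have G: "G > 0" by (simp add: G_def)
  have E: "E > 0" by (simp add: E_def)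
  have d: "d > 0" by (simp add: d_def)
  show "G * E * (d + 4) > 0" using G E d by simp
  fix y :: "real ^ 'd" and e :: real assume e: "0 \<le> e \<and> e \<le> 1"
  define r where "r = (norm y)\<^sup>2"
  have r: "r \<ge> 0" by (simp add: r_def)
  define q where "q s = s powr (- d / 2) * exp (- r / (4 * s))" for s
  define q' where "q' s = s powr (- d / 2) * exp (- r / (4 * s)) * (r / (4 * s\<^sup>2) - d / (2 * s))" for s
  have der: "(q has_real_derivative q' s) (at s)" if "s > 0" for s
  proof -
    have 1: "((\<lambda>s. s powr (- d / 2)) has_real_derivative (- d / 2) * s powr (- d / 2 - 1)) (at s)"
      using that by (rule has_real_derivative_powr)
    have 2: "((\<lambda>s. exp (- r / (4 * s))) has_real_derivative exp (- r / (4 * s)) * (r / (4 * s\<^sup>2))) (at s)"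
      using that by (auto intro!: derivative_eq_intros simp: power2_eq_square)
    have 3: "s powr (- d / 2 - 1) = s powr (- d / 2) / s" using that by (simp add: powr_diff)
    show ?thesis unfolding q_def
      by (rule DERIV_cong[OF DERIV_mult[OF 1 2]]) (simp only: 3 q'_def, simp add: algebra_simps)
  qed
  have q'b: "\<bar>q' s\<bar> \<le> E * (d + 4) * decay y" if s: "1 \<le> s" "s \<le> 2" for s
  proof -
    have "s powr (- d / 2) \<le> 1 powr (- d / 2)" using s d by (intro powr_mono2') auto
    moreover have "exp (- r / (4 * s)) \<le> exp (- r / 8)"
      using divide_left_mono[of "4 * s" 8 r] s r by simp
    moreover have "\<bar>r / (4 * s\<^sup>2) - d / (2 * s)\<bar> \<le> r / 4 + d"
    proof -
      have "1 \<le> s\<^sup>2" using s by simp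
      then have "r / (4 * s\<^sup>2) \<le> r / 4" using r by (intro divide_left_mono) auto
      moreover have "d / (2 * s) \<le> d" using s d by (simp add: field_simps)
      moreover have "r / (4 * s\<^sup>2) \<ge> 0" "d / (2 * s) \<ge> 0" using s r d by auto
      ultimately show ?thesis by linarith
    qed
    ultimately have "\<bar>q' s\<bar> \<le> 1 * exp (- r / 8) * (r / 4 + d)"
      unfolding q'_def abs_mult using r d by (intro mult_mono) auto
    also have "\<dots> \<le> exp (- r / 8) * ((d + 4) * exp (r / 16))"
    proof -
      have "(d + 4) * (1 + r / 16) = d + 4 + d * r / 16 + r / 4" by (simp add: field_simps)
      moreover have "d * r / 16 \<ge> 0" using r d by simp
      ultimately have "r / 4 + d \<le> (d + 4) * (1 + r / 16)" by linarith
      also have "\<dots> \<le> (d + 4) * exp (r / 16)" using d by (intro mult_left_mono exp_ge_add_one_self) auto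
      finally show ?thesis by simp
    qed
    also have "\<dots> = (d + 4) * exp (- (1 / 16 * r))" by (simp add: mult.left_commute exp_add[symmetric])
    also have "\<dots> \<le> (d + 4) * (E * decay y)"
      unfolding E_def r_def d_def using exp_le_decay[of "1 / 16" y] by (intro mult_left_mono) auto
    finally show ?thesis by (simp add: mult_ac)
  qed
  have qb: "\<bar>q 1 - q (1 + e)\<bar> \<le> E * (d + 4) * decay y * e"
  proof (cases "e = 0")
    case False
    then have "\<exists>z. 1 < z \<and> z < 1 + e \<and> q (1 + e) - q 1 = (1 + e - 1) * q' z"
      using e by (intro MVT2) (auto intro: der)
    then obtain z where z: "1 < z" "z < 1 + e" "q (1 + e) - q 1 = e * q' z" by auto
    have "q 1 - q (1 + e) = - (e * q' z)" using z(3) by simp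
    then have "\<bar>q 1 - q (1 + e)\<bar> = e * \<bar>q' z\<bar>" using e by (simp only: abs_minus_cancel abs_mult) simp
    also have "\<dots> \<le> e * (E * (d + 4) * decay y)" using z e by (intro mult_left_mono q'b) auto
    finally show ?thesis by (simp add: mult_ac)
  qed simp
  have "heat_kernel y = G * q 1" by (simp add: heat_kernel_eq q_def G_def r_def)
  moreover have "(1 + e) powr (- real CARD('d) / 2) * heat_kernel (y /\<^sub>R sqrt (1 + e)) = G * q (1 + e)"
  proof -
    have "norm (y /\<^sub>R sqrt (1 + e)) = norm y / sqrt (1 + e)" using e by (simp add: divide_inverse_commute)
    then have "(norm (y /\<^sub>R sqrt (1 + e)))\<^sup>2 = r / (1 + e)" using e by (simp add: power_divide r_def)
    then have "heat_kernel (y /\<^sub>R sqrt (1 + e)) = G * exp (- (r / (1 + e)) / 4)" unfolding heat_kernel_eq G_def by simp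
    also have "- (r / (1 + e)) / 4 = - r / (4 * (1 + e))" by simp
    finally show ?thesis unfolding q_def d_def by simp
  qed
  ultimately have "\<bar>heat_kernel y - (1 + e) powr (- real CARD('d) / 2) * heat_kernel (y /\<^sub>R sqrt (1 + e))\<bar> = G * \<bar>q 1 - q (1 + e)\<bar>"
    using G by (simp only: right_diff_distrib[symmetric] abs_mult)
  also have "\<dots> \<le> G * (E * (d + 4) * decay y * e)" using G qb by (intro mult_left_mono) auto
  finally show "\<bar>heat_kernel y - (1 + e) powr (- real CARD('d) / 2) * heat_kernel (y /\<^sub>R sqrt (1 + e))\<bar> \<le> G * E * (d + 4) * e * decay y"
    by (simp add: mult_ac)
qed

text \<open>From ln r <= r the power r^s is at most exp (s r), hence at most exp (2 s^2 + r^2 / 8);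
  half of the exponent of the kernel remains for the decay.\<close>

lemma heat_kernel_moment:
  assumes s: "s \<ge> 0"
  shows "\<exists>A\<ge>0. (\<integral>\<^sup>+y. ennreal (heat_kernel (y :: real ^ 'd::finite) * norm y powr s) \<partial>lborel) \<le> ennreal A"
proof -
  define D where "D = (LINT y|lborel. decay (y :: real ^ 'd))"
  have D: "D \<ge> 0" unfolding D_def by (intro integral_nonneg_AE) auto
  define K where "K = exp (2 * s\<^sup>2) * exp ((real CARD('d))\<^sup>2 / (1 / 8))"
  have K: "K > 0" by (simp add: K_def)
  have le: "heat_kernel y * norm y powr s \<le> K * decay y" for y :: "real ^ 'd"
  proof (cases "y = 0")
    case False
    define r where "r = norm y"
    have r: "r > 0" using False by (simp add: r_def)
    have "r powr s = exp (s * ln r)" using r by (simp add: powr_def)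
    also have "\<dots> \<le> exp (s * r)" using s r ln_le_minus_one[of r] by (simp add: mult_left_mono)
    also have "\<dots> \<le> exp (2 * s\<^sup>2 + r\<^sup>2 / 8)"
    proof -
      have "0 \<le> (r - 4 * s)\<^sup>2" by simp
      then show ?thesis by (simp add: power2_eq_square algebra_simps)
    qed
    finally have a: "r powr s \<le> exp (2 * s\<^sup>2 + r\<^sup>2 / 8)" .
    have c: "(1 / sqrt (4 * pi)) ^ CARD('d) \<le> 1"
      using pi_ge_two by (intro power_le_one) (auto simp: real_le_rsqrt)
    have "heat_kernel y * r powr s \<le> (1 * exp (- r\<^sup>2 / 4)) * exp (2 * s\<^sup>2 + r\<^sup>2 / 8)"
      unfolding heat_kernel_eq r_def[symmetric] by (intro mult_mono a c) auto
    also have "\<dots> = exp (2 * s\<^sup>2) * exp (- (1 / 8 * r\<^sup>2))" by (simp add: exp_add[symmetric])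
    also have "\<dots> \<le> exp (2 * s\<^sup>2) * (exp ((real CARD('d))\<^sup>2 / (1 / 8)) * decay y)"
      unfolding r_def by (intro mult_left_mono exp_le_decay) auto
    finally show ?thesis by (simp add: K_def r_def mult_ac)
  qed (use K decay_pos[of y] in simp)
  have "(\<integral>\<^sup>+y. ennreal (heat_kernel (y :: real ^ 'd) * norm y powr s) \<partial>lborel) \<le> (\<integral>\<^sup>+y. ennreal (K * decay (y :: real ^ 'd)) \<partial>lborel)"
    by (intro nn_integral_mono ennreal_leI le)
  also have "\<dots> = ennreal (K * D)" using K by (subst decay_nn_integral) (simp_all add: D_def)
  finally show ?thesis using K D by (intro exI[of _ "K * D"]) simp
qed

section \<open>Heat averages\<close>

text \<open>Heat averages destroy compact support, so a class is used that contains the test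
  functions and is stable under averages, differences and affine changes of variable.\<close>

definition bounded_borel :: "(real ^ 'd::finite \<Rightarrow> complex) \<Rightarrow> bool" where
  "bounded_borel f \<longleftrightarrow> f \<in> borel_measurable borel \<and> (\<exists>B. \<forall>x. norm (f x) \<le> B)"

lemma bounded_borel_measurable [measurable_dest]: "bounded_borel f \<Longrightarrow> f \<in> borel_measurable borel"
  by (simp add: bounded_borel_def)

lemma bounded_borelI: "f \<in> borel_measurable borel \<Longrightarrow> (\<And>x. norm (f x) \<le> B) \<Longrightarrow> bounded_borel f"
  by (auto simp: bounded_borel_def)

lemma bounded_borelE:
  assumes "bounded_borel f" obtains B where "B > 0" "\<forall>x. norm (f x) \<le> B"
proof -
  obtain B where "\<forall>x. norm (f x) \<le> B" using assms by (auto simp: bounded_borel_def)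
  then have "\<forall>x. norm (f x) \<le> max B 1" by (auto intro: order_trans)
  then show thesis using that[of "max B 1"] by auto
qed

lemma test_function_bounded_borel: "f \<in> test_functions \<Longrightarrow> bounded_borel f"
  by (rule test_function_bounded) (auto simp: bounded_borel_def test_function_borel)

lemma bounded_borel_diff:
  assumes f: "bounded_borel f" and g: "bounded_borel g" shows "bounded_borel (\<lambda>x. f x - g x)"
proof -
  obtain B where B: "B > 0" "\<forall>x. norm (f x) \<le> B" by (rule bounded_borelE[OF f])
  obtain C where C: "C > 0" "\<forall>x. norm (g x) \<le> C" by (rule bounded_borelE[OF g])
  note [measurable] = bounded_borel_measurable[OF f] bounded_borel_measurable[OF g]
  have "norm (f x - g x) \<le> B + C" for x
    using norm_triangle_ineq4[of "f x" "g x"] B(2)[rule_format, of x] C(2)[rule_format, of x] by linarith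
  then show ?thesis by (intro bounded_borelI) auto
qed

lemma bounded_borel_cmult:
  assumes f: "bounded_borel f" shows "bounded_borel (\<lambda>x. c *\<^sub>R f x)"
proof -
  obtain B where B: "B > 0" "\<forall>x. norm (f x) \<le> B" by (rule bounded_borelE[OF f])
  note [measurable] = bounded_borel_measurable[OF f]
  show ?thesis using B by (intro bounded_borelI[where B="\<bar>c\<bar> * B"]) (auto intro: mult_left_mono)
qed

lemma bounded_borel_zero: "bounded_borel (\<lambda>x. 0)"
  by (rule bounded_borelI[where B=0]) auto

lemma bounded_borel_add:
  assumes f: "bounded_borel f" and g: "bounded_borel g" shows "bounded_borel (\<lambda>x. f x + g x)"
  using bounded_borel_diff[OF f bounded_borel_diff[OF bounded_borel_zero g]] by simp

lemma bounded_borel_sum: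
  assumes "finite I" "\<And>i. i \<in> I \<Longrightarrow> bounded_borel (f i)" shows "bounded_borel (\<lambda>x. \<Sum>i\<in>I. f i x)"
  using assms by (induction I rule: finite_induct) (auto intro: bounded_borel_add bounded_borel_zero)

lemma bounded_borel_affine:
  assumes f: "bounded_borel f" shows "bounded_borel (\<lambda>x. f (c *\<^sub>R x + t))"
proof -
  obtain B where B: "B > 0" "\<forall>x. norm (f x) \<le> B" by (rule bounded_borelE[OF f])
  note [measurable] = bounded_borel_measurable[OF f]
  show ?thesis using B by (intro bounded_borelI[where B=B]) auto
qed

lemma bounded_borel_translate: "bounded_borel f \<Longrightarrow> bounded_borel (\<lambda>x. f (x + t))"
  using bounded_borel_affine[of f 1 t] by simp

text \<open>Since the kernel is even, this is convolution with the Gaussian dilated by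
  \<open>\<rho>\<close>, that is, the heat semigroup at time \<open>\<rho>\<^sup>2\<close>.\<close>

definition heat :: "real \<Rightarrow> (real ^ 'd::finite \<Rightarrow> complex) \<Rightarrow> real ^ 'd \<Rightarrow> complex" where
  "heat \<rho> f x = (LINT y|lborel. heat_kernel y *\<^sub>R f (x + \<rho> *\<^sub>R y))"

lemma integrable_kernel_mult:
  fixes k :: "real ^ 'd::finite \<Rightarrow> real"
  assumes k: "integrable lborel k" and f: "bounded_borel f"
  shows "integrable lborel (\<lambda>y. k y *\<^sub>R f (x + \<rho> *\<^sub>R y))"
proof -
  obtain B where B: "B > 0" "\<forall>x. norm (f x) \<le> B" by (rule bounded_borelE[OF f])
  note [measurable] = bounded_borel_measurable[OF f] borel_measurable_integrable[OF k, simplified]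
  show ?thesis
  proof (rule Bochner_Integration.integrable_bound)
    show "integrable lborel (\<lambda>y. norm (k y) * B)" using k by auto
    show "AE y in lborel. norm (k y *\<^sub>R f (x + \<rho> *\<^sub>R y)) \<le> norm (norm (k y) * B)"
      using B by (auto simp: abs_mult intro!: mult_left_mono)
  qed auto
qed

lemmas heat_integrable = integrable_kernel_mult[OF heat_kernel_integrable]

lemma norm_heat_le:
  fixes f :: "real ^ 'd::finite \<Rightarrow> complex"
  assumes B: "\<forall>x. norm (f x) \<le> B" and f: "bounded_borel f"
  shows "norm (heat \<rho> f x) \<le> B"
proof -
  have "norm (heat \<rho> f x) \<le> (LINT y|lborel. norm (heat_kernel y *\<^sub>R f (x + \<rho> *\<^sub>R y)))"
    unfolding heat_def by (rule integral_norm_bound)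
  also have "\<dots> \<le> (LINT y|lborel. heat_kernel (y :: real ^ 'd) * B)"
    using heat_integrable[OF f] heat_kernel_integrable B
    by (intro integral_mono integrable_norm) (auto intro: mult_left_mono)
  also have "\<dots> = B" by (simp add: heat_kernel_integral)
  finally show ?thesis .
qed

lemma heat_measurable [measurable]:
  assumes f: "bounded_borel f"
  shows "heat \<rho> f \<in> borel_measurable borel"
proof -
  note [measurable] = bounded_borel_measurable[OF f]
  have "heat \<rho> f \<in> borel_measurable lborel" unfolding heat_def[abs_def] by measurable
  then show ?thesis by simp
qed

lemma bounded_borel_heat:
  assumes f: "bounded_borel f" shows "bounded_borel (heat \<rho> f)"
proof -
  obtain B where B: "B > 0" "\<forall>x. norm (f x) \<le> B" by (rule bounded_borelE[OF f])
  show ?thesis by (rule bounded_borelI[OF heat_measurable[OF f] norm_heat_le[OF B(2) f]])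
qed

lemma heat_diff:
  assumes "bounded_borel f" "bounded_borel g"
  shows "heat \<rho> (\<lambda>x. f x - g x) x = heat \<rho> f x - heat \<rho> g x"
  unfolding heat_def scaleR_diff_right by (intro Bochner_Integration.integral_diff heat_integrable assms)

lemma heat_add:
  assumes "bounded_borel f" "bounded_borel g"
  shows "heat \<rho> (\<lambda>x. f x + g x) x = heat \<rho> f x + heat \<rho> g x"
  unfolding heat_def scaleR_add_right by (intro Bochner_Integration.integral_add heat_integrable assms)

lemma heat_cmult:
  fixes f :: "real ^ 'd::finite \<Rightarrow> complex"
  shows "heat \<rho> (\<lambda>x. c *\<^sub>R f x) x = c *\<^sub>R heat \<rho> f x"
proof -
  have "heat_kernel y *\<^sub>R c *\<^sub>R f z = c *\<^sub>R heat_kernel y *\<^sub>R f z" for y z :: "real ^ 'd" by (rule scaleR_left_commute)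
  then show ?thesis unfolding heat_def by (simp only: integral_scaleR_right)
qed

lemma heat_sum:
  assumes "finite I" "\<And>i. i \<in> I \<Longrightarrow> bounded_borel (f i)"
  shows "heat \<rho> (\<lambda>x. \<Sum>i\<in>I. f i x) x = (\<Sum>i\<in>I. heat \<rho> (f i) x)"
  using assms
proof (induction I rule: finite_induct)
  case empty
  then show ?case by (simp add: heat_def)
next
  case (insert i I)
  then show ?case by (simp add: heat_add bounded_borel_sum)
qed

text \<open>Averages at different scales must commute in order to factor
  \<open>S t - S (2 * t)\<close> in \<open>BMO_from_differences\<close>.\<close>

lemma heat_commute:
  fixes f :: "real ^ 'd::finite \<Rightarrow> complex"
  assumes f: "bounded_borel f"
  shows "heat a (heat b f) x = heat b (heat a f) x"
proof -
  note [measurable] = bounded_borel_measurable[OF f]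
  obtain B where B: "B > 0" "\<forall>x. norm (f x) \<le> B" by (rule bounded_borelE[OF f])
  have int: "integrable (lborel \<Otimes>\<^sub>M lborel) (\<lambda>(y, z). heat_kernel y *\<^sub>R heat_kernel z *\<^sub>R f (x + a *\<^sub>R y + b *\<^sub>R z))"
  proof (rule Bochner_Integration.integrable_bound)
    show "integrable (lborel \<Otimes>\<^sub>M lborel) (\<lambda>(y :: real ^ 'd, z :: real ^ 'd). heat_kernel y * (heat_kernel z * B))"
    proof (rule lborel_pair.Fubini_integrable)
      have "(\<lambda>y :: real ^ 'd. LINT z|lborel. norm (heat_kernel y * (heat_kernel (z :: real ^ 'd) * B))) = (\<lambda>y. heat_kernel y * B)"
        using B by (simp add: abs_mult heat_kernel_integral)
      then show "integrable lborel (\<lambda>y :: real ^ 'd. LINT z|lborel. norm (case (y, z :: real ^ 'd) of (y, z) \<Rightarrow> heat_kernel y * (heat_kernel z * B)))"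
        by (simp add: heat_kernel_integrable)
    qed (auto simp: heat_kernel_integrable)
    show "AE p in lborel \<Otimes>\<^sub>M lborel. norm (case p of (y, z) \<Rightarrow> heat_kernel y *\<^sub>R heat_kernel z *\<^sub>R f (x + a *\<^sub>R y + b *\<^sub>R z))
        \<le> norm (case p of (y, z) \<Rightarrow> heat_kernel y * (heat_kernel z * B))"
    proof (intro AE_I2, clarify)
      fix y z :: "real ^ 'd"
      have "heat_kernel y * (heat_kernel z * norm (f (x + a *\<^sub>R y + b *\<^sub>R z))) \<le> heat_kernel y * (heat_kernel z * B)"
        using B by (intro mult_left_mono) auto
      then show "norm (heat_kernel y *\<^sub>R heat_kernel z *\<^sub>R f (x + a *\<^sub>R y + b *\<^sub>R z)) \<le> norm (heat_kernel y * (heat_kernel z * B))"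
        using B by (simp add: abs_mult mult.assoc)
    qed
  qed measurable
  have "heat a (heat b f) x = (LINT y|lborel. LINT z|lborel. heat_kernel y *\<^sub>R heat_kernel z *\<^sub>R f (x + a *\<^sub>R y + b *\<^sub>R z))"
    unfolding heat_def by (simp only: integral_scaleR_right)
  also have "\<dots> = (LINT z|lborel. LINT y|lborel. heat_kernel y *\<^sub>R heat_kernel z *\<^sub>R f (x + a *\<^sub>R y + b *\<^sub>R z))"
    using lborel_pair.Fubini_integral[OF int] by simp
  also have "\<dots> = heat b (heat a f) x"
  proof -
    have "heat_kernel y *\<^sub>R heat_kernel z *\<^sub>R f (x + a *\<^sub>R y + b *\<^sub>R z) = heat_kernel z *\<^sub>R heat_kernel y *\<^sub>R f (x + b *\<^sub>R z + a *\<^sub>R y)" for y z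
      by (simp add: mult.commute add_ac)
    then show ?thesis unfolding heat_def by (simp only: integral_scaleR_right)
  qed
  finally show ?thesis .
qed

lemma mz_norm_kernel:
  fixes K :: "real ^ 'd::finite \<Rightarrow> 'a \<Rightarrow> complex"
  assumes N: "sigma_finite_measure N"
    and [measurable]: "(\<lambda>(x, y). K x y) \<in> borel_measurable (borel \<Otimes>\<^sub>M N)" "k \<in> borel_measurable N" "B \<in> borel_measurable N"
    and B: "\<And>y. y \<in> space N \<Longrightarrow> mz_seminorm p (\<lambda>x. K x y) \<le> B y"
    and int: "\<And>x. integrable N (\<lambda>y. k y *\<^sub>R K x y)"
  shows "mz_seminorm p (\<lambda>x. LINT y|N. k y *\<^sub>R K x y) \<le> (\<integral>\<^sup>+y. ennreal (norm (k y)) * B y \<partial>N)"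
proof -
  have "mz_seminorm p (\<lambda>x. LINT y|N. k y *\<^sub>R K x y)
      \<le> mz_norm p (\<lambda>x. \<integral>\<^sup>+y. ennreal (norm (k y)) * ennreal (norm (K x y)) \<partial>N)"
  proof (rule mz_norm_mono)
    fix x
    show "ennreal (norm (LINT y|N. k y *\<^sub>R K x y)) \<le> (\<integral>\<^sup>+y. ennreal (norm (k y)) * ennreal (norm (K x y)) \<partial>N)"
      using integral_norm_bound_ennreal[OF int[of x]] by (simp add: ennreal_mult)
  qed
  also have "\<dots> \<le> (\<integral>\<^sup>+y. ennreal (norm (k y)) * B y \<partial>N)"
  proof (rule mz_norm_integral[OF N])
    fix y assume y: "y \<in> space N"
    then have "(\<lambda>x. K x y) \<in> borel_measurable borel" by measurable
    then show "mz_norm p (\<lambda>x. ennreal (norm (k y)) * ennreal (norm (K x y))) \<le> ennreal (norm (k y)) * B y"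
      by (intro order_trans[OF mz_norm_cmult mult_left_mono[OF B[OF y]]]) auto
  qed measurable
  finally show ?thesis .
qed

lemma mz_norm_heat:
  fixes f :: "real ^ 'd::finite \<Rightarrow> complex"
  assumes f: "bounded_borel f"
  shows "mz_seminorm p (heat \<rho> f) \<le> mz_seminorm p f"
proof -
  note [measurable] = bounded_borel_measurable[OF f]
  have "mz_seminorm p (heat \<rho> f)
      \<le> (\<integral>\<^sup>+y. ennreal (norm (heat_kernel (y :: real ^ 'd))) * mz_seminorm p f \<partial>lborel)"
    unfolding heat_def
  proof (rule mz_norm_kernel[OF lborel.sigma_finite_measure_axioms])
    show "mz_seminorm p (\<lambda>x. f (x + \<rho> *\<^sub>R y)) \<le> mz_seminorm p f" for y
      by (rule mz_norm_translate[where G="\<lambda>x. ennreal (norm (f x))"]) measurable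
  qed (auto intro: heat_integrable f)
  also have "\<dots> = mz_seminorm p f"
    by (simp add: nn_integral_multc heat_kernel_nn_integral)
  finally show ?thesis .
qed

text \<open>Translation invariance of Lebesgue measure moves the shift from \<open>f\<close>, which
  has no regularity, to the smooth kernel.\<close>

lemma heat_shift:
  fixes f :: "real ^ 'd::finite \<Rightarrow> complex"
  assumes f: "bounded_borel f" and \<rho>: "\<rho> > 0"
  shows "heat \<rho> f (x + \<eta>) - heat \<rho> f x = (LINT y|lborel. (heat_kernel (y + (- \<eta> /\<^sub>R \<rho>)) - heat_kernel y) *\<^sub>R f (x + \<rho> *\<^sub>R y))"
proof -
  note [measurable] = bounded_borel_measurable[OF f]
  have int: "integrable lborel (\<lambda>y :: real ^ 'd. heat_kernel (y + t))" for t
  proof -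
    have "integrable (distr lborel borel ((+) t)) (heat_kernel :: real ^ 'd \<Rightarrow> real)"
      by (simp only: lborel_distr_plus heat_kernel_integrable)
    then show ?thesis by (subst (asm) integrable_distr_eq) (auto simp: add.commute)
  qed
  have "heat \<rho> f (x + \<eta>) = (LINT y|lborel. heat_kernel (y + (- \<eta> /\<^sub>R \<rho>)) *\<^sub>R f (x + \<rho> *\<^sub>R y))"
  proof -
    have "heat \<rho> f (x + \<eta>) = (LINT y|distr lborel borel (\<lambda>y. (\<eta> /\<^sub>R \<rho>) + y). heat_kernel (y + (- \<eta> /\<^sub>R \<rho>)) *\<^sub>R f (x + \<rho> *\<^sub>R y))"
      using \<rho> by (subst integral_distr) (auto simp: heat_def scaleR_add_right add_ac)
    then show ?thesis by (simp only: lborel_distr_plus)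
  qed
  then show ?thesis
    unfolding scaleR_diff_left Bochner_Integration.integral_diff[OF integrable_kernel_mult[OF int f] heat_integrable[OF f]]
    by (simp only: heat_def)
qed

text \<open>An increment of the average pairs \<open>f\<close> with a difference of kernels whose L1
  and sup norms are of order |eta| / rho. The first bound is duality after rescaling, which costs
  rho^(- d/p); the second uses the L1 norm of the kernel difference alone.\<close>

lemma heat_shift_bounds:
  obtains A where "A > 0"
    "\<And>(f :: real ^ 'd::finite \<Rightarrow> complex) (\<rho> :: real) x \<eta> p M. bounded_borel f \<Longrightarrow> \<rho> > 0 \<Longrightarrow> p > 1 \<Longrightarrow> M \<ge> 0 \<Longrightarrow>
      mz_seminorm p f \<le> ennreal M \<Longrightarrow>
      norm (heat \<rho> f (x + \<eta>) - heat \<rho> f x) \<le> A * (norm \<eta> / \<rho>) * \<rho> powr - (real CARD('d) / p) * M"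
    "\<And>(f :: real ^ 'd::finite \<Rightarrow> complex) (\<rho> :: real) x \<eta> B. bounded_borel f \<Longrightarrow> \<rho> > 0 \<Longrightarrow> (\<forall>x. norm (f x) \<le> B) \<Longrightarrow>
      norm (heat \<rho> f (x + \<eta>) - heat \<rho> f x) \<le> A * (norm \<eta> / \<rho>) * B"
proof -
  obtain A where A: "A > 0" and A1: "\<And>h y :: real ^ 'd. \<bar>heat_kernel (y + h) - heat_kernel y\<bar> \<le> A * norm h"
    and A2: "\<And>h :: real ^ 'd. (\<integral>\<^sup>+y. ennreal \<bar>heat_kernel (y + h) - heat_kernel y\<bar> \<partial>lborel) \<le> ennreal (A * norm h)"
    using heat_kernel_shift[where 'd='d] by auto
  have int: "integrable lborel (\<lambda>y :: real ^ 'd. heat_kernel (y + h) - heat_kernel y)" for h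
    using A2[of h] by (intro integrableI_bounded) (auto intro: le_less_trans)
  have le: "ennreal (norm (heat \<rho> f (x + \<eta>) - heat \<rho> f x))
      \<le> (\<integral>\<^sup>+y. ennreal \<bar>heat_kernel (y + (- \<eta> /\<^sub>R \<rho>)) - heat_kernel y\<bar> * ennreal (norm (f (x + \<rho> *\<^sub>R y))) \<partial>lborel)"
    if "bounded_borel f" "\<rho> > 0" for f :: "real ^ 'd \<Rightarrow> complex" and \<rho> :: real and x \<eta>
    using integral_norm_bound_ennreal[OF integrable_kernel_mult[OF int that(1), of "- \<eta> /\<^sub>R \<rho>" x \<rho>]]
    unfolding heat_shift[OF that] by (simp add: ennreal_mult)
  have nh: "norm (- \<eta> /\<^sub>R \<rho>) = norm \<eta> / \<rho>" if "\<rho> > 0" for \<eta> :: "real ^ 'd" and \<rho> :: real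
    using that by (simp add: divide_inverse_commute)
  show thesis
  proof (rule that)
    show "2 * A > 0" using A by simp
  next
    fix f :: "real ^ 'd \<Rightarrow> complex" and \<rho> :: real and x \<eta> p M
    assume f: "bounded_borel f" and \<rho>: "\<rho> > 0" and p: "p > 1" and M: "M \<ge> 0"
      and mz: "mz_seminorm p f \<le> ennreal M"
    note [measurable] = bounded_borel_measurable[OF f]
    have "mz_seminorm p (\<lambda>y. f (x + \<rho> *\<^sub>R y)) \<le> ennreal (\<rho> powr - (real CARD('d) / p)) * mz_seminorm p f"
      using \<rho> by (intro mz_norm_affine[where G="\<lambda>x. ennreal (norm (f x))"]) auto
    also have "\<dots> \<le> ennreal (\<rho> powr - (real CARD('d) / p)) * ennreal M" by (intro mult_left_mono mz) auto
    also have "\<dots> = ennreal (\<rho> powr - (real CARD('d) / p) * M)" using M by (simp add: ennreal_mult)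
    finally have m: "mz_seminorm p (\<lambda>y. f (x + \<rho> *\<^sub>R y)) \<le> ennreal (\<rho> powr - (real CARD('d) / p) * M)" .
    have "ennreal (norm (heat \<rho> f (x + \<eta>) - heat \<rho> f x))
        \<le> ennreal (2 * (A * (norm \<eta> / \<rho>)) * (\<rho> powr - (real CARD('d) / p) * M))"
      using A \<rho> M A1[of _ "- \<eta> /\<^sub>R \<rho>"] A2[of "- \<eta> /\<^sub>R \<rho>"]
      by (intro order_trans[OF le[OF f \<rho>]] mz_norm_hoelder[OF p _ _ m]) (auto simp only: nh[OF \<rho>] intro!: ennreal_leI, auto)
    then show "norm (heat \<rho> f (x + \<eta>) - heat \<rho> f x) \<le> 2 * A * (norm \<eta> / \<rho>) * \<rho> powr - (real CARD('d) / p) * M"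
      using A \<rho> M by (simp add: ennreal_le_iff mult.assoc)
  next
    fix f :: "real ^ 'd \<Rightarrow> complex" and \<rho> :: real and x \<eta> B
    assume f: "bounded_borel f" and \<rho>: "\<rho> > 0" and B: "\<forall>x. norm (f x) \<le> B"
    note [measurable] = bounded_borel_measurable[OF f]
    have B0: "B \<ge> 0" using B norm_ge_zero order_trans by blast
    have "ennreal (norm (heat \<rho> f (x + \<eta>) - heat \<rho> f x))
        \<le> (\<integral>\<^sup>+y. ennreal \<bar>heat_kernel (y + (- \<eta> /\<^sub>R \<rho>)) - heat_kernel y\<bar> * ennreal B \<partial>lborel)"
      using B by (intro order_trans[OF le[OF f \<rho>]] nn_integral_mono mult_left_mono ennreal_leI) auto
    also have "\<dots> \<le> ennreal (A * (norm \<eta> / \<rho>)) * ennreal B"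
      using A2[of "- \<eta> /\<^sub>R \<rho>"] unfolding nh[OF \<rho>] by (simp add: nn_integral_multc mult_right_mono)
    also have "\<dots> \<le> ennreal (2 * A * (norm \<eta> / \<rho>) * B)"
    proof -
      define X where "X = A * (norm \<eta> / \<rho>)"
      have X: "X \<ge> 0" "2 * A * (norm \<eta> / \<rho>) = 2 * X" using A \<rho> by (simp_all add: X_def)
      then have "X * B \<le> 2 * X * B" using B0 by (intro mult_right_mono) auto
      then show ?thesis unfolding X(2) X_def[symmetric] using X(1) B0 by (simp add: ennreal_mult[symmetric] ennreal_leI)
    qed
    finally show "norm (heat \<rho> f (x + \<eta>) - heat \<rho> f x) \<le> 2 * A * (norm \<eta> / \<rho>) * B"
      using A \<rho> B0 by (simp add: ennreal_le_iff)
  qed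
qed

text \<open>On a cube of side \<open>r\<close> the competing constant is the value of
  \<open>S\<close> at a corner. The difference f - S contributes K r^(d/p) r^(d (1 - 1/p)) = K r^d;
  every point is within d r of the corner, which gives the term with K d. The factor 2 is that of
  \<open>oscillation_le\<close>.\<close>

lemma BMO_by_smoothing:
  fixes f :: "real ^ 'd::finite \<Rightarrow> complex"
  assumes p: "p > 1" and f: "bounded_borel f" and K: "K \<ge> 0"
    and S: "\<And>r. r > 0 \<Longrightarrow> \<exists>S. bounded_borel S \<and>
      mz_seminorm p (\<lambda>x. f x - S x) \<le> ennreal (K * r powr (real CARD('d) / p)) \<and>
      (\<forall>x \<eta>. norm (S (x + \<eta>) - S x) \<le> K * (norm \<eta> / r))"
  shows "BMO_seminorm f \<le> ennreal (2 * (K + K * real CARD('d)))"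
proof -
  define d where "d = real CARD('d)"
  obtain B where B: "B > 0" "\<forall>x. norm (f x) \<le> B" by (rule bounded_borelE[OF f])
  have fl: "loc_integrable f"
    using B by (intro loc_integrable_bounded bounded_borel_measurable f) auto
  have "BMO_seminorm f \<le> 2 * ennreal (K + K * d)"
  proof (rule BMO_seminorm_le_approx[OF fl])
    fix a :: "real ^ 'd" and r :: real assume r: "r > 0"
    obtain S where Sb: "bounded_borel S" and S1: "mz_seminorm p (\<lambda>x. f x - S x) \<le> ennreal (K * r powr (d / p))"
      and S2: "\<forall>x \<eta>. norm (S (x + \<eta>) - S x) \<le> K * (norm \<eta> / r)"
      using S[OF r] by (auto simp: d_def)
    note [measurable] = bounded_borel_measurable[OF f] bounded_borel_measurable[OF Sb]
    let ?Q = "cube a r"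
    have bQ: "bounded ?Q" by (simp add: cube_def)
    have near: "norm (S x - S a) \<le> K * d" if x: "x \<in> ?Q" for x
    proof -
      have "norm (x - a) \<le> (\<Sum>i\<in>UNIV. \<bar>(x - a) $ i\<bar>)" by (rule norm_le_l1_cart)
      also have "\<dots> \<le> (\<Sum>i\<in>(UNIV :: 'd set). r)" 
      proof (rule sum_mono)
        fix i
        have "a $ i \<le> x $ i \<and> x $ i \<le> a $ i + r" using x by (simp add: mem_cube)
        then show "\<bar>(x - a) $ i\<bar> \<le> r" by auto
      qed
      also have "\<dots> = d * r" by (simp add: d_def)
      finally have "norm (x - a) / r \<le> d" using r by (simp add: divide_le_eq)
      then have "K * (norm (x - a) / r) \<le> K * d" using K by (intro mult_left_mono) auto
      moreover have "norm (S (a + (x - a)) - S a) \<le> K * (norm (x - a) / r)" using S2 by blast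
      ultimately show ?thesis by simp
    qed
    have "(\<integral>\<^sup>+x\<in>?Q. ennreal (norm (f x - S a)) \<partial>lebesgue) = (\<integral>\<^sup>+x\<in>?Q. ennreal (norm (f x - S a)) \<partial>lborel)"
      by (simp only: nn_integral_completion)
    also have "\<dots> \<le> (\<integral>\<^sup>+x. (ennreal (norm (f x - S x)) * indicator ?Q x + ennreal (K * d) * indicator ?Q x) \<partial>lborel)"
    proof (intro nn_integral_mono)
      fix x
      show "ennreal (norm (f x - S a)) * indicator ?Q x \<le> ennreal (norm (f x - S x)) * indicator ?Q x + ennreal (K * d) * indicator ?Q x"
      proof (cases "x \<in> ?Q")
        case True
        have "norm (f x - S a) \<le> norm (f x - S x) + K * d"
          using near[OF True] norm_triangle_ineq[of "f x - S x" "S x - S a"] by simp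
        then have "ennreal (norm (f x - S a)) \<le> ennreal (norm (f x - S x)) + ennreal (K * d)"
          using K by (metis d_def ennreal_leI ennreal_plus mult_nonneg_nonneg norm_ge_zero of_nat_0_le_iff)
        then show ?thesis using True by simp
      qed simp
    qed
    also have "\<dots> = (\<integral>\<^sup>+x\<in>?Q. ennreal (norm (f x - S x)) \<partial>lborel) + ennreal (K * d) * emeasure lborel ?Q"
      by (subst nn_integral_add) (auto simp: nn_integral_cmult_indicator)
    also have "\<dots> \<le> ennreal (K * r powr (d / p)) * ennreal (measure lborel ?Q powr (1 - 1 / p)) + ennreal (K * d) * ennreal (r ^ CARD('d))"
      using r by (intro add_mono order_trans[OF mz_normD[where p=p] mult_right_mono[OF S1]] bQ) auto
    also have "\<dots> = ennreal (K + K * d) * ennreal (r ^ CARD('d))"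
    proof -
      have "r ^ CARD('d) = r powr d" using r by (simp add: d_def powr_realpow)
      then have "r powr (d / p) * measure lborel ?Q powr (1 - 1 / p) = r ^ CARD('d)"
        using r by (simp add: powr_powr powr_add[symmetric] algebra_simps)
      then have "ennreal (K * r powr (d / p)) * ennreal (measure lborel ?Q powr (1 - 1 / p)) = ennreal K * ennreal (r ^ CARD('d))"
        using K r by (simp only: ennreal_mult[symmetric] mult_nonneg_nonneg powr_ge_zero zero_le_power less_imp_le mult.assoc)
      then show ?thesis using K by (simp add: distrib_right d_def)
    qed
    finally show "\<exists>c. (\<integral>\<^sup>+x\<in>?Q. ennreal (norm (f x - c)) \<partial>lebesgue) \<le> ennreal (K + K * d) * ennreal (r ^ CARD('d))"
      by blast
  qed
  also have "\<dots> = ennreal 2 * ennreal (K + K * d)" by simp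
  also have "\<dots> = ennreal (2 * (K + K * d))" using K by (subst ennreal_mult[symmetric]) (auto simp: d_def)
  finally show ?thesis by (simp add: d_def)
qed

section \<open>Besov spaces\<close>

text \<open>The coefficient of f x is recorded because it is a sign: the identity can be solved for
  f x.\<close>

lemma fwd_diff_pow_eq:
  "\<exists>c :: nat \<Rightarrow> real. c 0 = (- 1) ^ k \<and> (\<forall>(f :: real ^ 'd::finite \<Rightarrow> complex) h x.
     (fwd_diff h ^^ k) f x = (\<Sum>m\<le>k. c m *\<^sub>R f (x + real m *\<^sub>R h)))"
proof (induction k)
  case 0
  then show ?case by (intro exI[of _ "\<lambda>_. 1"]) simp
next
  case (Suc k)
  then obtain c :: "nat \<Rightarrow> real" where c0: "c 0 = (- 1) ^ k"
    and c: "\<And>(f :: real ^ 'd \<Rightarrow> complex) h x. (fwd_diff h ^^ k) f x = (\<Sum>m\<le>k. c m *\<^sub>R f (x + real m *\<^sub>R h))"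
    by blast
  \<comment> \<open>Pascal's rule; the two conditionals supply the zero coefficients beyond either
    end.\<close>
  define c' where "c' m = (if m = 0 then 0 else c (m - 1)) - (if m \<le> k then c m else 0)" for m
  have "(fwd_diff h ^^ Suc k) f x = (\<Sum>m\<le>Suc k. c' m *\<^sub>R f (x + real m *\<^sub>R h))"
    for f :: "real ^ 'd \<Rightarrow> complex" and h x
  proof -
    have 1: "(\<Sum>m\<le>Suc k. (if m = 0 then 0 else c (m - 1)) *\<^sub>R f (x + real m *\<^sub>R h)) = (\<Sum>m\<le>k. c m *\<^sub>R f (x + h + real m *\<^sub>R h))"
      unfolding sum.atMost_Suc_shift by (simp add: scaleR_add_left add_ac)
    have 2: "(\<Sum>m\<le>Suc k. (if m \<le> k then c m else 0) *\<^sub>R f (x + real m *\<^sub>R h)) = (\<Sum>m\<le>k. c m *\<^sub>R f (x + real m *\<^sub>R h))"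
      by simp
    show ?thesis
      unfolding c'_def scaleR_diff_left sum_subtractf 1 2 by (simp add: fwd_diff_def c)
  qed
  moreover have "c' 0 = (- 1) ^ Suc k" by (simp add: c'_def c0)
  ultimately show ?case by blast
qed

lemma fwd_diff_pow_remainder:
  obtains b :: "nat \<Rightarrow> real" where
    "\<forall>(f :: real ^ 'd::finite \<Rightarrow> complex) h x.
      f x = (- 1) ^ k *\<^sub>R (fwd_diff h ^^ k) f x + (\<Sum>m=1..k. b m *\<^sub>R f (x + real m *\<^sub>R h))"
proof -
  obtain c :: "nat \<Rightarrow> real" where c0: "c 0 = (- 1) ^ k"
    and c: "\<And>(f :: real ^ 'd \<Rightarrow> complex) h x. (fwd_diff h ^^ k) f x = (\<Sum>m\<le>k. c m *\<^sub>R f (x + real m *\<^sub>R h))"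
    using fwd_diff_pow_eq[where 'd='d, of k] by blast
  have eq: "f x = (- 1) ^ k *\<^sub>R (fwd_diff h ^^ k) f x + (\<Sum>m=1..k. (- ((- 1) ^ k * c m)) *\<^sub>R f (x + real m *\<^sub>R h))"
    for f :: "real ^ 'd \<Rightarrow> complex" and h x
  proof -
    have "{..k} = insert 0 {1..k}" by auto
    then have "(fwd_diff h ^^ k) f x = (- 1) ^ k *\<^sub>R f x + (\<Sum>m=1..k. c m *\<^sub>R f (x + real m *\<^sub>R h))"
      unfolding c by (simp add: c0)
    then have "(- 1) ^ k *\<^sub>R (fwd_diff h ^^ k) f x = ((- 1) ^ k * (- 1) ^ k) *\<^sub>R f x + (\<Sum>m=1..k. ((- 1) ^ k * c m) *\<^sub>R f (x + real m *\<^sub>R h))"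
      by (simp only: scaleR_add_right scaleR_sum_right scaleR_scaleR)
    moreover have "(- 1) ^ k * (- 1) ^ k = (1 :: real)" by (simp add: power_mult_distrib[symmetric])
    ultimately show ?thesis by (simp add: sum_negf)
  qed
  show thesis by (rule that[of "\<lambda>m. - ((- 1) ^ k * c m)"], intro allI, rule eq)
qed

section \<open>Smoothing operators that reproduce a function up to k-th differences\<close>

lemma bounded_borel_fwd_diff_pow: "bounded_borel f \<Longrightarrow> bounded_borel ((fwd_diff h ^^ k) f)"
  by (induction k) (auto simp: fwd_diff_def[abs_def] intro: bounded_borel_diff bounded_borel_translate)

lemma mz_norm_diff:
  assumes "bounded_borel f" "bounded_borel g"
  shows "mz_seminorm p (\<lambda>x. f x - g x) \<le> mz_seminorm p f + mz_seminorm p g"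
proof -
  note [measurable] = bounded_borel_measurable[OF assms(1)] bounded_borel_measurable[OF assms(2)]
  have "mz_seminorm p (\<lambda>x. f x - g x) \<le> mz_norm p (\<lambda>x. ennreal (norm (f x)) + ennreal (norm (g x)))"
    by (intro mz_norm_mono) (simp add: ennreal_plus[symmetric] norm_triangle_ineq4 ennreal_leI del: ennreal_plus)
  also have "\<dots> \<le> mz_seminorm p f + mz_seminorm p g"
    by (rule mz_norm_add) measurable
  finally show ?thesis .
qed

lemma mz_norm_sum_scaleR:
  assumes "finite I" and f: "\<And>i. i \<in> I \<Longrightarrow> bounded_borel (f i)"
    and le: "\<And>i. i \<in> I \<Longrightarrow> mz_seminorm p (f i) \<le> M"
  shows "mz_seminorm p (\<lambda>x. \<Sum>i\<in>I. b i *\<^sub>R f i x) \<le> ennreal (\<Sum>i\<in>I. \<bar>b i\<bar>) * M"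
proof -
  have m: "(\<lambda>x. ennreal (norm (f i x))) \<in> borel_measurable borel" if "i \<in> I" for i
    using bounded_borel_measurable[OF f[OF that]] by measurable
  have "mz_seminorm p (\<lambda>x. \<Sum>i\<in>I. b i *\<^sub>R f i x) \<le> mz_norm p (\<lambda>x. \<Sum>i\<in>I. ennreal \<bar>b i\<bar> * ennreal (norm (f i x)))"
    by (intro mz_norm_mono) (auto simp: ennreal_mult[symmetric] sum_ennreal intro!: ennreal_leI order_trans[OF norm_sum])
  also have "\<dots> \<le> (\<Sum>i\<in>I. mz_norm p (\<lambda>x. ennreal \<bar>b i\<bar> * ennreal (norm (f i x))))"
  proof (rule mz_norm_sum[OF \<open>finite I\<close>])
    fix i assume "i \<in> I"
    then have [measurable]: "f i \<in> borel_measurable borel" by (rule bounded_borel_measurable[OF f])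
    show "(\<lambda>x. ennreal \<bar>b i\<bar> * ennreal (norm (f i x))) \<in> borel_measurable borel" by measurable
  qed
  also have "\<dots> \<le> (\<Sum>i\<in>I. ennreal \<bar>b i\<bar> * M)"
    by (intro sum_mono order_trans[OF mz_norm_cmult[OF m] mult_left_mono[OF le]]) auto
  also have "\<dots> = ennreal (\<Sum>i\<in>I. \<bar>b i\<bar>) * M" by (simp add: sum_distrib_right[symmetric] sum_ennreal)
  finally show ?thesis .
qed

text \<open>The Gaussian average, over steps h = t y, of the remainder sum in
  \<open>fwd_diff_pow_remainder\<close>: the m-th translate of \<open>f\<close> becomes its heat
  average at scale m t.\<close>

definition smoothing :: "(nat \<Rightarrow> real) \<Rightarrow> nat \<Rightarrow> real \<Rightarrow> (real ^ 'd::finite \<Rightarrow> complex) \<Rightarrow> real ^ 'd \<Rightarrow> complex" where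
  "smoothing b k t f x = (\<Sum>m=1..k. b m *\<^sub>R heat (real m * t) f x)"

lemma bounded_borel_smoothing: "bounded_borel f \<Longrightarrow> bounded_borel (smoothing b k t f)"
  unfolding smoothing_def[abs_def] by (intro bounded_borel_sum bounded_borel_cmult bounded_borel_heat) auto

lemma smoothing_diff:
  "bounded_borel f \<Longrightarrow> bounded_borel g \<Longrightarrow> smoothing b k t (\<lambda>x. f x - g x) x = smoothing b k t f x - smoothing b k t g x"
  unfolding smoothing_def by (simp add: heat_diff scaleR_diff_right sum_subtractf)

lemma smoothing_add:
  "bounded_borel f \<Longrightarrow> bounded_borel g \<Longrightarrow> smoothing b k t (\<lambda>x. f x + g x) x = smoothing b k t f x + smoothing b k t g x"
  unfolding smoothing_def by (simp add: heat_add scaleR_add_right sum.distrib)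

lemma smoothing_commute:
  assumes f: "bounded_borel f"
  shows "smoothing b k t (smoothing b k u f) x = smoothing b k u (smoothing b k t f) x"
proof -
  have *: "smoothing b k t (smoothing b k u f) x = (\<Sum>m=1..k. \<Sum>n=1..k. (b m * b n) *\<^sub>R heat (real m * t) (heat (real n * u) f) x)" for t u
  proof -
    have "smoothing b k t (smoothing b k u f) x
        = (\<Sum>m=1..k. b m *\<^sub>R heat (real m * t) (\<lambda>x. \<Sum>n=1..k. b n *\<^sub>R heat (real n * u) f x) x)"
      unfolding smoothing_def[abs_def] ..
    also have "\<dots> = (\<Sum>m=1..k. b m *\<^sub>R (\<Sum>n=1..k. b n *\<^sub>R heat (real m * t) (heat (real n * u) f) x))"
      using f by (subst heat_sum) (auto simp: heat_cmult intro: bounded_borel_cmult bounded_borel_heat)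
    finally show ?thesis by (simp add: scaleR_sum_right)
  qed
  show ?thesis unfolding * by (subst sum.swap) (simp add: heat_commute[OF f] mult.commute)
qed

lemma mz_norm_smoothing:
  assumes f: "bounded_borel f"
  shows "mz_seminorm p (smoothing b k t f) \<le> ennreal (\<Sum>m=1..k. \<bar>b m\<bar>) * mz_seminorm p f"
  unfolding smoothing_def by (intro mz_norm_sum_scaleR bounded_borel_heat f mz_norm_heat) auto

lemma norm_sum_scaleR_le:
  fixes v :: "nat \<Rightarrow> 'a::real_normed_vector"
  assumes "\<And>m. m \<in> I \<Longrightarrow> norm (v m) \<le> X"
  shows "norm (\<Sum>m\<in>I. b m *\<^sub>R v m) \<le> (\<Sum>m\<in>I. \<bar>b m\<bar>) * X"
  unfolding sum_distrib_right
  by (rule order_trans[OF norm_sum]) (auto intro!: sum_mono mult_left_mono assms)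

lemma smoothing_shift_bounds:
  obtains A where "A > 0"
    "\<And>(f :: real ^ 'd::finite \<Rightarrow> complex) (t :: real) x \<eta> p M. bounded_borel f \<Longrightarrow> t > 0 \<Longrightarrow> p > 1 \<Longrightarrow> M \<ge> 0 \<Longrightarrow>
      mz_seminorm p f \<le> ennreal M \<Longrightarrow>
      norm (smoothing b k t f (x + \<eta>) - smoothing b k t f x) \<le> A * (norm \<eta> / t) * t powr - (real CARD('d) / p) * M"
    "\<And>(f :: real ^ 'd::finite \<Rightarrow> complex) (t :: real) x \<eta> B. bounded_borel f \<Longrightarrow> t > 0 \<Longrightarrow> (\<forall>x. norm (f x) \<le> B) \<Longrightarrow>
      norm (smoothing b k t f (x + \<eta>) - smoothing b k t f x) \<le> A * (norm \<eta> / t) * B"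
proof -
  obtain A where A: "A > 0"
    and A1: "\<And>(f :: real ^ 'd \<Rightarrow> complex) (\<rho> :: real) x \<eta> p M. bounded_borel f \<Longrightarrow> \<rho> > 0 \<Longrightarrow> p > 1 \<Longrightarrow> M \<ge> 0 \<Longrightarrow>
      mz_seminorm p f \<le> ennreal M \<Longrightarrow>
      norm (heat \<rho> f (x + \<eta>) - heat \<rho> f x) \<le> A * (norm \<eta> / \<rho>) * \<rho> powr - (real CARD('d) / p) * M"
    and A2: "\<And>(f :: real ^ 'd \<Rightarrow> complex) (\<rho> :: real) x \<eta> B. bounded_borel f \<Longrightarrow> \<rho> > 0 \<Longrightarrow> (\<forall>x. norm (f x) \<le> B) \<Longrightarrow>
      norm (heat \<rho> f (x + \<eta>) - heat \<rho> f x) \<le> A * (norm \<eta> / \<rho>) * B"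
    by (rule heat_shift_bounds[where 'd='d]) auto
  define \<beta> where "\<beta> = (\<Sum>m=1..k. \<bar>b m\<bar>)"
  have \<beta>: "\<beta> \<ge> 0" by (simp add: \<beta>_def sum_nonneg)
  have eq: "smoothing b k t f (x + \<eta>) - smoothing b k t f x = (\<Sum>m=1..k. b m *\<^sub>R (heat (real m * t) f (x + \<eta>) - heat (real m * t) f x))"
    for f :: "real ^ 'd \<Rightarrow> complex" and t x \<eta>
    by (simp add: smoothing_def sum_subtractf scaleR_diff_right)
  \<comment> \<open>The sum starts at m = 1, so every scale m t is at least t, and both bounds
    decrease as the scale grows.\<close>
  have mt: "real m * t \<ge> t" "real m * t > 0" if "m \<in> {1..k}" "t > 0" for m and t :: real
    using that by (auto simp: mult_le_cancel_right1)
  show thesis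
  proof (rule that)
    \<comment> \<open>For k = 0 the sum of the weights is empty; the added 1 keeps the constant
      positive.\<close>
    show "(\<beta> + 1) * A > 0" using \<beta> A by simp
  next
    fix f :: "real ^ 'd \<Rightarrow> complex" and t :: real and x \<eta> p M
    assume f: "bounded_borel f" and t: "t > 0" and p: "p > 1" and M: "M \<ge> 0"
      and mz: "mz_seminorm p f \<le> ennreal M"
    have "norm (smoothing b k t f (x + \<eta>) - smoothing b k t f x) \<le> \<beta> * (A * (norm \<eta> / t) * t powr - (real CARD('d) / p) * M)"
      unfolding eq \<beta>_def
    proof (rule norm_sum_scaleR_le)
      fix m assume m: "m \<in> {1..k}"
      have "norm (heat (real m * t) f (x + \<eta>) - heat (real m * t) f x)
          \<le> A * (norm \<eta> / (real m * t)) * (real m * t) powr - (real CARD('d) / p) * M"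
        by (rule A1[OF f mt(2)[OF m t] p M mz])
      also have "\<dots> \<le> A * (norm \<eta> / t) * t powr - (real CARD('d) / p) * M"
        using A M t p mt[OF m t] by (intro mult_right_mono mult_mono divide_left_mono powr_mono2') auto
      finally show "norm (heat (real m * t) f (x + \<eta>) - heat (real m * t) f x) \<le> A * (norm \<eta> / t) * t powr - (real CARD('d) / p) * M" .
    qed
    also have "\<dots> \<le> (\<beta> + 1) * (A * (norm \<eta> / t) * t powr - (real CARD('d) / p) * M)"
      using A M t by (intro mult_right_mono) auto
    finally show "norm (smoothing b k t f (x + \<eta>) - smoothing b k t f x) \<le> (\<beta> + 1) * A * (norm \<eta> / t) * t powr - (real CARD('d) / p) * M"
      by (simp only: mult.assoc)
  next
    fix f :: "real ^ 'd \<Rightarrow> complex" and t :: real and x \<eta> B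
    assume f: "bounded_borel f" and t: "t > 0" and B: "\<forall>x. norm (f x) \<le> B"
    have B0: "B \<ge> 0" using B norm_ge_zero order_trans by blast
    have "norm (smoothing b k t f (x + \<eta>) - smoothing b k t f x) \<le> \<beta> * (A * (norm \<eta> / t) * B)"
      unfolding eq \<beta>_def
    proof (rule norm_sum_scaleR_le)
      fix m assume m: "m \<in> {1..k}"
      have "norm (heat (real m * t) f (x + \<eta>) - heat (real m * t) f x) \<le> A * (norm \<eta> / (real m * t)) * B"
        by (rule A2[OF f mt(2)[OF m t] B])
      also have "\<dots> \<le> A * (norm \<eta> / t) * B"
        using A B0 t mt[OF m t] by (intro mult_right_mono mult_left_mono divide_left_mono) auto
      finally show "norm (heat (real m * t) f (x + \<eta>) - heat (real m * t) f x) \<le> A * (norm \<eta> / t) * B" .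
    qed
    also have "\<dots> \<le> (\<beta> + 1) * (A * (norm \<eta> / t) * B)"
      using A B0 t by (intro mult_right_mono) auto
    finally show "norm (smoothing b k t f (x + \<eta>) - smoothing b k t f x) \<le> (\<beta> + 1) * A * (norm \<eta> / t) * B"
      by (simp only: mult.assoc)
  qed
qed

text \<open>The smoothing operator \<open>T\<^sub>t\<close> reproduces \<open>f\<close> up to an average of \<open>k\<close>-th differences. Squaring,
  \<open>I - (I - T\<^sub>t)\<^sup>2\<close> has the same property, and its increments in \<open>t\<close> apply a smoothing kernel to
  \<open>(I - T\<^sub>t) f\<close>, so they can be summed over dyadic scales.\<close>

lemma BMO_from_differences:
  assumes p: "p > 1"
  obtains C where "C > 0"
    "\<And>(f :: real ^ 'd::finite \<Rightarrow> complex) M. bounded_borel f \<Longrightarrow> M \<ge> 0 \<Longrightarrow>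
      (\<And>h. mz_seminorm p ((fwd_diff h ^^ k) f) \<le> ennreal (M * norm h powr (real CARD('d) / p))) \<Longrightarrow>
      BMO_seminorm f \<le> ennreal (C * M)"
proof -
  define s where "s = real CARD('d) / p"
  have s: "s > 0" using p by (simp add: s_def)
  obtain b where b: "\<forall>(f :: real ^ 'd \<Rightarrow> complex) h x.
      f x = (- 1) ^ k *\<^sub>R (fwd_diff h ^^ k) f x + (\<Sum>m=1..k. b m *\<^sub>R f (x + real m *\<^sub>R h))"
    by (rule fwd_diff_pow_remainder)
  define T where "T t f = smoothing b k t f" for t and f :: "real ^ 'd \<Rightarrow> complex"
  define \<beta> where "\<beta> = (\<Sum>m=1..k. \<bar>b m\<bar>)"
  have \<beta>: "\<beta> \<ge> 0" by (simp add: \<beta>_def sum_nonneg)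
  obtain A where A: "A > 0"
    and A1: "\<And>(f :: real ^ 'd \<Rightarrow> complex) (t :: real) x \<eta> p M. bounded_borel f \<Longrightarrow> t > 0 \<Longrightarrow> p > 1 \<Longrightarrow> M \<ge> 0 \<Longrightarrow>
      mz_seminorm p f \<le> ennreal M \<Longrightarrow>
      norm (T t f (x + \<eta>) - T t f x) \<le> A * (norm \<eta> / t) * t powr - (real CARD('d) / p) * M"
    and A2: "\<And>(f :: real ^ 'd \<Rightarrow> complex) (t :: real) x \<eta> B. bounded_borel f \<Longrightarrow> t > 0 \<Longrightarrow> (\<forall>x. norm (f x) \<le> B) \<Longrightarrow>
      norm (T t f (x + \<eta>) - T t f x) \<le> A * (norm \<eta> / t) * B"
    unfolding T_def by (rule smoothing_shift_bounds[where 'd='d and b=b and k=k]) auto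
  obtain C1 where C1: "C1 \<ge> 0" and mom: "(\<integral>\<^sup>+y. ennreal (heat_kernel (y :: real ^ 'd) * norm y powr s) \<partial>lborel) \<le> ennreal C1"
    using heat_kernel_moment[where 'd='d, of s] s by auto
  have Tb: "bounded_borel (T t f)" if "bounded_borel f" for t f
    unfolding T_def by (rule bounded_borel_smoothing[OF that])
  have Tdiff: "T t (\<lambda>x. f x - g x) x = T t f x - T t g x" if "bounded_borel f" "bounded_borel g" for t f g x
    unfolding T_def by (rule smoothing_diff[OF that])
  have Tadd: "T t (\<lambda>x. f x + g x) x = T t f x + T t g x" if "bounded_borel f" "bounded_borel g" for t f g x
    unfolding T_def by (rule smoothing_add[OF that])
  have Tcomm: "T t (T u f) x = T u (T t f) x" if "bounded_borel f" for t u f x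
    unfolding T_def by (rule smoothing_commute[OF that])
  \<comment> \<open>The norm of \<open>g\<close> below is at most C1 M t^s (1 + 2^s), and each of
    the operators \<open>T t\<close> and \<open>T (2 * t)\<close> contributes once, whence the
    factor 2.\<close>
  define C2 where "C2 = 2 * A * C1 * (1 + 2 powr s)"
  have C2: "C2 \<ge> 0" using A C1 by (simp add: C2_def)
  \<comment> \<open>The first term bounds f - S; the second bounds the increments of S after the
    dyadic scales have been summed, the geometric series being at most 2.\<close>
  define K where "K = (1 + \<beta>) * C1 + 2 * C2"
  have K: "K \<ge> 0" using \<beta> C1 C2 by (simp add: K_def)
  show thesis
  proof (rule that)
    show "2 * (K + K * real CARD('d)) + 1 > 0" using K by (simp add: add_nonneg_pos)
    fix f :: "real ^ 'd \<Rightarrow> complex" and M :: real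
    assume f: "bounded_borel f" and M: "M \<ge> 0"
      and H: "\<And>h. mz_seminorm p ((fwd_diff h ^^ k) f) \<le> ennreal (M * norm h powr (real CARD('d) / p))"
    note [measurable] = bounded_borel_measurable[OF f]
    obtain B where B: "B > 0" "\<forall>x. norm (f x) \<le> B" by (rule bounded_borelE[OF f])
    \<comment> \<open>The error is the Gaussian average of k-th differences with step t y, so the
      hypothesis and Minkowski's inequality leave t^s times the moment of order s.\<close>
    have D: "mz_seminorm p (\<lambda>x. f x - T t f x) \<le> ennreal (C1 * M * t powr s)" if t: "t > 0" for t
    proof -
      have i1: "integrable lborel (\<lambda>y :: real ^ 'd. heat_kernel y *\<^sub>R f x)" for x
        by (intro integrable_scaleR_left heat_kernel_integrable)
      have i2: "integrable lborel (\<lambda>y. b m *\<^sub>R heat_kernel y *\<^sub>R f (x + (real m * t) *\<^sub>R y))" for m x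
        by (intro integrable_scaleR_right heat_integrable f)
      have eq: "f x - T t f x = (LINT y|lborel. heat_kernel y *\<^sub>R ((- 1) ^ k *\<^sub>R (fwd_diff (t *\<^sub>R y) ^^ k) f x))" for x
      proof -
        have "(- 1) ^ k *\<^sub>R (fwd_diff (t *\<^sub>R y) ^^ k) f x = f x - (\<Sum>m=1..k. b m *\<^sub>R f (x + (real m * t) *\<^sub>R y))" for y
          using b[rule_format, of f x "t *\<^sub>R y"] by (simp add: eq_diff_eq)
        then have "(LINT y|lborel. heat_kernel y *\<^sub>R ((- 1) ^ k *\<^sub>R (fwd_diff (t *\<^sub>R y) ^^ k) f x))
            = (LINT y|lborel. heat_kernel y *\<^sub>R f x - (\<Sum>m=1..k. b m *\<^sub>R heat_kernel y *\<^sub>R f (x + (real m * t) *\<^sub>R y)))"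
          by (simp only: scaleR_diff_right scaleR_sum_right scaleR_left_commute[of "heat_kernel _"])
        also have "\<dots> = (LINT y|lborel. heat_kernel (y :: real ^ 'd) *\<^sub>R f x) - (\<Sum>m=1..k. b m *\<^sub>R (LINT y|lborel. heat_kernel y *\<^sub>R f (x + (real m * t) *\<^sub>R y)))"
          unfolding Bochner_Integration.integral_diff[OF i1 Bochner_Integration.integrable_sum[OF i2]]
            Bochner_Integration.integral_sum[OF i2] integral_scaleR_right ..
        also have "(LINT y|lborel. heat_kernel (y :: real ^ 'd) *\<^sub>R f x) = f x"
          by (simp add: heat_kernel_integrable heat_kernel_integral)
        finally show ?thesis by (simp add: T_def smoothing_def heat_def)
      qed
      have bb: "(- 1) ^ k *\<^sub>R (fwd_diff (t *\<^sub>R y) ^^ k) f x = f x - (\<Sum>m=1..k. b m *\<^sub>R f (x + real m *\<^sub>R t *\<^sub>R y))" for x y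
        using b[rule_format, of f x "t *\<^sub>R y"] by (simp add: eq_diff_eq)
      have "mz_seminorm p (\<lambda>x. f x - T t f x)
          \<le> (\<integral>\<^sup>+y. ennreal (norm (heat_kernel (y :: real ^ 'd))) * ennreal (M * norm (t *\<^sub>R y) powr s) \<partial>lborel)"
        unfolding eq
      proof (rule mz_norm_kernel[OF lborel.sigma_finite_measure_axioms])
        show "(\<lambda>(x, y). (- 1) ^ k *\<^sub>R (fwd_diff (t *\<^sub>R y) ^^ k) f x) \<in> borel_measurable (borel \<Otimes>\<^sub>M lborel)"
          unfolding bb by measurable
        show "mz_seminorm p (\<lambda>x. (- 1) ^ k *\<^sub>R (fwd_diff (t *\<^sub>R y) ^^ k) f x) \<le> ennreal (M * norm (t *\<^sub>R y) powr s)" for y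
          using H[of "t *\<^sub>R y"] by (simp add: s_def)
        show "integrable lborel (\<lambda>y. heat_kernel y *\<^sub>R (- 1) ^ k *\<^sub>R (fwd_diff (t *\<^sub>R y) ^^ k) f x)" for x
          unfolding bb scaleR_diff_right scaleR_sum_right scaleR_left_commute[of "heat_kernel _"] scaleR_scaleR[of "real _" t]
          by (intro Bochner_Integration.integrable_diff Bochner_Integration.integrable_sum i1 i2)
      qed measurable
      also have "\<dots> = (\<integral>\<^sup>+y. ennreal (M * t powr s) * ennreal (heat_kernel (y :: real ^ 'd) * norm y powr s) \<partial>lborel)"
        using M t by (intro nn_integral_cong) (simp add: ennreal_mult[symmetric] powr_mult mult_ac)
      also have "\<dots> \<le> ennreal (M * t powr s) * ennreal C1"
        by (subst nn_integral_cmult) (auto intro!: mult_left_mono mom)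
      also have "\<dots> = ennreal (C1 * M * t powr s)" using M C1 by (simp add: ennreal_mult[symmetric] mult_ac)
      finally show ?thesis .
    qed
    have [measurable]: "T t f \<in> borel_measurable borel" for t by (rule bounded_borel_measurable[OF Tb[OF f]])
    define S where "S t x = T t f x + T t f x - T t (T t f) x" for t x
    have Sb: "bounded_borel (S t)" for t
      unfolding S_def[abs_def] by (intro bounded_borel_diff bounded_borel_add Tb f)
    have fS: "mz_seminorm p (\<lambda>x. f x - S t x) \<le> ennreal ((1 + \<beta>) * C1 * M * t powr s)" if t: "t > 0" for t
    proof -
      define D0 where "D0 x = f x - T t f x" for x
      have D0b: "bounded_borel D0" unfolding D0_def[abs_def] by (intro bounded_borel_diff Tb f)
      have "f x - S t x = D0 x - T t D0 x" for x
        unfolding D0_def[abs_def] by (simp add: Tdiff Tb f S_def)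
      then have "mz_seminorm p (\<lambda>x. f x - S t x) = mz_seminorm p (\<lambda>x. D0 x - T t D0 x)" by simp
      also have "\<dots> \<le> mz_seminorm p D0 + mz_seminorm p (T t D0)"
        by (rule mz_norm_diff[OF D0b Tb[OF D0b]])
      also have "\<dots> \<le> ennreal (C1 * M * t powr s) + ennreal \<beta> * ennreal (C1 * M * t powr s)"
        unfolding T_def \<beta>_def using D[OF t]
        by (intro add_mono order_trans[OF mz_norm_smoothing[OF D0b] mult_left_mono]) (auto simp: D0_def T_def)
      also have "\<dots> = ennreal ((1 + \<beta>) * C1 * M * t powr s)"
        using C1 M \<beta> by (simp add: ennreal_mult[symmetric] ennreal_plus[symmetric] algebra_simps del: ennreal_plus)
      finally show ?thesis .
    qed
    have step: "norm ((S t (x + \<eta>) - S (2 * t) (x + \<eta>)) - (S t x - S (2 * t) x)) \<le> C2 * M * (norm \<eta> / t)" if t: "t > 0" for t x \<eta>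
    proof -
      \<comment> \<open>As the operators commute, S t - S (2 t) is T t - T (2 t) applied to g = (f -
        T t f) + (f - T (2 t) f). The increment is thus a smoothing of a small function.\<close>
      define g where "g x = (f x - T t f x) + (f x - T (2 * t) f x)" for x
      have gb: "bounded_borel g" unfolding g_def[abs_def] by (intro bounded_borel_add bounded_borel_diff Tb f)
      have Tg: "T u g x = (T u f x - T u (T t f) x) + (T u f x - T u (T (2 * t) f) x)" for u x
        unfolding g_def[abs_def] Tadd[OF bounded_borel_diff[OF f Tb[OF f]] bounded_borel_diff[OF f Tb[OF f]]] Tdiff[OF f Tb[OF f]] ..
      have SS: "S t x - S (2 * t) x = T t g x - T (2 * t) g x" for x
        unfolding Tg S_def Tcomm[OF f, of "2 * t" t] by (simp add: algebra_simps)
      define G where "G = C1 * M * t powr s * (1 + 2 powr s)"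
      have G: "G \<ge> 0" using C1 M by (simp add: G_def)
      have "mz_seminorm p g \<le> mz_norm p (\<lambda>x. ennreal (norm (f x - T t f x)) + ennreal (norm (f x - T (2 * t) f x)))"
        unfolding g_def by (intro mz_norm_mono order_trans[OF ennreal_leI[OF norm_triangle_ineq]]) simp
      also have "\<dots> \<le> mz_seminorm p (\<lambda>x. f x - T t f x) + mz_seminorm p (\<lambda>x. f x - T (2 * t) f x)"
        by (rule mz_norm_add) measurable
      also have "\<dots> \<le> ennreal (C1 * M * t powr s) + ennreal (C1 * M * (2 * t) powr s)"
        using t by (intro add_mono D) auto
      also have "\<dots> = ennreal G"
        using C1 M t by (simp add: G_def ennreal_plus[symmetric] powr_mult algebra_simps del: ennreal_plus)
      finally have g: "mz_seminorm p g \<le> ennreal G" .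
      \<comment> \<open>The exponent s = d/p is critical: the loss t^(-s) of the shift bound cancels
        the smallness t^s of g exactly. What remains is |eta| / t, which sums over dyadic
        scales.\<close>
      have tG: "t powr - s * G = C1 * M * (1 + 2 powr s)"
        using t by (simp add: G_def powr_minus)
      have tE: "A * (norm \<eta> / t) * t powr - s * G = A * (norm \<eta> / t) * (C1 * M * (1 + 2 powr s))"
        unfolding mult.assoc[of "A * (norm \<eta> / t)" "t powr - s" G] tG ..
      have e1: "norm (T t g (x + \<eta>) - T t g x) \<le> A * (norm \<eta> / t) * (C1 * M * (1 + 2 powr s))"
        using A1[OF gb t p G g, of x \<eta>] unfolding s_def[symmetric] tE .
      have "norm (T (2 * t) g (x + \<eta>) - T (2 * t) g x) \<le> A * (norm \<eta> / (2 * t)) * (2 * t) powr - s * G"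
        using A1[OF gb _ p G g, of "2 * t" x \<eta>] t unfolding s_def[symmetric] by simp
      also have "\<dots> \<le> A * (norm \<eta> / t) * t powr - s * G"
        using A G t s by (intro mult_right_mono mult_mono mult_left_mono divide_left_mono powr_mono2') auto
      also have "\<dots> = A * (norm \<eta> / t) * (C1 * M * (1 + 2 powr s))" by (rule tE)
      finally have e2: "norm (T (2 * t) g (x + \<eta>) - T (2 * t) g x) \<le> A * (norm \<eta> / t) * (C1 * M * (1 + 2 powr s))" .
      have "(S t (x + \<eta>) - S (2 * t) (x + \<eta>)) - (S t x - S (2 * t) x) = (T t g (x + \<eta>) - T t g x) - (T (2 * t) g (x + \<eta>) - T (2 * t) g x)"
        unfolding SS by simp
      then have "norm ((S t (x + \<eta>) - S (2 * t) (x + \<eta>)) - (S t x - S (2 * t) x)) \<le> norm (T t g (x + \<eta>) - T t g x) + norm (T (2 * t) g (x + \<eta>) - T (2 * t) g x)"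
        by (simp only: norm_triangle_ineq4)
      also have "\<dots> \<le> A * (norm \<eta> / t) * (C1 * M * (1 + 2 powr s)) + A * (norm \<eta> / t) * (C1 * M * (1 + 2 powr s))"
        by (intro add_mono e1 e2)
      also have "\<dots> = C2 * M * (norm \<eta> / t)" by (simp add: C2_def algebra_simps)
      finally show ?thesis .
    qed
    have osc: "norm (S r (x + \<eta>) - S r x) \<le> 2 * C2 * M * (norm \<eta> / r)" if r: "r > 0" for r x \<eta>
    proof -
      define d where "d j = S (2 ^ j * r) (x + \<eta>) - S (2 ^ j * r) x" for j :: nat
      have dj: "norm (d j) \<le> norm (d (Suc j)) + C2 * M * (norm \<eta> / r) * (1 / 2) ^ j" for j
      proof -
        have "d j - d (Suc j) = (S (2 ^ j * r) (x + \<eta>) - S (2 * (2 ^ j * r)) (x + \<eta>)) - (S (2 ^ j * r) x - S (2 * (2 ^ j * r)) x)"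
          by (simp add: d_def mult_ac)
        then have "norm (d j - d (Suc j)) \<le> C2 * M * (norm \<eta> / (2 ^ j * r))"
          using step[of "2 ^ j * r" x \<eta>] r by simp
        also have "\<dots> = C2 * M * (norm \<eta> / r) * (1 / 2) ^ j" by (simp add: power_one_over field_simps)
        finally show ?thesis using norm_triangle_sub[of "d j" "d (Suc j)"] by linarith
      qed
      have tel: "norm (d 0) \<le> norm (d n) + C2 * M * (norm \<eta> / r) * (\<Sum>j<n. (1 / 2) ^ j)" for n
      proof (induction n)
        case (Suc n)
        then show ?case using dj[of n] by (simp add: distrib_left)
      qed simp
      \<comment> \<open>The telescoping ends at a large scale, where the boundedness of
        \<open>f\<close> makes the increment tend to 0; the bound \<open>B\<close> therefore
        disappears from the final constant.\<close>
      have dn: "norm (d n) \<le> (2 + \<beta>) * A * B * (norm \<eta> / r) * (1 / 2) ^ n" for n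
      proof -
        define t where "t = 2 ^ n * r"
        have t: "t > 0" using r by (simp add: t_def)
        have hb: "\<forall>x. norm (heat \<rho> f x) \<le> B" for \<rho> using norm_heat_le[OF B(2) f] by blast
        have TB: "\<forall>x. norm (T t f x) \<le> \<beta> * B"
          unfolding T_def smoothing_def \<beta>_def using hb by (auto intro: norm_sum_scaleR_le)
        have "d n = (T t f (x + \<eta>) - T t f x) + (T t f (x + \<eta>) - T t f x) - (T t (T t f) (x + \<eta>) - T t (T t f) x)"
          by (simp add: d_def S_def t_def)
        then have "norm (d n) \<le> norm (T t f (x + \<eta>) - T t f x) + norm (T t f (x + \<eta>) - T t f x) + norm (T t (T t f) (x + \<eta>) - T t (T t f) x)"
          by (metis (no_types, lifting) add_mono_thms_linordered_semiring(3) norm_triangle_ineq norm_triangle_ineq4 order_trans)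
        also have "\<dots> \<le> A * (norm \<eta> / t) * B + A * (norm \<eta> / t) * B + A * (norm \<eta> / t) * (\<beta> * B)"
          by (intro add_mono A2 f Tb t B(2) TB)
        also have "\<dots> = (2 + \<beta>) * A * B * (norm \<eta> / t)" by (simp add: algebra_simps)
        also have "\<dots> = (2 + \<beta>) * A * B * (norm \<eta> / r) * (1 / 2) ^ n" by (simp add: t_def power_one_over field_simps)
        finally show ?thesis .
      qed
      have le: "norm (d 0) \<le> (2 + \<beta>) * A * B * (norm \<eta> / r) * (1 / 2) ^ n + C2 * M * (norm \<eta> / r) * 2" for n
      proof -
        have "(\<Sum>j<n. (1 / 2 :: real) ^ j) \<le> 2" by (simp add: sum_gp_strict)
        then have "C2 * M * (norm \<eta> / r) * (\<Sum>j<n. (1 / 2) ^ j) \<le> C2 * M * (norm \<eta> / r) * 2"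
          using C2 M r by (intro mult_left_mono) auto
        then show ?thesis using tel[of n] dn[of n] by linarith
      qed
      have "(\<lambda>n. (2 + \<beta>) * A * B * (norm \<eta> / r) * (1 / 2) ^ n + C2 * M * (norm \<eta> / r) * 2) \<longlonglongrightarrow>
          (2 + \<beta>) * A * B * (norm \<eta> / r) * 0 + C2 * M * (norm \<eta> / r) * 2"
        by (intro tendsto_intros LIMSEQ_realpow_zero) auto
      then have "norm (d 0) \<le> (2 + \<beta>) * A * B * (norm \<eta> / r) * 0 + C2 * M * (norm \<eta> / r) * 2"
        by (rule LIMSEQ_le_const) (use le in blast)
      then show ?thesis by (simp add: d_def mult_ac)
    qed
    have "BMO_seminorm f \<le> ennreal (2 * (K * M + K * M * real CARD('d)))"
    proof (rule BMO_by_smoothing[OF p f])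
      show "K * M \<ge> 0" using K M by simp
      fix r :: real assume r: "r > 0"
      have a: "(1 + \<beta>) * C1 * M * r powr s \<le> K * M * r powr s"
        using C2 M by (intro mult_right_mono) (auto simp: K_def)
      have c: "2 * C2 * M * (norm \<eta> / r) \<le> K * M * (norm \<eta> / r)" for \<eta> :: "real ^ 'd"
        using C1 \<beta> M r by (intro mult_right_mono) (auto simp: K_def)
      show "\<exists>S. bounded_borel S \<and> mz_seminorm p (\<lambda>x. f x - S x) \<le> ennreal (K * M * r powr (real CARD('d) / p)) \<and>
        (\<forall>x \<eta>. norm (S (x + \<eta>) - S x) \<le> K * M * (norm \<eta> / r))"
        using Sb[of r] order_trans[OF fS[OF r] ennreal_leI[OF a]] order_trans[OF osc[OF r] c] unfolding s_def by blast
    qed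
    also have "\<dots> \<le> ennreal ((2 * (K + K * real CARD('d)) + 1) * M)"
      using M by (intro ennreal_leI) (simp add: algebra_simps)
    finally show "BMO_seminorm f \<le> ennreal ((2 * (K + K * real CARD('d)) + 1) * M)" .
  qed
qed

text \<open>Each of the three seminorms is equivalent to a weighted supremum of norms of linear
  images \<open>L j f\<close>, indexed by steps, multi-indices or a single point. A supremum
  inherits lower semicontinuity, so this has to be proved for one operator at a time.\<close>

lemma embeds_in_BMO_family:
  fixes N :: "(real ^ 'd::finite \<Rightarrow> complex) \<Rightarrow> ennreal"
    and L :: "'j \<Rightarrow> (real ^ 'd \<Rightarrow> complex) \<Rightarrow> real ^ 'd \<Rightarrow> complex" and a :: "'j \<Rightarrow> real"
  assumes bb: "\<And>j f. j \<in> J \<Longrightarrow> f \<in> test_functions \<Longrightarrow> bounded_borel (L j f)"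
    and lin: "\<And>j f g. j \<in> J \<Longrightarrow> f \<in> test_functions \<Longrightarrow> g \<in> test_functions \<Longrightarrow>
      L j (\<lambda>x. f x - g x) = (\<lambda>x. L j f x - L j g x)"
    and conv: "\<And>j w v M. j \<in> J \<Longrightarrow> w \<in> test_functions \<Longrightarrow> (\<And>m :: nat. v m \<in> test_functions) \<Longrightarrow>
      (\<lambda>m. BMO_seminorm (v m)) \<longlonglongrightarrow> 0 \<Longrightarrow>
      (\<And>m. mz_seminorm p (\<lambda>x. L j w x - L j (v m) x) \<le> M) \<Longrightarrow>
      mz_seminorm p (L j w) \<le> M"
    and le1: "\<And>f. f \<in> test_functions \<Longrightarrow> N f \<le> ennreal K * (SUP j\<in>J. ennreal (a j) * mz_seminorm p (L j f))"
    and le2: "\<And>f. f \<in> test_functions \<Longrightarrow> (SUP j\<in>J. ennreal (a j) * mz_seminorm p (L j f)) \<le> ennreal K * N f"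
    and C: "C > 0"
    and bmo: "\<And>f M. f \<in> test_functions \<Longrightarrow> M \<ge> 0 \<Longrightarrow>
      (\<And>j. j \<in> J \<Longrightarrow> ennreal (a j) * mz_seminorm p (L j f) \<le> ennreal M) \<Longrightarrow>
      BMO_seminorm f \<le> ennreal (C * M)"
  shows "embeds_in_BMO N"
proof (rule embeds_in_BMO_criterion[OF le1 le2])
  let ?N = "\<lambda>f. SUP j\<in>J. ennreal (a j) * mz_seminorm p (L j f)"
  have L0: "L j (\<lambda>x. 0) = (\<lambda>x. 0)" if "j \<in> J" for j
    using lin[OF that test_function_zero test_function_zero] by simp
  have "?N (\<lambda>x. 0) \<le> 0" by (rule SUP_least) (simp add: L0)
  then show "?N (\<lambda>x. 0) = 0" by simp
  show "?N (\<lambda>x. f x - g x) \<le> ?N f + ?N g" if f: "f \<in> test_functions" and g: "g \<in> test_functions" for f g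
  proof (rule SUP_least)
    fix j assume j: "j \<in> J"
    have "ennreal (a j) * mz_seminorm p (L j (\<lambda>x. f x - g x))
        \<le> ennreal (a j) * (mz_seminorm p (L j f) + mz_seminorm p (L j g))"
      unfolding lin[OF j f g] by (intro mult_left_mono mz_norm_diff bb j f g) auto
    also have "\<dots> \<le> ?N f + ?N g"
      unfolding distrib_left using j by (intro add_mono SUP_upper)
    finally show "ennreal (a j) * mz_seminorm p (L j (\<lambda>x. f x - g x)) \<le> ?N f + ?N g" .
  qed
  show "BMO_seminorm f \<le> ennreal C * ?N f" if f: "f \<in> test_functions" for f
  proof (cases "?N f")
    case (real M)
    have "BMO_seminorm f \<le> ennreal (C * M)"
    proof (rule bmo[OF f real(1)])
      fix j assume "j \<in> J"
      then have "ennreal (a j) * mz_seminorm p (L j f) \<le> ?N f" by (intro SUP_upper)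
      then show "ennreal (a j) * mz_seminorm p (L j f) \<le> ennreal M" unfolding real(2) .
    qed
    then show ?thesis unfolding real(2) using C real(1) by (simp add: ennreal_mult)
  next
    case top
    then show ?thesis unfolding top using C by (simp add: ennreal_mult_top)
  qed
  show "?N w \<le> e" if w: "w \<in> test_functions" and v: "\<And>m. v m \<in> test_functions"
    and lim: "(\<lambda>m. BMO_seminorm (v m)) \<longlonglongrightarrow> 0" and le: "\<And>m :: nat. ?N (\<lambda>x. w x - v m x) \<le> e" for w v e
  proof (rule SUP_least)
    fix j assume j: "j \<in> J"
    show "ennreal (a j) * mz_seminorm p (L j w) \<le> e"
    proof (cases "a j > 0")
      case False
      then show ?thesis by (simp add: ennreal_neg)
    next
      case True
      \<comment> \<open>The reciprocal weight moves \<open>a j\<close> from one side of an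
        inequality in \<open>ennreal\<close> to the other.\<close>
      define b where "b = ennreal (1 / a j)"
      have ab: "b * (ennreal (a j) * x) = x" "ennreal (a j) * (b * x) = x" for x
        using True by (simp_all add: b_def mult.assoc[symmetric] ennreal_mult[symmetric])
      have D: "ennreal (a j) * x \<le> e \<longleftrightarrow> x \<le> b * e" for x
        using mult_left_mono[of "ennreal (a j) * x" e b] mult_left_mono[of x "b * e" "ennreal (a j)"] unfolding ab by auto
      have "mz_seminorm p (L j w) \<le> b * e"
      proof (rule conv[OF j w v lim])
        fix m
        have "ennreal (a j) * mz_seminorm p (L j (\<lambda>x. w x - v m x)) \<le> e"
          using le[of m] j by (simp add: SUP_le_iff)
        then show "mz_seminorm p (\<lambda>x. L j w x - L j (v m) x) \<le> b * e"
          unfolding lin[OF j w v] D .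
      qed
      then show ?thesis unfolding D .
    qed
  qed
qed

section \<open>Lower semicontinuity of finite differences along sequences that vanish in BMO\<close>

lemma mz_norm_lsc:
  fixes f :: "real ^ 'd::finite \<Rightarrow> complex" and g :: "nat \<Rightarrow> real ^ 'd \<Rightarrow> complex"
  assumes [measurable]: "f \<in> borel_measurable borel" "\<And>m. g m \<in> borel_measurable borel"
    and le: "\<And>m. mz_seminorm p (\<lambda>x. f x - g m x) \<le> M"
    and lim: "\<And>E. E \<in> sets borel \<Longrightarrow> bounded E \<Longrightarrow> (\<lambda>m. \<integral>\<^sup>+x\<in>E. ennreal (norm (g m x)) \<partial>lborel) \<longlonglongrightarrow> 0"
  shows "mz_seminorm p f \<le> M"
proof (rule mz_norm_approx)
  fix E :: "(real ^ 'd) set" and \<delta> :: real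
  assume E[measurable]: "E \<in> sets borel" and b: "bounded E" and \<delta>: "\<delta> > 0"
  have "\<forall>\<^sub>F m in sequentially. (\<integral>\<^sup>+x\<in>E. ennreal (norm (g m x)) \<partial>lborel) < ennreal \<delta>"
    using order_tendstoD(2)[OF lim[OF E b], of "ennreal \<delta>"] \<delta> by simp
  then obtain m where m: "(\<integral>\<^sup>+x\<in>E. ennreal (norm (g m x)) \<partial>lborel) < ennreal \<delta>" by (auto simp: eventually_sequentially)
  have "(\<integral>\<^sup>+x\<in>E. ennreal (norm (f x)) \<partial>lborel)
      \<le> (\<integral>\<^sup>+x. (ennreal (norm (f x - g m x)) * indicator E x + ennreal (norm (g m x)) * indicator E x) \<partial>lborel)"
  proof (intro nn_integral_mono)
    fix x
    have "ennreal (norm (f x)) \<le> ennreal (norm (f x - g m x) + norm (g m x))"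
      using norm_triangle_ineq[of "f x - g m x" "g m x"] by (intro ennreal_leI) simp
    then show "ennreal (norm (f x)) * indicator E x \<le> ennreal (norm (f x - g m x)) * indicator E x + ennreal (norm (g m x)) * indicator E x"
      by (simp add: indicator_def)
  qed
  also have "\<dots> = (\<integral>\<^sup>+x\<in>E. ennreal (norm (f x - g m x)) \<partial>lborel) + (\<integral>\<^sup>+x\<in>E. ennreal (norm (g m x)) \<partial>lborel)"
    by (rule nn_integral_add) measurable
  also have "\<dots> \<le> (\<integral>\<^sup>+x\<in>E. ennreal (norm (f x - g m x)) \<partial>lborel) + ennreal \<delta>"
    using m by (intro add_mono) auto
  finally show "\<exists>H. mz_norm p H \<le> M \<and> (\<integral>\<^sup>+x\<in>E. ennreal (norm (f x)) \<partial>lborel) \<le> (\<integral>\<^sup>+x\<in>E. H x \<partial>lborel) + ennreal \<delta>"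
    using le[of m] by blast
qed

lemma nn_integral_translate_set:
  fixes G :: "real ^ 'd::finite \<Rightarrow> ennreal"
  assumes [measurable]: "G \<in> borel_measurable borel" "E \<in> sets borel"
  shows "(\<integral>\<^sup>+x\<in>E. G (x + h) \<partial>lborel) = (\<integral>\<^sup>+x\<in>{x. x + (- h) \<in> E}. G x \<partial>lborel)"
proof -
  have [measurable]: "{x. x + (- h) \<in> E} \<in> sets borel"
    using sets_borel_vimage_affine[OF assms(2), of "- h" 1] by (simp add: add.commute)
  have "(\<integral>\<^sup>+x\<in>E. G (x + h) \<partial>lborel) = (\<integral>\<^sup>+x. (\<lambda>x. G x * indicator {x. x + (- h) \<in> E} x) (h + 1 *\<^sub>R x) \<partial>lborel)"
    by (intro nn_integral_cong) (auto simp: indicator_def add.commute)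
  also have "\<dots> = (\<integral>\<^sup>+x\<in>{x. x + (- h) \<in> E}. G x \<partial>lborel)"
    by (subst nn_integral_lborel_affine) auto
  finally show ?thesis .
qed

lemma nn_integral_fwd_diff_le:
  fixes g :: "real ^ 'd::finite \<Rightarrow> complex"
  assumes [measurable]: "g \<in> borel_measurable borel" "E \<in> sets borel"
  shows "(\<integral>\<^sup>+x\<in>E. ennreal (norm (fwd_diff h g x)) \<partial>lborel)
    \<le> (\<integral>\<^sup>+x\<in>{x. x + (- h) \<in> E}. ennreal (norm (g x - c)) \<partial>lborel) + (\<integral>\<^sup>+x\<in>E. ennreal (norm (g x - c)) \<partial>lborel)"
proof -
  have "(\<integral>\<^sup>+x\<in>E. ennreal (norm (fwd_diff h g x)) \<partial>lborel)
      \<le> (\<integral>\<^sup>+x. (ennreal (norm (g (x + h) - c)) * indicator E x + ennreal (norm (g x - c)) * indicator E x) \<partial>lborel)"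
  proof (intro nn_integral_mono)
    fix x
    have "ennreal (norm (fwd_diff h g x)) \<le> ennreal (norm (g (x + h) - c) + norm (g x - c))"
      using norm_triangle_ineq4[of "g (x + h) - c" "g x - c"] by (intro ennreal_leI) (simp add: fwd_diff_def)
    then show "ennreal (norm (fwd_diff h g x)) * indicator E x \<le> ennreal (norm (g (x + h) - c)) * indicator E x + ennreal (norm (g x - c)) * indicator E x"
      by (simp add: indicator_def)
  qed
  also have "\<dots> = (\<integral>\<^sup>+x\<in>E. ennreal (norm (g (x + h) - c)) \<partial>lborel) + (\<integral>\<^sup>+x\<in>E. ennreal (norm (g x - c)) \<partial>lborel)"
    by (rule nn_integral_add) measurable
  finally show ?thesis
    using nn_integral_translate_set[of "\<lambda>x. ennreal (norm (g x - c))" E h] by simp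
qed

lemma bounded_subset_cube:
  fixes E :: "(real ^ 'd::finite) set"
  assumes "bounded E" obtains a r where "r > 0" "E \<subseteq> cube a r"
proof -
  obtain B where B: "B > 0" "\<forall>x\<in>E. norm x \<le> B" using assms by (auto simp: bounded_pos)
  have "E \<subseteq> cube (\<chi> i. - B) (2 * B)"
  proof
    fix x assume "x \<in> E"
    then have "\<bar>x $ i\<bar> \<le> B" for i using B component_le_norm_cart[of x i] by force
    then have "- B \<le> x $ i" "x $ i \<le> - B + 2 * B" for i by (simp_all add: abs_le_iff minus_le_iff)
    then show "x \<in> cube (\<chi> i. - B) (2 * B)" unfolding mem_cube by simp
  qed
  then show thesis using B(1) by (intro that[of "2 * B" "\<chi> i. - B"]) auto
qed

lemma bounded_translate_set:
  fixes E :: "(real ^ 'd::finite) set"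
  assumes "bounded E" shows "bounded {x. x + (- h) \<in> E}"
proof -
  have "{x. x + (- h) \<in> E} = (\<lambda>x. h + x) ` E" by force
  then show ?thesis using bounded_translation[OF assms] by simp
qed

lemma bounded_borel_fwd_diffs: "bounded_borel f \<Longrightarrow> bounded_borel (foldr fwd_diff hs f)"
  by (induction hs) (auto simp: fwd_diff_def[abs_def] intro: bounded_borel_diff bounded_borel_translate)

text \<open>Convergence in BMO is convergence modulo constants, and one difference removes the
  constant; hence the list must be nonempty. Each further difference only requires the statement on
  the set and on a translate of it, both bounded.\<close>

lemma fwd_diffs_tendsto_0:
  fixes v :: "nat \<Rightarrow> real ^ 'd::finite \<Rightarrow> complex"
  assumes v: "\<And>m. bounded_borel (v m)" and lim: "(\<lambda>m. BMO_seminorm (v m)) \<longlonglongrightarrow> 0"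
    and "hs \<noteq> []" "E \<in> sets borel" "bounded E"
  shows "(\<lambda>m. \<integral>\<^sup>+x\<in>E. ennreal (norm (foldr fwd_diff hs (v m) x)) \<partial>lborel) \<longlonglongrightarrow> 0"
  using assms(3-)
proof (induction hs arbitrary: E rule: list_nonempty_induct)
  case (single h)
  let ?E' = "{x. x + (- h) \<in> E}"
  have [measurable]: "E \<in> sets borel" by fact
  have [measurable]: "?E' \<in> sets borel"
    using sets_borel_vimage_affine[OF single(1), of "- h" 1] by (simp add: add.commute)
  have "bounded (E \<union> ?E')" using single(2) bounded_translate_set[OF single(2), of h] by simp
  then obtain a r where r: "r > 0" "E \<union> ?E' \<subseteq> cube a r" by (rule bounded_subset_cube)
  show ?case
  proof (rule tendsto_0_ennreal_le[OF lim])
    fix m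
    note [measurable] = bounded_borel_measurable[OF v]
    let ?Q = "cube a r" and ?c = "average (v m) (cube a r)"
    have I: "(\<integral>\<^sup>+x\<in>F. ennreal (norm (v m x - ?c)) \<partial>lborel) \<le> BMO_seminorm (v m) * ennreal (r ^ CARD('d))" if "F \<subseteq> ?Q" for F
    proof -
      have "(\<integral>\<^sup>+x\<in>F. ennreal (norm (v m x - ?c)) \<partial>lborel) \<le> (\<integral>\<^sup>+x\<in>?Q. ennreal (norm (v m x - ?c)) \<partial>lborel)"
        using that by (intro nn_integral_mono) (auto simp: indicator_def)
      also have "\<dots> = (\<integral>\<^sup>+x\<in>?Q. ennreal (norm (v m x - ?c)) \<partial>lebesgue)" by (simp only: nn_integral_completion)
      also have "\<dots> \<le> BMO_seminorm (v m) * ennreal (r ^ CARD('d))" by (rule BMO_seminormD[OF r(1)])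
      finally show ?thesis .
    qed
    have "(\<integral>\<^sup>+x\<in>E. ennreal (norm (fwd_diff h (v m) x)) \<partial>lborel) \<le> BMO_seminorm (v m) * ennreal (r ^ CARD('d)) + BMO_seminorm (v m) * ennreal (r ^ CARD('d))"
      using r by (intro order_trans[OF nn_integral_fwd_diff_le add_mono[OF I I]]) auto
    also have "\<dots> = ennreal (2 * r ^ CARD('d)) * BMO_seminorm (v m)"
      using r by (simp add: ennreal_mult mult_2[symmetric] mult_ac)
    finally show "(\<integral>\<^sup>+x\<in>E. ennreal (norm (foldr fwd_diff [h] (v m) x)) \<partial>lborel) \<le> ennreal (2 * r ^ CARD('d)) * BMO_seminorm (v m)" by simp
  qed
next
  case (cons h hs)
  let ?E' = "{x. x + (- h) \<in> E}"
  have [measurable]: "E \<in> sets borel" by fact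
  have E'[measurable]: "?E' \<in> sets borel"
    using sets_borel_vimage_affine[OF cons(3), of "- h" 1] by (simp add: add.commute)
  show ?case
  proof (rule tendsto_0_ennreal_add)
    show "(\<lambda>m. \<integral>\<^sup>+x\<in>?E'. ennreal (norm (foldr fwd_diff hs (v m) x)) \<partial>lborel) \<longlonglongrightarrow> 0"
      by (rule cons(2)[OF E' bounded_translate_set[OF cons(4)]])
    show "(\<lambda>m. \<integral>\<^sup>+x\<in>E. ennreal (norm (foldr fwd_diff hs (v m) x)) \<partial>lborel) \<longlonglongrightarrow> 0"
      by (rule cons(2)[OF cons(3,4)])
    fix m
    note [measurable] = bounded_borel_measurable[OF bounded_borel_fwd_diffs[OF v]]
    show "(\<integral>\<^sup>+x\<in>E. ennreal (norm (foldr fwd_diff (h # hs) (v m) x)) \<partial>lborel)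
      \<le> (\<integral>\<^sup>+x\<in>?E'. ennreal (norm (foldr fwd_diff hs (v m) x)) \<partial>lborel) + (\<integral>\<^sup>+x\<in>E. ennreal (norm (foldr fwd_diff hs (v m) x)) \<partial>lborel)"
      using nn_integral_fwd_diff_le[of "foldr fwd_diff hs (v m)" E h 0] by simp
  qed
qed

lemma fwd_diffs_diff: "foldr fwd_diff hs (\<lambda>x. f x - g x) = (\<lambda>x. foldr fwd_diff hs f x - foldr fwd_diff hs g x)"
  by (induction hs) (auto simp: fwd_diff_def fun_eq_iff)

lemma fwd_diff_pow_foldr: "(fwd_diff h ^^ k) f = foldr fwd_diff (replicate k h) f"
  by (induction k) auto

lemma mz_norm_fwd_diffs_lsc:
  fixes v :: "nat \<Rightarrow> real ^ 'd::finite \<Rightarrow> complex"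
  assumes v: "\<And>m. bounded_borel (v m)" and w: "bounded_borel w" and lim: "(\<lambda>m. BMO_seminorm (v m)) \<longlonglongrightarrow> 0"
    and hs: "hs \<noteq> []"
    and le: "\<And>m. mz_seminorm p (\<lambda>x. foldr fwd_diff hs w x - foldr fwd_diff hs (v m) x) \<le> M"
  shows "mz_seminorm p (foldr fwd_diff hs w) \<le> M"
  by (rule mz_norm_lsc[OF _ _ le fwd_diffs_tendsto_0[OF v lim hs]])
    (intro bounded_borel_measurable bounded_borel_fwd_diffs v w)+

section \<open>The Besov seminorm as a supremum over steps\<close>

lemma fwd_diff_pow_zero:
  fixes f :: "real ^ 'd::finite \<Rightarrow> complex"
  assumes "k > 0" shows "(fwd_diff 0 ^^ k) f = (\<lambda>x. 0)"
proof -
  have *: "fwd_diff 0 g = (\<lambda>x. 0)" for g :: "real ^ 'd \<Rightarrow> complex" by (auto simp: fwd_diff_def)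
  show ?thesis using assms by (cases k) (auto simp: *)
qed

lemma mz_const_ge_1: "p > 1 \<Longrightarrow> mz_const p \<ge> 1"
  using powr_less_mono[of "1 - p" 0 2] by (simp add: mz_const_def)

text \<open>The weight t^(-s) decreases, so for a given step h the best choice among t >= |h| is t =
  |h|, and the double supremum collapses to one over h.\<close>

lemma Besov_seminorm_equiv:
  fixes f :: "real ^ 'd::finite \<Rightarrow> complex"
  assumes p: "p > 1" and s: "s > 0" and k: "k > 0" and f: "bounded_borel f"
  defines "N \<equiv> SUP h. ennreal (norm h powr - s) * mz_seminorm p ((fwd_diff h ^^ k) f)"
  shows "Besov_seminorm k s p f \<le> N" and "N \<le> ennreal (mz_const p) * Besov_seminorm k s p f"
proof -
  have m: "(\<lambda>x. norm ((fwd_diff h ^^ k) f x)) \<in> borel_measurable borel" for h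
    using bounded_borel_measurable[OF bounded_borel_fwd_diff_pow[OF f, where k=k and h=h]] by measurable
  show "Besov_seminorm k s p f \<le> N"
    unfolding Besov_seminorm_def modulus_smoothness_def SUP_mult_left_ennreal
  proof (intro SUP_least)
    fix t :: real and h :: "real ^ 'd" assume t: "t \<in> {0<..}" and h: "h \<in> {h. norm h \<le> t}"
    show "ennreal (t powr - s) * weak_Lp_norm p ((fwd_diff h ^^ k) f) \<le> N"
    \<comment> \<open>\<open>0 powr - s\<close> is 0, so the term for h = 0 drops out of
      \<open>N\<close>; its contribution on the other side is 0 because a difference of positive
      order with step 0 vanishes.\<close>
    proof (cases "h = 0")
      case True
      have "weak_Lp_norm p ((fwd_diff h ^^ k) f) \<le> 0"
        using weak_Lp_norm_le_mz_norm[OF p m[of h]] k by (simp add: True fwd_diff_pow_zero)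
      then show ?thesis by simp
    next
      case False
      have "ennreal (t powr - s) * weak_Lp_norm p ((fwd_diff h ^^ k) f)
          \<le> ennreal (norm h powr - s) * mz_seminorm p ((fwd_diff h ^^ k) f)"
        using t h False s by (intro mult_mono ennreal_leI powr_mono2' weak_Lp_norm_le_mz_norm[OF p m]) auto
      also have "\<dots> \<le> N" unfolding N_def by (intro SUP_upper) auto
      finally show ?thesis .
    qed
  qed
  show "N \<le> ennreal (mz_const p) * Besov_seminorm k s p f"
    unfolding N_def
  proof (rule SUP_least)
    fix h :: "real ^ 'd"
    show "ennreal (norm h powr - s) * mz_seminorm p ((fwd_diff h ^^ k) f) \<le> ennreal (mz_const p) * Besov_seminorm k s p f"
    proof (cases "h = 0")
      case False
      have "ennreal (norm h powr - s) * mz_seminorm p ((fwd_diff h ^^ k) f)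
          \<le> ennreal (norm h powr - s) * (ennreal (mz_const p) * weak_Lp_norm p ((fwd_diff h ^^ k) f))"
        by (intro mult_left_mono mz_norm_le_weak_Lp_norm[OF p m]) auto
      also have "\<dots> \<le> ennreal (norm h powr - s) * (ennreal (mz_const p) * modulus_smoothness k p f (norm h))"
        unfolding modulus_smoothness_def by (intro mult_left_mono SUP_upper) auto
      also have "\<dots> = ennreal (mz_const p) * (ennreal (norm h powr - s) * modulus_smoothness k p f (norm h))"
        by (rule mult.left_commute)
      also have "\<dots> \<le> ennreal (mz_const p) * Besov_seminorm k s p f"
        unfolding Besov_seminorm_def using False by (intro mult_left_mono SUP_upper) auto
      finally show ?thesis .
    qed simp
  qed
qed

lemma embeds_in_BMO_Besov:
  fixes p :: real
  assumes p: "p > 1" and k: "k > 0"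
  shows "embeds_in_BMO (Besov_seminorm k (real CARD('d::finite) / p) p :: (real ^ 'd \<Rightarrow> complex) \<Rightarrow> ennreal)"
proof -
  let ?s = "real CARD('d) / p"
  have s: "?s > 0" using p by simp
  obtain C where C: "C > 0"
    and bmo: "\<And>(f :: real ^ 'd \<Rightarrow> complex) M. bounded_borel f \<Longrightarrow> M \<ge> 0 \<Longrightarrow>
      (\<And>h. mz_seminorm p ((fwd_diff h ^^ k) f) \<le> ennreal (M * norm h powr ?s)) \<Longrightarrow>
      BMO_seminorm f \<le> ennreal (C * M)"
    by (rule BMO_from_differences[OF p, where 'd='d and k=k]) auto
  have c: "ennreal 1 \<le> ennreal (mz_const p)" by (intro ennreal_leI mz_const_ge_1 p)
  show ?thesis
  proof (rule embeds_in_BMO_family[where J=UNIV and L="\<lambda>h. fwd_diff h ^^ k" and a="\<lambda>h. norm h powr - ?s" and p=p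
        and K="mz_const p" and C=C])
    show "bounded_borel ((fwd_diff h ^^ k) f)" if "f \<in> test_functions" for h and f :: "real ^ 'd \<Rightarrow> complex"
      by (intro bounded_borel_fwd_diff_pow test_function_bounded_borel that)
    show "(fwd_diff h ^^ k) (\<lambda>x. f x - g x) = (\<lambda>x. (fwd_diff h ^^ k) f x - (fwd_diff h ^^ k) g x)" for h and f g :: "real ^ 'd \<Rightarrow> complex"
      unfolding fwd_diff_pow_foldr by (rule fwd_diffs_diff)
    show "mz_seminorm p ((fwd_diff h ^^ k) w) \<le> M"
      if "w \<in> test_functions" "\<And>m. v m \<in> test_functions" "(\<lambda>m. BMO_seminorm (v m)) \<longlonglongrightarrow> 0"
        "\<And>m :: nat. mz_seminorm p (\<lambda>x. (fwd_diff h ^^ k) w x - (fwd_diff h ^^ k) (v m) x) \<le> M"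
      for h :: "real ^ 'd" and w v M
      using that(4) k unfolding fwd_diff_pow_foldr
      by (intro mz_norm_fwd_diffs_lsc[OF _ _ that(3)] test_function_bounded_borel that(1,2)) auto
    fix f :: "real ^ 'd \<Rightarrow> complex" assume f: "f \<in> test_functions"
    note fb = test_function_bounded_borel[OF f]
    let ?N = "SUP h. ennreal (norm h powr - ?s) * mz_seminorm p ((fwd_diff h ^^ k) f)"
    have "Besov_seminorm k ?s p f \<le> ennreal 1 * ?N" using Besov_seminorm_equiv(1)[OF p s k fb] by simp
    also have "\<dots> \<le> ennreal (mz_const p) * ?N" by (rule mult_right_mono[OF c]) simp
    finally show "Besov_seminorm k ?s p f \<le> ennreal (mz_const p) * ?N" .
    show "?N \<le> ennreal (mz_const p) * Besov_seminorm k ?s p f" by (rule Besov_seminorm_equiv(2)[OF p s k fb])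
    fix M :: real
    assume M: "M \<ge> 0" and le: "\<And>h. h \<in> UNIV \<Longrightarrow> ennreal (norm h powr - ?s) * mz_seminorm p ((fwd_diff h ^^ k) f) \<le> ennreal M"
    show "BMO_seminorm f \<le> ennreal (C * M)"
    proof (rule bmo[OF fb M])
      fix h :: "real ^ 'd"
      let ?m = "mz_seminorm p ((fwd_diff h ^^ k) f)"
      show "?m \<le> ennreal (M * norm h powr ?s)"
      proof (cases "h = 0")
        case True
        then show ?thesis using k by (simp add: fwd_diff_pow_zero)
      next
        case False
        then have "?m = ennreal (norm h powr ?s) * (ennreal (norm h powr - ?s) * ?m)"
          by (simp add: mult.assoc[symmetric] ennreal_mult[symmetric] powr_add[symmetric])
        also have "\<dots> \<le> ennreal (norm h powr ?s) * ennreal M" by (intro mult_left_mono le) auto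
        also have "\<dots> = ennreal (M * norm h powr ?s)" using M by (simp add: ennreal_mult[symmetric] mult.commute)
        finally show ?thesis .
      qed
    qed
  qed (rule C)
qed

section \<open>Sobolev spaces\<close>

text \<open>\<open>partial_deriv\<close> differentiates at parameter 0; moving the base point along
  the line gives the derivative at every parameter, with the chain factor \<open>h\<close>.\<close>

lemma partial_line_derivative:
  assumes "smooth F"
  shows "((\<lambda>\<tau>. F (x + (\<tau> * h) *\<^sub>R axis i 1)) has_vector_derivative h *\<^sub>R partial_deriv i F (x + (\<tau> * h) *\<^sub>R axis i 1)) (at \<tau> within S)"
proof -
  let ?g = "\<lambda>t. F ((x + (\<tau> * h) *\<^sub>R axis i 1) + t *\<^sub>R axis i 1)"
  have g: "(?g has_vector_derivative partial_deriv i F (x + (\<tau> * h) *\<^sub>R axis i 1)) (at ((\<tau> - \<tau>) * h))"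
    using smooth_vector_derivative[OF assms, of "[]" "x + (\<tau> * h) *\<^sub>R axis i 1" i] by simp
  have f: "((\<lambda>\<tau>'. (\<tau>' - \<tau>) * h) has_vector_derivative h) (at \<tau>)"
    by (auto intro!: derivative_eq_intros)
  have "((?g \<circ> (\<lambda>\<tau>'. (\<tau>' - \<tau>) * h)) has_vector_derivative h *\<^sub>R partial_deriv i F (x + (\<tau> * h) *\<^sub>R axis i 1)) (at \<tau>)"
    by (rule vector_diff_chain_at[OF f g])
  moreover have "?g \<circ> (\<lambda>\<tau>'. (\<tau>' - \<tau>) * h) = (\<lambda>\<tau>. F (x + (\<tau> * h) *\<^sub>R axis i 1))"
    by (simp add: fun_eq_iff left_diff_distrib scaleR_diff_left)
  ultimately show ?thesis by (simp add: has_vector_derivative_at_within)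
qed

text \<open>By the fundamental theorem of calculus the difference is \<open>h\<close> times the mean
  of translates of the derivative, and Minkowski's inequality applies.\<close>

lemma mz_norm_partial_diff:
  fixes F :: "real ^ 'd::finite \<Rightarrow> complex"
  assumes F: "F \<in> test_functions"
  shows "mz_seminorm p (fwd_diff (h *\<^sub>R axis i 1) F) \<le> ennreal \<bar>h\<bar> * mz_seminorm p (partial_deriv i F)"
proof -
  have sm: "smooth F" by (rule test_function_smooth[OF F])
  have dT: "partial_deriv i F \<in> test_functions"
    using test_function_iterated_partial[OF F, of "[i]"] by simp
  note cont = test_function_continuous[OF dT]
  have [measurable]: "partial_deriv i F \<in> borel_measurable borel" by (rule test_function_borel[OF dT])
  have cI: "continuous_on {0..1} (\<lambda>\<tau>. h *\<^sub>R partial_deriv i F (x + (\<tau> * h) *\<^sub>R axis i 1))" for x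
    by (intro continuous_intros continuous_on_compose2[OF cont]) auto
  have eq: "fwd_diff (h *\<^sub>R axis i 1) F x = (LINT \<tau>|lborel. (indicator {0..1} \<tau> * h) *\<^sub>R partial_deriv i F (x + (\<tau> * h) *\<^sub>R axis i 1))" for x
    using integral_FTC_atLeastAtMost[of 0 1 "\<lambda>\<tau>. F (x + (\<tau> * h) *\<^sub>R axis i 1)", OF _ partial_line_derivative[OF sm] cI]
    by (simp add: fwd_diff_def)
  have "mz_seminorm p (fwd_diff (h *\<^sub>R axis i 1) F)
      \<le> (\<integral>\<^sup>+\<tau>. ennreal (norm (indicator {0..1::real} \<tau> * h)) * mz_seminorm p (partial_deriv i F) \<partial>lborel)"
    unfolding eq
  proof (rule mz_norm_kernel[OF lborel.sigma_finite_measure_axioms, where K="\<lambda>x \<tau>. partial_deriv i F (x + (\<tau> * h) *\<^sub>R axis i 1)"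
        and k="\<lambda>\<tau>. indicator {0..1} \<tau> * h" and B="\<lambda>_. mz_seminorm p (partial_deriv i F)"])
    show "mz_seminorm p (\<lambda>x. partial_deriv i F (x + (\<tau> * h) *\<^sub>R axis i 1)) \<le> mz_seminorm p (partial_deriv i F)" for \<tau>
      by (rule mz_norm_translate[where G="\<lambda>x. ennreal (norm (partial_deriv i F x))"]) measurable
    show "integrable lborel (\<lambda>\<tau>. (indicator {0..1} \<tau> * h) *\<^sub>R partial_deriv i F (x + (\<tau> * h) *\<^sub>R axis i 1))" for x
      using borel_integrable_compact[OF compact_Icc cI[of x]] by simp
  qed measurable
  also have "\<dots> = (\<integral>\<^sup>+\<tau>. (ennreal \<bar>h\<bar> * mz_seminorm p (partial_deriv i F)) * indicator {0..1::real} \<tau> \<partial>lborel)"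
    by (intro nn_integral_cong) (auto simp: indicator_def)
  also have "\<dots> = ennreal \<bar>h\<bar> * mz_seminorm p (partial_deriv i F)"
    by (simp add: nn_integral_cmult_indicator)
  finally show ?thesis .
qed

lemma fwd_diff_commute: "fwd_diff a (fwd_diff b f) = fwd_diff b (fwd_diff a f)"
  by (auto simp: fwd_diff_def fun_eq_iff algebra_simps)

lemma fwd_diffs_commute: "foldr fwd_diff hs (fwd_diff h f) = fwd_diff h (foldr fwd_diff hs f)"
  by (induction hs) (auto simp: fwd_diff_commute)

lemma fwd_diffs_mset:
  fixes hs :: "(real ^ 'd::finite) list"
  assumes "mset hs = mset hs'"
  shows "foldr fwd_diff hs = foldr fwd_diff hs'"
proof -
  have c: "fwd_diff x \<circ> fwd_diff y = fwd_diff y \<circ> fwd_diff x" for x y :: "real ^ 'd" by (auto simp: fwd_diff_commute)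
  then have "fold fwd_diff hs = fold fwd_diff hs'" using assms by (intro fold_multiset_equiv) auto
  moreover have "foldr fwd_diff xs = fold fwd_diff xs" for xs :: "(real ^ 'd) list" by (rule foldr_fold) (rule c)
  ultimately show ?thesis by simp
qed

lemma test_function_fwd_diff: "f \<in> test_functions \<Longrightarrow> fwd_diff h f \<in> test_functions"
  unfolding fwd_diff_def[abs_def] by (intro test_function_diff test_function_translate)

lemma iterated_partial_fwd_diff:
  assumes "f \<in> test_functions"
  shows "iterated_partial is (fwd_diff h f) = fwd_diff h (iterated_partial is f)"
  using test_function_smooth[OF assms] unfolding fwd_diff_def[abs_def]
  by (simp add: iterated_partial_diff smooth_translate iterated_partial_translate)

abbreviation axis_steps :: "('d \<Rightarrow> real) \<Rightarrow> 'd list \<Rightarrow> (real ^ 'd::finite) list" where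
  "axis_steps h is \<equiv> map (\<lambda>i. h i *\<^sub>R axis i 1) is"

lemma mz_norm_axis_diffs:
  fixes F :: "real ^ 'd::finite \<Rightarrow> complex"
  assumes "F \<in> test_functions"
  shows "mz_seminorm p (foldr fwd_diff (axis_steps h is) F)
    \<le> ennreal (\<Prod>i\<leftarrow>is. \<bar>h i\<bar>) * mz_seminorm p (iterated_partial is F)"
  using assms
proof (induction "is" arbitrary: F)
  case (Cons i "is")
  let ?hs = "axis_steps h is" and ?P = "\<Prod>i\<leftarrow>is. \<bar>h i\<bar>"
  have P: "?P \<ge> 0" by (induction "is") auto
  have dT: "iterated_partial is F \<in> test_functions" by (rule test_function_iterated_partial[OF Cons.prems])
  have "mz_seminorm p (foldr fwd_diff (axis_steps h (i # is)) F)
      = mz_seminorm p (foldr fwd_diff ?hs (fwd_diff (h i *\<^sub>R axis i 1) F))"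
    by (simp add: fwd_diffs_commute)
  also have "\<dots> \<le> ennreal ?P * mz_seminorm p (fwd_diff (h i *\<^sub>R axis i 1) (iterated_partial is F))"
    using Cons.IH[OF test_function_fwd_diff[OF Cons.prems]] by (simp add: iterated_partial_fwd_diff[OF Cons.prems])
  also have "\<dots> \<le> ennreal ?P * (ennreal \<bar>h i\<bar> * mz_seminorm p (partial_deriv i (iterated_partial is F)))"
    by (intro mult_left_mono mz_norm_partial_diff dT) auto
  also have "\<dots> = ennreal (\<Prod>i\<leftarrow>i # is. \<bar>h i\<bar>) * mz_seminorm p (iterated_partial (i # is) F)"
    using P by (simp add: ennreal_mult mult_ac)
  finally show ?case .
qed simp

text \<open>The step is walked along the axes: the difference for a + b at x is the difference for a
  at x + b plus the difference for b at x. Translation invariance makes each of the d pieces cost at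
  most \<open>M\<close>.\<close>

lemma mz_norm_fwd_diff_coords:
  fixes G :: "real ^ 'd::finite \<Rightarrow> complex"
  assumes G: "bounded_borel G"
    and le: "\<And>i. mz_seminorm p (fwd_diff (h $ i *\<^sub>R axis i 1) G) \<le> M"
  shows "mz_seminorm p (fwd_diff h G) \<le> ennreal (real CARD('d)) * M"
proof -
  note [measurable] = bounded_borel_measurable[OF G]
  have "mz_seminorm p (fwd_diff (\<Sum>i\<in>I. h $ i *\<^sub>R axis i 1) G) \<le> ennreal (real (card I)) * M" if "finite I" for I
    using that
  proof (induction I rule: finite_induct)
    case empty
    then show ?case by (simp add: fwd_diff_def)
  next
    case (insert i I)
    let ?h = "\<Sum>i\<in>I. h $ i *\<^sub>R axis i 1" and ?e = "h $ i *\<^sub>R axis i 1"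
    have m [measurable]: "fwd_diff e G \<in> borel_measurable borel" for e unfolding fwd_diff_def[abs_def] by measurable
    have "mz_seminorm p (fwd_diff (\<Sum>i\<in>insert i I. h $ i *\<^sub>R axis i 1) G)
        \<le> mz_norm p (\<lambda>x. ennreal (norm (fwd_diff ?e G (x + ?h))) + ennreal (norm (fwd_diff ?h G x)))"
    proof (rule mz_norm_mono)
      fix x
      have "fwd_diff (\<Sum>i\<in>insert i I. h $ i *\<^sub>R axis i 1) G x = fwd_diff ?e G (x + ?h) + fwd_diff ?h G x"
        using insert by (simp add: fwd_diff_def add_ac)
      then show "ennreal (norm (fwd_diff (\<Sum>i\<in>insert i I. h $ i *\<^sub>R axis i 1) G x)) \<le> ennreal (norm (fwd_diff ?e G (x + ?h))) + ennreal (norm (fwd_diff ?h G x))"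
        by (simp add: order_trans[OF ennreal_leI[OF norm_triangle_ineq]])
    qed
    also have "\<dots> \<le> mz_seminorm p (\<lambda>x. fwd_diff ?e G (x + ?h)) + mz_seminorm p (fwd_diff ?h G)"
      by (rule mz_norm_add) measurable
    also have "\<dots> \<le> M + ennreal (real (card I)) * M"
      by (intro add_mono insert.IH order_trans[OF mz_norm_translate[where G="\<lambda>x. ennreal (norm (fwd_diff ?e G x))"] le]) measurable
    also have "\<dots> = ennreal (real (card (insert i I))) * M"
      using insert by (simp add: ennreal_plus[symmetric] distrib_right del: ennreal_plus) (simp add: distrib_right)
    finally show ?case .
  qed
  from this[of UNIV] have *: "mz_seminorm p (fwd_diff (\<Sum>i\<in>UNIV. h $ i *\<^sub>R axis i 1) G) \<le> ennreal (real CARD('d)) * M" by simp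
  have "(\<Sum>i\<in>UNIV. h $ i *\<^sub>R axis i 1) = h" using basis_expansion[of h] by (simp add: scalar_mult_eq_scaleR)
  then show ?thesis using * by simp
qed

text \<open>Splitting each of the k differences along the axes produces d^k words of axis
  steps.\<close>

lemma mz_norm_fwd_diff_pow_coords:
  fixes G :: "real ^ 'd::finite \<Rightarrow> complex"
  assumes "bounded_borel G"
    and "\<And>is. length is = k \<Longrightarrow> mz_seminorm p (foldr fwd_diff (axis_steps (($) h) is) G) \<le> M"
  shows "mz_seminorm p ((fwd_diff h ^^ k) G) \<le> ennreal (real CARD('d) ^ k) * M"
  using assms
proof (induction k arbitrary: G)
  case 0
  from 0(2)[of "[]"] show ?case by simp
next
  case (Suc k)
  have "mz_seminorm p (fwd_diff h ((fwd_diff h ^^ k) G)) \<le> ennreal (real CARD('d)) * (ennreal (real CARD('d) ^ k) * M)"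
  proof (rule mz_norm_fwd_diff_coords[OF bounded_borel_fwd_diff_pow[OF Suc.prems(1)]])
    fix i
    let ?e = "h $ i *\<^sub>R axis i 1"
    have "fwd_diff ?e ((fwd_diff h ^^ k) G) = (fwd_diff h ^^ k) (fwd_diff ?e G)"
      unfolding fwd_diff_pow_foldr fwd_diffs_commute ..
    moreover have "mz_seminorm p ((fwd_diff h ^^ k) (fwd_diff ?e G)) \<le> ennreal (real CARD('d) ^ k) * M"
    proof (rule Suc.IH)
      show "bounded_borel (fwd_diff ?e G)" using bounded_borel_fwd_diffs[OF Suc.prems(1), of "[?e]"] by simp
      fix js :: "'d list" assume "length js = k"
      then show "mz_seminorm p (foldr fwd_diff (axis_steps (($) h) js) (fwd_diff ?e G)) \<le> M"
        using Suc.prems(2)[of "js @ [i]"] by simp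
    qed
    ultimately show "mz_seminorm p (fwd_diff ?e ((fwd_diff h ^^ k) G)) \<le> ennreal (real CARD('d) ^ k) * M" by simp
  qed
  then show ?case by (simp add: ennreal_mult mult.assoc)
qed

section \<open>Multi-indices and the lists that represent them\<close>

definition index_list :: "('d \<Rightarrow> nat) \<Rightarrow> 'd::finite list" where
  "index_list \<alpha> = (SOME is. \<forall>i. count_list is i = \<alpha> i)"

lemma multi_deriv_index_list: "multi_deriv \<alpha> f = iterated_partial (index_list \<alpha>) f"
  by (simp add: multi_deriv_def index_list_def)

lemma count_index_list: "count_list (index_list \<alpha>) i = \<alpha> i"
proof -
  obtain js where js: "mset js = (\<Sum>j\<in>UNIV. replicate_mset (\<alpha> j) j)" using ex_mset by blast
  have "count_list js i = (\<Sum>j\<in>UNIV. count (replicate_mset (\<alpha> j) j) i)" for i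
    unfolding count_mset[symmetric] js by (rule count_sum)
  then have "\<forall>i. count_list js i = \<alpha> i" by (simp add: sum.delta' cong: if_cong)
  then have "\<exists>js. \<forall>i. count_list js i = \<alpha> i" by blast
  from someI_ex[OF this] show ?thesis unfolding index_list_def by blast
qed

lemma length_index_list: "length (index_list \<alpha>) = (\<Sum>i\<in>UNIV. \<alpha> i)"
proof -
  have "(\<Sum>i\<in>UNIV. count_list (index_list \<alpha>) i) = length (index_list \<alpha>)"
    by (rule sum_count_set) auto
  then show ?thesis by (simp add: count_index_list)
qed

lemma mset_index_list_count: "mset (index_list (count_list is)) = mset is"
  by (rule multiset_eqI) (simp add: count_mset count_index_list)

lemma sum_count_list: "(\<Sum>i\<in>UNIV. count_list is i) = length (is :: 'd::finite list)"
  by (rule sum_count_set) auto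

text \<open>Finite differences commute, so \<open>k\<close>-th differences are controlled by the derivatives in the fixed
  order that the definition of \<open>multi_deriv\<close> selects; symmetry of partial derivatives is not used.\<close>

lemma mz_norm_fwd_diff_pow_derivs:
  fixes f :: "real ^ 'd::finite \<Rightarrow> complex"
  assumes f: "f \<in> test_functions"
    and le: "\<And>\<alpha>. (\<Sum>i\<in>UNIV. \<alpha> i) = k \<Longrightarrow> mz_seminorm p (multi_deriv \<alpha> f) \<le> ennreal M" and M: "M \<ge> 0"
  shows "mz_seminorm p ((fwd_diff h ^^ k) f) \<le> ennreal (real CARD('d) ^ k * M * norm h ^ k)"
proof -
  have "mz_seminorm p ((fwd_diff h ^^ k) f) \<le> ennreal (real CARD('d) ^ k) * ennreal (norm h ^ k * M)"
  proof (rule mz_norm_fwd_diff_pow_coords[OF test_function_bounded_borel[OF f]])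
    fix js :: "'d list" assume js: "length js = k"
    let ?l = "index_list (count_list js)"
    have l: "length ?l = k" by (simp add: length_index_list sum_count_list js)
    have "mset (axis_steps (($) h) js) = mset (axis_steps (($) h) ?l)"
      by (simp add: mset_index_list_count)
    then have "foldr fwd_diff (axis_steps (($) h) js) = foldr fwd_diff (axis_steps (($) h) ?l)" by (rule fwd_diffs_mset)
    then have "mz_seminorm p (foldr fwd_diff (axis_steps (($) h) js) f)
        \<le> ennreal (\<Prod>i\<leftarrow>?l. \<bar>h $ i\<bar>) * mz_seminorm p (iterated_partial ?l f)"
      using mz_norm_axis_diffs[OF f, of p "($) h" ?l] by simp
    also have "\<dots> \<le> ennreal (norm h ^ k) * ennreal M"
    proof (intro mult_mono ennreal_leI)
      have "(\<Prod>i\<leftarrow>l. \<bar>h $ i\<bar>) \<le> norm h ^ length l" for l :: "'d list"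
        by (induction l) (auto intro!: mult_mono component_le_norm_cart prod_list_nonneg)
      from this[of ?l] show "(\<Prod>i\<leftarrow>?l. \<bar>h $ i\<bar>) \<le> norm h ^ k" unfolding l .
      show "mz_seminorm p (iterated_partial ?l f) \<le> ennreal M"
        using le[of "count_list js"] js by (simp add: sum_count_list multi_deriv_index_list)
    qed auto
    also have "\<dots> = ennreal (norm h ^ k * M)" using M by (simp add: ennreal_mult)
    finally show "mz_seminorm p (foldr fwd_diff (axis_steps (($) h) js) f) \<le> ennreal (norm h ^ k * M)" .
  qed
  also have "\<dots> = ennreal (real CARD('d) ^ k * M * norm h ^ k)" using M by (simp add: ennreal_mult[symmetric] mult_ac)
  finally show ?thesis .
qed

text \<open>In the induction one difference is moved from the operator onto \<open>F\<close>.
  Integrating along its axis, the remaining derivative of the difference stays within h epsilon of h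
  c, on a ball whose radius has shrunk by h.\<close>

lemma axis_diffs_close:
  fixes F :: "real ^ 'd::finite \<Rightarrow> complex"
  assumes "F \<in> test_functions" "h > 0"
    and "\<And>z. norm z \<le> real (length is) * h \<Longrightarrow> norm (iterated_partial is F (x + z) - c) \<le> \<epsilon>"
  shows "norm (foldr fwd_diff (axis_steps (\<lambda>_. h) is) F x - h ^ length is *\<^sub>R c) \<le> \<epsilon> * h ^ length is"
  using assms
proof (induction "is" arbitrary: F c \<epsilon>)
  case Nil
  from Nil(3)[of 0] show ?case by simp
next
  case (Cons i "is")
  let ?e = "axis i 1 :: real ^ 'd"
  have "norm (foldr fwd_diff (axis_steps (\<lambda>_. h) is) (fwd_diff (h *\<^sub>R ?e) F) x - h ^ length is *\<^sub>R (h *\<^sub>R c)) \<le> (h * \<epsilon>) * h ^ length is"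
  proof (rule Cons.IH[OF test_function_fwd_diff[OF Cons.prems(1)] Cons.prems(2)])
    fix z :: "real ^ 'd" assume z: "norm z \<le> real (length is) * h"
    let ?G = "iterated_partial is F"
    let ?g = "\<lambda>\<tau>. ?G (x + z + (\<tau> * h) *\<^sub>R ?e) - \<tau> *\<^sub>R (h *\<^sub>R c)"
    have Gs: "smooth ?G" by (rule smooth_iterated_partial[OF test_function_smooth[OF Cons.prems(1)]])
    have int: "((\<lambda>\<tau>. h *\<^sub>R partial_deriv i ?G (x + z + (\<tau> * h) *\<^sub>R ?e) - h *\<^sub>R c) has_integral (?g 1 - ?g 0)) {0..1}"
    proof (rule fundamental_theorem_of_calculus)
      fix \<tau> :: real
      have cd: "((\<lambda>\<tau>. \<tau> *\<^sub>R (h *\<^sub>R c)) has_vector_derivative h *\<^sub>R c) (at \<tau> within {0..1})"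
        unfolding has_vector_derivative_def by (rule bounded_linear_imp_has_derivative[OF bounded_linear_scaleR_left])
      show "(?g has_vector_derivative h *\<^sub>R partial_deriv i ?G (x + z + (\<tau> * h) *\<^sub>R ?e) - h *\<^sub>R c) (at \<tau> within {0..1})"
        using has_vector_derivative_diff[OF partial_line_derivative[OF Gs, of "x + z" h i \<tau> "{0..1}"] cd] .
    qed simp
    have "norm (iterated_partial (i # is) F (x + 0) - c) \<le> \<epsilon>" using Cons.prems(2) by (intro Cons.prems(3)) simp
    then have \<epsilon>: "\<epsilon> \<ge> 0" by (rule order_trans[OF norm_ge_zero])
    have "norm (?g 1 - ?g 0) \<le> (h * \<epsilon>) * measure lborel {0..1::real}"
    proof (rule has_integral_bound_real[OF _ _ int])
      fix \<tau> :: real assume "\<tau> \<in> {0..1} - {}"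
      then have \<tau>: "0 \<le> \<tau>" "\<tau> \<le> 1" by auto
      have "norm (z + (\<tau> * h) *\<^sub>R ?e) \<le> norm z + \<tau> * h"
        using norm_triangle_ineq[of z "(\<tau> * h) *\<^sub>R ?e"] \<tau> Cons.prems(2) by (simp add: norm_axis_1)
      also have "\<dots> \<le> real (length is) * h + 1 * h" using z \<tau> Cons.prems(2) by (intro add_mono mult_right_mono) auto
      also have "\<dots> = real (length (i # is)) * h" by (simp add: algebra_simps)
      finally have "norm (iterated_partial (i # is) F (x + (z + (\<tau> * h) *\<^sub>R ?e)) - c) \<le> \<epsilon>" by (rule Cons.prems(3))
      then have "h * norm (partial_deriv i ?G (x + z + (\<tau> * h) *\<^sub>R ?e) - c) \<le> h * \<epsilon>"
        using Cons.prems(2) by (simp add: add.assoc)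
      then show "norm (h *\<^sub>R partial_deriv i ?G (x + z + (\<tau> * h) *\<^sub>R ?e) - h *\<^sub>R c) \<le> h * \<epsilon>"
        using Cons.prems(2) by (simp add: scaleR_diff_right[symmetric])
    qed (use \<epsilon> Cons.prems(2) in auto)
    then show "norm (iterated_partial is (fwd_diff (h *\<^sub>R ?e) F) (x + z) - h *\<^sub>R c) \<le> h * \<epsilon>"
      unfolding iterated_partial_fwd_diff[OF Cons.prems(1)] by (simp add: fwd_diff_def algebra_simps)
  qed
  then show ?case by (simp add: fwd_diffs_commute mult_ac)
qed

text \<open>Convergence in BMO controls differences rather than derivatives. The bound is passed to
  the limit for differences of a fixed step \<open>h\<close>, with the factor h^n; dividing by this
  factor and letting \<open>h\<close> be small recovers the derivative, uniformly on bounded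
  sets.\<close>

lemma mz_norm_partial_lsc:
  fixes w :: "real ^ 'd::finite \<Rightarrow> complex"
  assumes w: "w \<in> test_functions" and v: "\<And>m. v m \<in> test_functions"
    and lim: "(\<lambda>m. BMO_seminorm (v m)) \<longlonglongrightarrow> 0" and js: "js \<noteq> []"
    and le: "\<And>m :: nat. mz_seminorm p (\<lambda>x. iterated_partial js w x - iterated_partial js (v m) x) \<le> M"
  shows "mz_seminorm p (iterated_partial js w) \<le> M"
proof -
  let ?n = "length js"
  have D: "mz_seminorm p (foldr fwd_diff (axis_steps (\<lambda>_. h) js) w) \<le> ennreal (h ^ ?n) * M" if h: "h > 0" for h
  proof (rule mz_norm_fwd_diffs_lsc[OF _ _ lim])
    fix m
    have "(\<Prod>i\<leftarrow>js. \<bar>h\<bar>) = h ^ ?n" using h by (induction js) auto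
    then have "mz_seminorm p (\<lambda>x. foldr fwd_diff (axis_steps (\<lambda>_. h) js) (\<lambda>x. w x - v m x) x)
        \<le> ennreal (h ^ ?n) * mz_seminorm p (iterated_partial js (\<lambda>x. w x - v m x))"
      using mz_norm_axis_diffs[OF test_function_diff[OF w v], of p "\<lambda>_. h" js m] by simp
    also have "\<dots> \<le> ennreal (h ^ ?n) * M"
      unfolding iterated_partial_diff[OF test_function_smooth[OF w] test_function_smooth[OF v]]
      by (intro mult_left_mono le) auto
    finally show "mz_seminorm p (\<lambda>x. foldr fwd_diff (axis_steps (\<lambda>_. h) js) w x - foldr fwd_diff (axis_steps (\<lambda>_. h) js) (v m) x) \<le> ennreal (h ^ ?n) * M"
      unfolding fwd_diffs_diff .
  qed (use js test_function_bounded_borel w v in auto)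
  let ?G = "iterated_partial js w"
  have G: "?G \<in> test_functions" by (rule test_function_iterated_partial[OF w])
  show ?thesis
  proof (rule mz_norm_approx)
    fix E :: "(real ^ 'd) set" and \<delta> :: real
    assume E[measurable]: "E \<in> sets borel" and b: "bounded E" and \<delta>: "\<delta> > 0"
    obtain R where R: "\<forall>x\<in>E. norm x \<le> R" "R > 0" using b by (auto simp: bounded_pos)
    define \<epsilon> where "\<epsilon> = \<delta> / (measure lborel E + 1)"
    have \<epsilon>: "\<epsilon> > 0" using \<delta> by (simp add: \<epsilon>_def add_nonneg_pos)
    have "uniformly_continuous_on (cball 0 (R + 1)) ?G"
      by (intro compact_uniformly_continuous continuous_on_subset[OF test_function_continuous[OF G]]) auto
    then obtain \<eta> where \<eta>: "\<eta> > 0" "\<forall>x\<in>cball 0 (R + 1). \<forall>x'\<in>cball 0 (R + 1). dist x' x < \<eta> \<longrightarrow> dist (?G x') (?G x) < \<epsilon>"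
      using \<epsilon> unfolding uniformly_continuous_on_def by blast
    \<comment> \<open>All intermediate points then lie within min 1 (eta / 2) of x: they stay in the
      ball of radius R + 1 and within the modulus of continuity.\<close>
    define h where "h = min 1 (\<eta> / 2) / (real ?n + 1)"
    have h: "h > 0" using \<eta> by (simp add: h_def)
    have nh: "real ?n * h \<le> min 1 (\<eta> / 2)"
    proof -
      have "real ?n * h = min 1 (\<eta> / 2) * (real ?n / (real ?n + 1))" by (simp add: h_def)
      also have "\<dots> \<le> min 1 (\<eta> / 2) * 1" using \<eta> by (intro mult_left_mono) auto
      finally show ?thesis by simp
    qed
    let ?D = "foldr fwd_diff (axis_steps (\<lambda>_. h) js) w"
    have close: "norm (?D x - h ^ ?n *\<^sub>R ?G x) \<le> \<epsilon> * h ^ ?n" if x: "x \<in> E" for x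
    proof (rule axis_diffs_close[OF w h])
      fix z :: "real ^ 'd" assume "norm z \<le> real ?n * h"
      then have z: "norm z \<le> 1" "norm z < \<eta>" using nh \<eta>(1) by (auto simp: min_def split: if_splits)
      have "norm x \<le> R" using R x by blast
      then have "x \<in> cball 0 (R + 1)" "x + z \<in> cball 0 (R + 1)" using z norm_triangle_ineq[of x z] by auto
      then have "dist (?G (x + z)) (?G x) < \<epsilon>" using \<eta>(2) z(2) by (auto simp: dist_norm)
      then show "norm (?G (x + z) - ?G x) \<le> \<epsilon>" by (simp add: dist_norm)
    qed
    let ?H = "\<lambda>x. ennreal (1 / h ^ ?n) * ennreal (norm (?D x))"
    have Dm[measurable]: "?D \<in> borel_measurable borel"
      by (intro bounded_borel_measurable bounded_borel_fwd_diffs test_function_bounded_borel w)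
    have "mz_norm p ?H \<le> ennreal (1 / h ^ ?n) * (ennreal (h ^ ?n) * M)"
      by (rule order_trans[OF mz_norm_cmult mult_left_mono[OF D[OF h]]]) auto
    also have "\<dots> = M" using h by (simp add: mult.assoc[symmetric] ennreal_mult[symmetric])
    finally have HM: "mz_norm p ?H \<le> M" .
    have "(\<integral>\<^sup>+x\<in>E. ennreal (norm (?G x)) \<partial>lborel) \<le> (\<integral>\<^sup>+x. (?H x * indicator E x + ennreal \<epsilon> * indicator E x) \<partial>lborel)"
    proof (intro nn_integral_mono)
      fix x
      show "ennreal (norm (?G x)) * indicator E x \<le> ?H x * indicator E x + ennreal \<epsilon> * indicator E x"
      proof (cases "x \<in> E")
        case True
        have hp: "h ^ ?n > 0" using h by simp
        have "norm (h ^ ?n *\<^sub>R ?G x) \<le> norm (?D x) + \<epsilon> * h ^ ?n"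
          using close[OF True] norm_triangle_ineq3[of "?D x" "h ^ ?n *\<^sub>R ?G x"] by linarith
        then have "h ^ ?n * norm (?G x) \<le> norm (?D x) + \<epsilon> * h ^ ?n" using h by simp
        then have "norm (?G x) \<le> 1 / h ^ ?n * norm (?D x) + \<epsilon>" 
          using hp h divide_right_mono[of "h ^ ?n * norm (?G x)" "norm (?D x) + \<epsilon> * h ^ ?n" "h ^ ?n"] by (simp add: add_divide_distrib)
        then have "ennreal (norm (?G x)) \<le> ennreal (1 / h ^ ?n * norm (?D x) + \<epsilon>)" by (rule ennreal_leI)
        also have "\<dots> = ?H x + ennreal \<epsilon>" using hp \<epsilon> by (simp add: ennreal_plus ennreal_mult[symmetric])
        finally show ?thesis using True by simp
      qed simp
    qed
    also have "\<dots> = (\<integral>\<^sup>+x\<in>E. ?H x \<partial>lborel) + ennreal \<epsilon> * emeasure lborel E"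
      by (subst nn_integral_add) (auto simp: nn_integral_cmult_indicator)
    also have "ennreal \<epsilon> * emeasure lborel E \<le> ennreal \<delta>"
    proof -
      have "\<epsilon> * measure lborel E \<le> \<epsilon> * (measure lborel E + 1)" using \<epsilon> by (intro mult_left_mono) auto
      also have "\<dots> = \<delta>" using measure_nonneg[of lborel E] by (simp add: \<epsilon>_def add_nonneg_eq_0_iff)
      finally show ?thesis using \<epsilon> by (simp add: emeasure_lborel_bounded[OF b E] ennreal_mult[symmetric] ennreal_leI)
    qed
    finally show "\<exists>H. mz_norm p H \<le> M \<and> (\<integral>\<^sup>+x\<in>E. ennreal (norm (?G x)) \<partial>lborel) \<le> (\<integral>\<^sup>+x\<in>E. H x \<partial>lborel) + ennreal \<delta>"
      using HM by (auto simp: add_left_mono)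
  qed
qed

lemma finite_multi_indices: "finite {\<alpha> :: 'd::finite \<Rightarrow> nat. (\<Sum>i\<in>UNIV. \<alpha> i) = k}"
proof (rule finite_subset)
  show "{\<alpha> :: 'd \<Rightarrow> nat. (\<Sum>i\<in>UNIV. \<alpha> i) = k} \<subseteq> PiE UNIV (\<lambda>_. {..k})"
    using member_le_sum[of _ "UNIV :: 'd set"] by (auto simp: PiE_UNIV_domain)
qed (auto intro: finite_PiE)

lemma grad_norm_L2_set: "grad_norm k f x = L2_set (\<lambda>\<alpha>. norm (multi_deriv \<alpha> f x)) {\<alpha>. (\<Sum>i\<in>UNIV. \<alpha> i) = k}"
  by (simp add: grad_norm_def L2_set_def)

lemma embeds_in_BMO_Sobolev:
  assumes k: "0 < k" "k < CARD('d::finite)"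
  shows "embeds_in_BMO (Sobolev_seminorm k (real CARD('d) / real k) :: (real ^ 'd \<Rightarrow> complex) \<Rightarrow> ennreal)"
proof -
  define p where "p = real CARD('d) / real k"
  have p: "p > 1" and dp: "real CARD('d) / p = real k" using k by (simp_all add: p_def)
  define J :: "('d \<Rightarrow> nat) set" where "J = {\<alpha>. (\<Sum>i\<in>UNIV. \<alpha> i) = k}"
  have J: "finite J" unfolding J_def by (rule finite_multi_indices)
  \<comment> \<open>One constant for both comparisons: the number of multi-indices bounds a sum by a
    supremum, and \<open>mz_const p\<close> passes from the weak norm to
    \<open>mz_norm\<close>.\<close>
  define c where "c = real (card J) + mz_const p"
  have c: "real (card J) \<le> c" "mz_const p \<le> c" using mz_const_pos[OF p] by (simp_all add: c_def)
  obtain C where C: "C > 0"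
    and bmo: "\<And>(f :: real ^ 'd \<Rightarrow> complex) M. bounded_borel f \<Longrightarrow> M \<ge> 0 \<Longrightarrow>
      (\<And>h. mz_seminorm p ((fwd_diff h ^^ k) f) \<le> ennreal (M * norm h powr (real CARD('d) / p))) \<Longrightarrow>
      BMO_seminorm f \<le> ennreal (C * M)"
    by (rule BMO_from_differences[OF p, where 'd='d and k=k]) auto
  have dT: "multi_deriv \<alpha> f \<in> test_functions" if "f \<in> test_functions" for \<alpha> and f :: "real ^ 'd \<Rightarrow> complex"
    unfolding multi_deriv_index_list by (rule test_function_iterated_partial[OF that])
  have gm: "(\<lambda>x. grad_norm k f x) \<in> borel_measurable borel" if f: "f \<in> test_functions" for f :: "real ^ 'd \<Rightarrow> complex"
  proof -
    have [measurable]: "multi_deriv \<alpha> f \<in> borel_measurable borel" for \<alpha> by (rule test_function_borel[OF dT[OF f]])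
    show ?thesis unfolding grad_norm_def by measurable
  qed
  have g0: "norm (grad_norm k f x) = grad_norm k f x" for f :: "real ^ 'd \<Rightarrow> complex" and x
    by (simp add: grad_norm_L2_set L2_set_nonneg)
  have gm': "(\<lambda>x. norm (grad_norm k f x)) \<in> borel_measurable borel" if f: "f \<in> test_functions" for f :: "real ^ 'd \<Rightarrow> complex"
    unfolding g0 by (rule gm[OF f])
  show ?thesis unfolding p_def[symmetric]
  proof (rule embeds_in_BMO_family[where J=J and L=multi_deriv and a="\<lambda>_. 1" and p=p and K=c and C="C * real CARD('d) ^ k"])
    show "bounded_borel (multi_deriv \<alpha> f)" if "f \<in> test_functions" for \<alpha> and f :: "real ^ 'd \<Rightarrow> complex"
      by (rule test_function_bounded_borel[OF dT[OF that]])
    show "multi_deriv \<alpha> (\<lambda>x. f x - g x) = (\<lambda>x. multi_deriv \<alpha> f x - multi_deriv \<alpha> g x)"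
      if "f \<in> test_functions" "g \<in> test_functions" for \<alpha> and f g :: "real ^ 'd \<Rightarrow> complex"
      unfolding multi_deriv_index_list by (rule iterated_partial_diff[OF that[THEN test_function_smooth]])
    show "mz_seminorm p (multi_deriv \<alpha> w) \<le> M"
      if "\<alpha> \<in> J" "w \<in> test_functions" "\<And>m. v m \<in> test_functions" "(\<lambda>m. BMO_seminorm (v m)) \<longlonglongrightarrow> 0"
        "\<And>m :: nat. mz_seminorm p (\<lambda>x. multi_deriv \<alpha> w x - multi_deriv \<alpha> (v m) x) \<le> M"
      for \<alpha> w v M
    proof -
      have "length (index_list \<alpha>) = k" using that(1) by (simp add: length_index_list J_def)
      then have "index_list \<alpha> \<noteq> []" using k by auto
      then show ?thesis
        using mz_norm_partial_lsc[OF that(2,3,4), of "index_list \<alpha>" p M] that(5) unfolding multi_deriv_index_list by blast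
    qed
    show "C * real CARD('d) ^ k > 0" using C by simp
    fix f :: "real ^ 'd \<Rightarrow> complex" assume f: "f \<in> test_functions"
    let ?N = "SUP \<alpha>\<in>J. ennreal 1 * mz_seminorm p (multi_deriv \<alpha> f)"
    have [measurable]: "multi_deriv \<alpha> f \<in> borel_measurable borel" for \<alpha> by (rule test_function_borel[OF dT[OF f]])
    have "Sobolev_seminorm k p f \<le> mz_seminorm p (grad_norm k f)"
      unfolding Sobolev_seminorm_def by (rule weak_Lp_norm_le_mz_norm[OF p gm'[OF f]])
    also have "\<dots> \<le> mz_norm p (\<lambda>x. \<Sum>\<alpha>\<in>J. ennreal (norm (multi_deriv \<alpha> f x)))"
      unfolding g0 grad_norm_L2_set J_def[symmetric]
      by (intro mz_norm_mono) (simp add: sum_ennreal ennreal_leI L2_set_le_sum)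
    also have "\<dots> \<le> (\<Sum>\<alpha>\<in>J. mz_seminorm p (multi_deriv \<alpha> f))"
      by (rule mz_norm_sum[OF J]) measurable
    also have "\<dots> \<le> (\<Sum>\<alpha>\<in>J. ?N)" by (intro sum_mono SUP_upper2) auto
    also have "\<dots> = ennreal (real (card J)) * ?N" by (simp add: ennreal_of_nat_eq_real_of_nat)
    also have "\<dots> \<le> ennreal c * ?N" using c by (intro mult_right_mono ennreal_leI) auto
    finally show "Sobolev_seminorm k p f \<le> ennreal c * ?N" .
    have "?N \<le> mz_seminorm p (grad_norm k f)"
      unfolding g0 grad_norm_L2_set J_def[symmetric]
      by (rule SUP_least) (auto intro!: mz_norm_mono ennreal_leI member_le_L2_set[OF J])
    also have "\<dots> \<le> ennreal (mz_const p) * Sobolev_seminorm k p f"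
      unfolding Sobolev_seminorm_def by (rule mz_norm_le_weak_Lp_norm[OF p gm'[OF f]])
    also have "\<dots> \<le> ennreal c * Sobolev_seminorm k p f" using c by (intro mult_right_mono ennreal_leI) auto
    finally show "?N \<le> ennreal c * Sobolev_seminorm k p f" .
    fix M :: real
    assume M: "M \<ge> 0" and le: "\<And>\<alpha>. \<alpha> \<in> J \<Longrightarrow> ennreal 1 * mz_seminorm p (multi_deriv \<alpha> f) \<le> ennreal M"
    have "BMO_seminorm f \<le> ennreal (C * (real CARD('d) ^ k * M))"
    proof (rule bmo[OF test_function_bounded_borel[OF f]])
      show "real CARD('d) ^ k * M \<ge> 0" using M by simp
      fix h :: "real ^ 'd"
      have "norm h ^ k = norm h powr real k"
        using k by (cases "h = 0") (simp_all add: powr_realpow)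
      moreover have "mz_seminorm p ((fwd_diff h ^^ k) f) \<le> ennreal (real CARD('d) ^ k * M * norm h ^ k)"
        using le by (intro mz_norm_fwd_diff_pow_derivs[OF f _ M]) (auto simp: J_def)
      ultimately show "mz_seminorm p ((fwd_diff h ^^ k) f) \<le> ennreal (real CARD('d) ^ k * M * norm h powr (real CARD('d) / p))"
        unfolding dp by simp
    qed
    then show "BMO_seminorm f \<le> ennreal (C * real CARD('d) ^ k * M)" by (simp add: mult.assoc)
  qed
qed

section \<open>The Fourier transform of test functions\<close>

lemma lborel_integral_affine:
  fixes f :: "real ^ 'd::finite \<Rightarrow> complex"
  assumes [measurable]: "f \<in> borel_measurable borel" and c: "c > 0"
  shows "(LINT x|lborel. f (t + c *\<^sub>R x)) = (1 / c ^ CARD('d)) *\<^sub>R (LINT x|lborel. f x)"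
proof -
  have "(LINT x|lborel. f x) = (LINT x|density (distr lborel borel (\<lambda>x. t + c *\<^sub>R x)) (\<lambda>_. \<bar>c\<bar> ^ DIM(real ^ 'd)). f x)"
    using c by (subst lborel_affine[of c t]) auto
  also have "\<dots> = (LINT x|distr lborel borel (\<lambda>x. t + c *\<^sub>R x). (c ^ CARD('d)) *\<^sub>R f x)"
    using c by (subst integral_density) auto
  also have "\<dots> = (c ^ CARD('d)) *\<^sub>R (LINT x|lborel. f (t + c *\<^sub>R x))"
    by (subst integral_distr) auto
  finally show ?thesis using c by simp
qed

lemma vector_derivative_seq:
  fixes g :: "real \<Rightarrow> 'a::real_normed_vector"
  assumes g: "(g has_vector_derivative g') (at 0)" and t0: "t \<longlonglongrightarrow> 0" and t: "\<And>n. t n > 0"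
  shows "(\<lambda>n. (1 / t n) *\<^sub>R (g (t n) - g 0)) \<longlonglongrightarrow> g'"
proof -
  have lim: "((\<lambda>h. norm (g (0 + h) - g 0 - h *\<^sub>R g') / norm h) \<longlongrightarrow> 0) (at 0)"
    using g unfolding has_vector_derivative_def has_derivative_at by blast
  have "filterlim t (at 0) sequentially"
    unfolding filterlim_at using t0 t by (auto simp: less_imp_neq[symmetric])
  from filterlim_compose[OF lim this]
  have "(\<lambda>n. norm (g (t n) - g 0 - t n *\<^sub>R g') / norm (t n)) \<longlonglongrightarrow> 0" by simp
  moreover have "norm (g (t n) - g 0 - t n *\<^sub>R g') / norm (t n) = norm ((1 / t n) *\<^sub>R (g (t n) - g 0) - g')" for n
  proof -
    have "(1 / t n) *\<^sub>R (g (t n) - g 0) - g' = (1 / t n) *\<^sub>R (g (t n) - g 0 - t n *\<^sub>R g')"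
      using t[of n] by (simp add: scaleR_diff_right)
    then show ?thesis using t[of n] by simp
  qed
  ultimately have "(\<lambda>n. norm ((1 / t n) *\<^sub>R (g (t n) - g 0) - g')) \<longlonglongrightarrow> 0" by simp
  then have "(\<lambda>n. (1 / t n) *\<^sub>R (g (t n) - g 0) - g') \<longlonglongrightarrow> 0" by (rule tendsto_norm_zero_cancel)
  then show ?thesis by (rule LIM_zero_cancel)
qed

definition inv_fourier :: "(real ^ 'd::finite \<Rightarrow> complex) \<Rightarrow> real ^ 'd \<Rightarrow> complex" where
  "inv_fourier m x = (LINT \<xi>|lborel. exp (\<i> * complex_of_real (x \<bullet> \<xi>)) * m \<xi>) / (2 * complex_of_real pi) ^ CARD('d)"

lemma inv_fourier_integrable:
  assumes m: "integrable lborel m" shows "integrable lborel (\<lambda>\<xi>. exp (\<i> * complex_of_real (x \<bullet> \<xi>)) * m \<xi>)"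
proof -
  note [measurable] = borel_measurable_integrable[OF m, simplified]
  show ?thesis by (rule Bochner_Integration.integrable_bound[OF m]) (auto simp: norm_mult)
qed

lemma norm_inv_fourier_le:
  fixes m :: "real ^ 'd::finite \<Rightarrow> complex"
  assumes m: "integrable lborel m" shows "norm (inv_fourier m x) \<le> (LINT \<xi>|lborel. norm (m \<xi>))"
proof -
  have "norm (LINT \<xi>|lborel. exp (\<i> * complex_of_real (x \<bullet> \<xi>)) * m \<xi>) \<le> (LINT \<xi>|lborel. norm (exp (\<i> * complex_of_real (x \<bullet> \<xi>)) * m \<xi>))"
    by (rule integral_norm_bound)
  also have "\<dots> = (LINT \<xi>|lborel. norm (m \<xi>))" by (simp add: norm_mult)
  finally have "norm (LINT \<xi>|lborel. exp (\<i> * complex_of_real (x \<bullet> \<xi>)) * m \<xi>) \<le> (LINT \<xi>|lborel. norm (m \<xi>))" .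
  moreover have "1 \<le> (2 * pi) ^ CARD('d)" using pi_ge_two by (intro one_le_power) auto
  then have "norm (LINT \<xi>|lborel. exp (\<i> * complex_of_real (x \<bullet> \<xi>)) * m \<xi>) / (2 * pi) ^ CARD('d)
      \<le> norm (LINT \<xi>|lborel. exp (\<i> * complex_of_real (x \<bullet> \<xi>)) * m \<xi>) / 1"
    by (intro divide_left_mono) auto
  ultimately show ?thesis by (simp add: inv_fourier_def norm_divide norm_power norm_mult)
qed

lemma bounded_borel_inv_fourier:
  assumes m: "integrable lborel m" shows "bounded_borel (inv_fourier m)"
proof (rule bounded_borelI[OF _ norm_inv_fourier_le[OF m]])
  note [measurable] = borel_measurable_integrable[OF m, simplified]
  have "inv_fourier m \<in> borel_measurable lborel" unfolding inv_fourier_def[abs_def] by measurable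
  then show "inv_fourier m \<in> borel_measurable borel" by simp
qed

lemma inv_fourier_diff:
  assumes "integrable lborel m" "integrable lborel n"
  shows "inv_fourier (\<lambda>\<xi>. m \<xi> - n \<xi>) x = inv_fourier m x - inv_fourier n x"
  unfolding inv_fourier_def right_diff_distrib
  by (simp add: Bochner_Integration.integral_diff[OF inv_fourier_integrable[OF assms(1)] inv_fourier_integrable[OF assms(2)]] diff_divide_distrib)

lemma inv_fourier_cmult: "inv_fourier (\<lambda>\<xi>. complex_of_real c * m \<xi>) x = complex_of_real c * inv_fourier m x"
  unfolding inv_fourier_def by (simp add: mult.left_commute[of _ "complex_of_real c"])

text \<open>Stated for an arbitrary integrable symbol: it is applied to products of a transform with
  |xi|^(2 sigma) or with powers of Gaussian differences, which need not be transforms of test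
  functions.\<close>

lemma heat_inv_fourier:
  fixes m :: "real ^ 'd::finite \<Rightarrow> complex"
  assumes m: "integrable lborel m"
  shows "heat \<rho> (inv_fourier m) x = inv_fourier (\<lambda>\<xi>. complex_of_real (exp (- (\<rho> * norm \<xi>)\<^sup>2)) * m \<xi>) x"
proof -
  note [measurable] = borel_measurable_integrable[OF m, simplified]
  let ?K = "\<lambda>y \<xi>. complex_of_real (heat_kernel y) * (exp (\<i> * complex_of_real ((x + \<rho> *\<^sub>R y) \<bullet> \<xi>)) * m \<xi>)"
  let ?P = "(2 * complex_of_real pi) ^ CARD('d)"
  have int: "integrable (lborel \<Otimes>\<^sub>M lborel) (\<lambda>(y, \<xi>). ?K y \<xi>)"
  proof (rule lborel_pair.Fubini_integrable)
    have "(\<lambda>y :: real ^ 'd. LINT \<xi>|lborel. norm (?K y \<xi>)) = (\<lambda>y. heat_kernel y * (LINT \<xi>|lborel. norm (m \<xi>)))"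
      by (simp add: norm_mult)
    then show "integrable lborel (\<lambda>y :: real ^ 'd. LINT \<xi>|lborel. norm (case (y, \<xi>) of (y, \<xi>) \<Rightarrow> ?K y \<xi>))"
      by (simp add: heat_kernel_integrable)
    show "AE y :: real ^ 'd in lborel. integrable lborel (\<lambda>\<xi>. case (y, \<xi>) of (y, \<xi>) \<Rightarrow> ?K y \<xi>)"
      using inv_fourier_integrable[OF m] by (intro AE_I2) simp
  qed measurable
  have "heat \<rho> (inv_fourier m) x = (LINT y|lborel. (LINT \<xi>|lborel. ?K y \<xi>) / ?P)"
    unfolding heat_def inv_fourier_def scaleR_conv_of_real times_divide_eq_right by simp
  also have "\<dots> = (LINT \<xi>|lborel. (LINT y|lborel. ?K y \<xi>)) / ?P"
    using lborel_pair.Fubini_integral[OF int] by simp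
  also have "(\<lambda>\<xi>. LINT y|lborel. ?K y \<xi>) = (\<lambda>\<xi>. exp (\<i> * complex_of_real (x \<bullet> \<xi>)) * (complex_of_real (exp (- (\<rho> * norm \<xi>)\<^sup>2)) * m \<xi>))"
  proof
    fix \<xi>
    have "?K y \<xi> = (exp (\<i> * complex_of_real (x \<bullet> \<xi>)) * m \<xi>) * (complex_of_real (heat_kernel y) * exp (\<i> * complex_of_real (y \<bullet> (\<rho> *\<^sub>R \<xi>))))" for y
      by (simp add: inner_add_left distrib_left exp_add mult_ac)
    then have "(LINT y|lborel. ?K y \<xi>) = (exp (\<i> * complex_of_real (x \<bullet> \<xi>)) * m \<xi>) * complex_of_real (exp (- (norm (\<rho> *\<^sub>R \<xi>))\<^sup>2))"
      by (simp only: integral_mult_right_zero heat_kernel_fourier(2))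
    then show "(LINT y|lborel. ?K y \<xi>) = exp (\<i> * complex_of_real (x \<bullet> \<xi>)) * (complex_of_real (exp (- (\<rho> * norm \<xi>)\<^sup>2)) * m \<xi>)"
      by (simp add: power_mult_distrib mult_ac)
  qed
  finally show ?thesis unfolding inv_fourier_def .
qed

lemma fourier_measurable:
  assumes [measurable]: "f \<in> borel_measurable borel" shows "fourier f \<in> borel_measurable borel"
proof -
  have "fourier f \<in> borel_measurable lborel" unfolding fourier_def[abs_def] by measurable
  then show ?thesis by simp
qed

lemma fourier_integrable:
  assumes f: "integrable lborel f" shows "integrable lborel (\<lambda>x. exp (- \<i> * complex_of_real (x \<bullet> \<xi>)) * f x)"
proof -
  note [measurable] = borel_measurable_integrable[OF f, simplified]
  show ?thesis by (rule Bochner_Integration.integrable_bound[OF f]) (auto simp: norm_mult)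
qed

lemma norm_fourier_le:
  assumes f: "integrable lborel f" shows "norm (fourier f \<xi>) \<le> (LINT x|lborel. norm (f x))"
proof -
  have "norm (fourier f \<xi>) \<le> (LINT x|lborel. norm (exp (- \<i> * complex_of_real (x \<bullet> \<xi>)) * f x))"
    unfolding fourier_def by (rule integral_norm_bound)
  then show ?thesis by (simp add: norm_mult)
qed

lemma fourier_diff:
  assumes "integrable lborel f" "integrable lborel g"
  shows "fourier (\<lambda>x. f x - g x) \<xi> = fourier f \<xi> - fourier g \<xi>"
  unfolding fourier_def right_diff_distrib
  by (rule Bochner_Integration.integral_diff[OF fourier_integrable[OF assms(1)] fourier_integrable[OF assms(2)]])

lemma fourier_translate:
  fixes f :: "real ^ 'd::finite \<Rightarrow> complex"
  assumes [measurable]: "f \<in> borel_measurable borel"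
  shows "fourier (\<lambda>x. f (x + h)) \<xi> = exp (\<i> * complex_of_real (h \<bullet> \<xi>)) * fourier f \<xi>"
proof -
  let ?F = "\<lambda>x. exp (\<i> * complex_of_real (h \<bullet> \<xi>)) * (exp (- \<i> * complex_of_real (x \<bullet> \<xi>)) * f x)"
  have "fourier (\<lambda>x. f (x + h)) \<xi> = (LINT x|lborel. ?F (h + 1 *\<^sub>R x))"
    unfolding fourier_def
    by (intro Bochner_Integration.integral_cong refl)
       (simp add: inner_add_left mult.assoc[symmetric] exp_add[symmetric] algebra_simps)
  also have "\<dots> = (LINT x|lborel. ?F x)" by (subst lborel_integral_affine[where f="?F"]) auto
  also have "\<dots> = exp (\<i> * complex_of_real (h \<bullet> \<xi>)) * fourier f \<xi>" unfolding fourier_def by simp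
  finally show ?thesis .
qed

lemma fwd_diff_bound:
  fixes f :: "real ^ 'd::finite \<Rightarrow> complex"
  assumes "f \<in> test_functions" "t > 0" "\<And>x. norm (partial_deriv i f x) \<le> B"
  shows "norm (fwd_diff (t *\<^sub>R axis i 1) f x) \<le> B * t"
proof -
  let ?g = "\<lambda>\<tau>. f (x + (\<tau> * t) *\<^sub>R axis i 1)"
  have "norm (?g 1 - ?g 0) \<le> (\<bar>t\<bar> * B) * norm (1 - 0 :: real)"
  proof (rule differentiable_bound[of "{0..1}"])
    fix \<tau> :: real
    show "(?g has_derivative (\<lambda>y. y *\<^sub>R (t *\<^sub>R partial_deriv i f (x + (\<tau> * t) *\<^sub>R axis i 1)))) (at \<tau> within {0..1})"
      using partial_line_derivative[OF test_function_smooth[OF assms(1)]] unfolding has_vector_derivative_def .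
    show "onorm (\<lambda>y :: real. y *\<^sub>R (t *\<^sub>R partial_deriv i f (x + (\<tau> * t) *\<^sub>R axis i 1))) \<le> \<bar>t\<bar> * B"
    proof (rule onorm_le)
      fix y :: real
      show "norm (y *\<^sub>R (t *\<^sub>R partial_deriv i f (x + (\<tau> * t) *\<^sub>R axis i 1))) \<le> \<bar>t\<bar> * B * norm y"
        using mult_left_mono[OF assms(3)[of "x + (\<tau> * t) *\<^sub>R axis i 1"], of "\<bar>y\<bar> * \<bar>t\<bar>"] by (simp add: mult_ac abs_mult)
    qed
  qed auto
  then show ?thesis using assms(2) by (simp add: fwd_diff_def mult.commute)
qed

text \<open>The translation rule is differentiated. For steps at most 1 the difference quotients
  live in the ball of radius R + 1 and are bounded by the supremum of the derivative, so dominated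
  convergence applies.\<close>

lemma fourier_partial:
  fixes f :: "real ^ 'd::finite \<Rightarrow> complex"
  assumes f: "f \<in> test_functions"
  shows "fourier (partial_deriv i f) \<xi> = \<i> * complex_of_real (\<xi> $ i) * fourier f \<xi>"
proof -
  let ?e = "axis i 1 :: real ^ 'd"
  define t where "t n = 1 / real (Suc n)" for n
  have t: "t n > 0" "t n \<le> 1" for n by (simp_all add: t_def)
  have t0: "t \<longlonglongrightarrow> 0" unfolding t_def by (rule LIMSEQ_Suc[OF lim_const_over_n[of 1]])
  have dT: "partial_deriv i f \<in> test_functions" using test_function_iterated_partial[OF f, of "[i]"] by simp
  obtain R where R: "R > 0" "\<forall>x. norm x > R \<longrightarrow> f x = 0" by (rule test_function_support[OF f])
  obtain B where B: "B > 0" "\<forall>x. norm (partial_deriv i f x) \<le> B" by (rule test_function_bounded[OF dT])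
  have [measurable]: "f \<in> borel_measurable borel" "partial_deriv i f \<in> borel_measurable borel"
    by (intro test_function_borel f dT)+
  define q where "q n x = (1 / t n) *\<^sub>R fwd_diff (t n *\<^sub>R ?e) f x" for n x
  have [measurable]: "q n \<in> borel_measurable borel" for n unfolding q_def fwd_diff_def by measurable
  have qb: "norm (q n x) \<le> indicator (cball 0 (R + 1)) x * B" for n x
  proof (cases "norm x \<le> R + 1")
    case True
    have "norm (fwd_diff (t n *\<^sub>R ?e) f x) \<le> B * t n" using B by (intro fwd_diff_bound f t) auto
    then show ?thesis using True t[of n] by (simp add: q_def field_simps)
  next
    case False
    have "norm (t n *\<^sub>R ?e) \<le> 1" using t[of n] by simp
    then have "norm (x + t n *\<^sub>R ?e) > R" using False norm_diff_ineq[of x "t n *\<^sub>R ?e"] by linarith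
    then show ?thesis using False R by (simp add: q_def fwd_diff_def)
  qed
  have ql: "(\<lambda>n. q n x) \<longlonglongrightarrow> partial_deriv i f x" for x
  proof -
    have "((\<lambda>t. f (x + t *\<^sub>R ?e)) has_vector_derivative partial_deriv i f x) (at 0)"
      using smooth_vector_derivative[OF test_function_smooth[OF f], of "[]"] by simp
    from vector_derivative_seq[OF this t0 t(1)] show ?thesis by (simp add: q_def fwd_diff_def)
  qed
  have int1: "(\<lambda>n. fourier (q n) \<xi>) \<longlonglongrightarrow> fourier (partial_deriv i f) \<xi>"
    unfolding fourier_def
  proof (rule integral_dominated_convergence[where w="\<lambda>x. indicator (cball 0 (R + 1)) x * B"])
    show "integrable lborel (\<lambda>x :: real ^ 'd. indicator (cball 0 (R + 1)) x * B)"
      using emeasure_lborel_cball_finite[of 0 "R + 1"] by (auto intro!: integrable_real_indicator integrable_mult_left)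
    show "AE x in lborel. (\<lambda>n. exp (- \<i> * complex_of_real (x \<bullet> \<xi>)) * q n x) \<longlonglongrightarrow> exp (- \<i> * complex_of_real (x \<bullet> \<xi>)) * partial_deriv i f x"
      by (intro AE_I2 tendsto_mult tendsto_const ql)
    show "AE x in lborel. norm (exp (- \<i> * complex_of_real (x \<bullet> \<xi>)) * q n x) \<le> indicator (cball 0 (R + 1)) x * B" for n
      using qb by (intro AE_I2) (simp add: norm_mult)
  qed measurable
  have q: "fourier (q n) \<xi> = ((exp (\<i> * complex_of_real (t n * \<xi> $ i)) - 1) / complex_of_real (t n)) * fourier f \<xi>" for n
  proof -
    have fi: "integrable lborel f" by (rule test_function_integrable[OF f])
    have fi': "integrable lborel (\<lambda>x. f (x + t n *\<^sub>R ?e))" by (rule test_function_integrable[OF test_function_translate[OF f]])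
    have "fourier (q n) \<xi> = (1 / t n) *\<^sub>R fourier (\<lambda>x. f (x + t n *\<^sub>R ?e) - f x) \<xi>"
      unfolding fourier_def q_def fwd_diff_def by (simp flip: integral_scaleR_right)
    also have "\<dots> = (1 / t n) *\<^sub>R (exp (\<i> * complex_of_real (t n * \<xi> $ i)) * fourier f \<xi> - fourier f \<xi>)"
      by (subst fourier_diff[OF fi' fi], subst fourier_translate) (auto simp: inner_axis')
    finally show ?thesis by (simp add: scaleR_conv_of_real algebra_simps divide_inverse)
  qed
  have "(\<lambda>n. ((exp (\<i> * complex_of_real (t n * \<xi> $ i)) - 1) / complex_of_real (t n)) * fourier f \<xi>)
      \<longlonglongrightarrow> (\<i> * complex_of_real (\<xi> $ i)) * fourier f \<xi>"
  proof (intro tendsto_mult tendsto_const)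
    have "((\<lambda>z. exp (\<i> * (z * complex_of_real (\<xi> $ i)))) has_field_derivative \<i> * complex_of_real (\<xi> $ i)) (at (complex_of_real 0))"
      by (auto intro!: derivative_eq_intros)
    then have "((\<lambda>t. exp (\<i> * (complex_of_real t * complex_of_real (\<xi> $ i)))) has_vector_derivative \<i> * complex_of_real (\<xi> $ i)) (at 0)"
      by (rule has_vector_derivative_real_field)
    from vector_derivative_seq[OF this t0 t(1)]
    show "(\<lambda>n. (exp (\<i> * complex_of_real (t n * \<xi> $ i)) - 1) / complex_of_real (t n)) \<longlonglongrightarrow> \<i> * complex_of_real (\<xi> $ i)"
      by (simp add: scaleR_conv_of_real divide_inverse mult.commute)
  qed
  then have "(\<lambda>n. fourier (q n) \<xi>) \<longlonglongrightarrow> \<i> * complex_of_real (\<xi> $ i) * fourier f \<xi>" unfolding q .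
  from LIMSEQ_unique[OF int1 this] show ?thesis .
qed

text \<open>Decay without smoothness: a factor |xi|^a with a >= 0 can be singular at the origin, yet
  it preserves this property.\<close>

definition rapid :: "(real ^ 'd::finite \<Rightarrow> complex) \<Rightarrow> bool" where
  "rapid m \<longleftrightarrow> m \<in> borel_measurable borel \<and> (\<forall>n. \<exists>C. \<forall>\<xi>. (1 + norm \<xi>) ^ n * norm (m \<xi>) \<le> C)"

lemma rapid_integrable:
  fixes m :: "real ^ 'd::finite \<Rightarrow> complex"
  assumes m: "rapid m" shows "integrable lborel m"
proof -
  have [measurable]: "m \<in> borel_measurable borel" using m by (simp add: rapid_def)
  obtain C where C: "\<forall>\<xi>. (1 + norm \<xi>) ^ (2 * CARD('d)) * norm (m \<xi>) \<le> C" using m unfolding rapid_def by blast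
  show ?thesis
  proof (rule Bochner_Integration.integrable_bound)
    show "integrable lborel (\<lambda>\<xi> :: real ^ 'd. C * decay \<xi>)" using decay_integrable by (rule integrable_mult_right)
    show "AE \<xi> in lborel. norm (m \<xi>) \<le> norm (C * decay \<xi>)"
    proof (intro AE_I2)
      fix \<xi> :: "real ^ 'd"
      have p: "(1 + norm \<xi>) ^ (2 * CARD('d)) > 0" by (intro zero_less_power add_pos_nonneg) auto
      have "norm (m \<xi>) \<le> C * decay \<xi>"
        using C[rule_format, of \<xi>] p unfolding decay_def by (simp add: field_simps)
      then show "norm (m \<xi>) \<le> norm (C * decay \<xi>)" by (simp add: abs_le_iff)
    qed
  qed auto
qed

lemma rapid_cmult_powr:
  assumes m: "rapid m" and a: "a \<ge> 0" shows "rapid (\<lambda>\<xi>. complex_of_real (norm \<xi> powr a) * m \<xi>)"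
  unfolding rapid_def
proof (intro conjI allI)
  have [measurable]: "m \<in> borel_measurable borel" using m by (simp add: rapid_def)
  show "(\<lambda>\<xi>. complex_of_real (norm \<xi> powr a) * m \<xi>) \<in> borel_measurable borel" by measurable
  fix n
  define k where "k = nat \<lceil>a\<rceil>"
  obtain C where C: "\<forall>\<xi>. (1 + norm \<xi>) ^ (n + k) * norm (m \<xi>) \<le> C" using m unfolding rapid_def by blast
  show "\<exists>C. \<forall>\<xi>. (1 + norm \<xi>) ^ n * norm (complex_of_real (norm \<xi> powr a) * m \<xi>) \<le> C"
  proof (intro exI allI)
    fix \<xi> :: "real ^ 'a"
    have "norm \<xi> powr a \<le> (1 + norm \<xi>) powr a" using a by (intro powr_mono2) auto
    also have "\<dots> \<le> (1 + norm \<xi>) powr real k" using a by (intro powr_mono) (auto simp: k_def)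
    also have "\<dots> = (1 + norm \<xi>) ^ k" by (intro powr_realpow add_pos_nonneg) auto
    finally have "(1 + norm \<xi>) ^ n * (norm \<xi> powr a * norm (m \<xi>)) \<le> (1 + norm \<xi>) ^ n * ((1 + norm \<xi>) ^ k * norm (m \<xi>))"
      by (intro mult_left_mono mult_right_mono) auto
    also have "\<dots> \<le> C" using C by (simp add: power_add mult.assoc)
    finally show "(1 + norm \<xi>) ^ n * norm (complex_of_real (norm \<xi> powr a) * m \<xi>) \<le> C" by (simp add: norm_mult)
  qed
qed

lemma rapid_mult_bounded:
  assumes m: "rapid m" and [measurable]: "g \<in> borel_measurable borel" and g: "\<And>\<xi>. norm (g \<xi>) \<le> 1"
  shows "rapid (\<lambda>\<xi>. g \<xi> * m \<xi>)"
  unfolding rapid_def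
proof (intro conjI allI)
  have [measurable]: "m \<in> borel_measurable borel" using m by (simp add: rapid_def)
  show "(\<lambda>\<xi>. g \<xi> * m \<xi>) \<in> borel_measurable borel" by measurable
  fix n
  obtain C where C: "\<forall>\<xi>. (1 + norm \<xi>) ^ n * norm (m \<xi>) \<le> C" using m unfolding rapid_def by blast
  show "\<exists>C. \<forall>\<xi>. (1 + norm \<xi>) ^ n * norm (g \<xi> * m \<xi>) \<le> C"
  proof (intro exI allI)
    fix \<xi> :: "real ^ 'a"
    have "norm (g \<xi>) * norm (m \<xi>) \<le> norm (m \<xi>)" using g by (intro mult_left_le_one_le) auto
    then have "(1 + norm \<xi>) ^ n * (norm (g \<xi>) * norm (m \<xi>)) \<le> (1 + norm \<xi>) ^ n * norm (m \<xi>)" by (intro mult_left_mono) auto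
    then show "(1 + norm \<xi>) ^ n * norm (g \<xi> * m \<xi>) \<le> C" using order_trans[OF _ C[rule_format]] by (simp add: norm_mult)
  qed
qed

lemma fourier_iterated_partial:
  fixes f :: "real ^ 'd::finite \<Rightarrow> complex"
  assumes "f \<in> test_functions"
  shows "fourier (iterated_partial (replicate n i) f) \<xi> = (\<i> * complex_of_real (\<xi> $ i)) ^ n * fourier f \<xi>"
proof (induction n)
  case (Suc n)
  then show ?case using fourier_partial[OF test_function_iterated_partial[OF assms, of "replicate n i"], of i \<xi>] by simp
qed simp

lemma rapid_fourier:
  fixes f :: "real ^ 'd::finite \<Rightarrow> complex"
  assumes f: "f \<in> test_functions" shows "rapid (fourier f)"
  unfolding rapid_def
proof (intro conjI allI)
  show "fourier f \<in> borel_measurable borel" by (intro fourier_measurable test_function_borel f)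
  fix n
  define d where "d = real CARD('d)"
  have d: "d > 0" by (simp add: d_def)
  define L where "L i = (LINT x|lborel. norm (iterated_partial (replicate n i) f x))" for i
  define L0 where "L0 = (LINT x|lborel. norm (f x))"
  have L: "L i \<ge> 0" for i unfolding L_def by (intro integral_nonneg_AE) auto
  have b0: "norm (fourier f \<xi>) \<le> L0" for \<xi>
    unfolding L0_def by (rule norm_fourier_le[OF test_function_integrable[OF f]])
  have bi: "\<bar>\<xi> $ i\<bar> ^ n * norm (fourier f \<xi>) \<le> L i" for \<xi> i
    using norm_fourier_le[OF test_function_integrable[OF test_function_iterated_partial[OF f, of "replicate n i"]], of \<xi>]
    unfolding fourier_iterated_partial[OF f] L_def[symmetric] by (simp add: norm_mult norm_power)
  show "\<exists>C. \<forall>\<xi>. (1 + norm \<xi>) ^ n * norm (fourier f \<xi>) \<le> C"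
  proof (intro exI allI)
    fix \<xi> :: "real ^ 'd"
    \<comment> \<open>Some coordinate carries at least the fraction 1/d of the norm; differentiating
      n times in that direction controls the n-th power of |xi|.\<close>
    have "\<exists>i. norm \<xi> \<le> d * \<bar>\<xi> $ i\<bar>"
    proof (rule ccontr)
      assume "\<not> ?thesis"
      then have "\<bar>\<xi> $ i\<bar> < norm \<xi> / d" for i using d by (simp add: not_le pos_less_divide_eq mult.commute)
      then have "(\<Sum>i\<in>UNIV. \<bar>\<xi> $ i\<bar>) < (\<Sum>i\<in>(UNIV :: 'd set). norm \<xi> / d)" by (intro sum_strict_mono) auto
      then show False using norm_le_l1_cart[of \<xi>] by (simp add: d_def)
    qed
    then obtain i where i: "norm \<xi> \<le> d * \<bar>\<xi> $ i\<bar>" ..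
    have "(1 + norm \<xi>) ^ n \<le> (2 * max 1 (norm \<xi>)) ^ n" by (intro power_mono) auto
    also have "\<dots> = 2 ^ n * max 1 (norm \<xi>) ^ n" by (rule power_mult_distrib)
    also have "\<dots> \<le> 2 ^ n * (1 + norm \<xi> ^ n)" by (intro mult_left_mono) (auto simp: max_def)
    finally have "(1 + norm \<xi>) ^ n * norm (fourier f \<xi>) \<le> 2 ^ n * (1 + norm \<xi> ^ n) * norm (fourier f \<xi>)"
      by (rule mult_right_mono) simp
    also have "\<dots> = 2 ^ n * (norm (fourier f \<xi>) + norm \<xi> ^ n * norm (fourier f \<xi>))" by (simp add: algebra_simps)
    also have "\<dots> \<le> 2 ^ n * (L0 + d ^ n * L i)"
    proof (intro mult_left_mono add_mono b0)
      have "norm \<xi> ^ n * norm (fourier f \<xi>) \<le> (d * \<bar>\<xi> $ i\<bar>) ^ n * norm (fourier f \<xi>)"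
        by (intro mult_right_mono power_mono i) auto
      also have "\<dots> = d ^ n * (\<bar>\<xi> $ i\<bar> ^ n * norm (fourier f \<xi>))" by (simp add: power_mult_distrib)
      also have "\<dots> \<le> d ^ n * L i" using d by (intro mult_left_mono bi) auto
      finally show "norm \<xi> ^ n * norm (fourier f \<xi>) \<le> d ^ n * L i" .
    qed auto
    also have "\<dots> \<le> 2 ^ n * (L0 + d ^ n * (\<Sum>i\<in>UNIV. L i))"
      using d L by (intro mult_left_mono add_left_mono member_le_sum) auto
    finally show "(1 + norm \<xi>) ^ n * norm (fourier f \<xi>) \<le> 2 ^ n * (L0 + d ^ n * (\<Sum>i\<in>UNIV. L i))" .
  qed
qed

text \<open>The substitution eta = 2 rho xi turns the Gaussian into 1/G times
  \<open>heat_kernel\<close>, whose transform is known. The power of 2 pi arises from G^2 (4 pi)^d =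
  1.\<close>

lemma gaussian_integral:
  fixes u :: "real ^ 'd::finite"
  assumes \<rho>: "\<rho> > 0"
  shows "(LINT \<xi>|lborel. exp (\<i> * complex_of_real (u \<bullet> \<xi>)) * complex_of_real (exp (- (\<rho> * norm \<xi>)\<^sup>2)))
    = (2 * complex_of_real pi) ^ CARD('d) * complex_of_real (heat_kernel ((1 / \<rho>) *\<^sub>R u) / \<rho> ^ CARD('d))"
proof -
  define G where "G = (1 / sqrt (4 * pi)) ^ CARD('d)"
  have G: "G > 0" by (simp add: G_def)
  let ?F = "\<lambda>\<eta> :: real ^ 'd. complex_of_real (heat_kernel \<eta>) * exp (\<i> * complex_of_real (\<eta> \<bullet> ((1 / (2 * \<rho>)) *\<^sub>R u)))"
  have "exp (\<i> * complex_of_real (u \<bullet> \<xi>)) * complex_of_real (exp (- (\<rho> * norm \<xi>)\<^sup>2)) = complex_of_real (1 / G) * ?F (0 + (2 * \<rho>) *\<^sub>R \<xi>)" for \<xi>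
  proof -
    have "heat_kernel ((2 * \<rho>) *\<^sub>R \<xi>) = G * exp (- (\<rho> * norm \<xi>)\<^sup>2)"
      using \<rho> by (simp add: heat_kernel_eq G_def power_mult_distrib)
    moreover have "((2 * \<rho>) *\<^sub>R \<xi>) \<bullet> ((1 / (2 * \<rho>)) *\<^sub>R u) = u \<bullet> \<xi>"
      using \<rho> by (simp add: inner_commute)
    ultimately show ?thesis using G by simp
  qed
  then have "(LINT \<xi>|lborel. exp (\<i> * complex_of_real (u \<bullet> \<xi>)) * complex_of_real (exp (- (\<rho> * norm \<xi>)\<^sup>2)))
      = complex_of_real (1 / G) * (LINT \<xi>|lborel. ?F (0 + (2 * \<rho>) *\<^sub>R \<xi>))" by simp
  also have "\<dots> = complex_of_real (1 / G) * ((1 / (2 * \<rho>) ^ CARD('d)) *\<^sub>R (LINT \<xi>|lborel. ?F \<xi>))"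
    using \<rho> by (subst lborel_integral_affine[where f="?F"]) auto
  also have "(LINT \<xi>|lborel. ?F \<xi>) = complex_of_real (exp (- (norm ((1 / (2 * \<rho>)) *\<^sub>R u))\<^sup>2))"
    by (rule heat_kernel_fourier(2))
  also have "complex_of_real (1 / G) * ((1 / (2 * \<rho>) ^ CARD('d)) *\<^sub>R complex_of_real (exp (- (norm ((1 / (2 * \<rho>)) *\<^sub>R u))\<^sup>2)))
      = (2 * complex_of_real pi) ^ CARD('d) * complex_of_real (heat_kernel ((1 / \<rho>) *\<^sub>R u) / \<rho> ^ CARD('d))"
  proof -
    have e: "(norm ((1 / (2 * \<rho>)) *\<^sub>R u))\<^sup>2 = (norm ((1 / \<rho>) *\<^sub>R u))\<^sup>2 / 4"
      using \<rho> by (simp add: power_divide power_mult_distrib)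
    have c: "1 / G * (1 / (2 * \<rho>) ^ CARD('d)) = (2 * pi) ^ CARD('d) * (G / \<rho> ^ CARD('d))"
    proof -
      define S where "S = sqrt (4 * pi) ^ CARD('d)"
      have S: "1 / G = S" "G * S = 1" by (simp_all add: G_def S_def power_one_over)
      have "S * S = (4 * pi) ^ CARD('d)" unfolding S_def power_mult_distrib[symmetric] by simp
      also have "\<dots> = (2 * pi) ^ CARD('d) * 2 ^ CARD('d)" unfolding power_mult_distrib[symmetric] by simp
      finally have "S * (G * S) = (2 * pi) ^ CARD('d) * 2 ^ CARD('d) * G" by (simp add: mult_ac)
      then have "S = (2 * pi) ^ CARD('d) * 2 ^ CARD('d) * G" unfolding S(2) by simp
      then have "1 / G * (1 / (2 * \<rho>) ^ CARD('d)) = (2 * pi) ^ CARD('d) * 2 ^ CARD('d) * G * (1 / (2 * \<rho>) ^ CARD('d))" unfolding S(1) by simp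
      also have "\<dots> = (2 * pi) ^ CARD('d) * (G / \<rho> ^ CARD('d))" by (simp add: power_mult_distrib)
      finally show ?thesis .
    qed
    define X where "X = exp (- (norm ((1 / \<rho>) *\<^sub>R u))\<^sup>2 / 4)"
    have "1 / G * (1 / (2 * \<rho>) ^ CARD('d) * X) = (1 / G * (1 / (2 * \<rho>) ^ CARD('d))) * X" by (simp only: mult.assoc)
    also have "\<dots> = (2 * pi) ^ CARD('d) * (heat_kernel ((1 / \<rho>) *\<^sub>R u) / \<rho> ^ CARD('d))"
      unfolding c heat_kernel_eq G_def[symmetric] X_def by simp
    finally have "1 / G * (1 / (2 * \<rho>) ^ CARD('d) * X) = (2 * pi) ^ CARD('d) * (heat_kernel ((1 / \<rho>) *\<^sub>R u) / \<rho> ^ CARD('d))" .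
    from arg_cong[OF this, of complex_of_real] show ?thesis unfolding e X_def by (simp add: scaleR_conv_of_real)
  qed
  finally show ?thesis .
qed

lemma heat_kernel_minus: "heat_kernel (- y) = heat_kernel y"
  by (simp add: heat_kernel_eq)

text \<open>The Gaussian factor makes the double integral absolutely convergent, so the inversion
  formula for an average of \<open>f\<close> is a case of Fubini's theorem. The inversion formula
  for \<open>f\<close> itself is the limit of this one.\<close>

lemma heat_as_inv_fourier:
  fixes f :: "real ^ 'd::finite \<Rightarrow> complex"
  assumes f: "f \<in> test_functions" and \<rho>: "\<rho> > 0"
  shows "heat \<rho> f x = inv_fourier (\<lambda>\<xi>. complex_of_real (exp (- (\<rho> * norm \<xi>)\<^sup>2)) * fourier f \<xi>) x"
proof -
  note fi = test_function_integrable[OF f]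
  have [measurable]: "f \<in> borel_measurable borel" by (rule test_function_borel[OF f])
  let ?g = "\<lambda>\<xi> :: real ^ 'd. complex_of_real (exp (- (\<rho> * norm \<xi>)\<^sup>2))"
  let ?P = "(2 * complex_of_real pi) ^ CARD('d)"
  let ?K = "\<lambda>\<xi> z. exp (\<i> * complex_of_real ((x - z) \<bullet> \<xi>)) * ?g \<xi> * f z"
  have gi: "integrable lborel (\<lambda>\<xi> :: real ^ 'd. exp (- (\<rho> * norm \<xi>)\<^sup>2))"
  proof (rule Bochner_Integration.integrable_bound)
    show "integrable lborel (\<lambda>\<xi> :: real ^ 'd. exp ((real CARD('d))\<^sup>2 / \<rho>\<^sup>2) * decay \<xi>)" by (intro integrable_mult_right decay_integrable)
    show "AE \<xi> :: real ^ 'd in lborel. norm (exp (- (\<rho> * norm \<xi>)\<^sup>2)) \<le> norm (exp ((real CARD('d))\<^sup>2 / \<rho>\<^sup>2) * decay \<xi>)"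
      using exp_le_decay[of "\<rho>\<^sup>2", where 'd='d] \<rho> by (auto simp: power_mult_distrib abs_mult)
  qed measurable
  have int: "integrable (lborel \<Otimes>\<^sub>M lborel) (\<lambda>(\<xi>, z). ?K \<xi> z)"
  proof (rule lborel_pair.Fubini_integrable)
    have "(\<lambda>\<xi> :: real ^ 'd. LINT z|lborel. norm (?K \<xi> z)) = (\<lambda>\<xi>. exp (- (\<rho> * norm \<xi>)\<^sup>2) * (LINT z|lborel. norm (f z)))"
      by (simp add: norm_mult)
    then show "integrable lborel (\<lambda>\<xi> :: real ^ 'd. LINT z|lborel. norm (case (\<xi>, z) of (\<xi>, z) \<Rightarrow> ?K \<xi> z))"
      using gi by simp
    show "AE \<xi> :: real ^ 'd in lborel. integrable lborel (\<lambda>z. case (\<xi>, z) of (\<xi>, z) \<Rightarrow> ?K \<xi> z)"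
    proof (intro AE_I2)
      fix \<xi> :: "real ^ 'd"
      have "integrable lborel (\<lambda>z. ?K \<xi> z)"
        by (rule Bochner_Integration.integrable_bound[OF fi]) (auto simp: norm_mult intro!: mult_left_le_one_le)
      then show "integrable lborel (\<lambda>z. case (\<xi>, z) of (\<xi>, z) \<Rightarrow> ?K \<xi> z)" by simp
    qed
  qed measurable
  have "inv_fourier (\<lambda>\<xi>. ?g \<xi> * fourier f \<xi>) x = (LINT \<xi>|lborel. LINT z|lborel. ?K \<xi> z) / ?P"
  proof -
    have "exp (\<i> * complex_of_real (x \<bullet> \<xi>)) * (?g \<xi> * fourier f \<xi>) = (LINT z|lborel. ?K \<xi> z)" for \<xi>
    proof -
      have "?K \<xi> z = (exp (\<i> * complex_of_real (x \<bullet> \<xi>)) * ?g \<xi>) * (exp (- \<i> * complex_of_real (z \<bullet> \<xi>)) * f z)" for z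
        by (simp add: inner_diff_left right_diff_distrib exp_diff exp_minus divide_inverse mult_ac)
      then show ?thesis unfolding fourier_def by (simp only: integral_mult_right_zero mult.assoc)
    qed
    then show ?thesis unfolding inv_fourier_def by simp
  qed
  also have "\<dots> = (LINT z|lborel. LINT \<xi>|lborel. ?K \<xi> z) / ?P"
    using lborel_pair.Fubini_integral[OF int] by simp
  also have "\<dots> = (LINT z|lborel. complex_of_real (heat_kernel ((1 / \<rho>) *\<^sub>R (x - z)) / \<rho> ^ CARD('d)) * f z)"
  proof -
    have "(LINT \<xi>|lborel. ?K \<xi> z) = ?P * (complex_of_real (heat_kernel ((1 / \<rho>) *\<^sub>R (x - z)) / \<rho> ^ CARD('d)) * f z)" for z
      by (subst integral_mult_left_zero) (simp only: gaussian_integral[OF \<rho>] mult.assoc)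
    then show ?thesis by simp
  qed
  also have "\<dots> = heat \<rho> f x"
  proof -
    let ?F = "\<lambda>z. complex_of_real (heat_kernel ((1 / \<rho>) *\<^sub>R (x - z)) / \<rho> ^ CARD('d)) * f z"
    have "?F (x + \<rho> *\<^sub>R y) = complex_of_real (1 / \<rho> ^ CARD('d)) * (heat_kernel y *\<^sub>R f (x + \<rho> *\<^sub>R y))" for y
    proof -
      have "(1 / \<rho>) *\<^sub>R (x - (x + \<rho> *\<^sub>R y)) = - y" using \<rho> by simp
      then show ?thesis by (simp only: heat_kernel_minus) (simp add: scaleR_conv_of_real[where 'a=complex])
    qed
    then have "(LINT y|lborel. ?F (x + \<rho> *\<^sub>R y)) = complex_of_real (1 / \<rho> ^ CARD('d)) * heat \<rho> f x"
      unfolding heat_def by (simp only: integral_mult_right_zero)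
    moreover have "(LINT y|lborel. ?F (x + \<rho> *\<^sub>R y)) = (1 / \<rho> ^ CARD('d)) *\<^sub>R (LINT z|lborel. ?F z)"
      using \<rho> by (subst lborel_integral_affine[where f="?F"]) auto
    ultimately have "complex_of_real (1 / \<rho> ^ CARD('d)) * (LINT z|lborel. ?F z) = complex_of_real (1 / \<rho> ^ CARD('d)) * heat \<rho> f x"
      by (simp only: scaleR_conv_of_real)
    moreover have "complex_of_real (1 / \<rho> ^ CARD('d)) \<noteq> 0" using \<rho> by simp
    ultimately show ?thesis using mult_left_cancel[of "complex_of_real (1 / \<rho> ^ CARD('d))"] by blast
  qed
  finally show ?thesis ..
qed

text \<open>The averages of \<open>f\<close> at scales tending to 0 converge to f x by continuity
  and, in their Fourier form, to the inversion integral; both limits are by dominated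
  convergence.\<close>

lemma fourier_inversion:
  fixes f :: "real ^ 'd::finite \<Rightarrow> complex"
  assumes f: "f \<in> test_functions"
  shows "f x = inv_fourier (fourier f) x"
proof -
  define t where "t n = 1 / real (Suc n)" for n
  have t: "t n > 0" for n by (simp add: t_def)
  have t0: "t \<longlonglongrightarrow> 0" unfolding t_def by (rule LIMSEQ_Suc[OF lim_const_over_n[of 1]])
  have fi: "integrable lborel (fourier f)" by (rule rapid_integrable[OF rapid_fourier[OF f]])
  have [measurable]: "f \<in> borel_measurable borel" "fourier f \<in> borel_measurable borel"
    by (intro fourier_measurable test_function_borel f)+
  obtain B where B: "B > 0" "\<forall>x. norm (f x) \<le> B" by (rule test_function_bounded[OF f])
  have "(\<lambda>n. heat (t n) f x) \<longlonglongrightarrow> (LINT y|lborel. heat_kernel (y :: real ^ 'd) *\<^sub>R f x)"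
    unfolding heat_def
  proof (rule integral_dominated_convergence[where w="\<lambda>y. heat_kernel y * B"])
    show "integrable lborel (\<lambda>y :: real ^ 'd. heat_kernel y * B)" by (intro integrable_mult_left heat_kernel_integrable)
    show "AE y in lborel. norm (heat_kernel y *\<^sub>R f (x + t n *\<^sub>R y)) \<le> heat_kernel y * B" for n
      using B by (auto intro!: mult_left_mono)
    show "AE y in lborel. (\<lambda>n. heat_kernel y *\<^sub>R f (x + t n *\<^sub>R y)) \<longlonglongrightarrow> heat_kernel y *\<^sub>R f x"
    proof (intro AE_I2 tendsto_scaleR tendsto_const)
      fix y
      have "(\<lambda>n. x + t n *\<^sub>R y) \<longlonglongrightarrow> x + 0 *\<^sub>R y" by (intro tendsto_intros t0)
      then have lim: "(\<lambda>n. x + t n *\<^sub>R y) \<longlonglongrightarrow> x" by simp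
      have "isCont f x" using test_function_continuous[OF f] by (simp add: continuous_on_eq_continuous_at)
      then show "(\<lambda>n. f (x + t n *\<^sub>R y)) \<longlonglongrightarrow> f x" by (rule isCont_tendsto_compose[OF _ lim])
    qed
  qed measurable
  then have 1: "(\<lambda>n. heat (t n) f x) \<longlonglongrightarrow> f x" by (simp add: heat_kernel_integral heat_kernel_integrable)
  have "(\<lambda>n. LINT \<xi>|lborel. exp (\<i> * complex_of_real (x \<bullet> \<xi>)) * (complex_of_real (exp (- (t n * norm \<xi>)\<^sup>2)) * fourier f \<xi>))
      \<longlonglongrightarrow> (LINT \<xi>|lborel. exp (\<i> * complex_of_real (x \<bullet> \<xi>)) * fourier f \<xi>)"
  proof (rule integral_dominated_convergence[where w="\<lambda>\<xi>. norm (fourier f \<xi>)"])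
    show "AE \<xi> in lborel. norm (exp (\<i> * complex_of_real (x \<bullet> \<xi>)) * (complex_of_real (exp (- (t n * norm \<xi>)\<^sup>2)) * fourier f \<xi>)) \<le> norm (fourier f \<xi>)" for n
      by (intro AE_I2) (auto simp: norm_mult intro!: mult_left_le_one_le)
    show "AE \<xi> in lborel. (\<lambda>n. exp (\<i> * complex_of_real (x \<bullet> \<xi>)) * (complex_of_real (exp (- (t n * norm \<xi>)\<^sup>2)) * fourier f \<xi>))
        \<longlonglongrightarrow> exp (\<i> * complex_of_real (x \<bullet> \<xi>)) * fourier f \<xi>"
    proof (intro AE_I2 tendsto_mult tendsto_const)
      fix \<xi> :: "real ^ 'd"
      have "(\<lambda>n. complex_of_real (exp (- (t n * norm \<xi>)\<^sup>2)) * fourier f \<xi>) \<longlonglongrightarrow> complex_of_real (exp (- (0 * norm \<xi>)\<^sup>2)) * fourier f \<xi>"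
        by (intro tendsto_intros t0)
      then show "(\<lambda>n. complex_of_real (exp (- (t n * norm \<xi>)\<^sup>2)) * fourier f \<xi>) \<longlonglongrightarrow> fourier f \<xi>" by simp
    qed
  qed (use fi in \<open>auto intro: integrable_norm\<close>)
  then have "(\<lambda>n. heat (t n) f x) \<longlonglongrightarrow> inv_fourier (fourier f) x"
    unfolding heat_as_inv_fourier[OF f t] inv_fourier_def by (intro tendsto_divide tendsto_const) auto
  from LIMSEQ_unique[OF 1 this] show ?thesis .
qed

section \<open>Riesz potentials\<close>

text \<open>The homogeneity behind both integral representations of powers of |xi|: the exponent a =
  sigma - 1 serves the Gamma integral, a = - sigma - 1 the powers of exponential
  differences.\<close>

lemma nn_integral_powr_scale:
  fixes g :: "real \<Rightarrow> real"
  assumes [measurable]: "g \<in> borel_measurable borel" and r: "r > 0"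
  shows "(\<integral>\<^sup>+u. ennreal (indicator {0..} u * u powr a * g (u * r\<^sup>2)) \<partial>lborel)
    = ennreal (r powr - (2 * (a + 1))) * (\<integral>\<^sup>+u. ennreal (indicator {0..} u * u powr a * g u) \<partial>lborel)"
proof -
  let ?f = "\<lambda>u. ennreal (indicator {0..} u * u powr a * g (u * r\<^sup>2))"
  let ?h = "\<lambda>u. ennreal (indicator {0..} u * u powr a * g u)"
  have r2: "r\<^sup>2 > 0" using r by simp
  have "(\<integral>\<^sup>+u. ?f u \<partial>lborel) = \<bar>1 / r\<^sup>2\<bar> * (\<integral>\<^sup>+u. ?f (0 + 1 / r\<^sup>2 * u) \<partial>lborel)"
    using r by (intro nn_integral_real_affine) auto
  also have "(\<integral>\<^sup>+u. ?f (0 + 1 / r\<^sup>2 * u) \<partial>lborel) = (\<integral>\<^sup>+u. ennreal ((1 / r\<^sup>2) powr a) * ?h u \<partial>lborel)"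
  proof (intro nn_integral_cong)
    fix u :: real
    show "?f (0 + 1 / r\<^sup>2 * u) = ennreal ((1 / r\<^sup>2) powr a) * ?h u"
    proof (cases "u \<ge> 0")
      case True
      have "(u / r\<^sup>2) powr a = (1 / r\<^sup>2) powr a * u powr a"
        using True r powr_mult[of "1 / r\<^sup>2" u a] by simp
      moreover have "indicator {0..} (0 + 1 / r\<^sup>2 * u) * (0 + 1 / r\<^sup>2 * u) powr a * g ((0 + 1 / r\<^sup>2 * u) * r\<^sup>2) = (u / r\<^sup>2) powr a * g u"
        using True r by simp
      ultimately show ?thesis using True by (simp only:) (simp add: ennreal_mult' mult.assoc)
    next
      case False
      then have "u / r\<^sup>2 < 0" using r2 by (simp add: divide_neg_pos)
      then show ?thesis using False by simp
    qed
  qed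
  also have "\<dots> = ennreal ((1 / r\<^sup>2) powr a) * (\<integral>\<^sup>+u. ?h u \<partial>lborel)" by (rule nn_integral_cmult) measurable
  also have "ennreal \<bar>1 / r\<^sup>2\<bar> * \<dots> = ennreal (\<bar>1 / r\<^sup>2\<bar> * (1 / r\<^sup>2) powr a) * (\<integral>\<^sup>+u. ?h u \<partial>lborel)"
    by (simp only: ennreal_mult abs_ge_zero powr_ge_zero mult.assoc)
  also have "\<bar>1 / r\<^sup>2\<bar> * (1 / r\<^sup>2) powr a = r powr - (2 * (a + 1))"
  proof -
    have "1 / r\<^sup>2 = r powr (- 2)" using r by (simp add: powr_minus powr_numeral inverse_eq_divide)
    moreover have "\<bar>1 / r\<^sup>2\<bar> = 1 / r\<^sup>2" by simp
    ultimately show ?thesis using r by (simp add: powr_powr powr_add[symmetric] algebra_simps)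
  qed
  finally show ?thesis .
qed

lemma Gamma_nn_integral:
  assumes \<sigma>: "\<sigma> > 0" and l: "l > 0"
  shows "(\<integral>\<^sup>+t. ennreal (indicator {0..} t * t powr (\<sigma> - 1) * exp (- (t * l\<^sup>2))) \<partial>lborel) = ennreal (Gamma \<sigma> * l powr - (2 * \<sigma>))"
proof -
  have "(\<integral>\<^sup>+t. ennreal (indicator {0..} t * t powr (\<sigma> - 1) * exp (- t)) \<partial>lborel)
      = (\<integral>\<^sup>+t. ennreal (t powr (\<sigma> - 1) / exp t) * indicator {0..} t \<partial>lborel)"
    by (intro nn_integral_cong) (auto simp: indicator_def exp_minus divide_inverse)
  also have "\<dots> = ennreal (Gamma \<sigma>)"
    using nn_integral_has_integral_lebesgue'[OF _ Gamma_integral_real[OF \<sigma>]] by simp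
  finally show ?thesis
    using nn_integral_powr_scale[of "\<lambda>u. exp (- u)" l "\<sigma> - 1"] l Gamma_real_pos[OF \<sigma>]
    by (simp add: ennreal_mult mult.commute)
qed

text \<open>If the symbols \<open>h t\<close>, weighted by \<open>\<kappa>\<close>, superpose to
  \<open>\<Phi>\<close>, then so do the operators. Since weights and symbols are nonnegative,
  integrability of \<open>\<Phi> * m\<close> is precisely the absolute convergence that Fubini's
  theorem asks for. The frequency 0 is excluded because the superposition may diverge there; it is a
  null set.\<close>

lemma subordination:
  fixes m n :: "real ^ 'd::finite \<Rightarrow> complex" and \<kappa> :: "real \<Rightarrow> real" and h :: "real \<Rightarrow> real ^ 'd \<Rightarrow> real"
  assumes [measurable]: "\<kappa> \<in> borel_measurable borel" "(\<lambda>(\<xi>, t). h t \<xi>) \<in> borel_measurable (borel \<Otimes>\<^sub>M borel)"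
    and \<kappa>: "\<And>t. \<kappa> t \<ge> 0" and h: "\<And>t \<xi>. h t \<xi> \<ge> 0" and m: "integrable lborel m" and n: "integrable lborel n"
    and \<Phi>: "\<And>\<xi>. \<xi> \<noteq> 0 \<Longrightarrow> (\<integral>\<^sup>+t. ennreal (\<kappa> t * h t \<xi>) \<partial>lborel) = ennreal (\<Phi> \<xi>)"
    and \<Phi>0: "\<And>\<xi>. \<Phi> \<xi> \<ge> 0" and nm: "\<And>\<xi>. \<xi> \<noteq> 0 \<Longrightarrow> n \<xi> = complex_of_real (\<Phi> \<xi>) * m \<xi>"
  shows subordination_integrable:
      "integrable lborel (\<lambda>t. \<kappa> t *\<^sub>R inv_fourier (\<lambda>\<xi>. complex_of_real (h t \<xi>) * m \<xi>) x)"
    and subordination_integral: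
      "(LINT t|lborel. \<kappa> t *\<^sub>R inv_fourier (\<lambda>\<xi>. complex_of_real (h t \<xi>) * m \<xi>) x) = inv_fourier n x"
proof -
  note [measurable] = borel_measurable_integrable[OF m, simplified] borel_measurable_integrable[OF n, simplified]
  let ?h = "\<lambda>\<xi> t. \<kappa> t * h t \<xi>"
  have [measurable]: "h t \<in> borel_measurable borel" "(\<lambda>t. h t \<xi>) \<in> borel_measurable borel" for t \<xi>
    by measurable
  let ?K = "\<lambda>\<xi> t. exp (\<i> * complex_of_real (x \<bullet> \<xi>)) * m \<xi> * complex_of_real (?h \<xi> t)"
  let ?P = "(2 * complex_of_real pi) ^ CARD('d)"
  have hb: "has_bochner_integral lborel (?h \<xi>) (\<Phi> \<xi>)" if "\<xi> \<noteq> 0" for \<xi> :: "real ^ 'd"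
    using \<kappa> h \<Phi>[OF that] \<Phi>0 by (intro has_bochner_integral_nn_integral) auto
  then have hi: "integrable lborel (?h \<xi>)" and hI: "(LINT t|lborel. ?h \<xi> t) = \<Phi> \<xi>" if "\<xi> \<noteq> 0" for \<xi> :: "real ^ 'd"
    using that by (auto simp: has_bochner_integral_iff)
  have int: "integrable (lborel \<Otimes>\<^sub>M lborel) (\<lambda>(\<xi>, t). ?K \<xi> t)"
  proof (rule lborel_pair.Fubini_integrable)
    show "integrable lborel (\<lambda>\<xi> :: real ^ 'd. LINT t|lborel. norm (case (\<xi>, t) of (\<xi>, t) \<Rightarrow> ?K \<xi> t))"
    proof (subst integrable_cong_AE[where g="\<lambda>\<xi>. norm (n \<xi>)"])
      show "AE \<xi> :: real ^ 'd in lborel. (LINT t|lborel. norm (case (\<xi>, t) of (\<xi>, t) \<Rightarrow> ?K \<xi> t)) = norm (n \<xi>)"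
        using AE_lborel_singleton[of "0 :: real ^ 'd"]
      proof eventually_elim
        fix \<xi> :: "real ^ 'd" assume "\<xi> \<noteq> 0"
        then show "(LINT t|lborel. norm (case (\<xi>, t) of (\<xi>, t) \<Rightarrow> ?K \<xi> t)) = norm (n \<xi>)"
          using \<kappa> h \<Phi>0[of \<xi>] hI[of \<xi>] by (simp add: norm_mult abs_mult nm mult.commute)
      qed
      show "integrable lborel (\<lambda>\<xi>. norm (n \<xi>))" using n by (rule integrable_norm)
    qed measurable
    show "AE \<xi> :: real ^ 'd in lborel. integrable lborel (\<lambda>t. case (\<xi>, t) of (\<xi>, t) \<Rightarrow> ?K \<xi> t)"
      using AE_lborel_singleton[of "0 :: real ^ 'd"]
    proof eventually_elim
      fix \<xi> :: "real ^ 'd" assume "\<xi> \<noteq> 0"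
      then have "integrable lborel (?h \<xi>)" by (rule hi)
      then have "integrable lborel (\<lambda>t. complex_of_real (?h \<xi> t))" by (rule integrable_of_real)
      then show "integrable lborel (\<lambda>t. case (\<xi>, t) of (\<xi>, t) \<Rightarrow> ?K \<xi> t)"
        unfolding prod.case by (rule integrable_mult_right)
    qed
  qed measurable
  have inner: "\<kappa> t *\<^sub>R inv_fourier (\<lambda>\<xi>. complex_of_real (h t \<xi>) * m \<xi>) x = (LINT \<xi>|lborel. ?K \<xi> t) / ?P" for t
  proof -
    have "?K \<xi> t = complex_of_real (\<kappa> t) * (exp (\<i> * complex_of_real (x \<bullet> \<xi>)) * (complex_of_real (h t \<xi>) * m \<xi>))" for \<xi>
      by (simp only: of_real_mult mult_ac)
    then have "(LINT \<xi>|lborel. ?K \<xi> t) = complex_of_real (\<kappa> t) * (LINT \<xi>|lborel. exp (\<i> * complex_of_real (x \<bullet> \<xi>)) * (complex_of_real (h t \<xi>) * m \<xi>))"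
      by (simp only: integral_mult_right_zero)
    then show ?thesis unfolding inv_fourier_def scaleR_conv_of_real times_divide_eq_right by (simp only:)
  qed
  show "integrable lborel (\<lambda>t. \<kappa> t *\<^sub>R inv_fourier (\<lambda>\<xi>. complex_of_real (h t \<xi>) * m \<xi>) x)"
    unfolding inner by (intro integrable_divide lborel_pair.integrable_snd[OF int])
  have "(LINT t|lborel. \<kappa> t *\<^sub>R inv_fourier (\<lambda>\<xi>. complex_of_real (h t \<xi>) * m \<xi>) x)
      = (LINT t|lborel. LINT \<xi>|lborel. ?K \<xi> t) / ?P"
    unfolding inner by (rule integral_divide_zero)
  also have "(LINT t|lborel. LINT \<xi>|lborel. ?K \<xi> t) = (LINT \<xi>|lborel. LINT t|lborel. ?K \<xi> t)"
    by (rule lborel_pair.Fubini_integral[OF int])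
  also have "\<dots> = (LINT \<xi>|lborel. exp (\<i> * complex_of_real (x \<bullet> \<xi>)) * n \<xi>)"
  proof (rule integral_cong_AE)
    show "AE \<xi> :: real ^ 'd in lborel. (LINT t|lborel. ?K \<xi> t) = exp (\<i> * complex_of_real (x \<bullet> \<xi>)) * n \<xi>"
      using AE_lborel_singleton[of "0 :: real ^ 'd"]
    proof eventually_elim
      fix \<xi> :: "real ^ 'd" assume \<xi>: "\<xi> \<noteq> 0"
      have "(LINT t|lborel. ?K \<xi> t) = exp (\<i> * complex_of_real (x \<bullet> \<xi>)) * m \<xi> * complex_of_real (LINT t|lborel. ?h \<xi> t)"
        by (simp only: integral_mult_right_zero integral_complex_of_real)
      then show "(LINT t|lborel. ?K \<xi> t) = exp (\<i> * complex_of_real (x \<bullet> \<xi>)) * n \<xi>"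
        unfolding hI[OF \<xi>] nm[OF \<xi>] by (simp only: mult_ac)
    qed
  qed measurable
  finally show "(LINT t|lborel. \<kappa> t *\<^sub>R inv_fourier (\<lambda>\<xi>. complex_of_real (h t \<xi>) * m \<xi>) x) = inv_fourier n x"
    unfolding inv_fourier_def .
qed

lemma frac_laplacian_inv_fourier:
  "frac_laplacian \<sigma> f = inv_fourier (\<lambda>\<xi>. complex_of_real (norm \<xi> powr (2 * \<sigma>)) * fourier f \<xi>)"
  by (simp add: fun_eq_iff frac_laplacian_def inv_fourier_def mult.assoc)

lemma rapid_frac_symbol:
  "f \<in> test_functions \<Longrightarrow> \<sigma> > 0 \<Longrightarrow> rapid (\<lambda>\<xi>. complex_of_real (norm \<xi> powr (2 * \<sigma>)) * fourier f \<xi>)"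
  by (intro rapid_cmult_powr rapid_fourier) auto

lemma bounded_borel_frac_laplacian:
  "f \<in> test_functions \<Longrightarrow> \<sigma> > 0 \<Longrightarrow> bounded_borel (frac_laplacian \<sigma> f)"
  unfolding frac_laplacian_inv_fourier by (intro bounded_borel_inv_fourier rapid_integrable rapid_frac_symbol)

lemma heat_sqrt_frac_laplacian:
  assumes f: "f \<in> test_functions" and \<sigma>: "\<sigma> > 0" and t: "t \<ge> 0"
  shows "heat (sqrt t) (frac_laplacian \<sigma> f) x = inv_fourier (\<lambda>\<xi>. complex_of_real (exp (- (t * (norm \<xi>)\<^sup>2))) *
    (complex_of_real (norm \<xi> powr (2 * \<sigma>)) * fourier f \<xi>)) x"
  unfolding frac_laplacian_inv_fourier using t
  by (subst heat_inv_fourier[OF rapid_integrable[OF rapid_frac_symbol[OF f \<sigma>]]]) (simp add: power_mult_distrib)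

text \<open>Gamma sigma times |xi|^(- 2 sigma) is the integral of t^(sigma - 1) exp (- t |xi|^2),
  which undoes the symbol of the fractional Laplacian; the average at scale sqrt t is the heat
  semigroup at time t.\<close>

lemma Riesz_representation:
  fixes f :: "real ^ 'd::finite \<Rightarrow> complex"
  assumes f: "f \<in> test_functions" and \<sigma>: "\<sigma> > 0"
  shows "integrable lborel (\<lambda>t. (indicator {0..} t * t powr (\<sigma> - 1)) *\<^sub>R heat (sqrt t) (frac_laplacian \<sigma> f) x)"
    and "(LINT t|lborel. (indicator {0..} t * t powr (\<sigma> - 1)) *\<^sub>R heat (sqrt t) (frac_laplacian \<sigma> f) x) = Gamma \<sigma> *\<^sub>R f x"
proof -
  let ?m = "\<lambda>\<xi>. complex_of_real (norm \<xi> powr (2 * \<sigma>)) * fourier f \<xi>"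
  let ?n = "\<lambda>\<xi>. complex_of_real (Gamma \<sigma>) * fourier f \<xi>"
  have G: "Gamma \<sigma> > 0" by (rule Gamma_real_pos[OF \<sigma>])
  have eq: "(indicator {0..} t * t powr (\<sigma> - 1)) *\<^sub>R heat (sqrt t) (frac_laplacian \<sigma> f) x
      = (indicator {0..} t * t powr (\<sigma> - 1)) *\<^sub>R inv_fourier (\<lambda>\<xi>. complex_of_real (exp (- (t * (norm \<xi>)\<^sup>2))) * ?m \<xi>) x" for t
    using heat_sqrt_frac_laplacian[OF f \<sigma>, of t x] by (cases "t \<ge> 0") auto
  have m: "integrable lborel ?m" by (rule rapid_integrable[OF rapid_frac_symbol[OF f \<sigma>]])
  have n: "integrable lborel ?n" by (intro integrable_mult_right rapid_integrable rapid_fourier f)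
  have nm: "?n \<xi> = complex_of_real (Gamma \<sigma> * norm \<xi> powr - (2 * \<sigma>)) * ?m \<xi>" if "\<xi> \<noteq> 0" for \<xi>
  proof -
    have "norm \<xi> powr - (2 * \<sigma>) * norm \<xi> powr (2 * \<sigma>) = 1" using that by (simp add: powr_add[symmetric])
    then have "complex_of_real (norm \<xi> powr - (2 * \<sigma>)) * complex_of_real (norm \<xi> powr (2 * \<sigma>)) = 1"
      by (metis of_real_1 of_real_mult)
    then show ?thesis by (simp add: mult.assoc mult.left_commute[of "complex_of_real (norm \<xi> powr (2 * \<sigma>))"])
  qed
  note sub = subordination[where \<kappa>="\<lambda>t. indicator {0..} t * t powr (\<sigma> - 1)" and h="\<lambda>t \<xi>. exp (- (t * (norm \<xi>)\<^sup>2))" and \<Phi>="\<lambda>\<xi>. Gamma \<sigma> * norm \<xi> powr - (2 * \<sigma>)",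
      OF _ _ _ _ m n _ _ nm]
  show "integrable lborel (\<lambda>t. (indicator {0..} t * t powr (\<sigma> - 1)) *\<^sub>R heat (sqrt t) (frac_laplacian \<sigma> f) x)"
    unfolding eq using G by (intro sub(1)) (auto simp: Gamma_nn_integral[OF \<sigma>])
  have "(LINT t|lborel. (indicator {0..} t * t powr (\<sigma> - 1)) *\<^sub>R heat (sqrt t) (frac_laplacian \<sigma> f) x) = inv_fourier ?n x"
    unfolding eq using G by (intro sub(2)) (auto simp: Gamma_nn_integral[OF \<sigma>])
  also have "\<dots> = Gamma \<sigma> *\<^sub>R f x"
    unfolding inv_fourier_cmult fourier_inversion[OF f, symmetric] by (simp add: scaleR_conv_of_real[where 'a=complex])
  finally show "(LINT t|lborel. (indicator {0..} t * t powr (\<sigma> - 1)) *\<^sub>R heat (sqrt t) (frac_laplacian \<sigma> f) x) = Gamma \<sigma> *\<^sub>R f x" .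
qed

text \<open>The time integral is cut at t = r^2. For short times the weight t^(sigma - 1) has mass
  r^(2 sigma) / sigma, with 2 sigma = d/p, and the averages contract the norm. For long times the
  increment at scale sqrt t costs |eta| t^(- 1/2 - sigma), so the integrand is of order t^(- 3/2)
  and its tail integrates to 2 / r; this is the 2 in \<open>K\<close>.\<close>

lemma BMO_from_Riesz:
  assumes p: "p > 1"
  obtains C where "C > 0"
    "\<And>(f :: real ^ 'd::finite \<Rightarrow> complex) M. f \<in> test_functions \<Longrightarrow> M \<ge> 0 \<Longrightarrow>
      mz_seminorm p (frac_laplacian (real CARD('d) / p / 2) f) \<le> ennreal M \<Longrightarrow>
      BMO_seminorm f \<le> ennreal (C * M)"
proof -
  define \<sigma> where "\<sigma> = real CARD('d) / p / 2"
  have \<sigma>: "\<sigma> > 0" using p by (simp add: \<sigma>_def)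
  have s: "real CARD('d) / p = 2 * \<sigma>" by (simp add: \<sigma>_def)
  obtain A where A: "A > 0"
    and A1: "\<And>(f :: real ^ 'd \<Rightarrow> complex) (\<rho> :: real) x \<eta> p M. bounded_borel f \<Longrightarrow> \<rho> > 0 \<Longrightarrow> p > 1 \<Longrightarrow> M \<ge> 0 \<Longrightarrow>
      mz_seminorm p f \<le> ennreal M \<Longrightarrow>
      norm (heat \<rho> f (x + \<eta>) - heat \<rho> f x) \<le> A * (norm \<eta> / \<rho>) * \<rho> powr - (real CARD('d) / p) * M"
    by (rule heat_shift_bounds[where 'd='d]) auto
  define c where "c = 1 / Gamma \<sigma>"
  have c: "c > 0" using Gamma_real_pos[OF \<sigma>] by (simp add: c_def)
  define K where "K = c / \<sigma> + 2 * c * A"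
  have K: "K > 0" "c / \<sigma> \<le> K" "2 * c * A \<le> K" using c \<sigma> A by (simp_all add: K_def add_pos_pos)
  show thesis
  proof (rule that)
    show "2 * (K + K * real CARD('d)) > 0" using K by (simp add: add_pos_nonneg)
    fix f :: "real ^ 'd \<Rightarrow> complex" and M :: real
    assume f: "f \<in> test_functions" and M: "M \<ge> 0"
      and H: "mz_seminorm p (frac_laplacian (real CARD('d) / p / 2) f) \<le> ennreal M"
    define g where "g = frac_laplacian \<sigma> f"
    have g: "bounded_borel g" unfolding g_def by (rule bounded_borel_frac_laplacian[OF f \<sigma>])
    have Hg: "mz_seminorm p g \<le> ennreal M" using H by (simp add: g_def \<sigma>_def)
    obtain B where B: "B > 0" "\<forall>x. norm (g x) \<le> B" by (rule bounded_borelE[OF g])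
    note [measurable] = bounded_borel_measurable[OF g]
    have hm[measurable]: "(\<lambda>(x, t). heat (sqrt t) g x) \<in> borel_measurable (borel \<Otimes>\<^sub>M lborel)"
      unfolding heat_def split_beta' by measurable
    have "BMO_seminorm f \<le> ennreal (2 * (K * M + K * M * real CARD('d)))"
    proof (rule BMO_by_smoothing[OF p test_function_bounded_borel[OF f]])
      show "K * M \<ge> 0" using K M by simp
      fix r :: real assume r: "r > 0"
      define k where "k t = indicator {0..r\<^sup>2} t * t powr (\<sigma> - 1)" for t :: real
      define k' where "k' t = indicator {r\<^sup>2<..} t * t powr (\<sigma> - 1)" for t :: real
      have [measurable]: "k \<in> borel_measurable borel" "k' \<in> borel_measurable borel"
        unfolding k_def[abs_def] k'_def[abs_def] by measurable
      have k0: "k t \<ge> 0" "k' t \<ge> 0" for t by (simp_all add: k_def k'_def)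
      have kk: "indicator {0..} t * t powr (\<sigma> - 1) = k t + k' t" for t :: real
        using order.strict_trans1[OF zero_le_power2[of r], of t] by (auto simp: k_def k'_def indicator_def)
      have kI: "(\<integral>\<^sup>+t. ennreal (k t) \<partial>lborel) = ennreal (r powr (2 * \<sigma>) / \<sigma>)"
      proof -
        have "((\<lambda>t. t powr (\<sigma> - 1)) has_integral ((r\<^sup>2) powr (\<sigma> - 1 + 1) / (\<sigma> - 1 + 1))) {0..r\<^sup>2}"
          using \<sigma> by (intro has_integral_powr_from_0) auto
        from nn_integral_has_integral_lebesgue'[OF _ this]
        have "(\<integral>\<^sup>+t. ennreal (t powr (\<sigma> - 1)) * indicator {0..r\<^sup>2} t \<partial>lborel) = ennreal ((r\<^sup>2) powr \<sigma> / \<sigma>)" by simp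
        moreover have "(r\<^sup>2) powr \<sigma> = r powr (2 * \<sigma>)"
        proof -
          have "r\<^sup>2 = r powr 2" using r by simp
          then show ?thesis by (simp only: powr_powr)
        qed
        moreover have "ennreal (k t) = ennreal (t powr (\<sigma> - 1)) * indicator {0..r\<^sup>2} t" for t by (simp add: k_def indicator_def)
        ultimately show ?thesis by simp
      qed
      have ki: "integrable lborel k"
        using kI k0 by (intro integrableI_nonneg) (auto simp: less_top[symmetric])
      have kh: "integrable lborel (\<lambda>t. k t *\<^sub>R heat (sqrt t) g x)" for x
      proof (rule Bochner_Integration.integrable_bound)
        show "integrable lborel (\<lambda>t. k t * B)" using ki by (rule integrable_mult_left)
        show "AE t in lborel. norm (k t *\<^sub>R heat (sqrt t) g x) \<le> norm (k t * B)"
          using k0 B norm_heat_le[OF B(2) g] by (intro AE_I2) (simp add: mult_left_mono)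
      qed measurable
      \<comment> \<open>The long-time part is integrable as the full representation minus the
        short-time part.\<close>
      have k'h: "integrable lborel (\<lambda>t. k' t *\<^sub>R heat (sqrt t) g x)" for x
        using Bochner_Integration.integrable_diff[OF Riesz_representation(1)[OF f \<sigma>, folded g_def, of x] kh[of x]]
        unfolding kk by (simp add: scaleR_add_left)
      define a where "a x = c *\<^sub>R (LINT t|lborel. k t *\<^sub>R heat (sqrt t) g x)" for x
      define S where "S x = f x - a x" for x
      have ab: "bounded_borel a"
        unfolding a_def[abs_def]
      proof (rule bounded_borel_cmult, rule bounded_borelI)
        have "(\<lambda>x. LINT t|lborel. k t *\<^sub>R heat (sqrt t) g x) \<in> borel_measurable borel" by measurable
        then show "(\<lambda>x. LINT t|lborel. k t *\<^sub>R heat (sqrt t) g x) \<in> borel_measurable borel" .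
        fix x
        have "norm (LINT t|lborel. k t *\<^sub>R heat (sqrt t) g x) \<le> (LINT t|lborel. norm (k t *\<^sub>R heat (sqrt t) g x))"
          by (rule integral_norm_bound)
        also have "\<dots> \<le> (LINT t|lborel. k t * B)"
          using k0 norm_heat_le[OF B(2) g] by (intro integral_mono integrable_norm kh integrable_mult_left ki) (simp add: mult_left_mono)
        finally show "norm (LINT t|lborel. k t *\<^sub>R heat (sqrt t) g x) \<le> (LINT t|lborel. k t * B)" .
      qed
      have Sf: "S x = c *\<^sub>R (LINT t|lborel. k' t *\<^sub>R heat (sqrt t) g x)" for x
      proof -
        have "Gamma \<sigma> *\<^sub>R f x = (LINT t|lborel. k t *\<^sub>R heat (sqrt t) g x + k' t *\<^sub>R heat (sqrt t) g x)"
          using Riesz_representation(2)[OF f \<sigma>, folded g_def, of x] unfolding kk by (simp add: scaleR_add_left)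
        also have "\<dots> = (LINT t|lborel. k t *\<^sub>R heat (sqrt t) g x) + (LINT t|lborel. k' t *\<^sub>R heat (sqrt t) g x)"
          by (rule Bochner_Integration.integral_add[OF kh k'h])
        finally have "c *\<^sub>R (Gamma \<sigma> *\<^sub>R f x) = a x + c *\<^sub>R (LINT t|lborel. k' t *\<^sub>R heat (sqrt t) g x)"
          by (simp add: a_def scaleR_add_right)
        moreover have "c *\<^sub>R (Gamma \<sigma> *\<^sub>R f x) = f x" using Gamma_real_pos[OF \<sigma>] by (simp add: c_def)
        ultimately have "f x = a x + c *\<^sub>R (LINT t|lborel. k' t *\<^sub>R heat (sqrt t) g x)" by (simp only:)
        then show ?thesis unfolding S_def by (simp only: add_diff_cancel_left')
      qed
      show "\<exists>S. bounded_borel S \<and> mz_seminorm p (\<lambda>x. f x - S x) \<le> ennreal (K * M * r powr (real CARD('d) / p)) \<and>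
        (\<forall>x \<eta>. norm (S (x + \<eta>) - S x) \<le> K * M * (norm \<eta> / r))"
      proof (intro exI[of _ S] conjI allI)
        show "bounded_borel S" unfolding S_def[abs_def] by (intro bounded_borel_diff test_function_bounded_borel f ab)
        have [measurable]: "(\<lambda>x. LINT t|lborel. k t *\<^sub>R heat (sqrt t) g x) \<in> borel_measurable borel" by measurable
        have "mz_seminorm p (\<lambda>x. f x - S x) = mz_norm p (\<lambda>x. ennreal c * ennreal (norm (LINT t|lborel. k t *\<^sub>R heat (sqrt t) g x)))"
          using c by (simp add: S_def a_def ennreal_mult)
        also have "\<dots> \<le> ennreal c * mz_seminorm p (\<lambda>x. LINT t|lborel. k t *\<^sub>R heat (sqrt t) g x)"
          by (rule mz_norm_cmult) measurable
        also have "\<dots> \<le> ennreal c * (\<integral>\<^sup>+t. ennreal (norm (k t)) * ennreal M \<partial>lborel)"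
        proof (intro mult_left_mono mz_norm_kernel[OF lborel.sigma_finite_measure_axioms])
          show "mz_seminorm p (heat (sqrt t) g) \<le> ennreal M" for t
            by (rule order_trans[OF mz_norm_heat[OF g] Hg])
        qed (use kh hm in auto)
        also have "\<dots> = ennreal c * (ennreal (r powr (2 * \<sigma>) / \<sigma>) * ennreal M)"
          using k0 kI by (simp add: nn_integral_multc)
        also have "\<dots> = ennreal (c / \<sigma> * (M * r powr (2 * \<sigma>)))"
          using c \<sigma> M by (simp add: ennreal_mult[symmetric] mult_ac)
        also have "\<dots> \<le> ennreal (K * (M * r powr (2 * \<sigma>)))"
          using K M by (intro ennreal_leI mult_right_mono) auto
        finally show "mz_seminorm p (\<lambda>x. f x - S x) \<le> ennreal (K * M * r powr (real CARD('d) / p))"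
          unfolding s by (simp add: mult.assoc)
        fix x \<eta> :: "real ^ 'd"
        have di: "integrable lborel (\<lambda>t. k' t *\<^sub>R (heat (sqrt t) g (x + \<eta>) - heat (sqrt t) g x))"
          unfolding scaleR_diff_right by (intro Bochner_Integration.integrable_diff k'h)
        have "S (x + \<eta>) - S x = c *\<^sub>R (LINT t|lborel. k' t *\<^sub>R (heat (sqrt t) g (x + \<eta>) - heat (sqrt t) g x))"
          unfolding Sf scaleR_diff_right Bochner_Integration.integral_diff[OF k'h k'h] ..
        then have "ennreal (norm (S (x + \<eta>) - S x)) = ennreal c * ennreal (norm (LINT t|lborel. k' t *\<^sub>R (heat (sqrt t) g (x + \<eta>) - heat (sqrt t) g x)))"
          using c by (simp add: ennreal_mult)
        also have "\<dots> \<le> ennreal c * (\<integral>\<^sup>+t. ennreal (norm (k' t *\<^sub>R (heat (sqrt t) g (x + \<eta>) - heat (sqrt t) g x))) \<partial>lborel)"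
          by (intro mult_left_mono integral_norm_bound_ennreal di) auto
        also have "\<dots> \<le> ennreal c * (\<integral>\<^sup>+t. ennreal (A * norm \<eta> * M) * (ennreal (t powr (- 3 / 2)) * indicator {r\<^sup>2..} t) \<partial>lborel)"
        proof (intro mult_left_mono nn_integral_mono)
          fix t :: real
          show "ennreal (norm (k' t *\<^sub>R (heat (sqrt t) g (x + \<eta>) - heat (sqrt t) g x))) \<le> ennreal (A * norm \<eta> * M) * (ennreal (t powr (- 3 / 2)) * indicator {r\<^sup>2..} t)"
          proof (cases "t > r\<^sup>2")
            case True
            then have t: "t > 0" using zero_le_power2[of r] by linarith
            have "norm (heat (sqrt t) g (x + \<eta>) - heat (sqrt t) g x) \<le> A * (norm \<eta> / sqrt t) * sqrt t powr - (2 * \<sigma>) * M"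
              using A1[OF g _ p M Hg, of "sqrt t" x \<eta>] t unfolding s by simp
            then have "t powr (\<sigma> - 1) * norm (heat (sqrt t) g (x + \<eta>) - heat (sqrt t) g x) \<le> t powr (\<sigma> - 1) * (A * (norm \<eta> / sqrt t) * sqrt t powr - (2 * \<sigma>) * M)"
              by (intro mult_left_mono) auto
            also have "\<dots> = A * norm \<eta> * M * (t powr (\<sigma> - 1) * (1 / sqrt t) * sqrt t powr - (2 * \<sigma>))" by simp
            also have "t powr (\<sigma> - 1) * (1 / sqrt t) * sqrt t powr - (2 * \<sigma>) = t powr (- 3 / 2)"
            proof -
              have "1 / sqrt t = t powr (- (1 / 2))" "sqrt t powr - (2 * \<sigma>) = t powr (- \<sigma>)"
                using t by (simp_all add: powr_half_sqrt[symmetric] powr_minus powr_powr inverse_eq_divide)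
              then show ?thesis by (simp add: powr_add[symmetric])
            qed
            finally have "t powr (\<sigma> - 1) * norm (heat (sqrt t) g (x + \<eta>) - heat (sqrt t) g x) \<le> A * norm \<eta> * M * t powr (- 3 / 2)" .
            then show ?thesis using True A M by (simp add: k'_def ennreal_mult[symmetric] ennreal_leI)
          qed (simp add: k'_def)
        qed auto
        also have "(\<integral>\<^sup>+t. ennreal (A * norm \<eta> * M) * (ennreal (t powr (- 3 / 2)) * indicator {r\<^sup>2..} t) \<partial>lborel) = ennreal (A * norm \<eta> * M) * ennreal (2 / r)"
        proof -
          have "((\<lambda>t. t powr (- 3 / 2)) has_integral - ((r\<^sup>2) powr (- 3 / 2 + 1)) / (- 3 / 2 + 1)) {r\<^sup>2..}"
            using r by (intro has_integral_powr_to_inf) auto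
          from nn_integral_has_integral_lebesgue'[OF _ this]
          have "(\<integral>\<^sup>+t. ennreal (t powr (- 3 / 2)) * indicator {r\<^sup>2..} t \<partial>lborel) = ennreal (2 * (r\<^sup>2) powr (- (1 / 2)))" by simp
          moreover have "(r\<^sup>2) powr (- (1 / 2)) = 1 / r" using r by (simp add: powr_minus powr_half_sqrt inverse_eq_divide)
          ultimately show ?thesis by (subst nn_integral_cmult) auto
        qed
        also have "ennreal c * (ennreal (A * norm \<eta> * M) * ennreal (2 / r)) = ennreal (2 * c * A * (M * (norm \<eta> / r)))"
          using c A M r by (simp add: ennreal_mult[symmetric] mult_ac)
        also have "\<dots> \<le> ennreal (K * (M * (norm \<eta> / r)))" using K M r by (intro ennreal_leI mult_right_mono) auto
        finally show "norm (S (x + \<eta>) - S x) \<le> K * M * (norm \<eta> / r)"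
          using K M r by (simp add: ennreal_le_iff mult.assoc)
      qed
    qed
    also have "2 * (K * M + K * M * real CARD('d)) = 2 * (K + K * real CARD('d)) * M" by (simp add: algebra_simps)
    finally show "BMO_seminorm f \<le> ennreal (2 * (K + K * real CARD('d)) * M)" .
  qed
qed

section \<open>Lower semicontinuity of the Riesz seminorm\<close>

text \<open>The averages over dyadic cubes drift by a fixed amount from one cube to the next, so the
  mean deviation from the first average grows linearly in j. With D = 2^d, the volume grows like D^j
  while the weight decays like D^(- 2 j), and the sum over j converges.\<close>

lemma BMO_decay_integral:
  obtains C where "C > 0"
    "\<And>(v :: real ^ 'd::finite \<Rightarrow> complex) x (\<tau> :: real). bounded_borel v \<Longrightarrow> \<tau> > 0 \<Longrightarrow>
      \<exists>c. (\<integral>\<^sup>+y. ennreal (decay y) * ennreal (norm (v (x + \<tau> *\<^sub>R y) - c)) \<partial>lborel) \<le> ennreal C * BMO_seminorm v"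
proof -
  define D where "D = (2 :: real) ^ CARD('d)"
  have D: "D \<ge> 2" unfolding D_def by (intro self_le_power) auto
  define K where "K = 2 * D ^ 4"
  have K: "K > 0" using D by (simp add: K_def)
  show thesis
  proof (rule that)
    show "4 * K > 0" using K by simp
    fix v :: "real ^ 'd \<Rightarrow> complex" and x and \<tau> :: real
    assume v: "bounded_borel v" and \<tau>: "\<tau> > 0"
    note [measurable] = bounded_borel_measurable[OF v]
    obtain B where B: "B > 0" "\<forall>x. norm (v x) \<le> B" by (rule bounded_borelE[OF v])
    have vl: "loc_integrable v" using B by (intro loc_integrable_bounded) auto
    define b where "b = BMO_seminorm v"
    define a where "a j = (\<chi> i. - (2 ^ j) :: real ^ 'd)" for j :: nat
    define Q where "Q j = cube (a j) (2 * 2 ^ j)" for j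
    have [measurable]: "Q j \<in> sets borel" for j by (simp add: Q_def)
    \<comment> \<open>The images of the cubes \<open>Q j\<close> under the map y to x + tau y. They
      are again cubes, so the constant depends neither on x nor on tau.\<close>
    define Q' where "Q' j = cube (x + \<tau> *\<^sub>R a j) (\<tau> * (2 * 2 ^ j))" for j
    have mem_Q: "y \<in> Q j \<longleftrightarrow> (\<forall>i. \<bar>y $ i\<bar> \<le> 2 ^ j)" for y j
    proof -
      have "(- c \<le> z \<and> z \<le> - c + 2 * c) \<longleftrightarrow> \<bar>z\<bar> \<le> c" for c z :: real by auto
      then show ?thesis by (simp only: Q_def a_def mem_cube vec_lambda_beta)
    qed
    have QQ': "x + \<tau> *\<^sub>R y \<in> Q' j \<longleftrightarrow> y \<in> Q j" for y j
    proof -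
      have "(x $ i + \<tau> * a j $ i \<le> x $ i + \<tau> * y $ i \<and> x $ i + \<tau> * y $ i \<le> x $ i + \<tau> * a j $ i + \<tau> * (2 * 2 ^ j))
          \<longleftrightarrow> (a j $ i \<le> y $ i \<and> y $ i \<le> a j $ i + 2 * 2 ^ j)" for i
      proof -
        have "x $ i + \<tau> * a j $ i + \<tau> * (2 * 2 ^ j) = x $ i + \<tau> * (a j $ i + 2 * 2 ^ j)" by (simp add: distrib_left)
        then show ?thesis using \<tau> by simp
      qed
      then show ?thesis by (simp add: Q_def Q'_def mem_cube)
    qed
    define c where "c j = average v (Q' j)" for j
    have I: "(\<integral>\<^sup>+y\<in>Q j. ennreal (norm (v (x + \<tau> *\<^sub>R y) - c j)) \<partial>lborel) \<le> ennreal (D * D ^ j) * b" for j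
    proof -
      have [measurable]: "Q' j \<in> sets borel" by (simp add: Q'_def)
      let ?F = "\<lambda>z. ennreal (norm (v z - c j)) * indicator (Q' j) z"
      have "(\<integral>\<^sup>+y\<in>Q j. ennreal (norm (v (x + \<tau> *\<^sub>R y) - c j)) \<partial>lborel) = (\<integral>\<^sup>+y. ?F (x + \<tau> *\<^sub>R y) \<partial>lborel)"
        by (intro nn_integral_cong) (auto simp: indicator_def QQ')
      also have "\<dots> = ennreal (\<tau> powr - real CARD('d)) * (\<integral>\<^sup>+z\<in>Q' j. ennreal (norm (v z - c j)) \<partial>lborel)"
        using \<tau> by (subst nn_integral_lborel_affine[where f="?F"]) auto
      also have "(\<integral>\<^sup>+z\<in>Q' j. ennreal (norm (v z - c j)) \<partial>lborel) = (\<integral>\<^sup>+z\<in>Q' j. ennreal (norm (v z - c j)) \<partial>lebesgue)"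
        by (simp only: nn_integral_completion)
      also have "ennreal (\<tau> powr - real CARD('d)) * \<dots> \<le> ennreal (\<tau> powr - real CARD('d)) * (b * ennreal ((\<tau> * (2 * 2 ^ j)) ^ CARD('d)))"
        unfolding b_def c_def Q'_def using \<tau> by (intro mult_left_mono BMO_seminormD) auto
      also have "\<dots> = ennreal (\<tau> powr - real CARD('d) * (\<tau> * (2 * 2 ^ j)) ^ CARD('d)) * b"
        using \<tau> by (simp add: ennreal_mult mult_ac)
      also have "\<tau> powr - real CARD('d) * (\<tau> * (2 * 2 ^ j)) ^ CARD('d) = D * D ^ j"
      proof -
        have "\<tau> powr - real CARD('d) * \<tau> ^ CARD('d) = 1"
          using \<tau> by (simp add: powr_realpow[symmetric] powr_add[symmetric])
        then have "\<tau> powr - real CARD('d) * (\<tau> * (2 * 2 ^ j)) ^ CARD('d) = (2 * 2 ^ j) ^ CARD('d)"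
          by (simp only: power_mult_distrib mult.assoc[symmetric] mult_1_left)
        also have "\<dots> = D * D ^ j" by (simp add: D_def power_mult_distrib power_mult[symmetric] mult.commute)
        finally show ?thesis .
      qed
      finally show ?thesis .
    qed
    have cs: "ennreal (norm (c j - c (Suc j))) \<le> ennreal D * b" for j
    proof -
      have sub: "Q' j \<subseteq> Q' (Suc j)"
      proof
        fix z assume z: "z \<in> Q' j"
        define y where "y = (1 / \<tau>) *\<^sub>R (z - x)"
        have zy: "z = x + \<tau> *\<^sub>R y" using \<tau> by (simp add: y_def)
        have "y \<in> Q j" using z unfolding zy QQ' .
        then have "y \<in> Q (Suc j)" unfolding mem_Q by (auto intro: order_trans)
        then show "z \<in> Q' (Suc j)" unfolding zy QQ' .
      qed
      have "ennreal (norm (c j - c (Suc j))) \<le> b * ennreal (((\<tau> * (2 * 2 ^ Suc j)) / (\<tau> * (2 * 2 ^ j))) ^ CARD('d))"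
        unfolding b_def c_def using sub \<tau> unfolding Q'_def by (intro average_subcube vl) auto
      also have "(\<tau> * (2 * 2 ^ Suc j)) / (\<tau> * (2 * 2 ^ j)) = 2" using \<tau> by simp
      finally show ?thesis by (simp add: D_def mult.commute)
    qed
    have c0: "ennreal (norm (c j - c 0)) \<le> ennreal (real j * D) * b" for j
    proof (induction j)
      case (Suc j)
      have "norm (c (Suc j) - c 0) \<le> norm (c j - c (Suc j)) + norm (c j - c 0)"
        using norm_triangle_ineq4[of "c j - c 0" "c j - c (Suc j)"] by simp
      then have "ennreal (norm (c (Suc j) - c 0)) \<le> ennreal (norm (c j - c (Suc j)) + norm (c j - c 0))" by (rule ennreal_leI)
      also have "\<dots> = ennreal (norm (c j - c (Suc j))) + ennreal (norm (c j - c 0))" by simp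
      also have "\<dots> \<le> ennreal D * b + ennreal (real j * D) * b" by (intro add_mono cs Suc)
      also have "\<dots> = ennreal (real (Suc j) * D) * b"
      proof -
        have "real (Suc j) * D = D + real j * D" by (simp add: algebra_simps)
        then have "ennreal (real (Suc j) * D) = ennreal D + ennreal (real j * D)" using D by (simp only:) simp
        then show ?thesis by (simp only: distrib_right)
      qed
      finally show ?case .
    qed simp
    have J: "(\<integral>\<^sup>+y\<in>Q j. ennreal (norm (v (x + \<tau> *\<^sub>R y) - c 0)) \<partial>lborel) \<le> ennreal (D * D ^ j * (1 + real j * D)) * b" for j
    proof -
      have "(\<integral>\<^sup>+y\<in>Q j. ennreal (norm (v (x + \<tau> *\<^sub>R y) - c 0)) \<partial>lborel)
          \<le> (\<integral>\<^sup>+y. (ennreal (norm (v (x + \<tau> *\<^sub>R y) - c j)) * indicator (Q j) y + ennreal (norm (c j - c 0)) * indicator (Q j) y) \<partial>lborel)"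
      proof (intro nn_integral_mono)
        fix y
        have "norm (v (x + \<tau> *\<^sub>R y) - c 0) \<le> norm (v (x + \<tau> *\<^sub>R y) - c j) + norm (c j - c 0)"
          using norm_triangle_ineq[of "v (x + \<tau> *\<^sub>R y) - c j" "c j - c 0"] by simp
        then have "ennreal (norm (v (x + \<tau> *\<^sub>R y) - c 0)) \<le> ennreal (norm (v (x + \<tau> *\<^sub>R y) - c j) + norm (c j - c 0))" by (rule ennreal_leI)
        then show "ennreal (norm (v (x + \<tau> *\<^sub>R y) - c 0)) * indicator (Q j) y
            \<le> ennreal (norm (v (x + \<tau> *\<^sub>R y) - c j)) * indicator (Q j) y + ennreal (norm (c j - c 0)) * indicator (Q j) y"
          by (simp add: indicator_def)
      qed
      also have "\<dots> = (\<integral>\<^sup>+y\<in>Q j. ennreal (norm (v (x + \<tau> *\<^sub>R y) - c j)) \<partial>lborel) + ennreal (norm (c j - c 0)) * emeasure lborel (Q j)"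
        by (subst nn_integral_add) (auto simp: nn_integral_cmult_indicator)
      also have "emeasure lborel (Q j) = ennreal (D * D ^ j)"
        by (simp add: Q_def D_def power_mult_distrib power_mult[symmetric] mult.commute)
      also have "(\<integral>\<^sup>+y\<in>Q j. ennreal (norm (v (x + \<tau> *\<^sub>R y) - c j)) \<partial>lborel) + ennreal (norm (c j - c 0)) * ennreal (D * D ^ j)
          \<le> ennreal (D * D ^ j) * b + (ennreal (real j * D) * b) * ennreal (D * D ^ j)"
        by (intro add_mono mult_right_mono I c0) auto
      also have "\<dots> = ennreal (D * D ^ j * (1 + real j * D)) * b"
      proof -
        have "ennreal (D * D ^ j * (1 + real j * D)) = ennreal (D * D ^ j) + ennreal (real j * D) * ennreal (D * D ^ j)"
          using D by (simp add: ennreal_plus[symmetric] ennreal_mult[symmetric] algebra_simps del: ennreal_plus)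
        then show ?thesis by (simp only: distrib_right distrib_left mult_ac)
      qed
      finally show ?thesis .
    qed
    \<comment> \<open>The factor D^2 pays for an index shift: the smallest cube containing y has
      index j, and y is known to lie outside the cube of index j - 1 only.\<close>
    define w where "w j = D\<^sup>2 * (1 / D\<^sup>2) ^ j" for j :: nat
    have w: "w j \<ge> 0" for j by (simp add: w_def)
    have dec: "ennreal (decay y) \<le> (\<Sum>j. ennreal (w j) * indicator (Q j) y)" for y :: "real ^ 'd"
    proof -
      obtain n :: nat where "norm y < 2 ^ n" using real_arch_pow[of 2 "norm y"] by auto
      then have "y \<in> Q n" unfolding mem_Q using component_le_norm_cart[of y] by (meson less_imp_le order_trans)
      define j where "j = (LEAST j. y \<in> Q j)"
      have j: "y \<in> Q j" unfolding j_def by (rule LeastI[of _ n]) fact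
      have "decay y \<le> w j"
      proof (cases j)
        case 0
        have "1 \<le> D\<^sup>2" using D by (intro one_le_power) auto
        then show ?thesis using decay_le_1[of y] by (simp add: w_def 0)
      next
        case (Suc k)
        have "y \<notin> Q k" using not_less_Least[of k "\<lambda>j. y \<in> Q j"] Suc unfolding j_def by simp
        then obtain i where "2 ^ k < \<bar>y $ i\<bar>" unfolding mem_Q by (auto simp: not_le)
        then have "2 ^ k \<le> 1 + norm y" using component_le_norm_cart[of y i] by linarith
        then have "(2 ^ k) ^ (2 * CARD('d)) \<le> (1 + norm y) ^ (2 * CARD('d))" by (intro power_mono) auto
        moreover have "(2 ^ k :: real) ^ (2 * CARD('d)) = (D\<^sup>2) ^ k" by (simp add: D_def power_mult[symmetric] mult_ac)
        ultimately have "decay y \<le> 1 / (D\<^sup>2) ^ k" unfolding decay_def using D by (intro divide_left_mono) (auto intro!: mult_pos_pos add_pos_nonneg zero_less_power)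
        also have "\<dots> = w j" using D by (simp add: w_def Suc power_one_over)
        finally show ?thesis .
      qed
      then have "ennreal (decay y) \<le> (\<Sum>j\<in>{j}. ennreal (w j) * indicator (Q j) y)" using j by (simp add: ennreal_leI)
      also have "\<dots> \<le> (\<Sum>j. ennreal (w j) * indicator (Q j) y)" by (intro sum_le_suminf) auto
      finally show ?thesis .
    qed
    have "(\<integral>\<^sup>+y. ennreal (decay y) * ennreal (norm (v (x + \<tau> *\<^sub>R y) - c 0)) \<partial>lborel)
        \<le> (\<integral>\<^sup>+y. (\<Sum>j. ennreal (w j) * (ennreal (norm (v (x + \<tau> *\<^sub>R y) - c 0)) * indicator (Q j) y)) \<partial>lborel)"
    proof (intro nn_integral_mono)
      fix y
      have "ennreal (decay y) * ennreal (norm (v (x + \<tau> *\<^sub>R y) - c 0)) \<le> (\<Sum>j. ennreal (w j) * indicator (Q j) y) * ennreal (norm (v (x + \<tau> *\<^sub>R y) - c 0))"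
        by (rule mult_right_mono[OF dec]) simp
      also have "\<dots> = (\<Sum>j. ennreal (w j) * indicator (Q j) y * ennreal (norm (v (x + \<tau> *\<^sub>R y) - c 0)))" by simp
      also have "\<dots> = (\<Sum>j. ennreal (w j) * (ennreal (norm (v (x + \<tau> *\<^sub>R y) - c 0)) * indicator (Q j) y))" by (simp only: mult_ac)
      finally show "ennreal (decay y) * ennreal (norm (v (x + \<tau> *\<^sub>R y) - c 0)) \<le> (\<Sum>j. ennreal (w j) * (ennreal (norm (v (x + \<tau> *\<^sub>R y) - c 0)) * indicator (Q j) y))" .
    qed
    also have "\<dots> = (\<Sum>j. ennreal (w j) * (\<integral>\<^sup>+y\<in>Q j. ennreal (norm (v (x + \<tau> *\<^sub>R y) - c 0)) \<partial>lborel))"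
      by (subst nn_integral_suminf) (auto simp: nn_integral_cmult)
    also have "\<dots> \<le> (\<Sum>j. ennreal (K * (3 / 4) ^ j) * b)"
    proof (intro suminf_le)
      fix j
      have "w j * (D * D ^ j * (1 + real j * D)) \<le> K * (3 / 4) ^ j"
      proof -
        \<comment> \<open>Bernoulli's inequality trades the linear factor for (3/2)^j. Against
          (1/2)^j this leaves (3/4)^j, whose sum is the 4 in the final constant.\<close>
        have j: "1 + real j * D \<le> D * (2 * (3 / 2) ^ j)"
        proof -
          have "1 + real j * (1 / 2) \<le> (1 + 1 / 2 :: real) ^ j" by (rule Bernoulli_inequality) auto
          then have "1 + real j \<le> 2 * (3 / 2 :: real) ^ j" by simp
          then have "D * (1 + real j) \<le> D * (2 * (3 / 2) ^ j)" using D by (intro mult_left_mono) auto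
          moreover have "1 + real j * D \<le> D * (1 + real j)" using D by (simp add: algebra_simps)
          ultimately show ?thesis by linarith
        qed
        have "w j * (D * D ^ j) = D ^ 3 * (1 / D) ^ j"
          using D by (simp add: w_def power_one_over power2_eq_square power3_eq_cube power_mult_distrib)
        then have "w j * (D * D ^ j * (1 + real j * D)) = D ^ 3 * (1 / D) ^ j * (1 + real j * D)" by (simp only: mult.assoc[symmetric])
        also have "\<dots> \<le> D ^ 3 * (1 / 2) ^ j * (D * (2 * (3 / 2) ^ j))"
          using D by (intro mult_mono j power_mono) (auto intro!: mult_nonneg_nonneg add_nonneg_nonneg simp: divide_le_cancel frac_le)
        also have "\<dots> = K * ((1 / 2) ^ j * (3 / 2) ^ j)" by (simp add: K_def power4_eq_xxxx power3_eq_cube)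
        also have "(1 / 2) ^ j * (3 / 2) ^ j = (3 / 4 :: real) ^ j" by (simp add: power_mult_distrib[symmetric])
        finally show ?thesis .
      qed
      have "ennreal (w j) * (\<integral>\<^sup>+y\<in>Q j. ennreal (norm (v (x + \<tau> *\<^sub>R y) - c 0)) \<partial>lborel) \<le> ennreal (w j) * (ennreal (D * D ^ j * (1 + real j * D)) * b)"
        by (intro mult_left_mono J) auto
      also have "\<dots> = ennreal (w j * (D * D ^ j * (1 + real j * D))) * b"
        using w[of j] D by (simp add: ennreal_mult mult.assoc)
      also have "\<dots> \<le> ennreal (K * (3 / 4) ^ j) * b"
        by (intro mult_right_mono ennreal_leI) (fact, simp)
      finally show "ennreal (w j) * (\<integral>\<^sup>+y\<in>Q j. ennreal (norm (v (x + \<tau> *\<^sub>R y) - c 0)) \<partial>lborel) \<le> ennreal (K * (3 / 4) ^ j) * b" .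
    qed auto
    also have "\<dots> = (\<Sum>j. ennreal (K * (3 / 4) ^ j)) * b" by simp
    also have "(\<Sum>j. ennreal (K * (3 / 4) ^ j)) = ennreal (4 * K)"
    proof -
      have "(\<lambda>j. K * (3 / 4) ^ j) sums (K * (1 / (1 - 3 / 4)))" by (intro sums_mult geometric_sums) auto
      then show ?thesis using K by (subst suminf_ennreal_eq) (auto simp: mult.commute)
    qed
    finally show "\<exists>c. (\<integral>\<^sup>+y. ennreal (decay y) * ennreal (norm (v (x + \<tau> *\<^sub>R y) - c)) \<partial>lborel) \<le> ennreal (4 * K) * BMO_seminorm v"
      unfolding b_def by blast
  qed
qed

section \<open>Differences of heat averages at two scales\<close>

lemma heat_const: "heat \<rho> (\<lambda>_. c) x = c"
proof -
  have "heat \<rho> (\<lambda>_. c) x = (LINT y|lborel. heat_kernel (y :: real ^ 'b)) *\<^sub>R c" for \<rho> and x :: "real ^ 'b"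
    unfolding heat_def by (rule integral_scaleR_left) (rule heat_kernel_integrable)
  then show ?thesis by (simp add: heat_kernel_integral)
qed

text \<open>The average at the larger scale is rewritten over the points x + tau y of the smaller
  one, so that the two kernels can be subtracted under one integral.\<close>

lemma heat_dilate:
  fixes f :: "real ^ 'd::finite \<Rightarrow> complex"
  assumes f: "bounded_borel f" and e: "e \<ge> 0"
  shows "integrable lborel (\<lambda>y. (heat_kernel y - (1 + e) powr (- real CARD('d) / 2) * heat_kernel (y /\<^sub>R sqrt (1 + e))) *\<^sub>R f (x + \<tau> *\<^sub>R y))"
    and "heat \<tau> f x - heat (\<tau> * sqrt (1 + e)) f x
      = (LINT y|lborel. (heat_kernel y - (1 + e) powr (- real CARD('d) / 2) * heat_kernel (y /\<^sub>R sqrt (1 + e))) *\<^sub>R f (x + \<tau> *\<^sub>R y))"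
proof -
  note [measurable] = bounded_borel_measurable[OF f]
  define s where "s = sqrt (1 + e)"
  have s: "s > 0" using e by (simp add: s_def)
  let ?F = "\<lambda>z. heat_kernel (z /\<^sub>R s) *\<^sub>R f (x + \<tau> *\<^sub>R z)"
  let ?q = "(1 + e) powr (- real CARD('d) / 2)"
  have q: "?q = 1 / s ^ CARD('d)"
  proof -
    have "s ^ CARD('d) = (1 + e) powr (real CARD('d) / 2)"
      using e by (simp add: s_def powr_half_sqrt[symmetric] powr_powr powr_realpow[symmetric])
    then show ?thesis by (simp add: powr_minus_divide)
  qed
  have F: "?F (0 + s *\<^sub>R y) = heat_kernel y *\<^sub>R f (x + (\<tau> * s) *\<^sub>R y)" for y
    using s by simp
  have i2: "heat (\<tau> * s) f x = ?q *\<^sub>R (LINT z|lborel. ?F z)"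
    unfolding heat_def F[symmetric] q by (rule lborel_integral_affine[OF _ s]) measurable
  have "integrable lborel (\<lambda>y :: real ^ 'd. heat_kernel (y /\<^sub>R s))"
  proof -
    have "integrable (distr lborel borel (\<lambda>y. 0 + inverse s *\<^sub>R y)) (heat_kernel :: real ^ 'd \<Rightarrow> real)"
    proof -
      have "integrable (density (distr lborel borel (\<lambda>y :: real ^ 'd. 0 + inverse s *\<^sub>R y)) (\<lambda>_. \<bar>inverse s\<bar> ^ DIM(real ^ 'd))) heat_kernel"
        using s heat_kernel_integrable by (subst lborel_affine[symmetric]) auto
      then show ?thesis using s by (subst (asm) integrable_density) auto
    qed
    then show ?thesis by (simp add: integrable_distr_eq)
  qed
  then have int: "integrable lborel ?F" by (rule integrable_kernel_mult[OF _ f])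
  have split: "(heat_kernel y - ?q * heat_kernel (y /\<^sub>R s)) *\<^sub>R f (x + \<tau> *\<^sub>R y) = heat_kernel y *\<^sub>R f (x + \<tau> *\<^sub>R y) - ?q *\<^sub>R ?F y" for y
    by (simp add: scaleR_diff_left)
  show "integrable lborel (\<lambda>y. (heat_kernel y - ?q * heat_kernel (y /\<^sub>R sqrt (1 + e))) *\<^sub>R f (x + \<tau> *\<^sub>R y))"
    unfolding s_def[symmetric] split by (intro Bochner_Integration.integrable_diff heat_integrable f integrable_scaleR_right int)
  have "(LINT y|lborel. (heat_kernel y - ?q * heat_kernel (y /\<^sub>R s)) *\<^sub>R f (x + \<tau> *\<^sub>R y))
      = (LINT y|lborel. heat_kernel y *\<^sub>R f (x + \<tau> *\<^sub>R y)) - (LINT y|lborel. ?q *\<^sub>R ?F y)"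
    unfolding split by (intro Bochner_Integration.integral_diff heat_integrable f integrable_scaleR_right int)
  also have "\<dots> = heat \<tau> f x - heat (\<tau> * s) f x"
    unfolding i2 integral_scaleR_right unfolding heat_def ..
  finally show "heat \<tau> f x - heat (\<tau> * sqrt (1 + e)) f x
      = (LINT y|lborel. (heat_kernel y - ?q * heat_kernel (y /\<^sub>R sqrt (1 + e))) *\<^sub>R f (x + \<tau> *\<^sub>R y))"
    unfolding s_def by simp
qed

text \<open>Both averages reproduce constants, so any constant can be subtracted from f before
  estimating. The constant 0 gives the bound by the supremum, the one of
  \<open>BMO_decay_integral\<close> the bound by BMO.\<close>

lemma heat_dilate_bounds:
  obtains A where "A > 0"
    "\<And>(f :: real ^ 'd::finite \<Rightarrow> complex) x \<tau> e B. bounded_borel f \<Longrightarrow> 0 \<le> e \<Longrightarrow> e \<le> 1 \<Longrightarrow> \<forall>x. norm (f x) \<le> B \<Longrightarrow>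
      norm (heat \<tau> f x - heat (\<tau> * sqrt (1 + e)) f x) \<le> A * e * B"
    "\<And>(f :: real ^ 'd::finite \<Rightarrow> complex) x \<tau> e. bounded_borel f \<Longrightarrow> \<tau> > 0 \<Longrightarrow> 0 \<le> e \<Longrightarrow> e \<le> 1 \<Longrightarrow>
      ennreal (norm (heat \<tau> f x - heat (\<tau> * sqrt (1 + e)) f x)) \<le> ennreal (A * e) * BMO_seminorm f"
proof -
  obtain A0 where A0: "A0 > 0" and A: "\<forall>(y :: real ^ 'd) e. 0 \<le> e \<and> e \<le> 1 \<longrightarrow>
     \<bar>heat_kernel y - (1 + e) powr (- real CARD('d) / 2) * heat_kernel (y /\<^sub>R sqrt (1 + e))\<bar> \<le> A0 * e * decay y"
    using heat_kernel_dilate_decay[where 'd='d] by blast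
  obtain C where C: "C > 0" and C1: "\<And>(v :: real ^ 'd \<Rightarrow> complex) x (\<tau> :: real). bounded_borel v \<Longrightarrow> \<tau> > 0 \<Longrightarrow>
      \<exists>c. (\<integral>\<^sup>+y. ennreal (decay y) * ennreal (norm (v (x + \<tau> *\<^sub>R y) - c)) \<partial>lborel) \<le> ennreal C * BMO_seminorm v"
    by (rule BMO_decay_integral[where 'd='d]) auto
  define D where "D = (LINT y|lborel. decay (y :: real ^ 'd))"
  have D: "D \<ge> 0" unfolding D_def by (intro integral_nonneg_AE) auto
  have main: "ennreal (norm (heat \<tau> f x - heat (\<tau> * sqrt (1 + e)) f x))
      \<le> ennreal (A0 * e) * (\<integral>\<^sup>+y. ennreal (decay y) * ennreal (norm (f (x + \<tau> *\<^sub>R y) - c)) \<partial>lborel)"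
    if f: "bounded_borel f" and e: "0 \<le> e" "e \<le> 1" for f :: "real ^ 'd \<Rightarrow> complex" and x \<tau> e c
  proof -
    let ?k = "\<lambda>y :: real ^ 'd. heat_kernel y - (1 + e) powr (- real CARD('d) / 2) * heat_kernel (y /\<^sub>R sqrt (1 + e))"
    note [measurable] = bounded_borel_measurable[OF f]
    have cb: "bounded_borel (\<lambda>_ :: real ^ 'd. c)" by (rule bounded_borelI[where B="norm c"]) auto
    have g: "bounded_borel (\<lambda>x. f x - c)" by (rule bounded_borel_diff[OF f cb])
    have "heat \<tau> f x - heat (\<tau> * sqrt (1 + e)) f x = heat \<tau> (\<lambda>x. f x - c) x - heat (\<tau> * sqrt (1 + e)) (\<lambda>x. f x - c) x"
      by (simp add: heat_diff[OF f cb] heat_const)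
    also have "\<dots> = (LINT y|lborel. ?k y *\<^sub>R (f (x + \<tau> *\<^sub>R y) - c))"
      by (rule heat_dilate(2)[OF g e(1)])
    finally have "ennreal (norm (heat \<tau> f x - heat (\<tau> * sqrt (1 + e)) f x)) \<le> (\<integral>\<^sup>+y. ennreal (norm (?k y *\<^sub>R (f (x + \<tau> *\<^sub>R y) - c))) \<partial>lborel)"
      using integral_norm_bound_ennreal[OF heat_dilate(1)[OF g e(1)]] by simp
    also have "\<dots> \<le> (\<integral>\<^sup>+y. ennreal (A0 * e) * (ennreal (decay y) * ennreal (norm (f (x + \<tau> *\<^sub>R y) - c))) \<partial>lborel)"
    proof (intro nn_integral_mono)
      fix y :: "real ^ 'd"
      have "norm (?k y *\<^sub>R (f (x + \<tau> *\<^sub>R y) - c)) \<le> A0 * e * decay y * norm (f (x + \<tau> *\<^sub>R y) - c)"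
        unfolding norm_scaleR using A e by (intro mult_right_mono) auto
      then have "ennreal (norm (?k y *\<^sub>R (f (x + \<tau> *\<^sub>R y) - c))) \<le> ennreal (A0 * e * decay y * norm (f (x + \<tau> *\<^sub>R y) - c))"
        by (rule ennreal_leI)
      also have "\<dots> = ennreal (A0 * e) * (ennreal (decay y) * ennreal (norm (f (x + \<tau> *\<^sub>R y) - c)))"
        using A0 e by (simp add: ennreal_mult[symmetric] mult.assoc)
      finally show "ennreal (norm (?k y *\<^sub>R (f (x + \<tau> *\<^sub>R y) - c))) \<le> ennreal (A0 * e) * (ennreal (decay y) * ennreal (norm (f (x + \<tau> *\<^sub>R y) - c)))" .
    qed
    also have "\<dots> = ennreal (A0 * e) * (\<integral>\<^sup>+y. ennreal (decay y) * ennreal (norm (f (x + \<tau> *\<^sub>R y) - c)) \<partial>lborel)"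
      by (rule nn_integral_cmult) measurable
    finally show ?thesis .
  qed
  show thesis
  proof (rule that)
    show "A0 * (C + D) > 0" using A0 C D by simp
    fix f :: "real ^ 'd \<Rightarrow> complex" and x and \<tau> e :: real
    assume f: "bounded_borel f" and e: "0 \<le> e" "e \<le> 1"
    note [measurable] = bounded_borel_measurable[OF f]
    show "norm (heat \<tau> f x - heat (\<tau> * sqrt (1 + e)) f x) \<le> A0 * (C + D) * e * B" if B: "\<forall>x. norm (f x) \<le> B" for B
    proof -
      have B0: "B \<ge> 0" using B[rule_format, of 0] norm_ge_zero[of "f 0"] by linarith
      have "ennreal (norm (heat \<tau> f x - heat (\<tau> * sqrt (1 + e)) f x))
          \<le> ennreal (A0 * e) * (\<integral>\<^sup>+y. ennreal (decay y) * ennreal (norm (f (x + \<tau> *\<^sub>R y) - 0)) \<partial>lborel)"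
        by (rule main[OF f e])
      also have "\<dots> \<le> ennreal (A0 * e) * (\<integral>\<^sup>+y. ennreal (B * decay (y :: real ^ 'd)) \<partial>lborel)"
        using B B0 by (intro mult_left_mono nn_integral_mono) (auto simp: ennreal_mult[symmetric] mult.commute[of B] intro!: ennreal_leI mult_left_mono)
      also have "\<dots> = ennreal (A0 * e * (B * D))"
        unfolding decay_nn_integral[OF B0] D_def[symmetric] using A0 e B0 D by (simp add: ennreal_mult)
      finally have "norm (heat \<tau> f x - heat (\<tau> * sqrt (1 + e)) f x) \<le> A0 * e * (B * D)"
        using A0 e B0 D by (simp add: ennreal_le_iff)
      also have "\<dots> \<le> A0 * (C + D) * e * B"
        using A0 e B0 C by (simp add: algebra_simps)
      finally show ?thesis .
    qed
    show "ennreal (norm (heat \<tau> f x - heat (\<tau> * sqrt (1 + e)) f x)) \<le> ennreal (A0 * (C + D) * e) * BMO_seminorm f" if \<tau>: "\<tau> > 0"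
    proof -
      obtain c where c: "(\<integral>\<^sup>+y. ennreal (decay y) * ennreal (norm (f (x + \<tau> *\<^sub>R y) - c)) \<partial>lborel) \<le> ennreal C * BMO_seminorm f"
        using C1[OF f \<tau>] by blast
      have "ennreal (norm (heat \<tau> f x - heat (\<tau> * sqrt (1 + e)) f x))
          \<le> ennreal (A0 * e) * (\<integral>\<^sup>+y. ennreal (decay y) * ennreal (norm (f (x + \<tau> *\<^sub>R y) - c)) \<partial>lborel)"
        by (rule main[OF f e])
      also have "\<dots> \<le> ennreal (A0 * e) * (ennreal C * BMO_seminorm f)" by (rule mult_left_mono[OF c]) simp
      also have "\<dots> = ennreal (A0 * e * C) * BMO_seminorm f"
        using A0 e C by (simp add: ennreal_mult mult.assoc)
      also have "\<dots> \<le> ennreal (A0 * (C + D) * e) * BMO_seminorm f"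
        using A0 e C D by (intro mult_right_mono ennreal_leI) (auto simp: algebra_simps)
      finally show ?thesis .
    qed
  qed
qed

text \<open>Near 0 the integrand is u^(l - sigma - 1), integrable because l > sigma; beyond 1 it is
  u^(- sigma - 1).\<close>

lemma powr_min_nn_integral:
  assumes \<sigma>: "\<sigma> > 0" and l: "real l > \<sigma>"
  shows "(\<integral>\<^sup>+u. ennreal (indicator {0..} u * u powr (- \<sigma> - 1) * (min 1 u) ^ l) \<partial>lborel) \<le> ennreal (1 / (real l - \<sigma>) + 1 / \<sigma>)"
proof -
  have "(\<integral>\<^sup>+u. ennreal (indicator {0..} u * u powr (- \<sigma> - 1) * (min 1 u) ^ l) \<partial>lborel)
      \<le> (\<integral>\<^sup>+u. (ennreal (u powr (real l - \<sigma> - 1)) * indicator {0..1} u + ennreal (u powr (- \<sigma> - 1)) * indicator {1..} u) \<partial>lborel)"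
  proof (intro nn_integral_mono)
    fix u :: real
    consider "u < 0" | "u = 0" | "0 < u" "u \<le> 1" | "u > 1" by linarith
    then show "ennreal (indicator {0..} u * u powr (- \<sigma> - 1) * (min 1 u) ^ l)
      \<le> ennreal (u powr (real l - \<sigma> - 1)) * indicator {0..1} u + ennreal (u powr (- \<sigma> - 1)) * indicator {1..} u"
    proof cases
      case 3
      have "u powr (- \<sigma> - 1) * u ^ l = u powr (real l - \<sigma> - 1)"
        using 3 by (simp add: powr_realpow[symmetric] powr_add[symmetric] algebra_simps)
      then have "ennreal (indicator {0..} u * u powr (- \<sigma> - 1) * (min 1 u) ^ l) = ennreal (u powr (real l - \<sigma> - 1))"
        using 3 by (simp add: min_def)
      also have "\<dots> \<le> ennreal (u powr (real l - \<sigma> - 1)) * indicator {0..1} u + ennreal (u powr (- \<sigma> - 1)) * indicator {1..} u"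
        using 3 by (simp add: indicator_def)
      finally show ?thesis .
    qed (auto simp: min_def)
  qed
  also have "\<dots> = (\<integral>\<^sup>+u. ennreal (u powr (real l - \<sigma> - 1)) * indicator {0..1} u \<partial>lborel) + (\<integral>\<^sup>+u. ennreal (u powr (- \<sigma> - 1)) * indicator {1..} u \<partial>lborel)"
    by (rule nn_integral_add) measurable
  also have "(\<integral>\<^sup>+u. ennreal (u powr (real l - \<sigma> - 1)) * indicator {0..1} u \<partial>lborel) = ennreal (1 / (real l - \<sigma>))"
  proof -
    have "((\<lambda>u. u powr (real l - \<sigma> - 1)) has_integral (1 powr (real l - \<sigma> - 1 + 1) / (real l - \<sigma> - 1 + 1))) {0..1}"
      using l by (intro has_integral_powr_from_0) auto
    from nn_integral_has_integral_lebesgue'[OF _ this] show ?thesis by simp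
  qed
  also have "(\<integral>\<^sup>+u. ennreal (u powr (- \<sigma> - 1)) * indicator {1..} u \<partial>lborel) = ennreal (1 / \<sigma>)"
  proof -
    have "((\<lambda>u. u powr (- \<sigma> - 1)) has_integral - (1 powr (- \<sigma> - 1 + 1)) / (- \<sigma> - 1 + 1)) {1..}"
      using \<sigma> by (intro has_integral_powr_to_inf) auto
    from nn_integral_has_integral_lebesgue'[OF _ this] show ?thesis by simp
  qed
  finally show ?thesis using \<sigma> l by simp
qed

text \<open>By scaling it suffices to take r = 1. The integral is then finite because the difference
  of exponentials is at most min 1 u, and positive because the integrand is positive on [1, 2];
  positivity allows dividing by c later.\<close>

lemma powr_exp_diff_nn_integral:
  assumes \<sigma>: "\<sigma> > 0" and l: "real l > \<sigma>"
  obtains c where "c > 0"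
    "\<forall>r>0. (\<integral>\<^sup>+u. ennreal (indicator {0..} u * u powr (- \<sigma> - 1) * (exp (- (u * r\<^sup>2)) - exp (- (2 * u * r\<^sup>2))) ^ l) \<partial>lborel)
      = ennreal (c * r powr (2 * \<sigma>))"
proof -
  let ?f = "\<lambda>r u. ennreal (indicator {0..} u * u powr (- \<sigma> - 1) * (exp (- (u * r\<^sup>2)) - exp (- (2 * u * r\<^sup>2))) ^ l)"
  define c where "c = enn2real (\<integral>\<^sup>+u. ?f 1 u \<partial>lborel)"
  have l0: "l > 0" using \<sigma> l by (cases l) auto
  have "(\<integral>\<^sup>+u. ?f 1 u \<partial>lborel) \<le> (\<integral>\<^sup>+u. ennreal (indicator {0..} u * u powr (- \<sigma> - 1) * (min 1 u) ^ l) \<partial>lborel)"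
  proof (intro nn_integral_mono ennreal_leI)
    fix u :: real
    show "indicator {0..} u * u powr (- \<sigma> - 1) * (exp (- (u * 1\<^sup>2)) - exp (- (2 * u * 1\<^sup>2))) ^ l \<le> indicator {0..} u * u powr (- \<sigma> - 1) * (min 1 u) ^ l"
    proof (cases "u \<ge> 0")
      case True
      have e: "exp (- (2 * u)) = exp (- u) * exp (- u)" by (simp add: exp_add[symmetric])
      have u: "1 - exp (- u) \<le> min 1 u" "0 \<le> 1 - exp (- u)" using True exp_ge_add_one_self[of "- u"] by auto
      have d: "exp (- u) - exp (- (2 * u)) = exp (- u) * (1 - exp (- u))" unfolding e by (simp add: right_diff_distrib)
      have "exp (- u) * (1 - exp (- u)) \<le> 1 * (1 - exp (- u))" using True by (intro mult_right_mono) auto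
      then have "exp (- u) - exp (- (2 * u)) \<le> min 1 u" using u(1) unfolding d mult_1_left by (rule order.trans)
      moreover have "0 \<le> exp (- u) - exp (- (2 * u))" unfolding d using u by (intro mult_nonneg_nonneg) auto
      ultimately have "(exp (- u) - exp (- (2 * u))) ^ l \<le> (min 1 u) ^ l" by (rule power_mono)
      then show ?thesis using True by (auto intro!: mult_left_mono)
    qed simp
  qed
  also have "\<dots> \<le> ennreal (1 / (real l - \<sigma>) + 1 / \<sigma>)" by (rule powr_min_nn_integral[OF \<sigma> l])
  also have "\<dots> < top" by simp
  finally have c: "(\<integral>\<^sup>+u. ?f 1 u \<partial>lborel) = ennreal c" by (simp add: c_def)
  have "c > 0"
  proof (rule ccontr)
    assume "\<not> c > 0"
    then have "(\<integral>\<^sup>+u. ?f 1 u \<partial>lborel) = 0" unfolding c by (simp add: ennreal_neg)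
    then have "AE u in lborel. ?f 1 u = 0" by (subst (asm) nn_integral_0_iff_AE) auto
    then have "AE u in lborel. \<not> (1 \<le> u \<and> u \<le> (2 :: real))"
    proof eventually_elim
      fix u :: real assume z: "?f 1 u = 0"
      show "\<not> (1 \<le> u \<and> u \<le> 2)"
      proof
        assume u: "1 \<le> u \<and> u \<le> 2"
        then have "indicator {0..} u * u powr (- \<sigma> - 1) * (exp (- (u * 1\<^sup>2)) - exp (- (2 * u * 1\<^sup>2))) ^ l > 0"
          by (auto intro!: mult_pos_pos zero_less_power)
        then show False using z by (simp only: ennreal_eq_0_iff)
      qed
    qed
    then have "emeasure lborel {1 .. 2 :: real} = 0"
      by (subst (asm) AE_iff_measurable[of "{1..2}"]) auto
    then show False by simp
  qed
  moreover have "\<forall>r>0. (\<integral>\<^sup>+u. ?f r u \<partial>lborel) = ennreal (c * r powr (2 * \<sigma>))"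
  proof (intro allI impI)
    fix r :: real assume r: "r > 0"
    have [measurable]: "(\<lambda>u. (exp (- u) - exp (- (2 * u))) ^ l) \<in> borel_measurable (borel :: real measure)" by measurable
    show "(\<integral>\<^sup>+u. ?f r u \<partial>lborel) = ennreal (c * r powr (2 * \<sigma>))"
      using nn_integral_powr_scale[of "\<lambda>u. (exp (- u) - exp (- (2 * u))) ^ l" r "- \<sigma> - 1"] r c \<open>c > 0\<close>
      by (simp add: ennreal_mult mult.assoc mult.commute[of "ennreal c"])
  qed
  ultimately show thesis by (rule that)
qed

text \<open>The symbol \<open>\<bar>\<xi>\<bar>\<^sup>2\<^sup>\<sigma> exp (- \<rho>\<^sup>2\<bar>\<xi>\<bar>\<^sup>2)\<close> is a superposition over \<open>u > 0\<close> of \<open>l\<close>-th powers of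
  \<open>exp (- (r\<^sup>2 + u)\<bar>\<xi>\<bar>\<^sup>2) - exp (- (r\<^sup>2 + 2u)\<bar>\<xi>\<bar>\<^sup>2)\<close> with \<open>l r\<^sup>2 = \<rho>\<^sup>2\<close>. Each factor is a convolution with a
  kernel of mean zero and norm \<open>O(u / (r\<^sup>2 + u))\<close>, and the first factor acts on BMO.\<close>

lemma heat_frac_laplacian_le_BMO:
  assumes \<sigma>: "\<sigma> > 0" and \<rho>: "\<rho> > 0"
  obtains C where "C > 0"
    "\<forall>v \<in> test_functions. \<forall>x :: real ^ 'd::finite. ennreal (norm (heat \<rho> (frac_laplacian \<sigma> v) x)) \<le> ennreal C * BMO_seminorm v"
proof -
  obtain A where A: "A > 0"
    and A1: "\<And>(f :: real ^ 'd \<Rightarrow> complex) x \<tau> e B. bounded_borel f \<Longrightarrow> 0 \<le> e \<Longrightarrow> e \<le> 1 \<Longrightarrow> \<forall>x. norm (f x) \<le> B \<Longrightarrow>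
      norm (heat \<tau> f x - heat (\<tau> * sqrt (1 + e)) f x) \<le> A * e * B"
    and A2: "\<And>(f :: real ^ 'd \<Rightarrow> complex) x \<tau> e. bounded_borel f \<Longrightarrow> \<tau> > 0 \<Longrightarrow> 0 \<le> e \<Longrightarrow> e \<le> 1 \<Longrightarrow>
      ennreal (norm (heat \<tau> f x - heat (\<tau> * sqrt (1 + e)) f x)) \<le> ennreal (A * e) * BMO_seminorm f"
    by (rule heat_dilate_bounds[where 'd='d]) auto
  \<comment> \<open>An integer above sigma: each of the l factors gains a power of u near 0, which
    outweighs u^(- sigma - 1).\<close>
  define l where "l = Suc (nat \<lceil>\<sigma>\<rceil>)"
  have l: "real l > \<sigma>" "l > 0" unfolding l_def by linarith+
  obtain c where c: "c > 0" and cI: "\<forall>r>0. (\<integral>\<^sup>+u. ennreal (indicator {0..} u * u powr (- \<sigma> - 1) * (exp (- (u * r\<^sup>2)) - exp (- (2 * u * r\<^sup>2))) ^ l) \<partial>lborel)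
      = ennreal (c * r powr (2 * \<sigma>))"
    by (rule powr_exp_diff_nn_integral[OF \<sigma> l(1)])
  define r where "r = \<rho> / sqrt (real l)"
  have r: "r > 0" using \<rho> l by (simp add: r_def)
  have r2: "real l * r\<^sup>2 = \<rho>\<^sup>2" using l by (simp add: r_def power_divide)
  define q where "q u \<xi> = exp (- ((r\<^sup>2 + u) * (norm \<xi>)\<^sup>2)) - exp (- ((r\<^sup>2 + 2 * u) * (norm \<xi>)\<^sup>2))" for u and \<xi> :: "real ^ 'd"
  have q: "0 \<le> q u \<xi>" "q u \<xi> \<le> 1" if "u \<ge> 0" for u \<xi>
  proof -
    have "(r\<^sup>2 + u) * (norm \<xi>)\<^sup>2 \<le> (r\<^sup>2 + 2 * u) * (norm \<xi>)\<^sup>2" using that by (intro mult_right_mono) auto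
    then show "0 \<le> q u \<xi>" by (simp add: q_def)
    have "exp (- ((r\<^sup>2 + u) * (norm \<xi>)\<^sup>2)) \<le> 1" using that by simp
    then show "q u \<xi> \<le> 1" unfolding q_def using exp_gt_zero[of "- ((r\<^sup>2 + 2 * u) * (norm \<xi>)\<^sup>2)"] by linarith
  qed
  have [measurable]: "q u \<in> borel_measurable borel" for u unfolding q_def[abs_def] by measurable
  define \<kappa> where "\<kappa> u = indicator {0..} u * u powr (- \<sigma> - 1)" for u :: real
  have \<kappa>: "\<kappa> u \<ge> 0" for u by (simp add: \<kappa>_def)
  have [measurable]: "\<kappa> \<in> borel_measurable borel" unfolding \<kappa>_def[abs_def] by measurable
  \<comment> \<open>The relative time step u / (r^2 + u) is at most max 1 (1 / r^2) times min 1
    u.\<close>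
  define K where "K = A * max 1 (1 / r\<^sup>2)"
  have K: "K > 0" using A by (simp add: K_def less_max_iff_disj)
  define W where "W = 1 / (real l - \<sigma>) + 1 / \<sigma>"
  have W: "W > 0" using \<sigma> l by (simp add: W_def add_pos_pos)
  show thesis
  proof (rule that[OF _ ballI[OF allI]])
    show "K ^ l * W / c > 0" using K W c by simp
  next
    fix v :: "real ^ 'd \<Rightarrow> complex" and x assume v: "v \<in> test_functions"
    obtain b where b: "BMO_seminorm v = ennreal b" "b \<ge> 0"
      using test_function_BMO[OF v] by (cases "BMO_seminorm v") auto
    define G where "G u j = inv_fourier (\<lambda>\<xi>. complex_of_real (q u \<xi> ^ j) * fourier v \<xi>)" for u j
    have rap: "rapid (\<lambda>\<xi>. complex_of_real (q u \<xi> ^ j) * fourier v \<xi>)" if "u \<ge> 0" for u j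
      using q[OF that] by (intro rapid_mult_bounded rapid_fourier v) (auto simp: norm_power power_le_one)
    have int: "integrable lborel (\<lambda>\<xi>. complex_of_real (q u \<xi> ^ j) * fourier v \<xi>)" if "u \<ge> 0" for u j
      by (rule rapid_integrable[OF rap[OF that]])
    have Gb: "bounded_borel (G u j)" if "u \<ge> 0" for u j
      unfolding G_def by (rule bounded_borel_inv_fourier[OF int[OF that]])
    have G0: "G u 0 = v" for u
      by (simp add: G_def fun_eq_iff fourier_inversion[OF v, symmetric])
    \<comment> \<open>The choice for which the times r^2 + u and r^2 + 2 u are the squares of the
      scales tau and tau sqrt (1 + e), as in \<open>heat_dilate_bounds\<close>.\<close>
    define e where "e u = u / (r\<^sup>2 + u)" for u
    define \<tau> where "\<tau> u = sqrt (r\<^sup>2 + u)" for u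
    have r0: "r\<^sup>2 > 0" using r by simp
    have e: "0 \<le> e u" "e u \<le> 1" if "u \<ge> 0" for u using that r0 unfolding e_def by (auto simp: divide_le_eq_1 add_pos_nonneg)
    have \<tau>: "\<tau> u > 0" "(\<tau> u)\<^sup>2 = r\<^sup>2 + u" "(\<tau> u * sqrt (1 + e u))\<^sup>2 = r\<^sup>2 + 2 * u" if "u \<ge> 0" for u
    proof -
      have p: "r\<^sup>2 + u > 0" using that r0 by linarith
      show "\<tau> u > 0" "(\<tau> u)\<^sup>2 = r\<^sup>2 + u" using p by (simp_all add: \<tau>_def)
      have "(sqrt (1 + e u))\<^sup>2 = 1 + e u" using e[OF that] by simp
      then have "(\<tau> u * sqrt (1 + e u))\<^sup>2 = (r\<^sup>2 + u) * (1 + e u)" using p by (simp add: \<tau>_def power_mult_distrib)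
      also have "\<dots> = r\<^sup>2 + 2 * u" using p by (simp add: e_def distrib_left)
      finally show "(\<tau> u * sqrt (1 + e u))\<^sup>2 = r\<^sup>2 + 2 * u" .
    qed
    have step: "heat (\<tau> u) (G u j) x - heat (\<tau> u * sqrt (1 + e u)) (G u j) x = G u (Suc j) x" if u: "u \<ge> 0" for u j x
    proof -
      let ?m = "\<lambda>\<xi>. complex_of_real (q u \<xi> ^ j) * fourier v \<xi>"
      have ei: "integrable lborel (\<lambda>\<xi>. complex_of_real (exp (- (t * norm \<xi>)\<^sup>2)) * ?m \<xi>)" for t
        by (intro rapid_integrable rapid_mult_bounded rap u) auto
      have "heat (\<tau> u) (G u j) x - heat (\<tau> u * sqrt (1 + e u)) (G u j) x
          = inv_fourier (\<lambda>\<xi>. complex_of_real (exp (- (\<tau> u * norm \<xi>)\<^sup>2)) * ?m \<xi> - complex_of_real (exp (- (\<tau> u * sqrt (1 + e u) * norm \<xi>)\<^sup>2)) * ?m \<xi>) x"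
        unfolding G_def heat_inv_fourier[OF int[OF u]] by (rule inv_fourier_diff[OF ei ei, symmetric])
      also have "\<dots> = G u (Suc j) x"
      proof -
        have "complex_of_real (exp (- (\<tau> u * norm \<xi>)\<^sup>2)) * ?m \<xi> - complex_of_real (exp (- (\<tau> u * sqrt (1 + e u) * norm \<xi>)\<^sup>2)) * ?m \<xi>
            = complex_of_real (q u \<xi> ^ Suc j) * fourier v \<xi>" for \<xi>
          unfolding power_mult_distrib[of _ "norm \<xi>"] \<tau>(2,3)[OF u] q_def by (simp add: algebra_simps)
        then show ?thesis by (simp only: G_def)
      qed
      finally show ?thesis .
    qed
    \<comment> \<open>The first difference of averages leads from BMO to bounded functions by
      \<open>A2\<close>; every later one acts on a bounded function and is estimated by
      \<open>A1\<close>.\<close>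
    have bound: "norm (G u (Suc j) x) \<le> (A * e u) ^ Suc j * b" if u: "u \<ge> 0" for u j x
    proof (induction j arbitrary: x)
      case 0
      have "ennreal (norm (G u (Suc 0) x)) \<le> ennreal (A * e u) * BMO_seminorm v"
        unfolding step[OF u, symmetric] G0 by (rule A2[OF test_function_bounded_borel[OF v] \<tau>(1)[OF u] e[OF u]])
      also have "\<dots> = ennreal (A * e u * b)" unfolding b(1) using A e[OF u] b(2) by (simp add: ennreal_mult)
      finally show ?case using A e[OF u] b(2) by (simp add: ennreal_le_iff)
    next
      case (Suc j)
      have "norm (G u (Suc (Suc j)) x) \<le> A * e u * ((A * e u) ^ Suc j * b)"
        unfolding step[OF u, of "Suc j", symmetric] by (intro A1 Gb u e allI Suc)
      then show ?case by (simp only: power_Suc mult.assoc)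
    qed
    have Gl: "norm (G u l x) \<le> K ^ l * b * (min 1 u) ^ l" if u: "u \<ge> 0" for u
    proof -
      obtain j where j: "l = Suc j" using l(2) by (cases l) auto
      have "e u \<le> max 1 (1 / r\<^sup>2) * min 1 u"
      proof (cases "u \<le> 1")
        case True
        have "e u \<le> u / r\<^sup>2" unfolding e_def using u r0 by (intro divide_left_mono mult_pos_pos add_pos_nonneg) auto
        also have "\<dots> = (1 / r\<^sup>2) * u" by simp
        also have "\<dots> \<le> max 1 (1 / r\<^sup>2) * u" using u by (intro mult_right_mono) auto
        finally show ?thesis using True by (simp add: min_def)
      next
        case False
        then show ?thesis using e(2)[OF u] by (simp add: min_def max_def)
      qed
      then have "A * e u \<le> K * min 1 u" unfolding K_def mult.assoc using A by (intro mult_left_mono) auto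
      then have "(A * e u) ^ l \<le> (K * min 1 u) ^ l" using A e[OF u] by (intro power_mono) auto
      then have "(A * e u) ^ l * b \<le> (K * min 1 u) ^ l * b" using b(2) by (intro mult_right_mono)
      then show ?thesis using bound[OF u, of j x] unfolding j[symmetric] power_mult_distrib by (simp add: mult_ac)
    qed
    define n0 where "n0 \<xi> = complex_of_real (exp (- (\<rho> * norm \<xi>)\<^sup>2)) * (complex_of_real (norm \<xi> powr (2 * \<sigma>)) * fourier v \<xi>)" for \<xi> :: "real ^ 'd"
    have n0i: "integrable lborel n0"
      unfolding n0_def by (intro rapid_integrable rapid_mult_bounded rapid_frac_symbol v \<sigma>) auto
    have H: "heat \<rho> (frac_laplacian \<sigma> v) x = inv_fourier n0 x"
      unfolding frac_laplacian_inv_fourier n0_def by (rule heat_inv_fourier[OF rapid_integrable[OF rapid_frac_symbol[OF v \<sigma>]]])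
    \<comment> \<open>\<open>subordination\<close> asks for a nonnegative symbol at every real u,
      whereas \<open>q u\<close> is nonnegative for u >= 0. The absolute value changes nothing where
      \<open>\<kappa>\<close> is nonzero.\<close>
    have \<Phi>: "(\<integral>\<^sup>+u. ennreal (\<kappa> u * \<bar>q u \<xi>\<bar> ^ l) \<partial>lborel) = ennreal (c * norm \<xi> powr (2 * \<sigma>) * exp (- (\<rho> * norm \<xi>)\<^sup>2))"
      if "\<xi> \<noteq> 0" for \<xi> :: "real ^ 'd"
    proof -
      have \<xi>: "norm \<xi> > 0" using that by simp
      let ?f = "\<lambda>u. ennreal (indicator {0..} u * u powr (- \<sigma> - 1) * (exp (- (u * (norm \<xi>)\<^sup>2)) - exp (- (2 * u * (norm \<xi>)\<^sup>2))) ^ l)"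
      let ?E = "exp (- (\<rho> * norm \<xi>)\<^sup>2)"
      have "(\<integral>\<^sup>+u. ennreal (\<kappa> u * \<bar>q u \<xi>\<bar> ^ l) \<partial>lborel) = (\<integral>\<^sup>+u. ennreal ?E * ?f u \<partial>lborel)"
      proof (intro nn_integral_cong)
        fix u :: real
        show "ennreal (\<kappa> u * \<bar>q u \<xi>\<bar> ^ l) = ennreal ?E * ?f u"
        proof (cases "u \<ge> 0")
          case True
          have "q u \<xi> = exp (- (r\<^sup>2 * (norm \<xi>)\<^sup>2)) * (exp (- (u * (norm \<xi>)\<^sup>2)) - exp (- (2 * u * (norm \<xi>)\<^sup>2)))"
            by (simp add: q_def right_diff_distrib exp_add[symmetric] distrib_right)
          then have "\<bar>q u \<xi>\<bar> ^ l = exp (- (r\<^sup>2 * (norm \<xi>)\<^sup>2)) ^ l * (exp (- (u * (norm \<xi>)\<^sup>2)) - exp (- (2 * u * (norm \<xi>)\<^sup>2))) ^ l"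
            using q(1)[OF True, of \<xi>] by (simp add: power_mult_distrib)
          also have "exp (- (r\<^sup>2 * (norm \<xi>)\<^sup>2)) ^ l = ?E"
            by (simp add: exp_of_nat_mult[symmetric] power_mult_distrib r2[symmetric] mult.assoc)
          finally have "\<kappa> u * \<bar>q u \<xi>\<bar> ^ l = ?E * (indicator {0..} u * u powr (- \<sigma> - 1) * (exp (- (u * (norm \<xi>)\<^sup>2)) - exp (- (2 * u * (norm \<xi>)\<^sup>2))) ^ l)"
            by (simp add: \<kappa>_def)
          then show ?thesis by (simp only: ennreal_mult' exp_ge_zero)
        qed (simp add: \<kappa>_def)
      qed
      also have "\<dots> = ennreal ?E * ennreal (c * norm \<xi> powr (2 * \<sigma>))"
        unfolding cI[rule_format, OF \<xi>, symmetric] by (rule nn_integral_cmult) measurable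
      also have "\<dots> = ennreal (c * norm \<xi> powr (2 * \<sigma>) * ?E)" using c by (simp add: ennreal_mult[symmetric] mult_ac)
      finally show ?thesis .
    qed
    have fi: "integrable lborel (fourier v)" by (rule rapid_integrable[OF rapid_fourier[OF v]])
    have ni: "integrable lborel (\<lambda>\<xi>. complex_of_real c * n0 \<xi>)" by (rule integrable_mult_right[OF n0i])
    have sub: "integrable lborel (\<lambda>u. \<kappa> u *\<^sub>R inv_fourier (\<lambda>\<xi>. complex_of_real (\<bar>q u \<xi>\<bar> ^ l) * fourier v \<xi>) x) \<and>
      (LINT u|lborel. \<kappa> u *\<^sub>R inv_fourier (\<lambda>\<xi>. complex_of_real (\<bar>q u \<xi>\<bar> ^ l) * fourier v \<xi>) x) = inv_fourier (\<lambda>\<xi>. complex_of_real c * n0 \<xi>) x"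
      by (intro conjI subordination[where h="\<lambda>u \<xi>. \<bar>q u \<xi>\<bar> ^ l" and \<Phi>="\<lambda>\<xi>. c * norm \<xi> powr (2 * \<sigma>) * exp (- (\<rho> * norm \<xi>)\<^sup>2)",
        OF _ _ \<kappa> _ fi ni \<Phi>]) (use c in \<open>auto simp: n0_def q_def mult_ac\<close>)
    have "ennreal c * ennreal (norm (heat \<rho> (frac_laplacian \<sigma> v) x)) = ennreal (norm (inv_fourier (\<lambda>\<xi>. complex_of_real c * n0 \<xi>) x))"
      unfolding inv_fourier_cmult H using c by (simp add: norm_mult ennreal_mult)
    also have "\<dots> \<le> (\<integral>\<^sup>+u. ennreal (norm (\<kappa> u *\<^sub>R inv_fourier (\<lambda>\<xi>. complex_of_real (\<bar>q u \<xi>\<bar> ^ l) * fourier v \<xi>) x)) \<partial>lborel)"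
      using integral_norm_bound_ennreal[OF conjunct1[OF sub]] unfolding conjunct2[OF sub] .
    also have "\<dots> \<le> (\<integral>\<^sup>+u. ennreal (K ^ l * b) * ennreal (indicator {0..} u * u powr (- \<sigma> - 1) * (min 1 u) ^ l) \<partial>lborel)"
    proof (intro nn_integral_mono)
      fix u :: real
      show "ennreal (norm (\<kappa> u *\<^sub>R inv_fourier (\<lambda>\<xi>. complex_of_real (\<bar>q u \<xi>\<bar> ^ l) * fourier v \<xi>) x))
          \<le> ennreal (K ^ l * b) * ennreal (indicator {0..} u * u powr (- \<sigma> - 1) * (min 1 u) ^ l)"
      proof (cases "u \<ge> 0")
        case True
        have "inv_fourier (\<lambda>\<xi>. complex_of_real (\<bar>q u \<xi>\<bar> ^ l) * fourier v \<xi>) x = G u l x"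
          unfolding G_def by (simp only: abs_of_nonneg[OF q(1)[OF True]])
        then have "norm (\<kappa> u *\<^sub>R inv_fourier (\<lambda>\<xi>. complex_of_real (\<bar>q u \<xi>\<bar> ^ l) * fourier v \<xi>) x) \<le> \<kappa> u * (K ^ l * b * (min 1 u) ^ l)"
          using Gl[OF True] \<kappa>[of u] by (simp only: norm_scaleR abs_of_nonneg) (rule mult_left_mono)
        also have "\<dots> = (K ^ l * b) * (indicator {0..} u * u powr (- \<sigma> - 1) * (min 1 u) ^ l)"
          unfolding \<kappa>_def by (simp only: mult_ac)
        finally have "ennreal (norm (\<kappa> u *\<^sub>R inv_fourier (\<lambda>\<xi>. complex_of_real (\<bar>q u \<xi>\<bar> ^ l) * fourier v \<xi>) x))
            \<le> ennreal ((K ^ l * b) * (indicator {0..} u * u powr (- \<sigma> - 1) * (min 1 u) ^ l))" by (rule ennreal_leI)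
        then show ?thesis using K b(2) by (simp add: ennreal_mult')
      qed (simp add: \<kappa>_def)
    qed
    also have "\<dots> = ennreal (K ^ l * b) * (\<integral>\<^sup>+u. ennreal (indicator {0..} u * u powr (- \<sigma> - 1) * (min 1 u) ^ l) \<partial>lborel)"
      by (rule nn_integral_cmult) measurable
    also have "\<dots> \<le> ennreal (K ^ l * b) * ennreal W"
      unfolding W_def by (intro mult_left_mono powr_min_nn_integral \<sigma> l) simp
    also have "\<dots> = ennreal (K ^ l * W * b)" using K W b(2) by (simp add: ennreal_mult[symmetric] mult_ac)
    finally have "ennreal (c * norm (heat \<rho> (frac_laplacian \<sigma> v) x)) \<le> ennreal (K ^ l * W * b)"
      using c by (simp add: ennreal_mult)
    then have "c * norm (heat \<rho> (frac_laplacian \<sigma> v) x) \<le> K ^ l * W * b" using K W b(2) by (simp add: ennreal_le_iff)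
    then have "norm (heat \<rho> (frac_laplacian \<sigma> v) x) \<le> K ^ l * W / c * b" using c by (simp add: field_simps)
    then have "ennreal (norm (heat \<rho> (frac_laplacian \<sigma> v) x)) \<le> ennreal (K ^ l * W / c * b)" by (rule ennreal_leI)
    also have "\<dots> = ennreal (K ^ l * W / c) * BMO_seminorm v" unfolding b(1) using b(2) K W c by (intro ennreal_mult) auto
    finally show "ennreal (norm (heat \<rho> (frac_laplacian \<sigma> v) x)) \<le> ennreal (K ^ l * W / c) * BMO_seminorm v" .
  qed
qed

text \<open>The convergence is uniform in x because it is controlled by the L1 norm of the
  difference of the symbols, which tends to 0 by dominated convergence.\<close>

lemma inv_fourier_heat_tendsto:
  fixes m :: "real ^ 'd::finite \<Rightarrow> complex"
  assumes m: "integrable lborel m" and \<delta>: "\<delta> > 0"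
  obtains \<rho> where "\<rho> > 0" "\<forall>x. norm (inv_fourier m x - heat \<rho> (inv_fourier m) x) \<le> \<delta>"
proof -
  note [measurable] = borel_measurable_integrable[OF m, simplified]
  let ?e = "\<lambda>n \<xi>. complex_of_real (exp (- (1 / real (Suc n) * norm \<xi>)\<^sup>2))"
  have ei: "integrable lborel (\<lambda>\<xi>. ?e n \<xi> * m \<xi>)" for n
    by (rule Bochner_Integration.integrable_bound[OF m]) (auto simp: norm_mult intro!: mult_left_le_one_le)
  have lim: "(\<lambda>n. LINT \<xi>|lborel. norm (m \<xi> - ?e n \<xi> * m \<xi>)) \<longlonglongrightarrow> (LINT \<xi>|lborel. norm (m \<xi> - complex_of_real (exp (- (0 * norm \<xi>)\<^sup>2)) * m \<xi>))"
  proof (rule integral_dominated_convergence[where w="\<lambda>\<xi>. 2 * norm (m \<xi>)"])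
    show "integrable lborel (\<lambda>\<xi>. 2 * norm (m \<xi>))" using m by simp
    show "AE \<xi> in lborel. (\<lambda>n. norm (m \<xi> - ?e n \<xi> * m \<xi>)) \<longlonglongrightarrow> norm (m \<xi> - complex_of_real (exp (- (0 * norm \<xi>)\<^sup>2)) * m \<xi>)"
      by (intro always_eventually allI tendsto_intros LIMSEQ_Suc[OF lim_const_over_n])
    show "AE \<xi> in lborel. norm (norm (m \<xi> - ?e n \<xi> * m \<xi>)) \<le> 2 * norm (m \<xi>)" for n
    proof (intro always_eventually allI)
      fix \<xi>
      have "norm (m \<xi> - ?e n \<xi> * m \<xi>) \<le> norm (m \<xi>) + norm (?e n \<xi> * m \<xi>)" by (rule norm_triangle_ineq4)
      also have "norm (?e n \<xi> * m \<xi>) \<le> norm (m \<xi>)" by (auto simp: norm_mult intro!: mult_left_le_one_le)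
      finally show "norm (norm (m \<xi> - ?e n \<xi> * m \<xi>)) \<le> 2 * norm (m \<xi>)" by simp
    qed
  qed measurable
  then have "(\<lambda>n. LINT \<xi>|lborel. norm (m \<xi> - ?e n \<xi> * m \<xi>)) \<longlonglongrightarrow> 0" by simp
  from order_tendstoD(2)[OF this \<delta>] obtain n where n: "(LINT \<xi>|lborel. norm (m \<xi> - ?e n \<xi> * m \<xi>)) < \<delta>"
    by (auto simp: eventually_sequentially)
  show thesis
  proof (rule that[of "1 / real (Suc n)"])
    show "\<forall>x. norm (inv_fourier m x - heat (1 / real (Suc n)) (inv_fourier m) x) \<le> \<delta>"
    proof
      fix x
      have "inv_fourier m x - heat (1 / real (Suc n)) (inv_fourier m) x = inv_fourier (\<lambda>\<xi>. m \<xi> - ?e n \<xi> * m \<xi>) x"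
        unfolding heat_inv_fourier[OF m] by (rule inv_fourier_diff[OF m ei, symmetric])
      also have "norm \<dots> \<le> (LINT \<xi>|lborel. norm (m \<xi> - ?e n \<xi> * m \<xi>))"
        by (rule norm_inv_fourier_le[OF Bochner_Integration.integrable_diff[OF m ei]])
      finally show "norm (inv_fourier m x - heat (1 / real (Suc n)) (inv_fourier m) x) \<le> \<delta>" using n by linarith
    qed
  qed simp
qed

text \<open>After averaging at a fixed scale the fractional Laplacian of \<open>v m\<close> tends to
  0 uniformly, by \<open>heat_frac_laplacian_le_BMO\<close>. The constant there depends on
  \<open>\<rho>\<close> but the resulting bound \<open>M\<close> does not, so the smoothing can be
  removed at the end.\<close>

lemma mz_norm_frac_laplacian_lsc:
  fixes v :: "nat \<Rightarrow> real ^ 'd::finite \<Rightarrow> complex"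
  assumes \<sigma>: "\<sigma> > 0" and w: "w \<in> test_functions" and v: "\<And>m. v m \<in> test_functions"
    and lim: "(\<lambda>m. BMO_seminorm (v m)) \<longlonglongrightarrow> 0"
    and le: "\<And>m. mz_seminorm p (\<lambda>x. frac_laplacian \<sigma> w x - frac_laplacian \<sigma> (v m) x) \<le> M"
  shows "mz_seminorm p (frac_laplacian \<sigma> w) \<le> M"
proof -
  let ?L = "frac_laplacian \<sigma>"
  note wb = bounded_borel_frac_laplacian[OF w \<sigma>] and vb = bounded_borel_frac_laplacian[OF v \<sigma>]
  have heat: "mz_seminorm p (heat \<rho> (?L w)) \<le> M" if \<rho>: "\<rho> > 0" for \<rho>
  proof (rule mz_norm_lsc)
    show "heat \<rho> (?L w) \<in> borel_measurable borel" by (rule heat_measurable[OF wb])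
    show "heat \<rho> (?L (v m)) \<in> borel_measurable borel" for m by (rule heat_measurable[OF vb])
    show "mz_seminorm p (\<lambda>x. heat \<rho> (?L w) x - heat \<rho> (?L (v m)) x) \<le> M" for m
      unfolding heat_diff[OF wb vb, symmetric]
      by (rule order.trans[OF mz_norm_heat[OF bounded_borel_diff[OF wb vb]] le])
    fix E :: "(real ^ 'd) set" assume E[measurable]: "E \<in> sets borel" and b: "bounded E"
    obtain C where C: "C > 0"
      "\<forall>v \<in> test_functions. \<forall>x :: real ^ 'd. ennreal (norm (heat \<rho> (?L v) x)) \<le> ennreal C * BMO_seminorm v"
      by (rule heat_frac_laplacian_le_BMO[OF \<sigma> \<rho>])
    show "(\<lambda>m. \<integral>\<^sup>+x\<in>E. ennreal (norm (heat \<rho> (?L (v m)) x)) \<partial>lborel) \<longlonglongrightarrow> 0"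
    proof (rule tendsto_0_ennreal_le[OF lim])
      fix m
      have "(\<integral>\<^sup>+x\<in>E. ennreal (norm (heat \<rho> (?L (v m)) x)) \<partial>lborel) \<le> (\<integral>\<^sup>+x\<in>E. ennreal C * BMO_seminorm (v m) \<partial>lborel)"
        using C(2) v by (intro nn_integral_mono mult_right_mono) auto
      also have "\<dots> = ennreal C * BMO_seminorm (v m) * ennreal (measure lborel E)"
        by (simp add: nn_integral_cmult_indicator emeasure_lborel_bounded[OF b E])
      also have "\<dots> = ennreal (C * measure lborel E) * BMO_seminorm (v m)"
        using C(1) by (simp add: ennreal_mult mult_ac)
      finally show "(\<integral>\<^sup>+x\<in>E. ennreal (norm (heat \<rho> (?L (v m)) x)) \<partial>lborel) \<le> ennreal (C * measure lborel E) * BMO_seminorm (v m)" .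
    qed
  qed
  show ?thesis
  proof (rule mz_norm_approx)
    fix E :: "(real ^ 'd) set" and \<delta> :: real
    assume E[measurable]: "E \<in> sets borel" and b: "bounded E" and \<delta>: "\<delta> > 0"
    define \<delta>' where "\<delta>' = \<delta> / (1 + measure lborel E)"
    have m1: "1 + measure lborel E > 0" by (simp add: add_pos_nonneg)
    have \<delta>': "\<delta>' > 0" using \<delta> m1 by (simp add: \<delta>'_def)
    obtain \<rho> where \<rho>: "\<rho> > 0" "\<forall>x. norm (?L w x - heat \<rho> (?L w) x) \<le> \<delta>'"
      unfolding frac_laplacian_inv_fourier by (rule inv_fourier_heat_tendsto[OF rapid_integrable[OF rapid_frac_symbol[OF w \<sigma>]] \<delta>'])
    have [measurable]: "heat \<rho> (?L w) \<in> borel_measurable borel" by (rule heat_measurable[OF wb])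
    have "(\<integral>\<^sup>+x\<in>E. ennreal (norm (?L w x)) \<partial>lborel) \<le> (\<integral>\<^sup>+x. (ennreal (norm (heat \<rho> (?L w) x)) * indicator E x + ennreal \<delta>' * indicator E x) \<partial>lborel)"
    proof (intro nn_integral_mono)
      fix x
      have "norm (?L w x) \<le> norm (heat \<rho> (?L w) x) + \<delta>'"
        using norm_triangle_sub[of "?L w x" "heat \<rho> (?L w) x"] \<rho>(2)[rule_format, of x] by linarith
      then have "ennreal (norm (?L w x)) \<le> ennreal (norm (heat \<rho> (?L w) x) + \<delta>')" by (rule ennreal_leI)
      also have "\<dots> = ennreal (norm (heat \<rho> (?L w) x)) + ennreal \<delta>'" using \<delta>' by simp
      finally show "ennreal (norm (?L w x)) * indicator E x \<le> ennreal (norm (heat \<rho> (?L w) x)) * indicator E x + ennreal \<delta>' * indicator E x"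
        by (simp add: indicator_def)
    qed
    also have "\<dots> = (\<integral>\<^sup>+x\<in>E. ennreal (norm (heat \<rho> (?L w) x)) \<partial>lborel) + ennreal \<delta>' * ennreal (measure lborel E)"
      by (subst nn_integral_add) (auto simp: nn_integral_cmult_indicator emeasure_lborel_bounded[OF b E])
    also have "ennreal \<delta>' * ennreal (measure lborel E) \<le> ennreal \<delta>"
    proof -
      have "\<delta>' * measure lborel E \<le> \<delta>" using \<delta> m1 by (simp add: \<delta>'_def field_simps)
      then show ?thesis using \<delta>' by (simp add: ennreal_mult[symmetric] ennreal_leI)
    qed
    finally have "(\<integral>\<^sup>+x\<in>E. ennreal (norm (?L w x)) \<partial>lborel) \<le> (\<integral>\<^sup>+x\<in>E. ennreal (norm (heat \<rho> (?L w) x)) \<partial>lborel) + ennreal \<delta>"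
      by (simp add: add_left_mono)
    then show "\<exists>H. mz_norm p H \<le> M \<and> (\<integral>\<^sup>+x\<in>E. ennreal (norm (?L w x)) \<partial>lborel) \<le> (\<integral>\<^sup>+x\<in>E. H x \<partial>lborel) + ennreal \<delta>"
      using heat[OF \<rho>(1)] by blast
  qed
qed

lemma frac_laplacian_diff:
  assumes f: "f \<in> test_functions" and g: "g \<in> test_functions" and \<sigma>: "\<sigma> > 0"
  shows "frac_laplacian \<sigma> (\<lambda>x. f x - g x) = (\<lambda>x. frac_laplacian \<sigma> f x - frac_laplacian \<sigma> g x)"
proof
  fix x
  show "frac_laplacian \<sigma> (\<lambda>x. f x - g x) x = frac_laplacian \<sigma> f x - frac_laplacian \<sigma> g x"
    unfolding frac_laplacian_inv_fourier fourier_diff[OF test_function_integrable[OF f] test_function_integrable[OF g]] right_diff_distrib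
    by (intro inv_fourier_diff rapid_integrable rapid_frac_symbol f g \<sigma>)
qed

lemma embeds_in_BMO_Riesz:
  assumes p: "p > 1"
  shows "embeds_in_BMO (Riesz_seminorm (real CARD('d::finite) / p) p :: (real ^ 'd \<Rightarrow> complex) \<Rightarrow> ennreal)"
proof -
  define \<sigma> where "\<sigma> = real CARD('d) / p / 2"
  have \<sigma>: "\<sigma> > 0" using p by (simp add: \<sigma>_def)
  obtain C where C: "C > 0"
    and bmo: "\<And>(f :: real ^ 'd \<Rightarrow> complex) M. f \<in> test_functions \<Longrightarrow> M \<ge> 0 \<Longrightarrow>
      mz_seminorm p (frac_laplacian (real CARD('d) / p / 2) f) \<le> ennreal M \<Longrightarrow>
      BMO_seminorm f \<le> ennreal (C * M)"
    by (rule BMO_from_Riesz[OF p, where 'd='d]) auto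
  have N: "Riesz_seminorm (real CARD('d) / p) p f = weak_Lp_norm p (frac_laplacian \<sigma> f)" for f :: "real ^ 'd \<Rightarrow> complex"
    by (simp add: Riesz_seminorm_def \<sigma>_def)
  show ?thesis
  proof (rule embeds_in_BMO_family[where J="{()}" and L="\<lambda>_. frac_laplacian \<sigma>" and a="\<lambda>_. 1" and p=p and K="mz_const p" and C=C])
    show "bounded_borel (frac_laplacian \<sigma> f)" if "f \<in> test_functions" for f :: "real ^ 'd \<Rightarrow> complex"
      by (rule bounded_borel_frac_laplacian[OF that \<sigma>])
    show "frac_laplacian \<sigma> (\<lambda>x. f x - g x) = (\<lambda>x. frac_laplacian \<sigma> f x - frac_laplacian \<sigma> g x)"
      if "f \<in> test_functions" "g \<in> test_functions" for f g :: "real ^ 'd \<Rightarrow> complex"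
      by (rule frac_laplacian_diff[OF that \<sigma>])
    show "mz_seminorm p (frac_laplacian \<sigma> w) \<le> M"
      if "w \<in> test_functions" "\<And>m. v m \<in> test_functions" "(\<lambda>m. BMO_seminorm (v m)) \<longlonglongrightarrow> 0"
        "\<And>m :: nat. mz_seminorm p (\<lambda>x. frac_laplacian \<sigma> w x - frac_laplacian \<sigma> (v m) x) \<le> M"
      for w and v :: "nat \<Rightarrow> real ^ 'd \<Rightarrow> complex" and M
      by (rule mz_norm_frac_laplacian_lsc[OF \<sigma> that])
    fix f :: "real ^ 'd \<Rightarrow> complex" assume f: "f \<in> test_functions"
    have m: "(\<lambda>x. norm (frac_laplacian \<sigma> f x)) \<in> borel_measurable borel"
      using bounded_borel_measurable[OF bounded_borel_frac_laplacian[OF f \<sigma>]] by measurable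
    let ?N = "SUP j\<in>{()}. ennreal 1 * mz_seminorm p (frac_laplacian \<sigma> f)"
    have "Riesz_seminorm (real CARD('d) / p) p f \<le> ennreal 1 * ?N"
      unfolding N using weak_Lp_norm_le_mz_norm[OF p m] by simp
    also have "\<dots> \<le> ennreal (mz_const p) * ?N" by (intro mult_right_mono ennreal_leI mz_const_ge_1 p) simp
    finally show "Riesz_seminorm (real CARD('d) / p) p f \<le> ennreal (mz_const p) * ?N" .
    show "?N \<le> ennreal (mz_const p) * Riesz_seminorm (real CARD('d) / p) p f"
      unfolding N using mz_norm_le_weak_Lp_norm[OF p m] by simp
    fix M :: real
    assume M: "M \<ge> 0" and le: "\<And>j. j \<in> {()} \<Longrightarrow> ennreal 1 * mz_seminorm p (frac_laplacian \<sigma> f) \<le> ennreal M"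
    show "BMO_seminorm f \<le> ennreal (C * M)"
      using bmo[OF f M] le[of "()"] unfolding \<sigma>_def[symmetric] by simp
  qed (rule C)
qed

theorem theorem2p4:
  fixes p :: real
  assumes "1 < p"
  shows "(\<forall>k::nat. real CARD('d::finite) / p < real k \<longrightarrow>
            embeds_in_BMO (Besov_seminorm k (real CARD('d) / p) p ::
              (real ^ 'd \<Rightarrow> complex) \<Rightarrow> ennreal)) \<and>
         embeds_in_BMO (Riesz_seminorm (real CARD('d) / p) p ::
           (real ^ 'd \<Rightarrow> complex) \<Rightarrow> ennreal) \<and>
         (\<forall>k::nat. 0 < k \<and> k < CARD('d) \<longrightarrow>
            embeds_in_BMO (Sobolev_seminorm k (real CARD('d) / real k) ::
              (real ^ 'd \<Rightarrow> complex) \<Rightarrow> ennreal))"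
proof (intro conjI allI impI)
  fix k :: nat assume k: "real CARD('d) / p < real k"
  have "real CARD('d) / p > 0" using assms by simp
  then have "k > 0" using k by (cases k) auto
  then show "embeds_in_BMO (Besov_seminorm k (real CARD('d) / p) p :: (real ^ 'd \<Rightarrow> complex) \<Rightarrow> ennreal)"
    by (rule embeds_in_BMO_Besov[OF assms])
next
  show "embeds_in_BMO (Riesz_seminorm (real CARD('d) / p) p :: (real ^ 'd \<Rightarrow> complex) \<Rightarrow> ennreal)"
    by (rule embeds_in_BMO_Riesz[OF assms])
next
  fix k :: nat assume "0 < k \<and> k < CARD('d)"
  then show "embeds_in_BMO (Sobolev_seminorm k (real CARD('d) / real k) :: (real ^ 'd \<Rightarrow> complex) \<Rightarrow> ennreal)"
    by (intro embeds_in_BMO_Sobolev) auto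
qed

end
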